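(* Let $(M,\tau)$ be a tracial von Neumann algebra generated by a unital von Neumann subalgebra $B\le M$ and a tuple of self-adjoint operators $\mathbf{x}=(x_i)_{i\in I}$ in $M$, where $I$ is a countable set with $|I|>1$. Assume that a $(B,\eta)$-conjugate system exists for $\mathbf{x}$, where $\eta$ is the covariance matrix $\eta=(\delta_{ij}E_B)_{i,j\in I}$. Then $$Z\big(B\vee(B'\cap M)\big)=Z(B).$$ In particular, $Z(M)\subset Z(B)$.
   Context: A tracial von Neumann algebra $(M,\tau)$ is a von Neumann algebra $M$ with a faithful normal tracial state $\tau$. $L^2(M,\tau)$ is the GNS Hilbert space with $\langle a,b\rangle_\tau=\tau(a^*b)$. $B\le M$ means von Neumann subalgebra, $B_1\vee B_2$ is the von Neumann algebra generated by $B_1,B_2$, $Z(N)=N'\cap N$ is the center of $N$, and $E_B:M\to B$ is the unique $\tau$-preserving faithful normal conditional expectation. $B\langle\mathbf{x}\rangle$ is the $*$-algebra generated by $B$ and $\{x_i:i\in I\}$; that $M$ is generated by $B$ and $\mathbf{x}$ means $M=B\langle\mathbf{x}\rangle''$. Covariance matrices. A covariance matrix on $B$ is a normal completely positive map $\eta:B\to B\otimes B(\ell^2(I))$ of the form $\eta(b)=\sum_{i,j\in I}\eta_{ij}(b)\otimes e_{ij}$ ($\sigma$-weak convergence), where $\eta_{ij}:B\to B$ are linear and $(e_{ij})$ are matrix units of $B(\ell^2(I))$. It is extended to $M$ by $\eta:=\eta\circ E_B$, i.e. $\eta_{ij}:=\eta_{ij}\circ E_B:M\to B$. It is always assumed $\tau$-symmetric: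 $\tau(\eta_{ij}(a)b)=\tau(a\,\eta_{ji}(b))$. The notation $\eta=(\delta_{ij}E_B)_{i,j\in I}$ means that after this extension $\eta_{ij}=\delta_{ij}E_B$ (so $\eta_{ij}=\delta_{ij}\,\mathrm{id}_B$ on $B$). Conjugate systems. A vector $\xi_i\in L^2(M,\tau)$ is the $i$-th $(B,\eta)$-conjugate variable for $\mathbf{x}$ if for all $d\ge 0$, $j_1,\dots,j_d\in I$ and $b_0,\dots,b_d\in B$, $$\langle \xi_i, b_0x_{j_1}b_1\cdots x_{j_d}b_d\rangle_\tau=\sum_{k=1}^d\tau\big(\eta_{ij_k}(b_0x_{j_1}\cdots x_{j_{k-1}}b_{k-1})\,E_B(b_kx_{j_{k+1}}\cdots x_{j_d}b_d)\big)$$ (for $d=0$ the right-hand side is $0$). A $(B,\eta)$-conjugate system for $\mathbf{x}$ is a tuple $(\xi_i)_{i\in I}$ such that each $\xi_i$ is the $i$-th $(B,\eta)$-conjugate variable. *)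

theory Defs
  imports "HOL-Analysis.Analysis"
begin

section \<open>Complex Hilbert spaces and their bounded operators\<close>

class scaleC =
  fixes scaleC :: "complex \<Rightarrow> 'a \<Rightarrow> 'a" (infixr "*\<^sub>C" 75)

text \<open>The inner product is conjugate-linear in its first argument. The class
  \<^class>\<open>real_inner\<close> provides positive definiteness and the norm, because the real
  inner product is required to be the real part of the complex one.\<close>

class complex_hilbert_space = scaleC + real_inner + complete_space +
  fixes cinner :: "'a \<Rightarrow> 'a \<Rightarrow> complex"
  assumes scaleC_add_right: "c *\<^sub>C (u + v) = c *\<^sub>C u + c *\<^sub>C v"
    and scaleC_add_left: "(c + d) *\<^sub>C u = c *\<^sub>C u + d *\<^sub>C u"
    and scaleC_scaleC: "c *\<^sub>C d *\<^sub>C u = (c * d) *\<^sub>C u"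
    and scaleC_complex_of_real: "complex_of_real r *\<^sub>C u = r *\<^sub>R u"
    and cinner_commute: "cinner u v = cnj (cinner v u)"
    and cinner_add_right: "cinner u (v + w) = cinner u v + cinner u w"
    and cinner_scaleC_right: "cinner u (c *\<^sub>C v) = c * cinner u v"
    and inner_eq_Re_cinner: "inner u v = Re (cinner u v)"

typedef (overloaded) ('a::complex_hilbert_space) bop =
  "{f :: 'a \<Rightarrow> 'a. bounded_linear f \<and> (\<forall>c v. f (c *\<^sub>C v) = c *\<^sub>C f v)}"
  morphisms op_apply Bop
  by (rule exI[of _ id]) (simp add: id_def bounded_linear_ident)

setup_lifting type_definition_bop

lemma bop_eqI: "(\<And>v. op_apply S v = op_apply T v) \<Longrightarrow> S = T"
  by (simp add: op_apply_inject[symmetric] fun_eq_iff)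

lemma bounded_linear_op_apply: "bounded_linear (op_apply T)"
  using op_apply[of T] by simp

text \<open>The zero space is not excluded, hence no instance of \<^class>\<open>ring_1\<close>.\<close>

instantiation bop :: (complex_hilbert_space) "{ring, monoid_mult, scaleC}"
begin

lift_definition zero_bop :: "'a bop" is "\<lambda>_. 0"
proof -
  have "c *\<^sub>C (0::'a) = 0" for c
    using scaleC_add_right[of c "0::'a" 0] by simp
  then show "bounded_linear (\<lambda>_::'a. 0::'a) \<and> (\<forall>c (v::'a). (0::'a) = c *\<^sub>C 0)"
    by (simp add: bounded_linear_zero)
qed

lift_definition one_bop :: "'a bop" is "\<lambda>v. v"
  by (simp add: bounded_linear_ident)

lift_definition plus_bop :: "'a bop \<Rightarrow> 'a bop \<Rightarrow> 'a bop" is "\<lambda>f g v. f v + g v"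
  by (simp add: bounded_linear_add scaleC_add_right)

lift_definition uminus_bop :: "'a bop \<Rightarrow> 'a bop" is "\<lambda>f v. - f v"
proof -
  fix f :: "'a \<Rightarrow> 'a"
  assume f: "bounded_linear f \<and> (\<forall>c v. f (c *\<^sub>C v) = c *\<^sub>C f v)"
  have "c *\<^sub>C (0::'a) = 0" for c
    using scaleC_add_right[of c "0::'a" 0] by simp
  then have "c *\<^sub>C (- u) = - (c *\<^sub>C u)" for c and u :: 'a
    using scaleC_add_right[of c u "- u"] by (simp add: minus_unique)
  with f show "bounded_linear (\<lambda>v. - f v) \<and> (\<forall>c v. - f (c *\<^sub>C v) = c *\<^sub>C (- f v))"
    by (simp add: bounded_linear_minus)
qed

definition minus_bop :: "'a bop \<Rightarrow> 'a bop \<Rightarrow> 'a bop" where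
  "minus_bop S T = S + - T"

lift_definition times_bop :: "'a bop \<Rightarrow> 'a bop \<Rightarrow> 'a bop" is "\<lambda>f g v. f (g v)"
  by (simp add: bounded_linear_compose)

lift_definition scaleC_bop :: "complex \<Rightarrow> 'a bop \<Rightarrow> 'a bop" is "\<lambda>c f v. c *\<^sub>C f v"
proof -
  fix c :: complex and f :: "'a \<Rightarrow> 'a"
  assume f: "bounded_linear f \<and> (\<forall>c v. f (c *\<^sub>C v) = c *\<^sub>C f v)"
  have "c *\<^sub>C (d *\<^sub>C u) = d *\<^sub>C (c *\<^sub>C u)" for d and u :: 'a
    by (simp add: scaleC_scaleC mult.commute)
  moreover have "bounded_linear (\<lambda>u::'a. c *\<^sub>C u)"
  proof (rule bounded_linear_intro)
    fix u v :: 'a and r :: real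
    show "c *\<^sub>C (u + v) = c *\<^sub>C u + c *\<^sub>C v"
      by (rule scaleC_add_right)
    show "c *\<^sub>C (r *\<^sub>R u) = r *\<^sub>R (c *\<^sub>C u)"
      by (simp add: scaleC_complex_of_real[symmetric] scaleC_scaleC mult.commute)
    have "cinner (c *\<^sub>C u) (c *\<^sub>C u) = c * cnj (c * cinner u u)"
      by (metis cinner_commute cinner_scaleC_right)
    also have "\<dots> = complex_of_real ((cmod c)\<^sup>2) * cinner u u"
      using cinner_commute[of u u] by (simp add: complex_norm_square del: of_real_power)
    finally have "(norm (c *\<^sub>C u))\<^sup>2 = (cmod c * norm u)\<^sup>2"
      by (simp add: power2_norm_eq_inner inner_eq_Re_cinner power_mult_distrib
          del: of_real_power)
    then show "norm (c *\<^sub>C u) \<le> norm u * cmod c"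
      by (metis abs_norm_cancel abs_of_nonneg mult.commute mult_nonneg_nonneg norm_ge_zero
          order_refl power2_eq_iff_nonneg)
  qed
  ultimately show
    "bounded_linear (\<lambda>v. c *\<^sub>C f v) \<and> (\<forall>d v. c *\<^sub>C f (d *\<^sub>C v) = d *\<^sub>C c *\<^sub>C f v)"
    using f by (simp add: bounded_linear_compose[of "\<lambda>u. c *\<^sub>C u"])
qed

instance
proof
  fix S T U :: "'a bop"
  show "S + T + U = S + (T + U)" "S + T = T + S" "0 + S = S" "- S + S = 0"
    "S * T * U = S * (T * U)" "1 * S = S" "S * 1 = S" "(S + T) * U = S * U + T * U"
    by (transfer; simp add: fun_eq_iff add.assoc add.commute)+
  show "S - T = S + - T"
    by (rule minus_bop_def)
  show "S * (T + U) = S * T + S * U"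
    by transfer (simp add: fun_eq_iff linear_add bounded_linear.linear)
qed

end

definition adj :: "'h::complex_hilbert_space bop \<Rightarrow> 'h bop" where
  "adj T = (THE S. \<forall>u v. cinner (op_apply S u) v = cinner u (op_apply T v))"

definition pos_op :: "'h::complex_hilbert_space bop \<Rightarrow> bool" where
  "pos_op T \<longleftrightarrow> (\<forall>v. cinner v (op_apply T v) \<in> \<real>\<^sub>\<ge>\<^sub>0)"

definition op_le :: "'h::complex_hilbert_space bop \<Rightarrow> 'h bop \<Rightarrow> bool" where
  "op_le S T \<longleftrightarrow> pos_op (T - S)"


section \<open>Von Neumann algebras\<close>

definition commutant :: "'h::complex_hilbert_space bop set \<Rightarrow> 'h bop set" where
  "commutant A = {T. \<forall>S\<in>A. T * S = S * T}"

definition center :: "'h::complex_hilbert_space bop set \<Rightarrow> 'h bop set" where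
  "center N = commutant N \<inter> N"

definition von_neumann_algebra :: "'h::complex_hilbert_space bop set \<Rightarrow> bool" where
  "von_neumann_algebra M \<longleftrightarrow> adj ` M \<subseteq> M \<and> commutant (commutant M) = M"

text \<open>All von Neumann algebras on a space contain its identity operator, so subalgebras
  are unital.\<close>

definition vn_subalgebra :: "'h::complex_hilbert_space bop set \<Rightarrow> 'h bop set \<Rightarrow> bool" where
  "vn_subalgebra B M \<longleftrightarrow> von_neumann_algebra B \<and> von_neumann_algebra M \<and> B \<subseteq> M"

definition vn_generated :: "'h::complex_hilbert_space bop set \<Rightarrow> 'h bop set" where
  "vn_generated S = \<Inter>{N. von_neumann_algebra N \<and> S \<subseteq> N}"

definition vn_join ::
    "'h::complex_hilbert_space bop set \<Rightarrow> 'h bop set \<Rightarrow> 'h bop set" (infixl "\<or>\<^sub>v\<^sub>N" 65) where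
  "A \<or>\<^sub>v\<^sub>N B = vn_generated (A \<union> B)"

definition star_subalgebra :: "'h::complex_hilbert_space bop set \<Rightarrow> bool" where
  "star_subalgebra A \<longleftrightarrow> 0 \<in> A \<and>
     (\<forall>a\<in>A. \<forall>b\<in>A. a + b \<in> A \<and> a * b \<in> A) \<and> (\<forall>c. \<forall>a\<in>A. c *\<^sub>C a \<in> A) \<and> adj ` A \<subseteq> A"

definition star_generated :: "'h::complex_hilbert_space bop set \<Rightarrow> 'h bop set" where
  "star_generated S = \<Inter>{A. star_subalgebra A \<and> S \<subseteq> A}"


section \<open>Normal maps, traces, conditional expectations\<close>

definition clinear_on :: "'h::complex_hilbert_space bop set \<Rightarrow>
    ('h bop \<Rightarrow> 'b::plus) \<Rightarrow> (complex \<Rightarrow> 'b \<Rightarrow> 'b) \<Rightarrow> bool" where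
  "clinear_on M f smul \<longleftrightarrow>
     (\<forall>a\<in>M. \<forall>b\<in>M. f (a + b) = f a + f b) \<and> (\<forall>c. \<forall>a\<in>M. f (c *\<^sub>C a) = smul c (f a))"

definition directed_selfadj :: "'h::complex_hilbert_space bop set \<Rightarrow> bool" where
  "directed_selfadj D \<longleftrightarrow> D \<noteq> {} \<and> (\<forall>a\<in>D. adj a = a) \<and>
     (\<forall>a\<in>D. \<forall>b\<in>D. \<exists>c\<in>D. op_le a c \<and> op_le b c)"

definition is_lub_in :: "'h::complex_hilbert_space bop set \<Rightarrow> 'h bop set \<Rightarrow> 'h bop \<Rightarrow> bool" where
  "is_lub_in M D s \<longleftrightarrow> s \<in> M \<and> (\<forall>a\<in>D. op_le a s) \<and>
     (\<forall>u\<in>M. (\<forall>a\<in>D. op_le a u) \<longrightarrow> op_le s u)"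

text \<open>Normality of a positive map: suprema of bounded increasing nets are preserved.\<close>

definition normal_functional ::
    "'h::complex_hilbert_space bop set \<Rightarrow> ('h bop \<Rightarrow> complex) \<Rightarrow> bool" where
  "normal_functional M \<phi> \<longleftrightarrow>
     (\<forall>D s. D \<subseteq> M \<and> directed_selfadj D \<and> is_lub_in M D s \<longrightarrow>
        Re (\<phi> s) = (SUP a\<in>D. Re (\<phi> a)))"

definition normal_map :: "'h::complex_hilbert_space bop set \<Rightarrow> 'h bop set \<Rightarrow>
    ('h bop \<Rightarrow> 'h bop) \<Rightarrow> bool" where
  "normal_map M B E \<longleftrightarrow>
     (\<forall>D s. D \<subseteq> M \<and> directed_selfadj D \<and> is_lub_in M D s \<longrightarrow> is_lub_in B (E ` D) (E s))"

definition tracial_state ::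
    "'h::complex_hilbert_space bop set \<Rightarrow> ('h bop \<Rightarrow> complex) \<Rightarrow> bool" where
  "tracial_state M \<tau> \<longleftrightarrow> clinear_on M \<tau> (*) \<and> (\<forall>a\<in>M. \<tau> (adj a * a) \<in> \<real>\<^sub>\<ge>\<^sub>0) \<and> \<tau> 1 = 1 \<and>
     (\<forall>a\<in>M. \<forall>b\<in>M. \<tau> (a * b) = \<tau> (b * a))"

definition tracial_vn_algebra ::
    "'h::complex_hilbert_space bop set \<Rightarrow> ('h bop \<Rightarrow> complex) \<Rightarrow> bool" where
  "tracial_vn_algebra M \<tau> \<longleftrightarrow> von_neumann_algebra M \<and> tracial_state M \<tau> \<and>
     (\<forall>a\<in>M. \<tau> (adj a * a) = 0 \<longrightarrow> a = 0) \<and> normal_functional M \<tau>"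

text \<open>For a tracial von Neumann algebra \<open>M\<close> and a von Neumann subalgebra \<open>B\<close> these conditions
  have exactly one solution on \<open>M\<close>; values outside \<open>M\<close> are left unspecified.\<close>

definition trace_cond_exp :: "'h::complex_hilbert_space bop set \<Rightarrow> ('h bop \<Rightarrow> complex) \<Rightarrow>
    'h bop set \<Rightarrow> ('h bop \<Rightarrow> 'h bop) \<Rightarrow> bool" where
  "trace_cond_exp M \<tau> B E \<longleftrightarrow> E ` M \<subseteq> B \<and> clinear_on M E (*\<^sub>C) \<and>
     (\<forall>a\<in>M. pos_op a \<longrightarrow> pos_op (E a)) \<and>
     (\<forall>b\<in>B. E b = b) \<and>
     (\<forall>a\<in>M. \<forall>b\<in>B. \<forall>c\<in>B. E (b * a * c) = b * E a * c) \<and>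
     (\<forall>a\<in>M. \<tau> (E a) = \<tau> a) \<and>
     (\<forall>a\<in>M. E (adj a * a) = 0 \<longrightarrow> a = 0) \<and>
     normal_map M B E"


section \<open>The GNS Hilbert space\<close>

text \<open>The completion of \<open>M\<close> for \<open>\<langle>a, b\<rangle> = \<tau> (a\<^sup>* b)\<close>, built as Cauchy sequences modulo null
  sequences.\<close>

definition trace_norm2 :: "('h::complex_hilbert_space bop \<Rightarrow> complex) \<Rightarrow> 'h bop \<Rightarrow> real" where
  "trace_norm2 \<tau> a = sqrt (Re (\<tau> (adj a * a)))"

definition L2_Cauchy :: "'h::complex_hilbert_space bop set \<Rightarrow> ('h bop \<Rightarrow> complex) \<Rightarrow>
    (nat \<Rightarrow> 'h bop) set" where
  "L2_Cauchy M \<tau> = {s. range s \<subseteq> M \<and>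
     (\<forall>e>0. \<exists>N. \<forall>m\<ge>N. \<forall>n\<ge>N. trace_norm2 \<tau> (s m - s n) < e)}"

definition L2_rel :: "'h::complex_hilbert_space bop set \<Rightarrow> ('h bop \<Rightarrow> complex) \<Rightarrow>
    (nat \<Rightarrow> 'h bop) rel" where
  "L2_rel M \<tau> = {(s, t). s \<in> L2_Cauchy M \<tau> \<and> t \<in> L2_Cauchy M \<tau> \<and>
     (\<lambda>n. trace_norm2 \<tau> (s n - t n)) \<longlonglongrightarrow> 0}"

definition L2 :: "'h::complex_hilbert_space bop set \<Rightarrow> ('h bop \<Rightarrow> complex) \<Rightarrow>
    (nat \<Rightarrow> 'h bop) set set" where
  "L2 M \<tau> = L2_Cauchy M \<tau> // L2_rel M \<tau>"

definition L2_vec :: "'h::complex_hilbert_space bop set \<Rightarrow> ('h bop \<Rightarrow> complex) \<Rightarrow>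
    'h bop \<Rightarrow> (nat \<Rightarrow> 'h bop) set" where
  "L2_vec M \<tau> a = L2_rel M \<tau> `` {\<lambda>_. a}"

definition L2_inner :: "('h::complex_hilbert_space bop \<Rightarrow> complex) \<Rightarrow>
    (nat \<Rightarrow> 'h bop) set \<Rightarrow> (nat \<Rightarrow> 'h bop) set \<Rightarrow> complex" where
  "L2_inner \<tau> \<xi> \<zeta> = (THE c. \<forall>s\<in>\<xi>. \<forall>t\<in>\<zeta>. (\<lambda>n. \<tau> (adj (s n) * t n)) \<longlonglongrightarrow> c)"


section \<open>Conjugate systems\<close>

text \<open>The word \<open>b\<^sub>m x\<^bsub>j (m+1)\<^esub> b\<^bsub>m+1\<^esub> \<cdots> x\<^bsub>j n\<^esub> b\<^sub>n\<close>, for \<open>m \<le> n\<close>.\<close>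

definition word :: "('i \<Rightarrow> 'h::complex_hilbert_space bop) \<Rightarrow> (nat \<Rightarrow> 'i) \<Rightarrow> (nat \<Rightarrow> 'h bop) \<Rightarrow>
    nat \<Rightarrow> nat \<Rightarrow> 'h bop" where
  "word x j b m n = b m * (\<Prod>k\<leftarrow>[Suc m..<Suc n]. x (j k) * b k)"

text \<open>The argument \<open>\<eta>\<close> consists of the entries \<open>\<eta>\<^sub>i\<^sub>j\<close> of a covariance matrix after extension
  from \<open>B\<close> to \<open>M\<close> by composition with the conditional expectation \<open>E\<close>.\<close>

definition conjugate_variable :: "'h::complex_hilbert_space bop set \<Rightarrow> ('h bop \<Rightarrow> complex) \<Rightarrow>
    'h bop set \<Rightarrow> ('h bop \<Rightarrow> 'h bop) \<Rightarrow> ('i \<Rightarrow> 'i \<Rightarrow> 'h bop \<Rightarrow> 'h bop) \<Rightarrow> 'i set \<Rightarrow>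
    ('i \<Rightarrow> 'h bop) \<Rightarrow> 'i \<Rightarrow> (nat \<Rightarrow> 'h bop) set \<Rightarrow> bool" where
  "conjugate_variable M \<tau> B E \<eta> I x i \<xi> \<longleftrightarrow> \<xi> \<in> L2 M \<tau> \<and>
     (\<forall>d j b. (\<forall>k\<in>{1..d}. j k \<in> I) \<and> (\<forall>k\<le>d. b k \<in> B) \<longrightarrow>
        L2_inner \<tau> \<xi> (L2_vec M \<tau> (word x j b 0 d)) =
          (\<Sum>k=1..d. \<tau> (\<eta> i (j k) (word x j b 0 (k - 1)) * E (word x j b k d))))"

definition conjugate_system :: "'h::complex_hilbert_space bop set \<Rightarrow> ('h bop \<Rightarrow> complex) \<Rightarrow>
    'h bop set \<Rightarrow> ('h bop \<Rightarrow> 'h bop) \<Rightarrow> ('i \<Rightarrow> 'i \<Rightarrow> 'h bop \<Rightarrow> 'h bop) \<Rightarrow> 'i set \<Rightarrow>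
    ('i \<Rightarrow> 'h bop) \<Rightarrow> ('i \<Rightarrow> (nat \<Rightarrow> 'h bop) set) \<Rightarrow> bool" where
  "conjugate_system M \<tau> B E \<eta> I x \<xi> \<longleftrightarrow>
     (\<forall>i\<in>I. conjugate_variable M \<tau> B E \<eta> I x i (\<xi> i))"

definition diagonal_covariance ::
    "('h::complex_hilbert_space bop \<Rightarrow> 'h bop) \<Rightarrow> 'i \<Rightarrow> 'i \<Rightarrow> 'h bop \<Rightarrow> 'h bop" where
  "diagonal_covariance E i j a = (if i = j then E a else 0)"

end

theory Submission
  imports Defs "HOL-Library.Poly_Mapping"
begin

text \<open>Write \<open>Q = B' \<inter> M\<close>. Averaging over the unitary group of \<open>B\<close> replaces every \<open>x\<^sub>j\<close> by some
  \<open>y\<^sub>j \<in> Q\<close> to which the conjugate relations pass on; here pairing with the conjugate variables matters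
  only as a family of functionals that are bounded for the trace norm. Let \<open>z \<in> M\<close> commute with \<open>B\<close> and
  \<open>Q\<close>, let \<open>i \<noteq> j\<close>, and let \<open>\<gamma>\<close> be polynomials approximating \<open>z\<close>.

  The conjugate relation for \<open>y\<^sub>j\<close> makes \<open>y\<^sub>j\<close> diffuse relative to \<open>B\<close>: for the bumps
  \<open>P\<^sub>n = \<Prod>m<n. 1 - X\<^sub>m\<^sup>2\<close>, where \<open>X\<^sub>0 = (s - r) / 2K\<close> and \<open>X\<^sub>m\<^sub>+\<^sub>1 = (3 X\<^sub>m - X\<^sub>m\<^sup>3) / 2\<close>, the operators
  \<open>P\<^sub>n\<close> with \<open>s\<close> and \<open>r\<close> acting as left and right multiplication by \<open>y\<^sub>j\<close> are contractions that fix \<open>z\<close>,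
  but they tend weakly to zero on the tensors of \<open>\<partial>\<^sub>i \<gamma>\<close>. As \<open>\<partial>\<^sub>i y\<^sub>j = 0\<close>, the derivation
  \<open>\<partial>\<^sub>i\<close> commutes with this action, so the pairing of \<open>\<partial>\<^sub>i \<gamma>\<close> with any vector \<open>a \<otimes> b\<close> in the
  domain of the adjoint of \<open>\<partial>\<^sub>i\<close>, where \<open>a, b \<in> Q\<close>, tends to zero. Comparing \<open>\<partial>\<^sub>i (\<gamma> y\<^sub>i)\<close> with
  \<open>\<partial>\<^sub>i (y\<^sub>i \<gamma>)\<close> then gives \<open>\<tau> (a z) = \<tau> (E a z)\<close> for the averages \<open>a\<close> of a dense set of
  elements, hence \<open>z = E z \<in> B\<close>.\<close>

text \<open>The derivation \<open>\<partial>\<^sub>i\<close> acts on formal words, since one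
  operator may be the value of several words. In place of closability there are bounds of its
  pairings by the trace norm of the value; they let polynomials near \<open>z\<close> replace
  \<open>z\<close>, although their operator norms are not controlled. The obstacle is that the
  commutator with \<open>y\<^sub>i\<close> leaves two Leibniz terms of unknown size. A second
  variable removes them: tensors fixed by all \<open>P\<^sub>n\<close> live on the diagonal
  \<open>s = r\<close> of \<open>y\<^sub>j\<close>, and a diffuse \<open>y\<^sub>j\<close> leaves no
  room there. The bumps decrease to the indicator of the diagonal. The indicator itself would leave
  the polynomials, where \<open>\<partial>\<^sub>i\<close> is at hand; iterating a cubic stays among
  them, bounded by 1 for \<open>s\<close> and \<open>r\<close> in \<open>[-K, K]\<close>, with
  slopes on the diagonal growing like \<open>(3/2)^n\<close>. If mass stayed on the diagonal,
  pairing these iterates with the conjugate variable would grow like the slopes, but it is bounded.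
  All inequalities are certified by sums of squares, so that they hold under every positive
  weight.\<close>

abbreviation ap :: "'h::complex_hilbert_space bop \<Rightarrow> 'h \<Rightarrow> 'h" (infixr "\<rhd>" 75) where
  "T \<rhd> v \<equiv> op_apply T v"

section \<open>Complex inner products\<close>

lemma scaleC_zero_right [simp]: "c *\<^sub>C (0::'h::complex_hilbert_space) = 0"
  using scaleC_add_right[of c "0::'h" 0] by simp

lemma scaleC_minus_right: "c *\<^sub>C (- u) = - (c *\<^sub>C (u::'h::complex_hilbert_space))"
  using scaleC_add_right[of c u "- u"] by (simp add: minus_unique)

lemma scaleC_one [simp]: "1 *\<^sub>C (u::'h::complex_hilbert_space) = u"
  using scaleC_complex_of_real[of 1 u] by simp

lemma scaleC_zero_left [simp]: "0 *\<^sub>C (u::'h::complex_hilbert_space) = 0"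
  using scaleC_complex_of_real[of 0 u] by simp

lemma scaleC_diff_right: "c *\<^sub>C (u - v) = c *\<^sub>C u - c *\<^sub>C (v::'h::complex_hilbert_space)"
  using scaleC_add_right[of c u "- v"] by (simp add: scaleC_minus_right)

lemma cinner_add_left: "cinner (u + v) w = cinner u w + cinner v (w::'h::complex_hilbert_space)"
  by (metis cinner_add_right cinner_commute complex_cnj_add)

lemma cinner_scaleC_left: "cinner (c *\<^sub>C u) v = cnj c * cinner u (v::'h::complex_hilbert_space)"
  by (metis cinner_commute cinner_scaleC_right complex_cnj_mult)

lemma cinner_zero_right [simp]: "cinner u (0::'h::complex_hilbert_space) = 0"
  using cinner_add_right[of u 0 0] by simp

lemma cinner_zero_left [simp]: "cinner (0::'h::complex_hilbert_space) u = 0"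
  using cinner_add_left[of 0 0 u] by simp

lemma cinner_minus_right: "cinner u (- v) = - cinner u (v::'h::complex_hilbert_space)"
  using cinner_add_right[of u v "- v"] by (simp add: minus_unique)

lemma cinner_minus_left: "cinner (- u) v = - cinner u (v::'h::complex_hilbert_space)"
  using cinner_add_left[of u "- u" v] by (simp add: minus_unique)

lemma cinner_diff_right: "cinner u (v - w) = cinner u v - cinner u (w::'h::complex_hilbert_space)"
  using cinner_add_right[of u v "- w"] by (simp add: cinner_minus_right)

lemma cinner_diff_left: "cinner (u - v) w = cinner u w - cinner v (w::'h::complex_hilbert_space)"
  using cinner_add_left[of u "- v" w] by (simp add: cinner_minus_left)

lemma cinner_scaleR_right: "cinner u (r *\<^sub>R v) = of_real r * cinner u (v::'h::complex_hilbert_space)"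
  by (metis cinner_scaleC_right scaleC_complex_of_real)

lemma cinner_scaleR_left: "cinner (r *\<^sub>R u) v = of_real r * cinner u (v::'h::complex_hilbert_space)"
  by (metis cinner_scaleC_left scaleC_complex_of_real complex_cnj_complex_of_real)

lemma cinner_self: "cinner u u = of_real ((norm (u::'h::complex_hilbert_space))\<^sup>2)"
proof -
  have "Im (cinner u u) = 0"
    using cinner_commute[of u u] by (metis complex_cnj cancel_comm_monoid_add_class.diff_cancel
        complex_eq_iff complex.sel(2) add.inverse_inverse cnj.sel(2) equal_neg_zero)
  then show ?thesis
    by (simp add: complex_eq_iff power2_norm_eq_inner inner_eq_Re_cinner del: of_real_power)
qed

lemma norm_scaleC: "norm (c *\<^sub>C u) = cmod c * norm (u::'h::complex_hilbert_space)"
proof -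
  have "cinner (c *\<^sub>C u) (c *\<^sub>C u) = of_real ((cmod c)\<^sup>2) * cinner u u"
    by (simp add: cinner_scaleC_left cinner_scaleC_right complex_norm_square del: of_real_power)
  then have "(norm (c *\<^sub>C u))\<^sup>2 = (cmod c * norm u)\<^sup>2"
    unfolding cinner_self by (metis of_real_eq_iff of_real_mult power_mult_distrib)
  then show ?thesis by (simp add: power2_eq_iff_nonneg)
qed

lemma cinner_CS: "cmod (cinner u v) \<le> norm u * norm (v::'h::complex_hilbert_space)"
proof (cases "cinner u v = 0")
  case False
  define c where "c = cnj (cinner u v) / cmod (cinner u v)"
  have cn: "cmod c = 1" using False by (simp add: c_def norm_divide)
  have "c * cinner u v = (cinner u v * cnj (cinner u v)) / cmod (cinner u v)"
    by (simp add: c_def mult.commute)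
  also have "\<dots> = of_real (cmod (cinner u v))"
    by (simp only: complex_norm_square[symmetric]) (simp add: power2_eq_square False)
  finally have "cinner u (c *\<^sub>C v) = of_real (cmod (cinner u v))"
    by (simp add: cinner_scaleC_right)
  then have "cmod (cinner u v) = inner u (c *\<^sub>C v)"
    by (simp add: inner_eq_Re_cinner)
  also have "\<dots> \<le> norm u * norm (c *\<^sub>C v)" by (rule norm_cauchy_schwarz)
  finally show ?thesis using cn by (simp add: norm_scaleC)
qed auto

lemma cinner_eqI_left:
  assumes "\<And>v. cinner u v = cinner u' (v::'h::complex_hilbert_space)" shows "u = u'"
proof -
  have "cinner (u - u') (u - u') = 0" using assms by (simp add: cinner_diff_left)
  then show ?thesis by (simp add: cinner_self)
qed

lemma cinner_eqI_right:
  assumes "\<And>v. cinner v u = cinner v (u'::'h::complex_hilbert_space)" shows "u = u'"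
  by (rule cinner_eqI_left) (metis assms cinner_commute)

lemma tendsto_cinner:
  assumes "(f \<longlongrightarrow> (u::'h::complex_hilbert_space)) F" "(g \<longlongrightarrow> v) F"
  shows "((\<lambda>n. cinner (f n) (g n)) \<longlongrightarrow> cinner u v) F"
proof -
  have "bounded_bilinear (cinner :: 'h \<Rightarrow> 'h \<Rightarrow> complex)"
    by (unfold_locales)
      (auto simp: cinner_add_left cinner_add_right cinner_scaleR_left cinner_scaleR_right
         scaleR_conv_of_real intro!: exI[of _ 1] cinner_CS)
  from bounded_bilinear.tendsto[OF this assms] show ?thesis .
qed

lemma tendsto_scaleC:
  assumes "(f \<longlongrightarrow> (u::'h::complex_hilbert_space)) F"
  shows "((\<lambda>n. c *\<^sub>C f n) \<longlongrightarrow> c *\<^sub>C u) F"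
proof -
  have "bounded_linear (\<lambda>u::'h. c *\<^sub>C u)"
    by (rule bounded_linear_intro[where K = "cmod c"])
      (simp_all add: scaleC_add_right norm_scaleC mult.commute
        scaleC_complex_of_real[symmetric] scaleC_scaleC)
  from bounded_linear.tendsto[OF this assms] show ?thesis .
qed

text \<open>Over complex scalars the quadratic form determines the operator: \<open>v + u\<close>
  controls the symmetric part of the sesquilinear form \<open>g\<close>, and
  \<open>v + \<i> u\<close> the antisymmetric part.\<close>

lemma polarization:
  fixes S T :: "'h::complex_hilbert_space bop"
  assumes "\<And>v. cinner v (S \<rhd> v) = cinner v (T \<rhd> v)" shows "S = T"
proof (rule bop_eqI, rule cinner_eqI_right)
  fix u v :: 'h
  have lin: "op_apply R (x + y) = op_apply R x + op_apply R y"
    "op_apply R (c *\<^sub>C x) = c *\<^sub>C op_apply R x" for R :: "'h bop" and x y c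
    using op_apply[of R] by (auto simp: linear_add bounded_linear.linear)
  define g where "g x y = cinner x (S \<rhd> y) - cinner x (T \<rhd> y)" for x y
  have g0: "g x x = 0" for x by (simp add: g_def assms)
  have "g (v + u) (v + u) = g v v + g v u + g u v + g u u"
    by (simp add: g_def lin cinner_add_left cinner_add_right algebra_simps)
  then have 1: "g v u + g u v = 0" by (simp add: g0)
  have "g (v + \<i> *\<^sub>C u) (v + \<i> *\<^sub>C u) = g v v + \<i> * g v u - \<i> * g u v + g u u"
    by (simp add: g_def lin cinner_add_left cinner_add_right cinner_scaleC_left
        cinner_scaleC_right algebra_simps)
  then have "\<i> * (g v u - g u v) = 0" by (simp add: g0 algebra_simps)
  then have "g v u = g u v" by simp
  with 1 have "g v u = 0" by simp
  then show "cinner v (op_apply S u) = cinner v (op_apply T u)" by (simp add: g_def)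
qed

section \<open>Minimizing sequences and the Riesz representation\<close>

text \<open>The parallelogram argument with an abstract squared distance \<open>d\<close>: a
  midpoint cannot fall below the infimum, so near-minimizers are close to each other. It serves the
  Riesz representation, the projection of tuples and the averaging over unitaries, which take place
  in different spaces.\<close>

lemma minimizing_sequence:
  fixes q :: "'a \<Rightarrow> real" and d :: "'a \<Rightarrow> 'a \<Rightarrow> real"
  assumes "S \<noteq> {}" and bd: "\<And>a. a \<in> S \<Longrightarrow> L \<le> q a"
    and mid: "\<And>a b. a \<in> S \<Longrightarrow> b \<in> S \<Longrightarrow> \<exists>m\<in>S. d a b \<le> 2 * q a + 2 * q b - 4 * q m"
  shows "\<exists>\<mu> s. (\<forall>n::nat. s n \<in> S) \<and> (\<lambda>n. q (s n)) \<longlonglongrightarrow> \<mu> \<and> (\<forall>a\<in>S. \<mu> \<le> q a) \<and>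
    (\<forall>n. q (s n) - \<mu> < 1 / real (Suc n)) \<and>
    (\<forall>a\<in>S. \<forall>b\<in>S. d a b \<le> 2 * (q a - \<mu>) + 2 * (q b - \<mu>))"
proof -
  define \<mu> where "\<mu> = Inf (q ` S)"
  have bb: "bdd_below (q ` S)" using bd by (auto simp: bdd_below_def)
  have le: "\<mu> \<le> q a" if "a \<in> S" for a
    unfolding \<mu>_def by (rule cInf_lower) (use that bb in auto)
  have "\<exists>a\<in>S. q a < \<mu> + 1 / real (Suc n)" for n
  proof -
    have "Inf (q ` S) < \<mu> + 1 / real (Suc n)" by (simp add: \<mu>_def)
    then show ?thesis using assms(1) cInf_lessD[of "q ` S"] by blast
  qed
  then obtain s where s: "\<And>n. s n \<in> S" "\<And>n. q (s n) < \<mu> + 1 / real (Suc n)" by metis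
  have lim: "(\<lambda>n. q (s n)) \<longlonglongrightarrow> \<mu>"
  proof (rule real_tendsto_sandwich[where f = "\<lambda>_. \<mu>" and h = "\<lambda>n. \<mu> + 1 / real (Suc n)"])
    show "(\<lambda>n. \<mu> + 1 / real (Suc n)) \<longlonglongrightarrow> \<mu>"
      using tendsto_add[OF tendsto_const[of \<mu>] LIMSEQ_Suc[OF lim_inverse_n]]
      by (simp add: inverse_eq_divide)
  qed (use le s in \<open>auto intro!: always_eventually less_imp_le\<close>)
  show ?thesis
  proof (intro exI conjI ballI allI)
    fix a b assume ab: "a \<in> S" "b \<in> S"
    then obtain m where "m \<in> S" "d a b \<le> 2 * q a + 2 * q b - 4 * q m" using mid by blast
    with le[of m] show "d a b \<le> 2 * (q a - \<mu>) + 2 * (q b - \<mu>)" by simp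
  next
    fix n show "q (s n) - \<mu> < 1 / real (Suc n)" using s(2)[of n] by simp
  qed (use s le lim in auto)
qed

lemma pair_less: "d \<le> 2 * a + 2 * b \<Longrightarrow> a < x \<Longrightarrow> b < y \<Longrightarrow> 2 * x + 2 * y < e \<Longrightarrow> d < (e::real)"
  by linarith

lemma inv_Suc_pair_less:
  assumes "e > (0::real)"
  shows "\<exists>N. \<forall>m\<ge>N. \<forall>n\<ge>N. 2 * (1 / real (Suc m)) + 2 * (1 / real (Suc n)) < e"
proof -
  obtain N where N: "1 / real (Suc N) < e / 4"
    using nat_approx_posE[of "e/4"] assms by auto
  have "2 * (1 / real (Suc m)) + 2 * (1 / real (Suc n)) < e" if "m \<ge> N" "n \<ge> N" for m n
  proof -
    have "1 / real (Suc m) \<le> 1 / real (Suc N)" "1 / real (Suc n) \<le> 1 / real (Suc N)"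
      using that by (auto simp: frac_le)
    then show ?thesis using N by linarith
  qed
  then show ?thesis by blast
qed

text \<open>The representing vector minimizes \<open>J\<close>, and the first-order condition at the
  minimum is the claim. With \<open>V\<close> the whole space this yields adjoints, with
  \<open>V\<close> a closed complex subspace the orthogonal projection.\<close>

lemma riesz_on_subspace:
  fixes \<phi> :: "'a::{real_inner, complete_space} \<Rightarrow> real"
  assumes V: "subspace V" "closed V" and lin: "linear \<phi>"
    and bd: "\<And>v. v \<in> V \<Longrightarrow> \<bar>\<phi> v\<bar> \<le> K * norm v"
  shows "\<exists>w\<in>V. \<forall>v\<in>V. \<phi> v = inner w v"
proof -
  define J where "J v = inner v v - 2 * \<phi> v" for v
  have lower: "- K\<^sup>2 \<le> J v" if "v \<in> V" for v
  proof -
    have "\<phi> v \<le> K * norm v" using bd[OF that] by linarith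
    then have "J v \<ge> (norm v)\<^sup>2 - 2 * (K * norm v)" by (simp add: J_def power2_norm_eq_inner)
    also have "(norm v)\<^sup>2 - 2 * (K * norm v) = (norm v - K)\<^sup>2 - K\<^sup>2"
      by (simp add: power2_eq_square algebra_simps)
    finally show ?thesis by (smt (verit) zero_le_power2)
  qed
  have mid: "\<exists>m\<in>V. (norm (a - b))\<^sup>2 \<le> 2 * J a + 2 * J b - 4 * J m" if "a \<in> V" "b \<in> V" for a b
  proof
    show "(1/2) *\<^sub>R (a + b) \<in> V" using V(1) that by (simp add: subspace_add subspace_scale)
    show "(norm (a - b))\<^sup>2 \<le> 2 * J a + 2 * J b - 4 * J ((1/2) *\<^sub>R (a + b))"
      by (simp add: J_def power2_norm_eq_inner linear_add[OF lin] linear_cmul[OF lin]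
          inner_add_left inner_add_right inner_diff_left inner_diff_right inner_commute[of b a]
          algebra_simps)
  qed
  have ne: "V \<noteq> {}" using V(1) subspace_0 by blast
  obtain \<mu> s where s: "\<And>n::nat. s n \<in> V" "(\<lambda>n. J (s n)) \<longlonglongrightarrow> \<mu>" "\<And>a. a \<in> V \<Longrightarrow> \<mu> \<le> J a"
    "\<And>n. J (s n) - \<mu> < 1 / real (Suc n)"
    "\<And>a b. a \<in> V \<Longrightarrow> b \<in> V \<Longrightarrow> (norm (a - b))\<^sup>2 \<le> 2 * (J a - \<mu>) + 2 * (J b - \<mu>)"
    using minimizing_sequence[of V "- K\<^sup>2" J "\<lambda>a b. (norm (a - b))\<^sup>2", OF ne lower mid] by blast
  have "Cauchy s"
  proof (rule metric_CauchyI)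
    fix e :: real assume e: "e > 0"
    obtain N where N: "\<And>m n. m \<ge> N \<Longrightarrow> n \<ge> N \<Longrightarrow>
      2 * (1 / real (Suc m)) + 2 * (1 / real (Suc n)) < e\<^sup>2"
      using inv_Suc_pair_less[of "e\<^sup>2"] e by (metis zero_less_power)
    have "dist (s m) (s n) < e" if "m \<ge> N" "n \<ge> N" for m n
    proof -
      have "(norm (s m - s n))\<^sup>2 < e\<^sup>2"
        by (rule pair_less[OF s(5)[OF s(1)[of m] s(1)[of n]] s(4)[of m] s(4)[of n] N[OF that]])
      then show ?thesis using e by (simp add: dist_norm power_less_imp_less_base)
    qed
    then show "\<exists>M. \<forall>m\<ge>M. \<forall>n\<ge>M. dist (s m) (s n) < e" by blast
  qed
  then obtain w where w: "s \<longlonglongrightarrow> w" using Cauchy_convergent convergent_def by blast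
  have wV: "w \<in> V" using closed_sequentially[OF V(2)] s(1) w by blast
  have phi_lim: "(\<lambda>n. \<phi> (s n)) \<longlonglongrightarrow> \<phi> w"
  proof (rule LIM_zero_cancel, rule Lim_null_comparison[where g = "\<lambda>n. K * norm (s n - w)"])
    show "\<forall>\<^sub>F n in sequentially. norm (\<phi> (s n) - \<phi> w) \<le> K * norm (s n - w)"
      using bd[OF subspace_diff[OF V(1) s(1) wV]]
      by (simp add: linear_diff[OF lin])
    have "(\<lambda>n. norm (s n - w)) \<longlonglongrightarrow> 0" using w by (simp add: LIM_zero tendsto_norm_zero)
    from tendsto_mult_right_zero[OF this, of K] show "(\<lambda>n. K * norm (s n - w)) \<longlonglongrightarrow> 0"
      by simp
  qed
  have "(\<lambda>n. J (s n)) \<longlonglongrightarrow> J w"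
    unfolding J_def by (intro tendsto_intros w phi_lim)
  then have Jw: "J w = \<mu>" using s(2) LIMSEQ_unique by blast
  have "\<phi> v = inner w v" if v: "v \<in> V" for v
  proof -
    define D where "D = inner w v - \<phi> v"
    have pos: "t\<^sup>2 * inner v v + 2 * t * D \<ge> 0" for t
    proof -
      have "\<mu> \<le> J (w + t *\<^sub>R v)" by (rule s(3)) (simp add: V(1) wV v subspace_add subspace_scale)
      then show ?thesis unfolding Jw[symmetric]
        by (simp add: J_def D_def linear_add[OF lin] linear_cmul[OF lin] inner_add_left
            inner_add_right inner_commute[of v w] power2_eq_square algebra_simps)
    qed
    have "D = 0"
    proof (cases "v = 0")
      case True then show ?thesis using linear_0[OF lin] by (simp add: D_def)
    next
      case False
      then have vv: "inner v v > 0" by simp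
      \<comment> \<open>The value of \<open>t\<close> at which the quadratic polynomial in
        \<open>pos\<close> is smallest.\<close>
      have "(- D / inner v v)\<^sup>2 * inner v v + 2 * (- D / inner v v) * D = - (D\<^sup>2 / inner v v)"
        using vv by (simp add: power2_eq_square field_simps)
      with pos[of "- D / inner v v"] have "D\<^sup>2 / inner v v \<le> 0" by linarith
      then show ?thesis using vv by (simp add: divide_le_0_iff)
    qed
    then show ?thesis by (simp add: D_def)
  qed
  then show ?thesis using wV by blast
qed

section \<open>Bounded operators\<close>

lemma ap_simps [simp]:
  fixes S T :: "'h::complex_hilbert_space bop"
  shows "(S + T) \<rhd> v = S \<rhd> v + T \<rhd> v" "(S * T) \<rhd> v = S \<rhd> (T \<rhd> v)" "(- S) \<rhd> v = - (S \<rhd> v)"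
    "(S - T) \<rhd> v = S \<rhd> v - T \<rhd> v" "(0::'h bop) \<rhd> v = 0" "(1::'h bop) \<rhd> v = v"
    "(c *\<^sub>C S) \<rhd> v = c *\<^sub>C (S \<rhd> v)"
proof -
  show "(S - T) \<rhd> v = S \<rhd> v - T \<rhd> v"
    unfolding minus_bop_def plus_bop.rep_eq uminus_bop.rep_eq by simp
qed (simp_all add: plus_bop.rep_eq times_bop.rep_eq uminus_bop.rep_eq zero_bop.rep_eq
    one_bop.rep_eq scaleC_bop.rep_eq)

lemma ap_add: "T \<rhd> (u + v) = T \<rhd> u + T \<rhd> v"
  and ap_scaleC: "T \<rhd> (c *\<^sub>C u) = c *\<^sub>C (T \<rhd> u)"
  and ap_zero [simp]: "T \<rhd> 0 = 0"
  and ap_minus: "T \<rhd> (- u) = - (T \<rhd> u)"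
  and ap_diff: "T \<rhd> (u - v) = T \<rhd> u - T \<rhd> v"
  and ap_scaleR: "T \<rhd> (r *\<^sub>R u) = r *\<^sub>R (T \<rhd> u)"
  using op_apply[of T] by (auto simp: linear_add linear_0 linear_neg linear_diff linear_cmul
      bounded_linear.linear)

lemma ap_sum: "T \<rhd> (\<Sum>i\<in>F. g i) = (\<Sum>i\<in>F. T \<rhd> g i)"
  by (induction F rule: infinite_finite_induct) (auto simp: ap_add)

lemma sum_ap: "(\<Sum>i\<in>F. S i) \<rhd> v = (\<Sum>i\<in>F. S i \<rhd> v)"
  by (induction F rule: infinite_finite_induct) auto

lemma tendsto_ap: "(f \<longlongrightarrow> u) F \<Longrightarrow> ((\<lambda>n. T \<rhd> f n) \<longlongrightarrow> T \<rhd> u) F"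
  using bounded_linear.tendsto[OF bounded_linear_op_apply] .

lemma Bop_ex:
  fixes f :: "'h::complex_hilbert_space \<Rightarrow> 'h"
  assumes "\<And>u v. f (u + v) = f u + f v" "\<And>c u. f (c *\<^sub>C u) = c *\<^sub>C f u"
    "\<And>v. norm (f v) \<le> K * norm v"
  shows "\<exists>T. \<forall>v. T \<rhd> v = f v"
proof -
  have "bounded_linear f"
    by (rule bounded_linear_intro[where K = K])
      (use assms in \<open>simp_all add: scaleC_complex_of_real[symmetric] mult.commute\<close>)
  then have "op_apply (Bop f) = f" using assms(2) by (simp add: Bop_inverse)
  then show ?thesis by metis
qed

lemma scaleC_bop_simps [simp]:
  fixes S T :: "'h::complex_hilbert_space bop"
  shows "(c *\<^sub>C S) * T = c *\<^sub>C (S * T)" "S * (c *\<^sub>C T) = c *\<^sub>C (S * T)"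
    "c *\<^sub>C (d *\<^sub>C S) = (c * d) *\<^sub>C S" "1 *\<^sub>C S = S" "0 *\<^sub>C S = 0" "c *\<^sub>C (0::'h bop) = 0"
  by (auto intro!: bop_eqI simp: ap_scaleC scaleC_scaleC)

lemma scaleC_bop_distrib:
  fixes S T :: "'h::complex_hilbert_space bop"
  shows "c *\<^sub>C (S + T) = c *\<^sub>C S + c *\<^sub>C T" "(c + d) *\<^sub>C S = c *\<^sub>C S + d *\<^sub>C S"
    "c *\<^sub>C (S - T) = c *\<^sub>C S - c *\<^sub>C T" "c *\<^sub>C (- S) = - (c *\<^sub>C S)" "(- c) *\<^sub>C S = - (c *\<^sub>C S)"
    "(c - d) *\<^sub>C S = c *\<^sub>C S - d *\<^sub>C S"
proof -
  have m: "(- c) *\<^sub>C u = - (c *\<^sub>C u)" for c and u :: 'h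
    using scaleC_add_left[of c "- c" u] by (simp add: minus_unique)
  show "c *\<^sub>C (S + T) = c *\<^sub>C S + c *\<^sub>C T" "(c + d) *\<^sub>C S = c *\<^sub>C S + d *\<^sub>C S"
    "c *\<^sub>C (S - T) = c *\<^sub>C S - c *\<^sub>C T" "c *\<^sub>C (- S) = - (c *\<^sub>C S)" "(- c) *\<^sub>C S = - (c *\<^sub>C S)"
    by (auto intro!: bop_eqI simp: m scaleC_add_right scaleC_add_left scaleC_diff_right
        scaleC_minus_right)
  show "(c - d) *\<^sub>C S = c *\<^sub>C S - d *\<^sub>C S"
  proof (rule bop_eqI)
    fix v
    show "((c - d) *\<^sub>C S) \<rhd> v = (c *\<^sub>C S - d *\<^sub>C S) \<rhd> v"
      using scaleC_add_left[of c "- d" "S \<rhd> v"] by (simp add: m)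
  qed
qed

text \<open>The real Riesz theorem represents only the real part of the functional; inserting
  \<open>\<i> v\<close> recovers the imaginary part.\<close>

lemma adj_ex: "\<exists>S. \<forall>u v. cinner (S \<rhd> u) v = cinner u (T \<rhd> (v::'h::complex_hilbert_space))"
proof -
  obtain K where K: "\<And>v. norm (T \<rhd> v) \<le> norm v * K"
    using bounded_linear.bounded[OF bounded_linear_op_apply[of T]] by blast
  have "\<exists>w. \<forall>v. cinner w v = cinner u (T \<rhd> v)" for u
  proof -
    have lin: "linear (\<lambda>v. Re (cinner u (T \<rhd> v)))"
      by (rule linearI) (simp_all add: ap_add ap_scaleR cinner_add_right cinner_scaleR_right)
    have "\<bar>Re (cinner u (T \<rhd> v))\<bar> \<le> (norm u * K) * norm v" for v
    proof -
      have "\<bar>Re (cinner u (T \<rhd> v))\<bar> \<le> norm u * norm (T \<rhd> v)"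
        using abs_Re_le_cmod cinner_CS order_trans by blast
      also have "\<dots> \<le> norm u * (norm v * K)" by (intro mult_left_mono K) auto
      finally show ?thesis by (simp add: mult_ac)
    qed
    from riesz_on_subspace[OF subspace_UNIV closed_UNIV lin this]
    obtain w where w: "\<And>v. Re (cinner u (T \<rhd> v)) = inner w v" by auto
    have "cinner w v = cinner u (T \<rhd> v)" for v
    proof (rule complex_eqI)
      show "Re (cinner w v) = Re (cinner u (T \<rhd> v))" by (simp add: w inner_eq_Re_cinner)
      have "Im (cinner w v) = - Re (cinner w (\<i> *\<^sub>C v))" by (simp add: cinner_scaleC_right)
      also have "\<dots> = - Re (cinner u (T \<rhd> (\<i> *\<^sub>C v)))" by (simp only: w inner_eq_Re_cinner)
      finally show "Im (cinner w v) = Im (cinner u (T \<rhd> v))"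
        by (simp add: ap_scaleC cinner_scaleC_right)
    qed
    then show ?thesis by blast
  qed
  then obtain f where f: "\<And>u v. cinner (f u) v = cinner u (T \<rhd> v)" by metis
  have bound: "norm (f u) \<le> K * norm u" for u
  proof (cases "f u = 0")
    case True
    have "0 \<le> norm u * K"
      using K[of u] norm_ge_zero order_trans by blast
    then show ?thesis using True by (simp add: mult.commute)
  next
    case False
    have "of_real ((norm (f u))\<^sup>2) = cinner u (T \<rhd> f u)" using f[of u "f u"] by (simp add: cinner_self)
    then have "(norm (f u))\<^sup>2 = cmod (cinner u (T \<rhd> f u))"
      by (metis abs_of_nonneg norm_of_real zero_le_power2)
    also have "\<dots> \<le> norm u * norm (T \<rhd> f u)" by (rule cinner_CS)
    also have "\<dots> \<le> norm u * (norm (f u) * K)" by (intro mult_left_mono K) auto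
    finally have "norm (f u) * norm (f u) \<le> norm (f u) * (K * norm u)"
      by (simp add: power2_eq_square mult_ac)
    then show ?thesis using False by simp
  qed
  have "\<exists>S. \<forall>v. S \<rhd> v = f v"
    by (rule Bop_ex[OF _ _ bound]; rule cinner_eqI_left)
      (simp_all add: f cinner_add_left cinner_scaleC_left)
  then show ?thesis using f by metis
qed

lemma adj_unique:
  assumes "\<And>u v. cinner (S \<rhd> u) v = cinner u (T \<rhd> (v::'h::complex_hilbert_space))"
  shows "adj T = S"
  unfolding adj_def
proof (rule the_equality)
  fix S' assume "\<forall>u v. cinner (S' \<rhd> u) v = cinner u (T \<rhd> v)"
  then show "S' = S" by (intro bop_eqI cinner_eqI_left) (simp add: assms)
qed (use assms in blast)

lemma cinner_adj_left: "cinner (adj T \<rhd> u) v = cinner u (T \<rhd> (v::'h::complex_hilbert_space))"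
proof -
  obtain S where S: "\<And>u v. cinner (S \<rhd> u) v = cinner u (T \<rhd> v)" using adj_ex[of T] by blast
  show ?thesis unfolding adj_unique[OF S] by (rule S)
qed

lemma cinner_adj_right: "cinner u (adj T \<rhd> v) = cinner (T \<rhd> u) (v::'h::complex_hilbert_space)"
  by (metis cinner_adj_left cinner_commute)

lemma adj_simps [simp]:
  fixes S T :: "'h::complex_hilbert_space bop"
  shows "adj (adj T) = T" "adj (S * T) = adj T * adj S" "adj (S + T) = adj S + adj T"
    "adj (S - T) = adj S - adj T" "adj (- T) = - adj T" "adj (c *\<^sub>C T) = cnj c *\<^sub>C adj T"
    "adj (0::'h bop) = 0" "adj (1::'h bop) = 1"
  by (rule adj_unique; simp add: cinner_adj_left cinner_adj_right cinner_add_left cinner_add_right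
      cinner_diff_left cinner_diff_right cinner_minus_left cinner_minus_right
      cinner_scaleC_left cinner_scaleC_right)+

lemma adj_sum: "adj (\<Sum>i\<in>F. S i) = (\<Sum>i\<in>F. adj (S i :: 'h::complex_hilbert_space bop))"
  by (induction F rule: infinite_finite_induct) auto

lemma adj_power [simp]: "adj (T ^ n) = adj (T::'h::complex_hilbert_space bop) ^ n"
  by (induction n) (auto simp: power_commutes)

definition nrm :: "'h::complex_hilbert_space bop \<Rightarrow> real" where
  "nrm T = onorm (op_apply T)"

lemma norm_ap_le: "norm (T \<rhd> v) \<le> nrm T * norm v"
  unfolding nrm_def by (rule onorm[OF bounded_linear_op_apply])

lemma nrm_nonneg [simp]: "0 \<le> nrm T"
  unfolding nrm_def by (rule onorm_pos_le[OF bounded_linear_op_apply])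

lemma nrm_le:
  assumes "0 \<le> K" "\<And>v. norm (T \<rhd> v) \<le> K * norm v" shows "nrm T \<le> K"
  unfolding nrm_def by (rule onorm_bound) (rule assms)+

lemma nrm_mult: "nrm (S * T) \<le> nrm S * nrm T"
proof (rule nrm_le, simp)
  fix v
  have "norm (S \<rhd> (T \<rhd> v)) \<le> nrm S * norm (T \<rhd> v)" by (rule norm_ap_le)
  also have "\<dots> \<le> nrm S * (nrm T * norm v)" by (intro mult_left_mono norm_ap_le) auto
  finally show "norm ((S * T) \<rhd> v) \<le> nrm S * nrm T * norm v" by simp
qed

lemma nrm_add: "nrm (S + T) \<le> nrm S + nrm T"
proof (rule nrm_le, simp)
  fix v
  show "norm ((S + T) \<rhd> v) \<le> (nrm S + nrm T) * norm v"
    using norm_triangle_ineq[of "S \<rhd> v" "T \<rhd> v"] norm_ap_le[of S v] norm_ap_le[of T v]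
    by (simp add: distrib_right)
qed

lemma nrm_scaleC: "nrm (c *\<^sub>C T) \<le> cmod c * nrm T"
  by (rule nrm_le) (simp_all add: norm_scaleC mult.assoc mult_left_mono norm_ap_le)

lemma nrm_minus [simp]: "nrm (- T) = nrm T"
  by (simp add: nrm_def uminus_bop.rep_eq onorm_neg)

lemma nrm_diff: "nrm (S - T) \<le> nrm S + nrm T"
  using nrm_add[of S "- T"] by simp

lemma nrm_one: "nrm (1::'h::complex_hilbert_space bop) \<le> 1"
  by (rule nrm_le) simp_all

lemma nrm_adj_le: "nrm (adj T) \<le> nrm (T::'h::complex_hilbert_space bop)"
proof (rule nrm_le, simp)
  fix u
  show "norm (adj T \<rhd> u) \<le> nrm T * norm u"
  proof (cases "adj T \<rhd> u = 0")
    case False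
    have "of_real ((norm (adj T \<rhd> u))\<^sup>2) = cinner u (T \<rhd> (adj T \<rhd> u))"
      by (metis cinner_adj_left cinner_self)
    then have "(norm (adj T \<rhd> u))\<^sup>2 = cmod (cinner u (T \<rhd> (adj T \<rhd> u)))"
      by (metis abs_of_nonneg norm_of_real zero_le_power2)
    also have "\<dots> \<le> norm u * norm (T \<rhd> (adj T \<rhd> u))" by (rule cinner_CS)
    also have "\<dots> \<le> norm u * (nrm T * norm (adj T \<rhd> u))" by (intro mult_left_mono norm_ap_le) auto
    finally have "norm (adj T \<rhd> u) * norm (adj T \<rhd> u) \<le> norm (adj T \<rhd> u) * (nrm T * norm u)"
      by (simp add: power2_eq_square mult_ac)
    then show ?thesis using False by simp
  qed simp
qed

lemma nrm_adj [simp]: "nrm (adj T) = nrm (T::'h::complex_hilbert_space bop)"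
  using nrm_adj_le[of T] nrm_adj_le[of "adj T"] by simp

lemma nrm_power: "nrm (T ^ n) \<le> nrm (T::'h::complex_hilbert_space bop) ^ n"
proof (induction n)
  case (Suc n)
  have "nrm (T ^ Suc n) \<le> nrm T * nrm (T ^ n)" by (simp add: nrm_mult)
  also have "\<dots> \<le> nrm T * nrm T ^ n" by (intro mult_left_mono Suc) auto
  finally show ?case by simp
qed (simp add: nrm_one)

section \<open>Positive operators\<close>

abbreviation qf :: "'h::complex_hilbert_space bop \<Rightarrow> 'h \<Rightarrow> real" where
  "qf T v \<equiv> Re (cinner v (T \<rhd> v))"

lemma qf_simps:
  "qf (S + T) v = qf S v + qf T v" "qf (S - T) v = qf S v - qf T v" "qf (- T) v = - qf T v"
  "qf (0::'h::complex_hilbert_space bop) v = 0" "qf (1::'h bop) v = (norm v)\<^sup>2"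
  "qf (complex_of_real r *\<^sub>C T) v = r * qf T v"
  by (simp_all add: cinner_add_right cinner_diff_right cinner_minus_right cinner_scaleC_right
      cinner_self del: of_real_power)

lemmas qf_algebra = cinner_add_right cinner_diff_right cinner_minus_right cinner_scaleC_right
  cinner_self

lemma pos_op_qf: "pos_op T \<Longrightarrow> 0 \<le> qf T v"
  by (simp add: pos_op_def complex_nonneg_Reals_iff)

lemma pos_op_adj: "pos_op T \<Longrightarrow> adj T = T"
proof (rule polarization)
  fix v assume "pos_op T"
  then have "Im (cinner v (T \<rhd> v)) = 0" by (simp add: pos_op_def complex_nonneg_Reals_iff)
  then show "cinner v (adj T \<rhd> v) = cinner v (T \<rhd> v)"
    by (metis cinner_adj_right cinner_commute complex_cnj_cancel_iff complex_eq_iff cnj.sel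
        neg_equal_zero)
qed

lemma pos_opI:
  assumes "adj T = T" "\<And>v. 0 \<le> qf T v" shows "pos_op T"
  unfolding pos_op_def
proof
  fix v
  have "cnj (cinner v (T \<rhd> v)) = cinner v (T \<rhd> v)"
    by (metis assms(1) cinner_adj_left cinner_commute)
  then have "Im (cinner v (T \<rhd> v)) = 0" by (simp add: complex_eq_iff)
  then show "cinner v (T \<rhd> v) \<in> \<real>\<^sub>\<ge>\<^sub>0" using assms(2) by (simp add: complex_nonneg_Reals_iff)
qed

lemma pos_op_iff: "pos_op T \<longleftrightarrow> adj T = T \<and> (\<forall>v. 0 \<le> qf T v)"
  using pos_opI pos_op_adj pos_op_qf by blast

lemma pos_op_add: "pos_op S \<Longrightarrow> pos_op T \<Longrightarrow> pos_op (S + T)"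
  by (simp add: pos_op_iff cinner_add_right)

lemma pos_op_zero [simp]: "pos_op 0"
  by (simp add: pos_op_iff)

lemma pos_op_sum: "(\<And>i. i \<in> F \<Longrightarrow> pos_op (S i)) \<Longrightarrow> pos_op (\<Sum>i\<in>F. S i)"
  by (induction F rule: infinite_finite_induct) (auto intro: pos_op_add)

lemma pos_op_scale: "pos_op T \<Longrightarrow> 0 \<le> r \<Longrightarrow> pos_op (complex_of_real r *\<^sub>C T)"
  by (simp add: pos_op_iff cinner_scaleC_right)

lemma pos_op_conj: "pos_op T \<Longrightarrow> pos_op (adj S * T * S)"
  unfolding pos_op_iff by (auto simp: mult.assoc cinner_adj_right)

lemma pos_op_adj_mult: "pos_op (adj S * S)"
  by (simp add: pos_op_iff cinner_adj_right inner_eq_Re_cinner[symmetric])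

lemma pos_op_one [simp]: "pos_op 1"
  using pos_op_adj_mult[of 1] by simp

lemma qf_adj_mult: "qf (adj S * S) v = (norm (S \<rhd> v))\<^sup>2"
  by (simp add: cinner_adj_right cinner_self del: of_real_power)

lemma qf_le_nrm: "qf T v \<le> nrm T * (norm v)\<^sup>2"
proof -
  have "qf T v \<le> norm v * norm (T \<rhd> v)"
    using complex_Re_le_cmod cinner_CS order_trans by blast
  also have "\<dots> \<le> norm v * (nrm T * norm v)" by (intro mult_left_mono norm_ap_le) auto
  finally show ?thesis by (simp add: power2_eq_square mult_ac)
qed

lemma pos_op_nrm_minus:
  assumes "adj T = T" "nrm T \<le> K" shows "pos_op (complex_of_real K *\<^sub>C 1 - T)"
proof (rule pos_opI)
  fix v
  have "qf T v \<le> K * (norm v)\<^sup>2"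
    using qf_le_nrm[of v T] assms(2) by (meson mult_right_mono order_trans zero_le_power2)
  then show "0 \<le> qf (complex_of_real K *\<^sub>C 1 - T) v" unfolding qf_simps by simp
qed (simp add: assms(1))

lemma pos_op_CS:
  assumes "pos_op T"
  shows "(cmod (cinner u (T \<rhd> v)))\<^sup>2 \<le> qf T u * qf T v"
proof -
  define z where "z = cinner u (T \<rhd> v)"
  \<comment> \<open>A phase that makes the mixed term real and nonnegative, so that a quadratic
    polynomial in one real variable suffices.\<close>
  define c where "c = (if z = 0 then 1 else z / cmod z)"
  have c1: "cmod c = 1" by (simp add: c_def norm_divide)
  have cz: "cnj c * z = of_real (cmod z)"
  proof (cases "z = 0")
    case False
    have "cnj c * z = (z * cnj z) / cmod z" using False by (simp add: c_def)
    also have "\<dots> = of_real (cmod z)"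
      by (simp only: complex_norm_square[symmetric]) (simp add: power2_eq_square False)
    finally show ?thesis .
  qed (simp add: c_def)
  define u' where "u' = c *\<^sub>C u"
  have u'v: "cinner u' (T \<rhd> v) = of_real (cmod z)"
    by (simp add: u'_def cinner_scaleC_left z_def[symmetric] cz)
  have vu': "cinner v (T \<rhd> u') = of_real (cmod z)"
    by (metis u'v assms cinner_adj_left cinner_commute complex_cnj_complex_of_real pos_op_adj)
  have u'u': "qf T u' = qf T u"
  proof -
    have "cinner u' (T \<rhd> u') = (c * cnj c) * cinner u (T \<rhd> u)"
      by (simp add: u'_def ap_scaleC cinner_scaleC_left cinner_scaleC_right)
    also have "c * cnj c = 1" using c1 by (simp add: complex_norm_square[symmetric])
    finally show ?thesis by simp
  qed
  have q: "0 \<le> qf T v * t\<^sup>2 + 2 * cmod z * t + qf T u" for t :: real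
  proof -
    have "qf T (u' + t *\<^sub>R v) = qf T u' + t * cmod z + t * cmod z + t * t * qf T v"
      by (simp add: ap_add ap_scaleR cinner_add_left cinner_add_right cinner_scaleR_left
          cinner_scaleR_right u'v vu' algebra_simps)
    then show ?thesis using pos_op_qf[OF assms, of "u' + t *\<^sub>R v"] u'u'
      by (simp add: power2_eq_square algebra_simps)
  qed
  have "(cmod z)\<^sup>2 \<le> qf T v * qf T u"
  proof (cases "qf T v = 0")
    case True
    have "cmod z = 0"
    proof (rule ccontr)
      assume "cmod z \<noteq> 0"
      then have "cmod z > 0" by simp
      then show False using q[of "- (qf T u + 1) / (2 * cmod z)"] True by (simp add: field_simps)
    qed
    then show ?thesis using True by simp
  next
    case False
    then have p: "qf T v > 0" using pos_op_qf[OF assms, of v] by linarith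
    have "qf T v * (- cmod z / qf T v)\<^sup>2 + 2 * cmod z * (- cmod z / qf T v) + qf T u
        = qf T u - (cmod z)\<^sup>2 / qf T v"
      using p by (simp add: power2_eq_square field_simps)
    then have "(cmod z)\<^sup>2 / qf T v \<le> qf T u" using q[of "- cmod z / qf T v"] by simp
    then show ?thesis using p by (simp add: field_simps)
  qed
  then show ?thesis by (simp add: z_def mult.commute)
qed

text \<open>Cauchy-Schwarz for the form of \<open>T\<close>, applied to \<open>T v\<close> and
  \<open>v\<close>. It upgrades convergence of quadratic forms to strong convergence.\<close>

lemma pos_op_ap_le:
  assumes "pos_op T" "\<And>v. qf T v \<le> K * (norm v)\<^sup>2"
  shows "(norm (T \<rhd> v))\<^sup>2 \<le> K * qf T v"
proof (cases "T \<rhd> v = 0")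
  case True
  then show ?thesis by simp
next
  case False
  define w where "w = T \<rhd> v"
  have "((norm w)\<^sup>2)\<^sup>2 = (cmod (cinner w (T \<rhd> v)))\<^sup>2"
    by (simp add: w_def[symmetric] cinner_self norm_power)
  also have "\<dots> \<le> qf T w * qf T v" by (rule pos_op_CS[OF assms(1)])
  also have "\<dots> \<le> (K * (norm w)\<^sup>2) * qf T v"
    by (intro mult_right_mono assms(2) pos_op_qf assms(1))
  finally have "(norm w)\<^sup>2 * (norm w)\<^sup>2 \<le> (norm w)\<^sup>2 * (K * qf T v)"
    by (simp add: power2_eq_square mult_ac)
  moreover have "(norm w)\<^sup>2 > 0" using False by (simp add: w_def)
  ultimately have "(norm w)\<^sup>2 \<le> K * qf T v" by (simp only: mult_le_cancel_left_pos)
  then show ?thesis by (simp add: w_def)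
qed

lemma pos_op_qf_zero:
  assumes "pos_op T" "qf T v = 0" shows "T \<rhd> v = 0"
  using pos_op_ap_le[OF assms(1) qf_le_nrm, of v] assms(2) by simp

lemma pos_op_nrm_le:
  assumes "pos_op T" "\<And>v. qf T v \<le> K * (norm v)\<^sup>2" "0 \<le> K" shows "nrm T \<le> K"
proof (rule nrm_le[OF assms(3)])
  fix v
  have "(norm (T \<rhd> v))\<^sup>2 \<le> K * (K * (norm v)\<^sup>2)"
    using pos_op_ap_le[OF assms(1,2), of v] mult_left_mono[OF assms(2)[of v] assms(3)] by linarith
  then have "(norm (T \<rhd> v))\<^sup>2 \<le> (K * norm v)\<^sup>2" by (simp add: power2_eq_square mult_ac)
  then show "norm (T \<rhd> v) \<le> K * norm v" by (rule power2_le_imp_le) (simp add: assms(3))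
qed

section \<open>Monotone sequences, inverses and square roots\<close>

lemma Bop_lim:
  fixes a :: "nat \<Rightarrow> 'h::complex_hilbert_space bop"
  assumes "\<And>v. Cauchy (\<lambda>n. a n \<rhd> v)" "\<And>n. nrm (a n) \<le> K"
  shows "\<exists>A. (\<forall>v. (\<lambda>n. a n \<rhd> v) \<longlonglongrightarrow> A \<rhd> v) \<and> nrm A \<le> K"
proof -
  have "\<forall>v. \<exists>w. (\<lambda>n. a n \<rhd> v) \<longlonglongrightarrow> w"
    using assms(1) Cauchy_convergent convergent_def by blast
  then obtain f where f: "\<And>v. (\<lambda>n. a n \<rhd> v) \<longlonglongrightarrow> f v" by metis
  have K0: "0 \<le> K" using assms(2)[of 0] nrm_nonneg order_trans by blast
  have fb: "norm (f v) \<le> K * norm v" for v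
  proof (rule LIMSEQ_le_const2[OF tendsto_norm[OF f]])
    show "\<exists>N. \<forall>n\<ge>N. norm (a n \<rhd> v) \<le> K * norm v"
      using norm_ap_le assms(2) by (meson mult_right_mono norm_ge_zero order_trans)
  qed
  have "\<exists>A. \<forall>v. A \<rhd> v = f v"
  proof (rule Bop_ex[OF _ _ fb])
    fix u v :: 'h and c
    have "(\<lambda>n. a n \<rhd> (u + v)) \<longlonglongrightarrow> f u + f v" unfolding ap_add by (intro tendsto_add f)
    then show "f (u + v) = f u + f v" using f LIMSEQ_unique by blast
    have "(\<lambda>n. a n \<rhd> (c *\<^sub>C u)) \<longlonglongrightarrow> c *\<^sub>C f u" unfolding ap_scaleC by (intro tendsto_scaleC f)
    then show "f (c *\<^sub>C u) = c *\<^sub>C f u" using f LIMSEQ_unique by blast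
  qed
  then obtain A where A: "\<And>v. A \<rhd> v = f v" by blast
  then show ?thesis using f fb nrm_le[OF K0, of A] by (intro exI[of _ A]) auto
qed

lemma adj_lim:
  assumes "\<And>v. (\<lambda>n::nat. a n \<rhd> v) \<longlonglongrightarrow> A \<rhd> (v::'h::complex_hilbert_space)" "\<And>n. adj (a n) = a n"
  shows "adj A = A"
proof (rule polarization)
  fix v
  have 1: "(\<lambda>n. cinner v (a n \<rhd> v)) \<longlonglongrightarrow> cinner v (A \<rhd> v)" by (intro tendsto_cinner assms tendsto_const)
  have 2: "(\<lambda>n. cinner (a n \<rhd> v) v) \<longlonglongrightarrow> cinner (A \<rhd> v) v" by (intro tendsto_cinner assms tendsto_const)
  have "cinner (a n \<rhd> v) v = cinner v (a n \<rhd> v)" for n by (metis assms(2) cinner_adj_left)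
  with 1 2 have "cinner (A \<rhd> v) v = cinner v (A \<rhd> v)" using LIMSEQ_unique by simp
  then show "cinner v (adj A \<rhd> v) = cinner v (A \<rhd> v)" by (simp add: cinner_adj_right)
qed

lemma tendsto_qf:
  assumes "\<And>v. (\<lambda>n::nat. a n \<rhd> v) \<longlonglongrightarrow> A \<rhd> (v::'h::complex_hilbert_space)"
  shows "(\<lambda>n. qf (a n) v) \<longlonglongrightarrow> qf A v"
  by (intro tendsto_Re tendsto_cinner assms tendsto_const)

text \<open>The scalars \<open>qf (a n) v\<close> increase and converge;
  \<open>pos_op_ap_le\<close>, applied to the positive differences, carries the Cauchy property over
  to the vectors \<open>a n v\<close>.\<close>

lemma monotone_bop_convergence:
  fixes a :: "nat \<Rightarrow> 'h::complex_hilbert_space bop"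
  assumes inc: "\<And>n. pos_op (a (Suc n) - a n)" and sa: "adj (a 0) = a 0"
    and bd: "\<And>n v. qf (a n) v \<le> K * (norm v)\<^sup>2"
  shows "\<exists>A. (\<forall>v. (\<lambda>n. a n \<rhd> v) \<longlonglongrightarrow> A \<rhd> v) \<and> (\<forall>n. pos_op (A - a n)) \<and> (\<forall>n. adj (a n) = a n)"
proof -
  have inc': "pos_op (a n - a m)" if "m \<le> n" for m n
    using that
  proof (induction n rule: dec_induct)
    case (step n)
    then show ?case using pos_op_add[OF step.IH inc[of n]] by simp
  qed simp
  have sa': "adj (a n) = a n" for n
    using pos_op_adj[OF inc'[of 0 n]] sa by simp
  \<comment> \<open>Dominates all differences: later terms are bounded above through
    \<open>K\<close>, every term is bounded below by \<open>- nrm (a 0)\<close>, and the summand 1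
    makes the constant positive.\<close>
  define K' where "K' = \<bar>K\<bar> + nrm (a 0) + 1"
  have K': "qf (a n - a m) v \<le> K' * (norm v)\<^sup>2" if "m \<le> n" for m n v
  proof -
    have "qf (a m) v \<ge> qf (a 0) v" using pos_op_qf[OF inc'[of 0 m], of v] by (simp add: qf_algebra)
    moreover have "- qf (a 0) v \<le> nrm (a 0) * (norm v)\<^sup>2"
      using qf_le_nrm[of v "- a 0"] by (simp add: qf_algebra)
    moreover have "K * (norm v)\<^sup>2 \<le> \<bar>K\<bar> * (norm v)\<^sup>2" by (intro mult_right_mono) auto
    ultimately show ?thesis using bd[of v n] zero_le_power2[of "norm v"] unfolding K'_def qf_simps distrib_right
      by linarith
  qed
  have K'0: "0 \<le> K'" by (simp add: K'_def)
  have cauchy: "Cauchy (\<lambda>n. a n \<rhd> v)" for v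
  proof -
    have "convergent (\<lambda>n. qf (a n) v)"
    proof (rule Bseq_mono_convergent)
      show "Bseq (\<lambda>n. qf (a n) v)"
      proof (rule BseqI'[where K = "\<bar>qf (a 0) v\<bar> + \<bar>K * (norm v)\<^sup>2\<bar>"])
        fix n
        have "qf (a n) v \<ge> qf (a 0) v" using pos_op_qf[OF inc'[of 0 n], of v] by (simp add: qf_algebra)
        then show "norm (qf (a n) v) \<le> \<bar>qf (a 0) v\<bar> + \<bar>K * (norm v)\<^sup>2\<bar>"
          using bd[of v n] unfolding real_norm_def by linarith
      qed
      show "\<forall>m n. m \<le> n \<longrightarrow> qf (a m) v \<le> qf (a n) v"
        using pos_op_qf[OF inc'] by (force simp: qf_algebra)
    qed
    then have C: "Cauchy (\<lambda>n. qf (a n) v)" by (simp add: convergent_Cauchy)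
    have est: "(norm (a n \<rhd> v - a m \<rhd> v))\<^sup>2 \<le> K' * \<bar>qf (a n) v - qf (a m) v\<bar>" for m n
    proof -
      have *: "(norm (a n \<rhd> v - a m \<rhd> v))\<^sup>2 \<le> K' * \<bar>qf (a n) v - qf (a m) v\<bar>" if "m \<le> n" for m n
      proof -
        have "(norm ((a n - a m) \<rhd> v))\<^sup>2 \<le> K' * qf (a n - a m) v"
          by (rule pos_op_ap_le[OF inc'[OF that] K'[OF that]])
        also have "\<dots> \<le> K' * \<bar>qf (a n) v - qf (a m) v\<bar>"
          using K'0 unfolding qf_simps by (intro mult_left_mono) auto
        finally show ?thesis by simp
      qed
      show ?thesis
        using *[of m n] *[of n m] by (cases "m \<le> n") (auto simp: norm_minus_commute abs_minus_commute)
    qed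
    show ?thesis
    proof (rule metric_CauchyI)
      fix e :: real assume e: "e > 0"
      have K1: "K' > 0" unfolding K'_def by (smt (verit) nrm_nonneg)
      then have "e\<^sup>2 / K' > 0" using e by simp
      then obtain N where N: "\<And>m n. m \<ge> N \<Longrightarrow> n \<ge> N \<Longrightarrow> dist (qf (a m) v) (qf (a n) v) < e\<^sup>2 / K'"
        using C metric_CauchyD by blast
      have "dist (a m \<rhd> v) (a n \<rhd> v) < e" if "m \<ge> N" "n \<ge> N" for m n
      proof -
        have "K' * \<bar>qf (a m) v - qf (a n) v\<bar> < e\<^sup>2"
          using N[OF that] K1 by (simp add: dist_real_def field_simps)
        with est[of m n] have "(norm (a m \<rhd> v - a n \<rhd> v))\<^sup>2 < e\<^sup>2" by linarith
        then show ?thesis using e by (simp add: dist_norm power_less_imp_less_base)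
      qed
      then show "\<exists>M. \<forall>m\<ge>M. \<forall>n\<ge>M. dist (a m \<rhd> v) (a n \<rhd> v) < e" by blast
    qed
  qed
  have "nrm (a n) \<le> K' + nrm (a 0)" for n
  proof -
    have "nrm (a n - a 0) \<le> K'" by (rule pos_op_nrm_le[OF inc' K' K'0]) auto
    then show ?thesis using nrm_add[of "a n - a 0" "a 0"] by simp
  qed
  from Bop_lim[OF cauchy this] obtain A where A: "\<And>v. (\<lambda>n. a n \<rhd> v) \<longlonglongrightarrow> A \<rhd> v" by blast
  have "pos_op (A - a n)" for n
  proof (rule pos_opI)
    show "adj (A - a n) = A - a n" using adj_lim[OF A sa'] sa' by simp
    fix v
    have "qf (a n) v \<le> qf A v"
    proof (rule LIMSEQ_le_const[OF tendsto_qf[OF A]], intro exI allI impI)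
      fix k assume "n \<le> k"
      then show "qf (a n) v \<le> qf (a k) v" using pos_op_qf[OF inc'[of n k], of v] by (simp add: qf_algebra)
    qed
    then show "0 \<le> qf (A - a n) v" unfolding qf_simps by simp
  qed
  then show ?thesis using A sa' by blast
qed

text \<open>Surjectivity comes from the fixed point of the contraction that sends \<open>v\<close>
  to \<open>v - \<rho> (T v - w)\<close>. Coercivity is assumed in place of self-adjointness because
  \<open>T\<close> is later also \<open>1 + \<i> c\<close>.\<close>

lemma lax_milgram_inverse:
  fixes T :: "'h::complex_hilbert_space bop"
  assumes co: "\<And>v. (norm v)\<^sup>2 \<le> qf T v"
  shows "\<exists>S. S * T = 1 \<and> T * S = 1 \<and> nrm S \<le> 1"
proof -
  have lower: "norm v \<le> norm (T \<rhd> v)" for v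
  proof (cases "v = 0")
    case False
    have "norm v * norm v \<le> norm v * norm (T \<rhd> v)"
      using co[of v] complex_Re_le_cmod[of "cinner v (T \<rhd> v)"] cinner_CS[of v "T \<rhd> v"]
      by (simp add: power2_eq_square)
    then show ?thesis using False by simp
  qed simp
  define N where "N = nrm T + 1"
  have N: "N \<ge> 1" "\<And>v. norm (T \<rhd> v) \<le> N * norm v"
    using norm_ap_le[of T] by (auto simp: N_def distrib_right add_increasing2)
  \<comment> \<open>With \<open>\<rho> * N\<^sup>2 = 1\<close> the second-order term adds at most
    \<open>\<rho> (norm v)\<^sup>2\<close>, while the first-order term removes at least twice as
    much; this leaves the factor \<open>1 - \<rho>\<close>.\<close>
  define \<rho> where "\<rho> = 1 / N\<^sup>2"
  have rho: "\<rho> > 0" "\<rho> \<le> 1" "\<rho> * N\<^sup>2 = 1"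
    using N(1) by (simp_all add: \<rho>_def divide_le_eq)
  define c where "c = sqrt (1 - \<rho>)"
  have contr: "norm (v - \<rho> *\<^sub>R (T \<rhd> v)) \<le> c * norm v" for v
  proof -
    have "(norm (T \<rhd> v))\<^sup>2 \<le> N\<^sup>2 * (norm v)\<^sup>2"
      using power_mono[OF N(2)[of v], of 2] by (simp add: power_mult_distrib)
    then have "\<rho>\<^sup>2 * (norm (T \<rhd> v))\<^sup>2 \<le> \<rho>\<^sup>2 * (N\<^sup>2 * (norm v)\<^sup>2)" by (rule mult_left_mono) simp
    also have "\<dots> = \<rho> * (\<rho> * N\<^sup>2) * (norm v)\<^sup>2" by (simp add: power2_eq_square mult_ac)
    finally have 1: "\<rho>\<^sup>2 * (norm (T \<rhd> v))\<^sup>2 \<le> \<rho> * (norm v)\<^sup>2" by (simp add: rho)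
    have 2: "\<rho> * (norm v)\<^sup>2 \<le> \<rho> * qf T v" using co[of v] rho(1) by simp
    have "(norm (v - \<rho> *\<^sub>R (T \<rhd> v)))\<^sup>2 = (norm v)\<^sup>2 - 2 * \<rho> * qf T v + \<rho>\<^sup>2 * (norm (T \<rhd> v))\<^sup>2"
    proof -
      have "inner v (T \<rhd> v) = qf T v" "inner (T \<rhd> v) v = qf T v"
        by (simp_all add: inner_eq_Re_cinner[of v] inner_commute[of "T \<rhd> v" v])
      then show ?thesis unfolding power2_norm_eq_inner
        by (simp add: inner_diff_left inner_diff_right power2_eq_square algebra_simps)
    qed
    also have "\<dots> \<le> (1 - \<rho>) * (norm v)\<^sup>2"
      using 1 2 unfolding left_diff_distrib by linarith
    also have "\<dots> = (c * norm v)\<^sup>2" using rho by (simp add: c_def power_mult_distrib)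
    finally show ?thesis by (rule power2_le_imp_le) (simp add: c_def rho)
  qed
  have surj: "\<exists>v. T \<rhd> v = w" for w
  proof -
    have "\<exists>!v. v - \<rho> *\<^sub>R (T \<rhd> v - w) = v"
    proof (rule banach_fix_type[of c])
      show "0 \<le> c" "c < 1" using rho by (auto simp: c_def)
      show "\<forall>x y. dist (x - \<rho> *\<^sub>R (T \<rhd> x - w)) (y - \<rho> *\<^sub>R (T \<rhd> y - w)) \<le> c * dist x y"
      proof (intro allI)
        fix x y :: 'h
        have "x - \<rho> *\<^sub>R (T \<rhd> x - w) - (y - \<rho> *\<^sub>R (T \<rhd> y - w)) = (x - y) - \<rho> *\<^sub>R (T \<rhd> (x - y))"
          by (simp add: ap_diff scaleR_diff_right algebra_simps)
        then show "dist (x - \<rho> *\<^sub>R (T \<rhd> x - w)) (y - \<rho> *\<^sub>R (T \<rhd> y - w)) \<le> c * dist x y"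
          using contr[of "x - y"] unfolding dist_norm by metis
      qed
    qed
    then obtain v where v: "v - \<rho> *\<^sub>R (T \<rhd> v - w) = v" by blast
    then have "\<rho> *\<^sub>R (T \<rhd> v - w) = 0"
      by (metis add_diff_cancel_left' diff_add_cancel diff_self)
    then show ?thesis using rho(1) by auto
  qed
  have inj: "v = v'" if "T \<rhd> v = T \<rhd> v'" for v v'
    using lower[of "v - v'"] that by (simp add: ap_diff)
  obtain f where f: "\<And>w. T \<rhd> f w = w" using surj by metis
  have "\<exists>S. \<forall>w. S \<rhd> w = f w"
  proof (rule Bop_ex[where K = 1])
    show "norm (f v) \<le> 1 * norm v" for v using lower[of "f v"] by (simp add: f)
  qed (rule inj; simp add: f ap_add ap_scaleC)+
  then obtain S where S: "\<And>w. S \<rhd> w = f w" by blast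
  have "T * S = 1" by (rule bop_eqI) (simp add: S f)
  moreover have "S * T = 1" by (rule bop_eqI, rule inj) (simp add: S f)
  moreover have "nrm S \<le> 1"
  proof (rule nrm_le)
    show "norm (S \<rhd> w) \<le> 1 * norm w" for w using lower[of "f w"] by (simp add: S f)
  qed simp
  ultimately show ?thesis by blast
qed

text \<open>The polynomials in \<open>t\<close> with nonnegative coefficients. They are closed under
  products and positive for positive \<open>t\<close>, which provides the order relations needed for
  the square root.\<close>

inductive_set pcone :: "'h::complex_hilbert_space bop \<Rightarrow> 'h bop set" for t where
  zero: "0 \<in> pcone t"
| add: "p \<in> pcone t \<Longrightarrow> 0 \<le> r \<Longrightarrow> p + complex_of_real r *\<^sub>C t ^ n \<in> pcone t"

lemma pcone_plus: "p \<in> pcone t \<Longrightarrow> q \<in> pcone t \<Longrightarrow> q + p \<in> pcone t"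
  by (induction rule: pcone.induct) (auto simp: add.assoc[symmetric] intro: pcone.intros)

lemma pcone_scale: "p \<in> pcone t \<Longrightarrow> 0 \<le> r \<Longrightarrow> complex_of_real r *\<^sub>C p \<in> pcone t"
proof (induction rule: pcone.induct)
  case (add p s n)
  then show ?case
    using pcone.add[of "complex_of_real r *\<^sub>C p" t "r * s" n] by (simp add: scaleC_bop_distrib)
qed (simp add: pcone.zero)

lemma pcone_power: "t ^ n \<in> pcone t"
  using pcone.add[OF pcone.zero, of 1 t n] by simp

lemma pcone_mult_power: "p \<in> pcone t \<Longrightarrow> p * t ^ n \<in> pcone t"
proof (induction rule: pcone.induct)
  case (add p s m)
  then show ?case
    using pcone.add[of "p * t ^ n" t s "m + n"] by (simp add: distrib_right power_add)
qed (simp add: pcone.zero)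

lemma pcone_mult: "q \<in> pcone t \<Longrightarrow> p \<in> pcone t \<Longrightarrow> p * q \<in> pcone t"
proof (induction rule: pcone.induct)
  case (add q s m)
  have "complex_of_real s *\<^sub>C (p * t ^ m) \<in> pcone t"
    using add by (intro pcone_scale pcone_mult_power)
  from pcone_plus[OF this add.IH[OF add.prems]] show ?case by (simp add: distrib_left)
qed (simp add: pcone.zero)

lemma pcone_commute:
  assumes "p \<in> pcone t" "x * t = t * x" shows "x * p = p * x"
  using assms(1)
proof (induction rule: pcone.induct)
  case (add p s m)
  have "x * t ^ m = t ^ m * x" by (rule power_commuting_commutes[OF assms(2)[symmetric], symmetric])
  then show ?case using add by (simp add: distrib_left distrib_right)
qed simp

text \<open>\<open>t ^ (2 * m + k)\<close> with \<open>k < 2\<close> is \<open>t ^ k\<close>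
  conjugated by the self-adjoint \<open>t ^ m\<close>.\<close>

lemma pos_op_power: "pos_op t \<Longrightarrow> pos_op (t ^ n)"
proof -
  assume t: "pos_op t"
  have "t ^ (2 * m + k) = adj (t ^ m) * t ^ k * t ^ m" for m k
    using t by (simp add: pos_op_adj power_add[symmetric] add.commute add.left_commute mult_2)
  moreover have "pos_op (t ^ k)" if "k < 2" for k
    using t that by (cases "k = 0") (auto simp: less_2_cases_iff)
  ultimately show ?thesis
    by (metis pos_op_conj mult_div_mod_eq mod_less_divisor zero_less_numeral)
qed

lemma pcone_pos: "p \<in> pcone t \<Longrightarrow> pos_op t \<Longrightarrow> pos_op p"
  by (induction rule: pcone.induct) (auto intro: pos_op_add pos_op_scale pos_op_power)

lemma pos_op_contr_square:
  assumes "pos_op y" "pos_op (1 - y)" shows "pos_op (1 - y * y)"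
proof (rule pos_opI)
  show "adj (1 - y * y) = 1 - y * y" using assms by (simp add: pos_op_adj)
  fix v
  have b: "qf y v \<le> 1 * (norm v)\<^sup>2" for v using pos_op_qf[OF assms(2), of v] by (simp add: qf_algebra)
  have "nrm y \<le> 1" by (rule pos_op_nrm_le[OF assms(1) b]) simp
  then have "norm (y \<rhd> v) \<le> 1 * norm v"
    using norm_ap_le[of y v] mult_right_mono[of "nrm y" 1 "norm v"] by simp
  then have "(norm (y \<rhd> v))\<^sup>2 \<le> (norm v)\<^sup>2" by (simp add: power_mono)
  then show "0 \<le> qf (1 - y * y) v"
    using qf_adj_mult[of v y] assms(1) by (simp add: qf_algebra pos_op_adj)
qed

text \<open>The iteration \<open>y \<mapsto> (t + y\<^sup>2) / 2\<close> increases to \<open>1 - sqrt (1 - t)\<close>; all iterates are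
  polynomials in \<open>t\<close> with nonnegative coefficients, which gives the monotonicity.\<close>

fun sqrt_iter :: "'h::complex_hilbert_space bop \<Rightarrow> nat \<Rightarrow> 'h bop" where
  "sqrt_iter t 0 = 0"
| "sqrt_iter t (Suc n) = complex_of_real (1/2) *\<^sub>C (t + sqrt_iter t n * sqrt_iter t n)"

lemma sqrt_iter_pcone: "sqrt_iter t n \<in> pcone t"
proof (induction n)
  case (Suc n)
  have "t \<in> pcone t" using pcone_power[of t 1] by simp
  then show ?case unfolding sqrt_iter.simps using Suc
    by (intro pcone_scale pcone_plus pcone_mult) auto
qed (simp add: pcone.zero)

lemma sqrt_iter_commute: "sqrt_iter t m * sqrt_iter t n = sqrt_iter t n * sqrt_iter t m"
proof -
  have "t * sqrt_iter t n = sqrt_iter t n * t" by (rule pcone_commute[OF sqrt_iter_pcone]) simp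
  then show ?thesis using pcone_commute[OF sqrt_iter_pcone[of t m], of "sqrt_iter t n"] by simp
qed

lemma sqrt_iter_mono: "sqrt_iter t (Suc n) - sqrt_iter t n \<in> pcone t"
proof (induction n)
  case 0
  then show ?case using pcone_scale[OF pcone_power[of t 1], of "1/2"] by simp
next
  case (Suc n)
  define a b where "a = sqrt_iter t (Suc n)" and "b = sqrt_iter t n"
  have ab: "a * b = b * a" unfolding a_def b_def by (rule sqrt_iter_commute)
  have "sqrt_iter t (Suc (Suc n)) - a = complex_of_real (1/2) *\<^sub>C (t + a * a) - complex_of_real (1/2) *\<^sub>C (t + b * b)"
    unfolding a_def b_def by simp
  also have "\<dots> = complex_of_real (1/2) *\<^sub>C ((a - b) * (a + b))"
    by (simp add: scaleC_bop_distrib(3)[symmetric] algebra_simps ab)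
  also have "\<dots> \<in> pcone t"
    using Suc unfolding a_def b_def
    by (intro pcone_scale pcone_mult pcone_plus sqrt_iter_pcone) auto
  finally show ?case by (simp add: a_def)
qed

lemma sqrt_iter_le:
  assumes "pos_op t" "pos_op (1 - t)" shows "pos_op (1 - sqrt_iter t n)"
proof (induction n)
  case (Suc n)
  let ?y = "sqrt_iter t n"
  have "pos_op (complex_of_real (1/2) *\<^sub>C ((1 - t) + (1 - ?y * ?y)))"
    using assms Suc by (intro pos_op_scale pos_op_add pos_op_contr_square
        pcone_pos[OF sqrt_iter_pcone]) auto
  also have "complex_of_real (1/2) *\<^sub>C ((1 - t) + (1 - ?y * ?y)) = 1 - sqrt_iter t (Suc n)"
  proof -
    have "complex_of_real (1/2) *\<^sub>C (1 + 1) = (1::'a bop)"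
      unfolding scaleC_bop_distrib(1) scaleC_bop_distrib(2)[symmetric] by simp
    then show ?thesis by (simp add: scaleC_bop_distrib algebra_simps)
  qed
  finally show ?case .
qed simp

text \<open>The limit \<open>A\<close> of the iteration for \<open>t = 1 - p\<close> satisfies
  \<open>2 A = t + A\<^sup>2\<close>, that is \<open>(1 - A)\<^sup>2 = p\<close>. The commutation
  clause is inherited from the iterates; later it places the root in a given von Neumann
  algebra.\<close>

lemma sqrt_contraction:
  fixes p :: "'h::complex_hilbert_space bop"
  assumes "pos_op p" "pos_op (1 - p)"
  shows "\<exists>d. pos_op d \<and> d * d = p \<and> (\<forall>x. x * p = p * x \<longrightarrow> x * d = d * x)"
proof -
  define t where "t = 1 - p"
  define y where "y = sqrt_iter t"
  have t: "pos_op t" "pos_op (1 - t)" using assms by (auto simp: t_def)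
  have inc: "pos_op (y (Suc n) - y n)" for n
    unfolding y_def by (rule pcone_pos[OF sqrt_iter_mono t(1)])
  have y1: "pos_op (1 - y n)" for n unfolding y_def by (rule sqrt_iter_le[OF t])
  have bd: "qf (y n) v \<le> 1 * (norm v)\<^sup>2" for n v
    using pos_op_qf[OF y1[of n], of v] by (simp add: qf_algebra)
  obtain A where A: "\<And>v. (\<lambda>n. y n \<rhd> v) \<longlonglongrightarrow> A \<rhd> v" and sa: "\<And>n. adj (y n) = y n"
    using monotone_bop_convergence[where a = y and K = 1, OF inc _ bd] by (auto simp: y_def)
  have saA: "adj A = A" by (rule adj_lim[OF A sa])
  have yb: "norm (y n \<rhd> v) \<le> norm v" for n v
  proof -
    have "pos_op (y n)" unfolding y_def by (rule pcone_pos[OF sqrt_iter_pcone t(1)])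
    then have "nrm (y n) \<le> 1" by (rule pos_op_nrm_le[OF _ bd]) simp
    then show ?thesis using norm_ap_le[of "y n" v] mult_right_mono[of "nrm (y n)" 1 "norm v"] by simp
  qed
  have sq: "(\<lambda>n. y n \<rhd> (y n \<rhd> v)) \<longlonglongrightarrow> A \<rhd> (A \<rhd> v)" for v
  proof -
    \<comment> \<open>A product of strongly convergent sequences converges once the left factors are
      uniformly bounded, here by \<open>yb\<close>.\<close>
    have "(\<lambda>n. y n \<rhd> (y n \<rhd> v - A \<rhd> v)) \<longlonglongrightarrow> 0"
    proof (rule Lim_null_comparison)
      show "\<forall>\<^sub>F n in sequentially. norm (y n \<rhd> (y n \<rhd> v - A \<rhd> v)) \<le> norm (y n \<rhd> v - A \<rhd> v)"
        using yb by auto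
      show "(\<lambda>n. norm (y n \<rhd> v - A \<rhd> v)) \<longlonglongrightarrow> 0" using A[of v] by (simp add: LIM_zero tendsto_norm_zero)
    qed
    from tendsto_add[OF this A[of "A \<rhd> v"]] show ?thesis by (simp add: ap_diff)
  qed
  have fixed: "A = complex_of_real (1/2) *\<^sub>C (t + A * A)"
  proof (rule bop_eqI)
    fix v
    have "(\<lambda>n. y (Suc n) \<rhd> v) \<longlonglongrightarrow> complex_of_real (1/2) *\<^sub>C (t \<rhd> v + A \<rhd> (A \<rhd> v))"
      unfolding y_def sqrt_iter.simps ap_simps
      by (intro tendsto_scaleC tendsto_add tendsto_const sq[unfolded y_def])
    from LIMSEQ_unique[OF LIMSEQ_Suc[OF A[of v]] this]
    show "A \<rhd> v = (complex_of_real (1/2) *\<^sub>C (t + A * A)) \<rhd> v" by (simp only: ap_simps)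
  qed
  have two: "A + A = t + A * A"
  proof -
    have "A + A = complex_of_real (1/2) *\<^sub>C (t + A * A) + complex_of_real (1/2) *\<^sub>C (t + A * A)"
      by (rule arg_cong2[where f = "(+)", OF fixed fixed])
    also have "\<dots> = t + A * A" by (simp only: scaleC_bop_distrib(2)[symmetric]) simp
    finally show ?thesis .
  qed
  have "(1 - A) * (1 - A) = 1 - (A + A) + A * A" by (simp add: algebra_simps)
  then have dd: "(1 - A) * (1 - A) = p" unfolding two by (simp add: t_def)
  have "pos_op (1 - A)"
  proof (rule pos_opI)
    fix v
    have "qf A v \<le> (norm v)\<^sup>2"
      by (rule LIMSEQ_le_const2[OF tendsto_qf[OF A]]) (use bd in auto)
    then show "0 \<le> qf (1 - A) v" by (simp add: qf_algebra)
  qed (simp add: saA)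
  moreover have "x * (1 - A) = (1 - A) * x" if x: "x * p = p * x" for x
  proof -
    have "x * t = t * x" using x by (simp add: t_def algebra_simps)
    then have c: "x * y n = y n * x" for n unfolding y_def by (rule pcone_commute[OF sqrt_iter_pcone])
    have "x * A = A * x"
    proof (rule bop_eqI)
      fix v
      have "(\<lambda>n. (x * y n) \<rhd> v) \<longlonglongrightarrow> x \<rhd> (A \<rhd> v)" unfolding ap_simps by (intro tendsto_ap A)
      moreover have "(\<lambda>n. (y n * x) \<rhd> v) \<longlonglongrightarrow> A \<rhd> (x \<rhd> v)" unfolding ap_simps by (intro A)
      ultimately show "(x * A) \<rhd> v = (A * x) \<rhd> v" using c LIMSEQ_unique by auto
    qed
    then show ?thesis by (simp add: algebra_simps)
  qed
  ultimately show ?thesis using dd by blast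
qed

lemma pos_op_sqrt:
  fixes p :: "'h::complex_hilbert_space bop"
  assumes "pos_op p"
  shows "\<exists>d. pos_op d \<and> d * d = p \<and> (\<forall>x. x * p = p * x \<longrightarrow> x * d = d * x)"
proof -
  define K where "K = nrm p + 1"
  have K: "K > 0" "nrm p \<le> K" unfolding K_def by (smt (verit) nrm_nonneg)+
  define p' where "p' = complex_of_real (1 / K) *\<^sub>C p"
  have p: "p = complex_of_real K *\<^sub>C p'" using K by (simp add: p'_def)
  have p'1: "pos_op p'" unfolding p'_def using assms K by (intro pos_op_scale) auto
  have "pos_op (complex_of_real (1 / K) *\<^sub>C (complex_of_real K *\<^sub>C 1 - p))"
    using K by (intro pos_op_scale pos_op_nrm_minus pos_op_adj assms) auto
  then have p'2: "pos_op (1 - p')" using K by (simp add: p'_def scaleC_bop_distrib)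
  obtain d where d: "pos_op d" "d * d = p'" "\<And>x. x * p' = p' * x \<Longrightarrow> x * d = d * x"
    using sqrt_contraction[OF p'1 p'2] by blast
  define e where "e = complex_of_real (sqrt K) *\<^sub>C d"
  have "pos_op e" unfolding e_def using d(1) K by (intro pos_op_scale) auto
  moreover have "e * e = p" using K d(2)
    by (simp add: e_def p of_real_mult[symmetric] del: of_real_mult)
  moreover have "x * e = e * x" if "x * p = p * x" for x
    using d(3)[of x] that by (simp add: e_def p'_def)
  ultimately show ?thesis by blast
qed

section \<open>Von Neumann algebras\<close>

lemma commutant_closed:
  fixes S :: "'h::complex_hilbert_space bop set"
  shows "1 \<in> commutant S" "0 \<in> commutant S" "a \<in> commutant S \<Longrightarrow> b \<in> commutant S \<Longrightarrow> a + b \<in> commutant S"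
    "a \<in> commutant S \<Longrightarrow> b \<in> commutant S \<Longrightarrow> a * b \<in> commutant S"
    "a \<in> commutant S \<Longrightarrow> b \<in> commutant S \<Longrightarrow> a - b \<in> commutant S"
    "a \<in> commutant S \<Longrightarrow> - a \<in> commutant S"
    "a \<in> commutant S \<Longrightarrow> c *\<^sub>C a \<in> commutant S"
proof -
  show "a \<in> commutant S \<Longrightarrow> b \<in> commutant S \<Longrightarrow> a * b \<in> commutant S"
    unfolding commutant_def by (auto simp: mult.assoc) (metis mult.assoc)
qed (auto simp: commutant_def algebra_simps)

lemma commutant_adj:
  assumes "adj ` S \<subseteq> S" "a \<in> commutant S" shows "adj a \<in> commutant S"
  unfolding commutant_def
proof safe
  fix s assume "s \<in> S"
  then have "a * adj s = adj s * a" using assms by (auto simp: commutant_def)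
  then have "adj (a * adj s) = adj (adj s * a)" by simp
  then show "adj a * s = s * adj a" by simp
qed

lemma commutant_lim:
  assumes "\<And>n::nat. a n \<in> commutant S" "\<And>v. (\<lambda>n. a n \<rhd> v) \<longlonglongrightarrow> A \<rhd> v"
  shows "A \<in> commutant S"
  unfolding commutant_def
proof safe
  fix x assume x: "x \<in> S"
  show "A * x = x * A"
  proof (rule bop_eqI)
    fix v
    have "(\<lambda>n. (x * a n) \<rhd> v) \<longlonglongrightarrow> x \<rhd> (A \<rhd> v)" unfolding ap_simps by (intro tendsto_ap assms)
    moreover have "(\<lambda>n. (a n * x) \<rhd> v) \<longlonglongrightarrow> A \<rhd> (x \<rhd> v)" unfolding ap_simps by (intro assms)
    moreover have "x * a n = a n * x" for n using assms(1)[of n] x by (auto simp: commutant_def)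
    ultimately show "(A * x) \<rhd> v = (x * A) \<rhd> v" using LIMSEQ_unique by auto
  qed
qed

lemma commutant_antimono: "S \<subseteq> T \<Longrightarrow> commutant T \<subseteq> commutant S"
  by (auto simp: commutant_def)

lemma subset_bicommutant: "S \<subseteq> commutant (commutant S)"
  by (auto simp: commutant_def)

lemma commutant_vna:
  assumes "adj ` S \<subseteq> S" shows "von_neumann_algebra (commutant S)"
  unfolding von_neumann_algebra_def
proof
  show "adj ` commutant S \<subseteq> commutant S" using commutant_adj[OF assms] by blast
  show "commutant (commutant (commutant S)) = commutant S"
    using subset_bicommutant commutant_antimono by (metis subset_antisym)
qed

locale vna =
  fixes M :: "'h::complex_hilbert_space bop set"
  assumes vN: "von_neumann_algebra M"
begin

lemma bicomm: "commutant (commutant M) = M"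
  using vN by (simp add: von_neumann_algebra_def)

lemma one_in [simp, intro]: "1 \<in> M"
  and zero_in [simp, intro]: "0 \<in> M"
  and add_in [simp, intro]: "a \<in> M \<Longrightarrow> b \<in> M \<Longrightarrow> a + b \<in> M"
  and mult_in [simp, intro]: "a \<in> M \<Longrightarrow> b \<in> M \<Longrightarrow> a * b \<in> M"
  and diff_in [simp, intro]: "a \<in> M \<Longrightarrow> b \<in> M \<Longrightarrow> a - b \<in> M"
  and minus_in [simp, intro]: "a \<in> M \<Longrightarrow> - a \<in> M"
  and scaleC_in [simp, intro]: "a \<in> M \<Longrightarrow> c *\<^sub>C a \<in> M"
  using commutant_closed[where S = "commutant M"] by (auto simp: bicomm)

lemma adj_in [simp, intro]: "a \<in> M \<Longrightarrow> adj a \<in> M"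
  using vN by (auto simp: von_neumann_algebra_def)

lemma sum_in [intro]: "(\<And>i. i \<in> F \<Longrightarrow> g i \<in> M) \<Longrightarrow> (\<Sum>i\<in>F. g i) \<in> M"
  by (induction F rule: infinite_finite_induct) auto

lemma power_in [simp, intro]: "a \<in> M \<Longrightarrow> a ^ n \<in> M"
  by (induction n) auto

lemma lim_in: "(\<And>n::nat. a n \<in> M) \<Longrightarrow> (\<And>v. (\<lambda>n. a n \<rhd> v) \<longlonglongrightarrow> A \<rhd> v) \<Longrightarrow> A \<in> M"
  using commutant_lim[where a = a and S = "commutant M" and A = A] by (simp add: bicomm)

lemma comm_in: "(\<And>x. x \<in> commutant M \<Longrightarrow> x * a = a * x) \<Longrightarrow> a \<in> M"
  by (subst bicomm[symmetric]) (auto simp: commutant_def)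

lemma commD: "x \<in> commutant M \<Longrightarrow> a \<in> M \<Longrightarrow> x * a = a * x"
  by (auto simp: commutant_def)

lemma inverse_in:
  assumes "a \<in> M" "s * a = 1" "a * s = 1" shows "s \<in> M"
proof (rule comm_in)
  fix x assume "x \<in> commutant M"
  then have "s * (x * a) * s = s * (a * x) * s" using assms(1) commD by metis
  then show "x * s = s * x" using assms(2,3) by (metis mult.assoc mult_1_left mult_1_right)
qed

lemma sqrt_in:
  assumes "p \<in> M" "pos_op p"
  shows "\<exists>d\<in>M. pos_op d \<and> d * d = p \<and> (\<forall>x. x * p = p * x \<longrightarrow> x * d = d * x)"
proof -
  obtain d where d: "pos_op d" "d * d = p" "\<And>x. x * p = p * x \<Longrightarrow> x * d = d * x"
    using pos_op_sqrt[OF assms(2)] by blast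
  moreover have "d \<in> M" by (rule comm_in) (use d(3) assms(1) commD in blast)
  ultimately show ?thesis by blast
qed

lemma commutant_vna': "von_neumann_algebra (commutant M)"
  by (rule commutant_vna) auto

end

section \<open>Tracial von Neumann algebras\<close>

locale tracial_vna =
  fixes M :: "'h::complex_hilbert_space bop set" and \<tau> :: "'h bop \<Rightarrow> complex"
  assumes tracial: "tracial_vn_algebra M \<tau>"

sublocale tracial_vna \<subseteq> vna M
  using tracial by unfold_locales (simp add: tracial_vn_algebra_def)

context tracial_vna
begin

lemma tr_add: "a \<in> M \<Longrightarrow> b \<in> M \<Longrightarrow> \<tau> (a + b) = \<tau> a + \<tau> b"
  and tr_scaleC: "a \<in> M \<Longrightarrow> \<tau> (c *\<^sub>C a) = c * \<tau> a"
  and tr_one [simp]: "\<tau> 1 = 1"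
  and tr_comm: "a \<in> M \<Longrightarrow> b \<in> M \<Longrightarrow> \<tau> (a * b) = \<tau> (b * a)"
  and tr_adj_mult: "a \<in> M \<Longrightarrow> \<tau> (adj a * a) \<in> \<real>\<^sub>\<ge>\<^sub>0"
  and tr_faithful: "a \<in> M \<Longrightarrow> \<tau> (adj a * a) = 0 \<Longrightarrow> a = 0"
  using tracial unfolding tracial_vn_algebra_def tracial_state_def clinear_on_def by auto

lemma tr_zero [simp]: "\<tau> 0 = 0"
  using tr_scaleC[OF zero_in, of 0] by simp

lemma tr_minus: "a \<in> M \<Longrightarrow> \<tau> (- a) = - \<tau> a"
  using tr_scaleC[of a "-1"] by (simp add: scaleC_bop_distrib)

lemma tr_diff: "a \<in> M \<Longrightarrow> b \<in> M \<Longrightarrow> \<tau> (a - b) = \<tau> a - \<tau> b"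
  using tr_add[of a "- b"] tr_minus[of b] by simp

lemma tr_sum: "(\<And>i. i \<in> F \<Longrightarrow> g i \<in> M) \<Longrightarrow> \<tau> (\<Sum>i\<in>F. g i) = (\<Sum>i\<in>F. \<tau> (g i))"
proof (induction F rule: infinite_finite_induct)
  case (insert x F)
  then show ?case using tr_add[of "g x" "sum g F"] sum_in[of F g] by auto
qed auto

lemma tr_pos: "a \<in> M \<Longrightarrow> pos_op a \<Longrightarrow> \<tau> a \<in> \<real>\<^sub>\<ge>\<^sub>0"
  using sqrt_in[of a] tr_adj_mult pos_op_adj by metis

lemma tr_pos_Re: "a \<in> M \<Longrightarrow> pos_op a \<Longrightarrow> 0 \<le> Re (\<tau> a)"
  using tr_pos[of a] by (simp add: complex_nonneg_Reals_iff)

lemma tr_mono: "a \<in> M \<Longrightarrow> b \<in> M \<Longrightarrow> pos_op (b - a) \<Longrightarrow> Re (\<tau> a) \<le> Re (\<tau> b)"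
  using tr_pos_Re[of "b - a"] by (simp add: tr_diff)

lemma tr_selfadj_real: assumes "a \<in> M" "adj a = a" shows "Im (\<tau> a) = 0"
proof -
  have "\<tau> (complex_of_real (nrm a) *\<^sub>C 1 - a) \<in> \<real>\<^sub>\<ge>\<^sub>0"
    by (intro tr_pos pos_op_nrm_minus) (use assms in auto)
  then show ?thesis using assms by (simp add: tr_diff tr_scaleC complex_nonneg_Reals_iff)
qed

lemma tr_adj: assumes "a \<in> M" shows "\<tau> (adj a) = cnj (\<tau> a)"
proof -
  have "Im (\<tau> (a + adj a)) = 0" by (rule tr_selfadj_real) (use assms in \<open>auto simp: add.commute\<close>)
  moreover have "Im (\<tau> (\<i> *\<^sub>C (a - adj a))) = 0"
    by (rule tr_selfadj_real) (use assms in \<open>auto simp: scaleC_bop_distrib\<close>)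
  ultimately show ?thesis using assms
    by (simp add: tr_add tr_diff tr_scaleC complex_eq_iff)
qed

text \<open>Faithfulness is given for operators of the form \<open>adj a * a\<close>; the square
  root brings a positive operator into this form.\<close>

lemma tr_pos_zero:
  assumes "a \<in> M" "pos_op a" "Re (\<tau> a) \<le> 0" shows "a = 0"
proof -
  obtain d where d: "d \<in> M" "pos_op d" "d * d = a" using sqrt_in[OF assms(1,2)] by blast
  have "\<tau> (adj d * d) = 0"
    using tr_pos[OF assms(1,2)] assms(3) d by (simp add: pos_op_adj complex_nonneg_Reals_iff complex_eq_iff)
  then have "d = 0" using tr_faithful[OF d(1)] by blast
  then show ?thesis using d by simp
qed

section \<open>The trace norm and its inequalities\<close>

abbreviation n2 :: "'h bop \<Rightarrow> real" where "n2 \<equiv> trace_norm2 \<tau>"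

lemma n2_nonneg [simp]: "a \<in> M \<Longrightarrow> 0 \<le> n2 a"
  using tr_adj_mult[of a] by (simp add: trace_norm2_def complex_nonneg_Reals_iff)

lemma n2_sq: "a \<in> M \<Longrightarrow> (n2 a)\<^sup>2 = Re (\<tau> (adj a * a))"
  using tr_adj_mult[of a] by (simp add: trace_norm2_def complex_nonneg_Reals_iff)

lemma tr_adj_mult_n2: "a \<in> M \<Longrightarrow> \<tau> (adj a * a) = of_real ((n2 a)\<^sup>2)"
  using tr_adj_mult[of a] n2_sq[of a] by (simp add: complex_nonneg_Reals_iff complex_eq_iff)

lemma n2_zero [simp]: "n2 0 = 0"
  by (simp add: trace_norm2_def)

lemma n2_eq_zero: "a \<in> M \<Longrightarrow> n2 a \<le> 0 \<Longrightarrow> a = 0"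
  by (metis tr_adj_mult_n2 tr_faithful n2_nonneg antisym_conv of_real_0 zero_power2)

lemma tr_CS:
  assumes "a \<in> M" "b \<in> M" shows "cmod (\<tau> (adj a * b)) \<le> n2 a * n2 b"
proof -
  define z where "z = \<tau> (adj a * b)"
  have ba: "\<tau> (adj b * a) = cnj z"
    using tr_adj[of "adj a * b"] assms by (simp add: z_def)
  have key: "0 \<le> (n2 a)\<^sup>2 - 2 * t * (cmod z)\<^sup>2 + t\<^sup>2 * (cmod z)\<^sup>2 * (n2 b)\<^sup>2" for t :: real
  proof -
    define c where "c = complex_of_real t * cnj z"
    have "0 \<le> Re (\<tau> (adj (a - c *\<^sub>C b) * (a - c *\<^sub>C b)))"
      using tr_adj_mult[of "a - c *\<^sub>C b"] assms by (simp add: complex_nonneg_Reals_iff)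
    also have "adj (a - c *\<^sub>C b) * (a - c *\<^sub>C b) = adj a * a - c *\<^sub>C (adj a * b)
        - cnj c *\<^sub>C (adj b * a) + (c * cnj c) *\<^sub>C (adj b * b)"
      by (simp add: algebra_simps scaleC_bop_distrib)
    also have "\<tau> \<dots> = of_real ((n2 a)\<^sup>2) - c * z - cnj c * cnj z + (c * cnj c) * of_real ((n2 b)\<^sup>2)"
      using assms by (simp add: tr_add tr_diff tr_scaleC tr_adj_mult_n2 ba z_def[symmetric] del: of_real_power)
    also have "c * z = of_real (t * (cmod z)\<^sup>2)"
      by (simp add: c_def complex_norm_square mult_ac del: of_real_power)
    also have "cnj c * cnj z = of_real (t * (cmod z)\<^sup>2)"
      by (simp add: c_def complex_norm_square mult_ac del: of_real_power)
    also have "c * cnj c = of_real (t\<^sup>2 * (cmod z)\<^sup>2)"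
    proof -
      have "c * cnj c = of_real (t\<^sup>2) * (z * cnj z)"
        by (simp add: c_def power2_eq_square mult_ac)
      then show ?thesis unfolding of_real_mult complex_norm_square .
    qed
    finally show ?thesis by simp
  qed
  have "(cmod z)\<^sup>2 \<le> (n2 a)\<^sup>2 * (n2 b)\<^sup>2"
  proof (cases "n2 b = 0")
    case True
    have "(cmod z)\<^sup>2 \<le> 0"
    proof (rule ccontr)
      assume "\<not> (cmod z)\<^sup>2 \<le> 0"
      then have p: "(cmod z)\<^sup>2 > 0" by simp
      have "2 * (((n2 a)\<^sup>2 + 1) / (2 * (cmod z)\<^sup>2)) * (cmod z)\<^sup>2 = (n2 a)\<^sup>2 + 1" using p by simp
      then show False using key[of "((n2 a)\<^sup>2 + 1) / (2 * (cmod z)\<^sup>2)"] True by simp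
    qed
    then show ?thesis using True by simp
  next
    case False
    then have p: "(n2 b)\<^sup>2 > 0" by simp
    have "(n2 a)\<^sup>2 - 2 * (1 / (n2 b)\<^sup>2) * (cmod z)\<^sup>2 + (1 / (n2 b)\<^sup>2)\<^sup>2 * (cmod z)\<^sup>2 * (n2 b)\<^sup>2
        = (n2 a)\<^sup>2 - (cmod z)\<^sup>2 / (n2 b)\<^sup>2"
      using False by (simp add: field_simps power2_eq_square)
    then have "(cmod z)\<^sup>2 / (n2 b)\<^sup>2 \<le> (n2 a)\<^sup>2" using key[of "1 / (n2 b)\<^sup>2"] by linarith
    then show ?thesis using p by (simp add: pos_divide_le_eq)
  qed
  then have "(cmod z)\<^sup>2 \<le> (n2 a * n2 b)\<^sup>2" by (simp add: power_mult_distrib)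
  then show ?thesis using assms by (auto simp: z_def intro: power2_le_imp_le)
qed

lemma n2_adj: "a \<in> M \<Longrightarrow> n2 (adj a) = n2 a"
  by (simp add: trace_norm2_def tr_comm[of a "adj a"])

lemma n2_scaleC: "a \<in> M \<Longrightarrow> n2 (c *\<^sub>C a) = cmod c * n2 a"
proof -
  assume a: "a \<in> M"
  have "\<tau> (adj (c *\<^sub>C a) * (c *\<^sub>C a)) = of_real ((cmod c)\<^sup>2) * \<tau> (adj a * a)"
    using a by (simp add: tr_scaleC complex_norm_square mult.commute del: of_real_power)
  then have "(n2 (c *\<^sub>C a))\<^sup>2 = (cmod c * n2 a)\<^sup>2"
    using a by (simp add: n2_sq power_mult_distrib del: adj_simps of_real_power)
  then show ?thesis using a by (simp add: power2_eq_iff_nonneg)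
qed

lemma n2_minus: "a \<in> M \<Longrightarrow> n2 (- a) = n2 a"
  by (simp add: trace_norm2_def)

lemma n2_diff_commute: "a \<in> M \<Longrightarrow> b \<in> M \<Longrightarrow> n2 (a - b) = n2 (b - a)"
  using n2_minus[of "a - b"] by simp

lemma n2_add_sq:
  assumes "a \<in> M" "b \<in> M"
  shows "(n2 (a + b))\<^sup>2 = (n2 a)\<^sup>2 + 2 * Re (\<tau> (adj a * b)) + (n2 b)\<^sup>2"
proof -
  have "\<tau> (adj b * a) = cnj (\<tau> (adj a * b))" using tr_adj[of "adj a * b"] assms by simp
  then show ?thesis using assms by (simp add: n2_sq tr_add algebra_simps)
qed

lemma n2_triangle: assumes "a \<in> M" "b \<in> M" shows "n2 (a + b) \<le> n2 a + n2 b"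
proof (rule power2_le_imp_le)
  have "Re (\<tau> (adj a * b)) \<le> n2 a * n2 b"
    using tr_CS[OF assms] complex_Re_le_cmod order_trans by blast
  then show "(n2 (a + b))\<^sup>2 \<le> (n2 a + n2 b)\<^sup>2"
    unfolding n2_add_sq[OF assms] by (simp add: power2_sum)
qed (use assms in auto)

lemma n2_triangle_diff: "a \<in> M \<Longrightarrow> b \<in> M \<Longrightarrow> n2 (a - b) \<le> n2 a + n2 b"
  using n2_triangle[of a "- b"] by (simp add: n2_minus)

lemma n2_triangle3: "a \<in> M \<Longrightarrow> b \<in> M \<Longrightarrow> c \<in> M \<Longrightarrow> n2 (a - c) \<le> n2 (a - b) + n2 (b - c)"
  using n2_triangle[of "a - b" "b - c"] by simp

lemma n2_parallelogram:
  assumes "a \<in> M" "b \<in> M"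
  shows "(n2 (a - b))\<^sup>2 = 2 * (n2 a)\<^sup>2 + 2 * (n2 b)\<^sup>2 - 4 * (n2 (complex_of_real (1/2) *\<^sub>C (a + b)))\<^sup>2"
proof -
  have "(n2 (a - b))\<^sup>2 = (n2 a)\<^sup>2 - 2 * Re (\<tau> (adj a * b)) + (n2 b)\<^sup>2"
    using n2_add_sq[of a "- b"] assms by (simp add: n2_minus tr_minus)
  moreover have "(n2 (complex_of_real (1/2) *\<^sub>C (a + b)))\<^sup>2 = (1/4) * (n2 (a + b))\<^sup>2"
    using assms by (subst n2_scaleC) (auto simp: power_mult_distrib power2_eq_square norm_divide)
  ultimately show ?thesis unfolding n2_add_sq[OF assms] by simp
qed

text \<open>The operator inequality \<open>adj a * a \<le> (nrm a)\<^sup>2\<close> survives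
  conjugation by \<open>b\<close>; then the trace is taken.\<close>

lemma n2_mult_left:
  assumes "a \<in> M" "b \<in> M" shows "n2 (a * b) \<le> nrm a * n2 b"
proof (rule power2_le_imp_le)
  define K where "K = (nrm a)\<^sup>2"
  have "pos_op (complex_of_real K *\<^sub>C 1 - adj a * a)"
  proof (rule pos_opI)
    fix v
    have "(norm (a \<rhd> v))\<^sup>2 \<le> K * (norm v)\<^sup>2"
      using power_mono[OF norm_ap_le[of a v], of 2] by (simp add: K_def power_mult_distrib)
    then show "0 \<le> qf (complex_of_real K *\<^sub>C 1 - adj a * a) v"
      using qf_adj_mult[of v a] unfolding qf_simps by simp
  qed simp
  from pos_op_conj[OF this, of b]
  have "pos_op (complex_of_real K *\<^sub>C (adj b * b) - adj (a * b) * (a * b))"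
    by (simp add: algebra_simps)
  from tr_mono[OF _ _ this] assms
  have "Re (\<tau> (adj (a * b) * (a * b))) \<le> K * Re (\<tau> (adj b * b))" by (simp add: tr_scaleC)
  then show "(n2 (a * b))\<^sup>2 \<le> (nrm a * n2 b)\<^sup>2"
    using assms by (simp add: n2_sq power_mult_distrib K_def del: adj_simps)
qed (use assms in auto)

lemma n2_mult_right: "a \<in> M \<Longrightarrow> b \<in> M \<Longrightarrow> n2 (a * b) \<le> n2 a * nrm b"
  using n2_mult_left[of "adj b" "adj a"] n2_adj[of "a * b"] by (simp add: n2_adj mult.commute)

lemma n2_mult3: assumes "a \<in> M" "b \<in> M" "c \<in> M" shows "n2 (a * b * c) \<le> nrm a * n2 b * nrm c"
proof -
  have "n2 (a * b * c) \<le> n2 (a * b) * nrm c" using assms by (intro n2_mult_right) auto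
  also have "\<dots> \<le> (nrm a * n2 b) * nrm c" using assms by (intro mult_right_mono n2_mult_left) auto
  finally show ?thesis .
qed

lemma n2_one [simp]: "n2 1 = 1"
  by (simp add: trace_norm2_def)

lemma n2_le_nrm: "a \<in> M \<Longrightarrow> n2 a \<le> nrm a"
  using n2_mult_left[of a 1] by simp

lemma tr_le_n2: "a \<in> M \<Longrightarrow> cmod (\<tau> a) \<le> n2 a"
  using tr_CS[of 1 a] by simp

subsection \<open>Normality\<close>

text \<open>Normality is about suprema within \<open>M\<close>. The strong limit of an increasing
  sequence is such a supremum, because upper bounds of quadratic forms pass to the limit.\<close>

lemma tr_normal_seq:
  assumes aM: "\<And>n. a n \<in> M" and inc: "\<And>n. pos_op (a (Suc n) - a n)" and sa: "\<And>n. adj (a n) = a n"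
    and lim: "\<And>v. (\<lambda>n. a n \<rhd> v) \<longlonglongrightarrow> A \<rhd> v" and le: "\<And>n. pos_op (A - a n)"
  shows "(\<lambda>n. Re (\<tau> (a n))) \<longlonglongrightarrow> Re (\<tau> A)"
proof -
  have AM: "A \<in> M" by (rule lim_in[OF aM lim])
  have inc': "pos_op (a n - a m)" if "m \<le> n" for m n
    using that
  proof (induction n rule: dec_induct)
    case (step n)
    then show ?case using pos_op_add[OF step.IH inc[of n]] by simp
  qed simp
  have "directed_selfadj (range a)"
    unfolding directed_selfadj_def op_le_def
  proof (intro conjI ballI)
    fix x y assume "x \<in> range a" "y \<in> range a"
    then obtain m n where "x = a m" "y = a n" by blast
    then show "\<exists>c\<in>range a. pos_op (c - x) \<and> pos_op (c - y)"
      using inc'[of m "max m n"] inc'[of n "max m n"] by (intro bexI[of _ "a (max m n)"]) auto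
  qed (use sa in auto)
  moreover have "is_lub_in M (range a) A"
    unfolding is_lub_in_def op_le_def
  proof (intro conjI ballI impI AM)
    fix u assume u: "u \<in> M" "\<forall>x\<in>range a. pos_op (u - x)"
    then have "adj (u - a 0) = u - a 0" using pos_op_adj by blast
    then have "adj u = u" using sa[of 0] by simp
    moreover have "adj A = A" by (rule adj_lim[OF lim sa])
    ultimately show "pos_op (u - A)"
    proof (intro pos_opI)
      fix v
      have "qf A v \<le> qf u v"
      proof (rule LIMSEQ_le_const2[OF tendsto_qf[OF lim]], intro exI allI impI)
        fix n
        show "qf (a n) v \<le> qf u v" using pos_op_qf[of "u - a n" v] u(2) by (simp add: qf_algebra)
      qed
      then show "0 \<le> qf (u - A) v" by (simp add: qf_algebra)
    qed simp
  qed (use le in auto)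
  ultimately have "Re (\<tau> A) = (SUP x\<in>range a. Re (\<tau> x))"
    using tracial aM unfolding tracial_vn_algebra_def normal_functional_def by blast
  then have sup: "Re (\<tau> A) = (SUP n. Re (\<tau> (a n)))" by (simp add: image_image)
  have mono: "incseq (\<lambda>n. Re (\<tau> (a n)))"
    by (rule incseq_SucI) (intro tr_mono aM inc)
  have bd: "bdd_above (range (\<lambda>n. Re (\<tau> (a n))))"
    using tr_mono[OF aM AM le] by (auto simp: bdd_above_def)
  show ?thesis unfolding sup by (rule LIMSEQ_incseq_SUP[OF bd mono])
qed

end

subsection \<open>A common small majorant of a summable sequence of positive operators\<close>

text \<open>\<open>cut s = s (1 + s)\<inverse>\<close>: it is operator monotone, bounded by \<open>1\<close> and by \<open>s\<close>, and comparable
  with \<open>s\<close> as long as \<open>s \<le> 1\<close>. Cutting off the partial sums of \<open>\<Sum>n. a n\<close> makes them converge.\<close>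

definition res1 :: "'h::complex_hilbert_space bop \<Rightarrow> 'h bop" where
  "res1 s = (SOME g. g * (1 + s) = 1 \<and> (1 + s) * g = 1)"

definition cut :: "'h::complex_hilbert_space bop \<Rightarrow> 'h bop" where
  "cut s = 1 - res1 s"

lemma res1:
  assumes "pos_op s" shows "res1 s * (1 + s) = 1" "(1 + s) * res1 s = 1"
proof -
  have "(norm v)\<^sup>2 \<le> qf (1 + s) v" for v
    using pos_op_qf[OF assms, of v] unfolding qf_simps by simp
  from lax_milgram_inverse[OF this]
  have "\<exists>g. g * (1 + s) = 1 \<and> (1 + s) * g = 1" by blast
  from someI_ex[OF this] show "res1 s * (1 + s) = 1" "(1 + s) * res1 s = 1"
    unfolding res1_def by blast+
qed

lemma res1_pos:
  assumes "pos_op s" shows "pos_op (res1 s)"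
proof -
  note r = res1[OF assms]
  have sa: "adj (res1 s) = res1 s"
  proof -
    have "adj (res1 s) = adj (res1 s) * ((1 + s) * res1 s)" by (simp add: r)
    also have "\<dots> = adj ((1 + s) * res1 s) * res1 s"
      using pos_op_adj[OF assms] by (simp add: mult.assoc)
    finally show ?thesis by (simp add: r)
  qed
  have "res1 s = adj (res1 s) * (1 + s) * res1 s" by (simp add: sa r)
  then show ?thesis by (metis pos_op_add pos_op_one pos_op_conj assms)
qed

text \<open>Both resolvent identities \<open>g - h = h (t - s) g = g (t - s) h\<close> are combined
  into \<open>h (t - s) h + h (t - s) g (t - s) h\<close>, a sum of conjugates of positive
  operators.\<close>

lemma res1_antimono:
  assumes "pos_op s" "pos_op (t - s)" shows "pos_op (res1 s - res1 t)"
proof -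
  have t: "pos_op t" using pos_op_add[OF assms] by simp
  define g h where "g = res1 s" and "h = res1 t"
  have g: "g * (1 + s) = 1" "(1 + s) * g = 1" "adj g = g" "pos_op g"
    and h: "h * (1 + t) = 1" "(1 + t) * h = 1" "adj h = h"
    using res1[OF assms(1)] res1[OF t] res1_pos[OF assms(1)] res1_pos[OF t]
    by (auto simp: g_def h_def pos_op_adj)
  have e1: "g - h = h * (t - s) * g"
  proof -
    have "h * (t - s) * g = (h * (1 + t)) * g - h * ((1 + s) * g)" by (simp add: algebra_simps)
    then show ?thesis by (simp add: g h)
  qed
  have "adj (t - s) = t - s" using assms(2) by (rule pos_op_adj)
  have e2: "g - h = g * (t - s) * h"
  proof -
    have "g * (t - s) * h = g * ((1 + t) * h) - (g * (1 + s)) * h" by (simp add: algebra_simps)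
    then show ?thesis by (simp add: g h)
  qed
  have "g - h = h * (t - s) * (h + g * (t - s) * h)"
    using e1 e2 by (metis add_diff_cancel_left' diff_add_cancel add.commute)
  also have "\<dots> = adj h * (t - s) * h + adj ((t - s) * h) * g * ((t - s) * h)"
    using h(3) \<open>adj (t - s) = t - s\<close> by (simp add: distrib_left mult.assoc del: adj_simps(4))
  finally show ?thesis unfolding g_def[symmetric] h_def[symmetric]
    using pos_op_add[OF pos_op_conj[OF assms(2)] pos_op_conj[OF g(4)]] by metis
qed

lemma cut_pos: "pos_op s \<Longrightarrow> pos_op (cut s)"
proof -
  assume s: "pos_op s"
  have "pos_op (res1 0 - res1 s)" by (rule res1_antimono) (use s in auto)
  moreover have "res1 (0::'a bop) = 1" using res1(1)[of "0::'a bop"] by simp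
  ultimately show ?thesis by (simp add: cut_def)
qed

lemma cut_le_one: "pos_op s \<Longrightarrow> pos_op (1 - cut s)"
  by (simp add: cut_def res1_pos)

lemma cut_mono: "pos_op s \<Longrightarrow> pos_op (t - s) \<Longrightarrow> pos_op (cut t - cut s)"
  using res1_antimono by (simp add: cut_def)

text \<open>The difference is the resolvent conjugated by \<open>s\<close>.\<close>

lemma cut_le: assumes "pos_op s" shows "pos_op (s - cut s)"
proof -
  define g where "g = res1 s"
  note r = res1[OF assms, folded g_def]
  have gs: "g * s = 1 - g" and sg: "s * g = 1 - g"
    using r by (simp_all add: distrib_left distrib_right eq_diff_eq add.commute)
  have "s * (g * s) = s - (1 - g)" unfolding gs by (simp add: right_diff_distrib sg)
  then have "s - cut s = adj s * g * s"
    using pos_op_adj[OF assms] by (simp add: cut_def g_def[symmetric] mult.assoc)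
  then show ?thesis using pos_op_conj[OF res1_pos[OF assms]] by (simp add: g_def)
qed

text \<open>With \<open>d\<close> the root of \<open>a\<close> one has \<open>cut a = d g d\<close>,
  and \<open>a \<le> 1\<close> forces \<open>g \<ge> 1/2\<close>.\<close>

lemma cut_ge:
  assumes "pos_op a" "pos_op (1 - a)" shows "pos_op (complex_of_real 2 *\<^sub>C cut a - a)"
proof -
  define g where "g = res1 a"
  note r = res1[OF assms(1), folded g_def]
  obtain d where d: "pos_op d" "d * d = a" "\<And>x. x * a = a * x \<Longrightarrow> x * d = d * x"
    using pos_op_sqrt[OF assms(1)] by blast
  have ga: "g * a = 1 - g" and ag: "a * g = 1 - g"
    using r by (simp_all add: distrib_left distrib_right eq_diff_eq add.commute)
  have gd: "g * d = d * g" by (rule d(3)) (simp add: ga ag)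
  have half: "res1 (1::'a bop) = complex_of_real (1/2) *\<^sub>C 1"
  proof -
    have "res1 1 + res1 1 = (1::'a bop)" using res1(1)[OF pos_op_one] by (simp add: distrib_left)
    then have "complex_of_real (1/2) *\<^sub>C (res1 1 + res1 1) = complex_of_real (1/2) *\<^sub>C (1::'a bop)" by simp
    then show ?thesis by (simp only: scaleC_bop_distrib(1) scaleC_bop_distrib(2)[symmetric]) simp
  qed
  have "pos_op (g - complex_of_real (1/2) *\<^sub>C 1)"
    unfolding half[symmetric] g_def by (rule res1_antimono[OF assms])
  from pos_op_scale[OF this, of 2]
  have p: "pos_op (complex_of_real 2 *\<^sub>C g - 1)" by (simp add: scaleC_bop_distrib)
  have "adj d * (complex_of_real 2 *\<^sub>C g - 1) * d = complex_of_real 2 *\<^sub>C (d * g * d) - d * d"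
    using d(1) by (simp add: pos_op_adj algebra_simps)
  also have "d * g * d = 1 - g" by (metis ag d(2) gd mult.assoc)
  finally show ?thesis using pos_op_conj[OF p, of d] d(2) by (simp add: cut_def g_def)
qed

lemma (in vna) cut_in: assumes "s \<in> M" "pos_op s" shows "cut s \<in> M"
proof -
  have "res1 s \<in> M" using inverse_in[of "1 + s" "res1 s"] res1[OF assms(2)] assms(1) by auto
  then show ?thesis by (simp add: cut_def)
qed

context tracial_vna
begin

lemma sum_pos_diff:
  assumes "\<And>n. pos_op (a n)" "m \<le> m'" "N' \<le> N"
  shows "pos_op ((\<Sum>n\<in>{m..<N::nat}. a n) - (\<Sum>n\<in>{m'..<N'}. a n))"
proof -
  have "{m'..<N'} \<subseteq> {m..<N}" using assms(2,3) by auto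
  then have "(\<Sum>n\<in>{m..<N}. a n) - (\<Sum>n\<in>{m'..<N'}. a n) = (\<Sum>n\<in>{m..<N} - {m'..<N'}. a n)"
    by (simp add: sum_diff)
  then show ?thesis by (simp add: pos_op_sum assms(1))
qed

text \<open>A noncommutative tail estimate. \<open>R m\<close> is the strong limit of the cut-off
  sums of the \<open>a n\<close> with \<open>n \<ge> m\<close>. It dominates \<open>a m\<close> up
  to the factor 2, and bounds on the uncut sums, at a vector or in trace, pass to it. The uncut sums
  may be unbounded, whereas \<open>R m\<close> exists and decreases to some \<open>R0\<close>, to
  which normality applies. This is the means of transferring smallness between the trace and
  vectors, in both directions.\<close>

lemma summable_majorant:
  assumes aM: "\<And>n. a n \<in> M" and pos: "\<And>n. pos_op (a n)" and le1: "\<And>n. pos_op (1 - a n)"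
  shows "\<exists>R R0. (\<forall>m. R m \<in> M \<and> pos_op (R m) \<and> pos_op (complex_of_real 2 *\<^sub>C R m - a m)) \<and>
    (\<forall>m v c. (\<forall>N. qf (\<Sum>n\<in>{m..<N}. a n) v \<le> c) \<longrightarrow> qf (R m) v \<le> c) \<and>
    (\<forall>m c. (\<forall>N. Re (\<tau> (\<Sum>n\<in>{m..<N}. a n)) \<le> c) \<longrightarrow> Re (\<tau> (R m)) \<le> c) \<and>
    R0 \<in> M \<and> pos_op R0 \<and> (\<forall>m. pos_op (R m - R0)) \<and> (\<forall>v. (\<lambda>m. R m \<rhd> v) \<longlonglongrightarrow> R0 \<rhd> v) \<and>
    (\<lambda>m. Re (\<tau> (R m))) \<longlonglongrightarrow> Re (\<tau> R0)"
proof -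
  define S where "S m N = (\<Sum>n\<in>{m..<N}. a n)" for m N :: nat
  have Spos: "pos_op (S m N)" for m N unfolding S_def by (intro pos_op_sum pos)
  have SM: "S m N \<in> M" for m N unfolding S_def by (intro sum_in aM)
  have Sd: "pos_op (S m N - S m' N')" if "m \<le> m'" "N' \<le> N" for m m' N N'
    unfolding S_def by (intro sum_pos_diff pos that)
  define \<rho> where "\<rho> m N = cut (S m N)" for m N
  have rM: "\<rho> m N \<in> M" for m N unfolding \<rho>_def by (intro cut_in SM Spos)
  have rpos: "pos_op (\<rho> m N)" for m N unfolding \<rho>_def by (intro cut_pos Spos)
  have rd: "pos_op (\<rho> m N - \<rho> m' N')" if "m \<le> m'" "N' \<le> N" for m m' N N'
    unfolding \<rho>_def by (intro cut_mono Spos Sd that)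
  have r1: "pos_op (1 - \<rho> m N)" for m N unfolding \<rho>_def by (intro cut_le_one Spos)
  have rS: "pos_op (S m N - \<rho> m N)" for m N unfolding \<rho>_def by (intro cut_le Spos)
  have "\<exists>A. (\<forall>v. (\<lambda>N. \<rho> m N \<rhd> v) \<longlonglongrightarrow> A \<rhd> v) \<and> (\<forall>N. pos_op (A - \<rho> m N)) \<and> (\<forall>N. adj (\<rho> m N) = \<rho> m N)" for m
  proof (rule monotone_bop_convergence[where K = 1])
    show "pos_op (\<rho> m (Suc n) - \<rho> m n)" for n by (rule rd) auto
    show "adj (\<rho> m 0) = \<rho> m 0" by (rule pos_op_adj[OF rpos])
    show "qf (\<rho> m n) v \<le> 1 * (norm v)\<^sup>2" for n v
      using pos_op_qf[OF r1, of v m n] by (simp add: qf_algebra)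
  qed
  then obtain R where R: "\<And>m v. (\<lambda>N. \<rho> m N \<rhd> v) \<longlonglongrightarrow> R m \<rhd> v"
      "\<And>m N. pos_op (R m - \<rho> m N)" by metis
  have RM: "R m \<in> M" for m by (rule lim_in[OF rM R(1)])
  have Rpos: "pos_op (R m)" for m using pos_op_add[OF R(2)[of m 0] rpos[of m 0]] by simp
  have R2: "pos_op (complex_of_real 2 *\<^sub>C R m - a m)" for m
  proof -
    have "S m (Suc m) = a m" by (simp add: S_def)
    then have "pos_op (R m - cut (a m))" using R(2)[of m "Suc m"] by (simp add: \<rho>_def)
    from pos_op_add[OF pos_op_scale[OF this, of 2] cut_ge[OF pos le1, of m]]
    show ?thesis by (simp add: scaleC_bop_distrib)
  qed
  have Rq: "qf (R m) v \<le> c" if "\<And>N. qf (S m N) v \<le> c" for m v c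
  proof (rule LIMSEQ_le_const2[OF tendsto_qf[OF R(1)]], intro exI allI impI)
    fix N
    have "qf (\<rho> m N) v \<le> qf (S m N) v" using pos_op_qf[OF rS, of v m N] by (simp add: qf_algebra)
    then show "qf (\<rho> m N) v \<le> c" using that[of N] by linarith
  qed
  have Rt: "Re (\<tau> (R m)) \<le> c" if "\<And>N. Re (\<tau> (S m N)) \<le> c" for m c
  proof (rule LIMSEQ_le_const2[OF tr_normal_seq[OF rM _ _ R(1) R(2)]])
    show "pos_op (\<rho> m (Suc n) - \<rho> m n)" for n by (rule rd) auto
    show "adj (\<rho> m n) = \<rho> m n" for n by (rule pos_op_adj[OF rpos])
    show "\<exists>N. \<forall>n\<ge>N. Re (\<tau> (\<rho> m n)) \<le> c"
      using tr_mono[OF rM SM rS] that order_trans by blast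
  qed
  have Rdec: "pos_op (R m - R (Suc m))" for m
  proof (rule pos_opI)
    show "adj (R m - R (Suc m)) = R m - R (Suc m)" using Rpos by (simp add: pos_op_adj)
    fix v
    have "qf (R (Suc m)) v \<le> qf (R m) v"
    proof (rule LIMSEQ_le[OF tendsto_qf[OF R(1)] tendsto_qf[OF R(1)]], intro exI allI impI)
      fix N
      show "qf (\<rho> (Suc m) N) v \<le> qf (\<rho> m N) v"
        using pos_op_qf[OF rd[of m "Suc m" N N], of v] by (simp add: qf_algebra)
    qed
    then show "0 \<le> qf (R m - R (Suc m)) v" by (simp add: qf_algebra)
  qed
  \<comment> \<open>The sign turns a decreasing sequence into an increasing one, for which the
    convergence lemmas are stated.\<close>
  define b where "b m = - R m" for m
  have binc: "pos_op (b (Suc m) - b m)" for m using Rdec by (simp add: b_def)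
  have bsa: "adj (b m) = b m" for m using Rpos by (simp add: b_def pos_op_adj)
  have "qf (b m) v \<le> 0 * (norm v)\<^sup>2" for m v
    using pos_op_qf[OF Rpos, of v m] by (simp add: b_def qf_algebra)
  from monotone_bop_convergence[where a = b, OF binc bsa this]
  obtain A where A: "\<And>v. (\<lambda>m. b m \<rhd> v) \<longlonglongrightarrow> A \<rhd> v" "\<And>m. pos_op (A - b m)" by blast
  define R0 where "R0 = - A"
  have lim: "(\<lambda>m. R m \<rhd> v) \<longlonglongrightarrow> R0 \<rhd> v" for v
    using tendsto_minus[OF A(1)[of v]] by (simp add: b_def R0_def)
  have bM: "b m \<in> M" for m using RM by (simp add: b_def)
  have AM: "A \<in> M" by (rule lim_in[OF bM A(1)])
  have "(\<lambda>m. Re (\<tau> (b m))) \<longlonglongrightarrow> Re (\<tau> A)"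
    by (rule tr_normal_seq[OF bM binc bsa A])
  from tendsto_minus[OF this] have tl: "(\<lambda>m. Re (\<tau> (R m))) \<longlonglongrightarrow> Re (\<tau> R0)"
    using RM AM by (simp add: b_def R0_def tr_minus)
  have R0pos: "pos_op R0"
  proof (rule pos_opI)
    show "adj R0 = R0" using adj_lim[OF A(1) bsa] by (simp add: R0_def)
    show "0 \<le> qf R0 v" for v
      by (rule LIMSEQ_le_const[OF tendsto_qf[OF lim]]) (use pos_op_qf[OF Rpos] in blast)
  qed
  show ?thesis
  proof (rule exI[of _ R], rule exI[of _ R0], intro conjI)
    show "\<forall>m. R m \<in> M \<and> pos_op (R m) \<and> pos_op (complex_of_real 2 *\<^sub>C R m - a m)"
      using RM Rpos R2 by blast
    show "\<forall>m v c. (\<forall>N. qf (\<Sum>n\<in>{m..<N}. a n) v \<le> c) \<longrightarrow> qf (R m) v \<le> c"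
      using Rq unfolding S_def by blast
    show "\<forall>m c. (\<forall>N. Re (\<tau> (\<Sum>n\<in>{m..<N}. a n)) \<le> c) \<longrightarrow> Re (\<tau> (R m)) \<le> c"
      using Rt unfolding S_def by blast
    show "\<forall>m. pos_op (R m - R0)" using A(2) by (simp add: b_def R0_def add.commute)
    show "R0 \<in> M" using AM by (simp add: R0_def)
  qed (use R0pos lim tl in auto)
qed

lemma geometric_tail_le: "(\<Sum>n\<in>{m..<N}. (1/2)^n) \<le> 2 * (1/2::real)^m"
proof (cases "m \<le> N")
  case True
  then have "(\<Sum>n\<in>{m..<N}. (1/2::real)^n) = 2 * (1/2)^m - 2 * (1/2)^N"
  proof (induction N rule: dec_induct)
    case (step n)
    then have "(\<Sum>k\<in>{m..<Suc n}. (1/2::real)^k) = (\<Sum>k\<in>{m..<n}. (1/2)^k) + (1/2)^n"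
      by (simp add: sum.atLeastLessThan_Suc)
    then show ?case using step.IH by simp
  qed simp
  then show ?thesis by simp
qed simp

lemma geometric_null: "(\<lambda>n. c * (1/2::real)^n) \<longlonglongrightarrow> 0"
  by (intro tendsto_mult_right_zero LIMSEQ_realpow_zero) auto

text \<open>The tails have trace at most \<open>2 * (1/2)^m\<close>, so \<open>R0\<close> has trace
  zero and vanishes. Hence \<open>R m\<close>, which dominates \<open>d m\<close> up to the factor
  2, tends strongly to zero.\<close>

lemma trace_small_imp_weak:
  assumes dM: "\<And>n. d n \<in> M" and pos: "\<And>n. pos_op (d n)" and le1: "\<And>n. pos_op (1 - d n)"
    and tr: "\<And>n. Re (\<tau> (d n)) \<le> (1/2)^n"
  shows "(\<lambda>n. qf (d n) v) \<longlonglongrightarrow> 0"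
proof -
  obtain R R0 where R: "\<And>m. R m \<in> M" "\<And>m. pos_op (complex_of_real 2 *\<^sub>C R m - d m)"
    "\<And>m c. (\<And>N. Re (\<tau> (\<Sum>n\<in>{m..<N}. d n)) \<le> c) \<Longrightarrow> Re (\<tau> (R m)) \<le> c"
    "R0 \<in> M" "pos_op R0" "\<And>m. pos_op (R m - R0)" "\<And>v. (\<lambda>m. R m \<rhd> v) \<longlonglongrightarrow> R0 \<rhd> v"
    using summable_majorant[of d, OF dM pos le1] by metis
  have Rm: "Re (\<tau> (R m)) \<le> 2 * (1/2)^m" for m
  proof (rule R(3))
    fix N
    have "Re (\<tau> (\<Sum>n\<in>{m..<N}. d n)) = (\<Sum>n\<in>{m..<N}. Re (\<tau> (d n)))" by (simp add: tr_sum dM)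
    also have "\<dots> \<le> (\<Sum>n\<in>{m..<N}. (1/2)^n)" by (intro sum_mono tr)
    also have "\<dots> \<le> 2 * (1/2)^m" by (rule geometric_tail_le)
    finally show "Re (\<tau> (\<Sum>n\<in>{m..<N}. d n)) \<le> 2 * (1/2)^m" .
  qed
  have "Re (\<tau> R0) \<le> 0"
  proof (rule LIMSEQ_le_const[OF geometric_null[of 2]], intro exI allI impI)
    fix m show "Re (\<tau> R0) \<le> 2 * (1/2)^m" using tr_mono[OF R(4) R(1) R(6)] Rm order_trans by blast
  qed
  then have "R0 = 0" using tr_pos_zero R by blast
  then have lim: "(\<lambda>m. 2 * qf (R m) v) \<longlonglongrightarrow> 0"
    using tendsto_mult_right_zero[OF tendsto_qf[OF R(7), of v, unfolded \<open>R0 = 0\<close> qf_simps], of 2] by simp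
  show ?thesis
  proof (rule real_tendsto_sandwich[OF _ _ tendsto_const lim])
    show "\<forall>\<^sub>F n in sequentially. 0 \<le> qf (d n) v" using pos_op_qf[OF pos] by simp
    show "\<forall>\<^sub>F n in sequentially. qf (d n) v \<le> 2 * qf (R n) v"
      using pos_op_qf[OF R(2), of v] by (simp add: qf_algebra)
  qed
qed

end

subsection \<open>A countable separating family of vectors\<close>

text \<open>The Riesz vector of \<open>inner u\<close> on \<open>W\<close> is the projection of
  \<open>u\<close>. The last clause, a consequence of uniqueness, is what puts projections onto
  invariant subspaces into a commutant.\<close>

lemma projection_exists:
  fixes W :: "'h::complex_hilbert_space set"
  assumes cl: "closed W" and W0: "0 \<in> W" and Wadd: "\<And>u v. u \<in> W \<Longrightarrow> v \<in> W \<Longrightarrow> u + v \<in> W"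
    and Wsc: "\<And>c u. u \<in> W \<Longrightarrow> c *\<^sub>C u \<in> W"
  shows "\<exists>P. pos_op P \<and> pos_op (1 - P) \<and> (\<forall>u. P \<rhd> u \<in> W) \<and> (\<forall>u\<in>W. P \<rhd> u = u) \<and>
    (\<forall>x. (\<forall>u\<in>W. x \<rhd> u \<in> W) \<and> (\<forall>u\<in>W. adj x \<rhd> u \<in> W) \<longrightarrow> x * P = P * x)"
proof -
  have sub: "subspace W"
    unfolding subspace_def using W0 Wadd Wsc by (metis scaleC_complex_of_real)
  have Wdiff: "u - v \<in> W" if "u \<in> W" "v \<in> W" for u v using sub that by (rule subspace_diff)
  have "\<exists>w\<in>W. \<forall>v\<in>W. inner u v = inner w v" for u :: 'h
  proof (rule riesz_on_subspace[OF sub cl])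
    show "linear (inner u)" by (rule bounded_linear.linear[OF bounded_linear_inner_right])
    show "\<bar>inner u v\<bar> \<le> norm u * norm v" for v by (rule Cauchy_Schwarz_ineq2)
  qed
  then obtain f where fW: "\<And>u. f u \<in> W" and f: "\<And>u v. v \<in> W \<Longrightarrow> inner u v = inner (f u) v" by metis
  have fc: "cinner (u - f u) v = 0" if "v \<in> W" for u v
  proof (rule complex_eqI)
    show "Re (cinner (u - f u) v) = Re 0"
      using f[OF that, of u] by (simp add: inner_eq_Re_cinner cinner_diff_left)
    have "Im (cinner (u - f u) v) = - Re (cinner (u - f u) (\<i> *\<^sub>C v))" by (simp add: cinner_scaleC_right)
    also have "\<dots> = 0" using f[OF Wsc[OF that, of \<i>], of u]
      by (simp add: inner_eq_Re_cinner cinner_diff_left)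
    finally show "Im (cinner (u - f u) v) = Im 0" by simp
  qed
  have uniq: "w = f u" if "w \<in> W" "\<And>v. v \<in> W \<Longrightarrow> cinner (u - w) v = 0" for w u
  proof -
    have "w - f u \<in> W" using that fW Wdiff by blast
    from fc[OF this, of u] that(2)[OF this]
    have "cinner (w - f u) (w - f u) = 0" by (simp add: cinner_diff_left)
    then show ?thesis by (simp add: cinner_self)
  qed
  have pyth: "cinner u (f u) = of_real ((norm (f u))\<^sup>2)" for u
    using fc[OF fW, of u u] by (simp add: cinner_diff_left cinner_self)
  have bound: "norm (f u) \<le> 1 * norm u" for u
  proof (cases "f u = 0")
    case False
    have "norm (f u) * norm (f u) \<le> norm u * norm (f u)"
      using cinner_CS[of u "f u"] unfolding pyth norm_of_real by (simp add: power2_eq_square)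
    then show ?thesis using False by simp
  qed simp
  have "\<exists>P. \<forall>u. P \<rhd> u = f u"
  proof (rule Bop_ex[OF _ _ bound])
    fix u v :: 'h and c
    show "f (u + v) = f u + f v"
    proof (rule uniq[symmetric])
      fix w assume "w \<in> W"
      then show "cinner (u + v - (f u + f v)) w = 0"
        using fc[of w u] fc[of w v] by (simp add: cinner_diff_left cinner_add_left)
    qed (use fW Wadd in blast)
    show "f (c *\<^sub>C u) = c *\<^sub>C f u"
    proof (rule uniq[symmetric])
      fix w assume "w \<in> W"
      then show "cinner (c *\<^sub>C u - c *\<^sub>C f u) w = 0"
        using fc[of w u] by (simp add: cinner_diff_left cinner_scaleC_left)
    qed (use fW Wsc in blast)
  qed
  then obtain P where P: "\<And>u. P \<rhd> u = f u" by blast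
  have "cinner u (P \<rhd> u) = of_real ((norm (f u))\<^sup>2)" for u by (simp add: P pyth)
  then have pos: "pos_op P" unfolding pos_op_def by (simp add: complex_nonneg_Reals_iff)
  have "cinner u ((1 - P) \<rhd> u) = of_real ((norm u)\<^sup>2 - (norm (f u))\<^sup>2)" for u
    by (simp add: P cinner_diff_right cinner_self pyth)
  moreover have "(norm (f u))\<^sup>2 \<le> (norm u)\<^sup>2" for u using bound[of u] by (simp add: power_mono)
  ultimately have pos': "pos_op (1 - P)"
    unfolding pos_op_def by (simp add: complex_nonneg_Reals_iff del: of_real_power)
  have inW: "P \<rhd> u = u" if "u \<in> W" for u
    using uniq[OF that, of u] by (simp add: P)
  have "x * P = P * x" if x: "\<forall>u\<in>W. x \<rhd> u \<in> W" "\<forall>u\<in>W. adj x \<rhd> u \<in> W" for x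
  proof (rule bop_eqI)
    fix u
    have "x \<rhd> f u = f (x \<rhd> u)"
    proof (rule uniq)
      show "x \<rhd> f u \<in> W" using x(1) fW by blast
      fix v assume "v \<in> W"
      then have "cinner (u - f u) (adj x \<rhd> v) = 0" using x(2) fc by blast
      then show "cinner (x \<rhd> u - x \<rhd> f u) v = 0"
        by (simp add: cinner_adj_right ap_diff)
    qed
    then show "(x * P) \<rhd> u = (P * x) \<rhd> u" by (simp add: P)
  qed
  then show ?thesis using pos pos' inW fW P by (intro exI[of _ P]) simp
qed

context tracial_vna
begin

text \<open>\<open>P V\<close> projects onto the orthogonal complement of all \<open>x w\<close>
  with \<open>w \<in> V\<close> and \<open>x\<close> in the commutant of \<open>M\<close>. This
  complement is invariant under the commutant, so \<open>P V\<close> lies in \<open>M\<close>; if it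
  is zero, \<open>V\<close> separates \<open>M\<close>.\<close>

lemma orth_projection:
  obtains P where "\<And>V. P V \<in> M" "\<And>V. pos_op (P V)"
    "\<And>V u w x. w \<in> V \<Longrightarrow> x \<in> commutant M \<Longrightarrow> cinner (x \<rhd> w) (P V \<rhd> u) = 0"
    "\<And>V u. (\<And>w x. w \<in> V \<Longrightarrow> x \<in> commutant M \<Longrightarrow> cinner (x \<rhd> w) u = 0) \<Longrightarrow> P V \<rhd> u = u"
    "\<And>V V'. V \<subseteq> V' \<Longrightarrow> pos_op (P V - P V')"
proof -
  define W where "W V = {u::'h. \<forall>w\<in>V. \<forall>x\<in>commutant M. cinner (x \<rhd> w) u = 0}" for V
  interpret M': vna "commutant M" by unfold_locales (rule commutant_vna')
  have cl: "closed (W V)" for V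
    unfolding closed_sequential_limits
  proof (intro allI impI)
    fix s l assume s: "(\<forall>n. s n \<in> W V) \<and> s \<longlonglongrightarrow> l"
    show "l \<in> W V" unfolding W_def
    proof safe
      fix w x assume "w \<in> V" "x \<in> commutant M"
      then have z: "cinner (x \<rhd> w) (s n) = 0" for n using s unfolding W_def by blast
      have "(\<lambda>n. cinner (x \<rhd> w) (s n)) \<longlonglongrightarrow> cinner (x \<rhd> w) l"
        by (rule tendsto_cinner[OF tendsto_const conjunct2[OF s]])
      from LIMSEQ_unique[OF this[unfolded z] tendsto_const] show "cinner (x \<rhd> w) l = 0" .
    qed
  qed
  have inv: "x \<rhd> u \<in> W V" if "x \<in> commutant M" "u \<in> W V" for x u V
    unfolding W_def
  proof safe
    fix w y assume "w \<in> V" "y \<in> commutant M"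
    then have "cinner ((adj x * y) \<rhd> w) u = 0" using that M'.mult_in M'.adj_in unfolding W_def by blast
    then show "cinner (y \<rhd> w) (x \<rhd> u) = 0" by (simp add: cinner_adj_left)
  qed
  have "\<exists>P. pos_op P \<and> pos_op (1 - P) \<and> (\<forall>u. P \<rhd> u \<in> W V) \<and> (\<forall>u\<in>W V. P \<rhd> u = u) \<and>
    (\<forall>x. (\<forall>u\<in>W V. x \<rhd> u \<in> W V) \<and> (\<forall>u\<in>W V. adj x \<rhd> u \<in> W V) \<longrightarrow> x * P = P * x)" for V
    by (rule projection_exists[OF cl])
      (simp_all add: W_def cinner_add_right cinner_scaleC_right)
  then have "\<exists>P. \<forall>V. pos_op (P V) \<and> pos_op (1 - P V) \<and> (\<forall>u. P V \<rhd> u \<in> W V) \<and> (\<forall>u\<in>W V. P V \<rhd> u = u) \<and>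
    (\<forall>x. (\<forall>u\<in>W V. x \<rhd> u \<in> W V) \<and> (\<forall>u\<in>W V. adj x \<rhd> u \<in> W V) \<longrightarrow> x * P V = P V * x)"
    by (intro choice allI)
  then obtain P where P: "\<And>V. pos_op (P V)" "\<And>V. pos_op (1 - P V)" "\<And>V u. P V \<rhd> u \<in> W V"
      "\<And>V u. u \<in> W V \<Longrightarrow> P V \<rhd> u = u"
      "\<And>V x. (\<forall>u\<in>W V. x \<rhd> u \<in> W V) \<Longrightarrow> (\<forall>u\<in>W V. adj x \<rhd> u \<in> W V) \<Longrightarrow> x * P V = P V * x"
    by blast
  show ?thesis
  proof (rule that[of P])
    show "P V \<in> M" for V
      by (rule comm_in, rule P(5)) (use inv M'.adj_in in blast)+
    show "cinner (x \<rhd> w) (P V \<rhd> u) = 0" if "w \<in> V" "x \<in> commutant M" for V u w x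
      using P(3)[where V = V and u = u] that unfolding W_def by blast
    show "P V \<rhd> u = u" if "\<And>w x. w \<in> V \<Longrightarrow> x \<in> commutant M \<Longrightarrow> cinner (x \<rhd> w) u = 0" for V u
      by (rule P(4)) (use that in \<open>auto simp: W_def\<close>)
    show "pos_op (P V - P V')" if "V \<subseteq> V'" for V V'
    proof -
      have e: "P V \<rhd> (P V' \<rhd> u) = P V' \<rhd> u" for u
        by (rule P(4)) (use P(3)[where V = V' and u = u] that in \<open>auto simp: W_def\<close>)
      have ee: "P V' \<rhd> (P V' \<rhd> u) = P V' \<rhd> u" for u by (rule P(4)) (rule P(3))
      have eV: "P V \<rhd> (P V \<rhd> u) = P V \<rhd> u" for u by (rule P(4)) (rule P(3))
      have a: "P V * P V' = P V'" "P V' * P V' = P V'" "P V * P V = P V"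
        by (auto intro!: bop_eqI simp: e ee eV)
      have b: "P V' * P V = P V'"
        using arg_cong[OF a(1), of adj] P(1) by (simp add: pos_op_adj)
      have "P V - P V' = adj (P V - P V') * (P V - P V')"
        using P(1) by (simp add: pos_op_adj algebra_simps a b)
      then show ?thesis by (metis pos_op_adj_mult)
    qed
  qed (use P in auto)
qed

text \<open>The Hilbert space may be nonseparable, but the faithful trace makes countably many
  vectors enough. Some countable \<open>V\<close> minimizes the trace of \<open>P V\<close>; adding
  a nonzero vector from the range of \<open>P V\<close> would lower the trace further, so
  \<open>P V = 0\<close>.\<close>

lemma separating_sequence:
  obtains v :: "nat \<Rightarrow> 'h" where "\<And>a. a \<in> M \<Longrightarrow> adj a = a \<Longrightarrow> (\<And>k. a \<rhd> v k = 0) \<Longrightarrow> a = 0"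
proof -
  obtain P where P: "\<And>V. P V \<in> M" "\<And>V. pos_op (P V)"
    "\<And>V u w x. w \<in> V \<Longrightarrow> x \<in> commutant M \<Longrightarrow> cinner (x \<rhd> w) (P V \<rhd> u) = 0"
    "\<And>V u. (\<And>w x. w \<in> V \<Longrightarrow> x \<in> commutant M \<Longrightarrow> cinner (x \<rhd> w) u = 0) \<Longrightarrow> P V \<rhd> u = u"
    "\<And>V V'. V \<subseteq> V' \<Longrightarrow> pos_op (P V - P V')"
    using orth_projection by blast
  interpret M': vna "commutant M" by unfold_locales (rule commutant_vna')
  define \<C> where "\<C> = {V::'h set. countable V}"
  define r where "r V = Re (\<tau> (P V))" for V
  define \<mu> where "\<mu> = Inf (r ` \<C>)"
  have ne: "r ` \<C> \<noteq> {}" unfolding \<C>_def by blast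
  have bb: "bdd_below (r ` \<C>)"
    using tr_pos_Re[OF P(1,2)] by (auto simp: bdd_below_def r_def)
  have "\<exists>V\<in>\<C>. r V < \<mu> + 1 / real (Suc n)" for n
    using cInf_lessD[OF ne, of "\<mu> + 1 / real (Suc n)"] by (auto simp: \<mu>_def)
  then obtain Vn where Vn: "\<And>n. Vn n \<in> \<C>" "\<And>n. r (Vn n) < \<mu> + 1 / real (Suc n)" by metis
  define V where "V = insert 0 (\<Union>n. Vn n)"
  have VC: "countable V" using Vn(1) by (auto simp: V_def \<C>_def)
  have mono: "r V' \<le> r V''" if "V'' \<subseteq> V'" for V' V''
    unfolding r_def by (intro tr_mono P that)
  have "r V \<le> \<mu>"
  proof (rule field_le_epsilon)
    fix e :: real assume "0 < e"
    then obtain n where "1 / real (Suc n) < e" using nat_approx_posE by blast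
    moreover have "r V \<le> r (Vn n)" by (rule mono) (auto simp: V_def)
    ultimately show "r V \<le> \<mu> + e" using Vn(2)[of n] by linarith
  qed
  have "P V = 0"
  proof (rule ccontr)
    assume "P V \<noteq> 0"
    then obtain u where u: "P V \<rhd> u \<noteq> 0" using bop_eqI[of "P V" 0] by auto
    define w where "w = P V \<rhd> u"
    have Pw: "P V \<rhd> w = w" unfolding w_def by (rule P(4)) (rule P(3))
    define V' where "V' = insert w V"
    have "cinner (1 \<rhd> w) (P V' \<rhd> w) = 0" by (rule P(3)) (auto simp: V'_def)
    then have "P V' \<rhd> w = 0" using pos_op_qf_zero[OF P(2), where v = w and V1 = V'] by simp
    then have neq: "P V - P V' \<noteq> 0"
      using Pw u w_def by (metis ap_simps(4,5) diff_zero)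
    have sub: "V \<subseteq> V'" by (auto simp: V'_def)
    have "\<not> Re (\<tau> (P V - P V')) \<le> 0"
      using tr_pos_zero[OF _ P(5)[OF sub]] P(1) neq by blast
    then have "r V' < r V" using P(1) by (simp add: r_def tr_diff)
    moreover have "\<mu> \<le> r V'"
      unfolding \<mu>_def by (rule cInf_lower[OF _ bb]) (use VC in \<open>auto simp: \<C>_def V'_def\<close>)
    ultimately show False using \<open>r V \<le> \<mu>\<close> by linarith
  qed
  show ?thesis
  proof (rule that[of "from_nat_into V"])
    fix a assume a: "a \<in> M" "adj a = a" "\<And>k. a \<rhd> from_nat_into V k = 0"
    have av: "a \<rhd> w = 0" if "w \<in> V" for w
      using a(3) from_nat_into_surj[OF VC that] by metis
    show "a = 0"
    proof (rule bop_eqI)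
      fix u
      have "P V \<rhd> (a \<rhd> u) = a \<rhd> u"
      proof (rule P(4))
        fix w x assume w: "w \<in> V" "x \<in> commutant M"
        have "cinner (x \<rhd> w) (a \<rhd> u) = cinner ((a * x) \<rhd> w) u"
          using cinner_adj_left[of a "x \<rhd> w" u] a(2) by simp
        also have "a * x = x * a" using commD[OF w(2) a(1)] by simp
        finally show "cinner (x \<rhd> w) (a \<rhd> u) = 0" using av[OF w(1)] by simp
      qed
      then show "a \<rhd> u = 0 \<rhd> u" using \<open>P V = 0\<close> by simp
    qed
  qed
qed

text \<open>Counterexamples \<open>a n\<close>, each small at the first \<open>n\<close> vectors,
  would have tail majorants whose limit \<open>R0\<close> vanishes at every \<open>v k\<close> and
  is therefore zero, although the traces of the majorants stay above
  \<open>\<epsilon> / 2\<close>.\<close>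

lemma weak_imp_trace_small:
  assumes sep: "\<And>a. a \<in> M \<Longrightarrow> adj a = a \<Longrightarrow> (\<And>k. a \<rhd> v k = 0) \<Longrightarrow> a = 0" and "\<epsilon> > 0"
  shows "\<exists>n. \<forall>a\<in>M. pos_op a \<longrightarrow> pos_op (1 - a) \<longrightarrow> (\<forall>k<n. qf a (v k) \<le> (1/2)^n) \<longrightarrow> Re (\<tau> a) < \<epsilon>"
proof (rule ccontr)
  assume "\<not> ?thesis"
  then have "\<forall>n. \<exists>a\<in>M. pos_op a \<and> pos_op (1 - a) \<and> (\<forall>k<n. qf a (v k) \<le> (1/2)^n) \<and> \<epsilon> \<le> Re (\<tau> a)"
    by (meson not_less)
  then obtain a where a: "\<And>n. a n \<in> M" "\<And>n. pos_op (a n)" "\<And>n. pos_op (1 - a n)"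
    "\<And>n k. k < n \<Longrightarrow> qf (a n) (v k) \<le> (1/2)^n" "\<And>n. \<epsilon> \<le> Re (\<tau> (a n))" by metis
  obtain R R0 where R: "\<And>m. R m \<in> M" "\<And>m. pos_op (complex_of_real 2 *\<^sub>C R m - a m)"
    "\<And>m v c. (\<And>N. qf (\<Sum>n\<in>{m..<N}. a n) v \<le> c) \<Longrightarrow> qf (R m) v \<le> c"
    "R0 \<in> M" "pos_op R0" "\<And>v. (\<lambda>m. R m \<rhd> v) \<longlonglongrightarrow> R0 \<rhd> v" "(\<lambda>m. Re (\<tau> (R m))) \<longlonglongrightarrow> Re (\<tau> R0)"
    using summable_majorant[of a, OF a(1-3)] by metis
  have "R0 \<rhd> v k = 0" for k
  proof -
    have "qf (R m) (v k) \<le> 2 * (1/2)^m" if "k < m" for m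
    proof (rule R(3))
      fix N
      have "qf (\<Sum>n\<in>{m..<N}. a n) (v k) = (\<Sum>n\<in>{m..<N}. qf (a n) (v k))"
        by (induction N) (auto simp: sum_ap cinner_add_right sum.atLeastLessThan_Suc not_less)
      also have "\<dots> \<le> (\<Sum>n\<in>{m..<N}. (1/2)^n)" using that by (intro sum_mono a(4)) auto
      also have "\<dots> \<le> 2 * (1/2)^m" by (rule geometric_tail_le)
      finally show "qf (\<Sum>n\<in>{m..<N}. a n) (v k) \<le> 2 * (1/2)^m" .
    qed
    then have "qf R0 (v k) \<le> 0"
      by (intro LIMSEQ_le[OF tendsto_qf[OF R(6)] geometric_null[of 2]] exI[of _ "Suc k"]) auto
    then have "qf R0 (v k) = 0" using pos_op_qf[OF R(5), of "v k"] by linarith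
    then show ?thesis by (rule pos_op_qf_zero[OF R(5)])
  qed
  then have "R0 = 0" using sep[OF R(4) pos_op_adj[OF R(5)]] by blast
  then have "(\<lambda>m. Re (\<tau> (R m))) \<longlonglongrightarrow> 0" using R(7) by simp
  moreover have "\<epsilon> / 2 \<le> Re (\<tau> (R m))" for m
  proof -
    have "Re (\<tau> (a m)) \<le> Re (\<tau> (complex_of_real 2 *\<^sub>C R m))" by (rule tr_mono[OF a(1) _ R(2)]) (simp add: R(1))
    then show ?thesis using a(5)[of m] tr_scaleC[OF R(1), of "complex_of_real 2" m] by simp
  qed
  ultimately have "\<epsilon> / 2 \<le> 0" by (intro LIMSEQ_le_const[where X = "\<lambda>m. Re (\<tau> (R m))"]) auto
  then show False using assms(2) by simp
qed

text \<open>Scales \<open>adj a * a\<close> into the interval between 0 and 1, where the two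
  comparisons of trace and vectors apply.\<close>

lemma normalized_square:
  assumes "a \<in> M" "nrm a \<le> K" "K > 0"
  defines "d \<equiv> complex_of_real (1 / K\<^sup>2) *\<^sub>C (adj a * a)"
  shows "d \<in> M" "pos_op d" "pos_op (1 - d)" "Re (\<tau> d) = (n2 a)\<^sup>2 / K\<^sup>2"
    "qf d v = (norm (a \<rhd> v))\<^sup>2 / K\<^sup>2"
proof -
  show "d \<in> M" unfolding d_def using assms(1) by blast
  show "pos_op d" unfolding d_def by (rule pos_op_scale[OF pos_op_adj_mult]) simp
  show "Re (\<tau> d) = (n2 a)\<^sup>2 / K\<^sup>2" using assms(1) by (simp add: d_def tr_scaleC n2_sq)
  show q: "qf d v = (norm (a \<rhd> v))\<^sup>2 / K\<^sup>2" for v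
    unfolding d_def qf_simps using qf_adj_mult[of v a] by simp
  show "pos_op (1 - d)"
  proof (rule pos_opI)
    show "adj (1 - d) = 1 - d" using \<open>pos_op d\<close> by (simp add: pos_op_adj)
    fix v
    have "norm (a \<rhd> v) \<le> K * norm v"
      using norm_ap_le[of a v] mult_right_mono[OF assms(2), of "norm v"] by simp
    then have "(norm (a \<rhd> v))\<^sup>2 \<le> K\<^sup>2 * (norm v)\<^sup>2"
      using power_mono[of "norm (a \<rhd> v)" "K * norm v" 2] by (simp add: power_mult_distrib)
    then have "(norm (a \<rhd> v))\<^sup>2 / K\<^sup>2 \<le> (norm v)\<^sup>2" using assms(3) by (simp add: pos_divide_le_eq mult.commute)
    then show "0 \<le> qf (1 - d) v" unfolding qf_simps q by simp
  qed
qed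

lemma strong_imp_n2:
  assumes "\<And>n. a n \<in> M" "\<And>n. nrm (a n) \<le> K" "\<And>v. (\<lambda>n. a n \<rhd> v) \<longlonglongrightarrow> 0"
  shows "(\<lambda>n. n2 (a n)) \<longlonglongrightarrow> 0"
proof (rule LIMSEQ_I)
  fix e :: real assume e: "e > 0"
  define K' where "K' = \<bar>K\<bar> + 1"
  have K': "K' > 0" "nrm (a n) \<le> K'" for n using assms(2)[of n] by (auto simp: K'_def)
  note d = normalized_square[OF assms(1) K'(2,1)]
  obtain v :: "nat \<Rightarrow> 'h" where v: "\<And>a. a \<in> M \<Longrightarrow> adj a = a \<Longrightarrow> (\<And>k. a \<rhd> v k = 0) \<Longrightarrow> a = 0"
    using separating_sequence by blast
  have "e\<^sup>2 / K'\<^sup>2 > 0" using e K' by simp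
  from weak_imp_trace_small[where v = v, OF v this] obtain n where
    n: "\<And>a. a \<in> M \<Longrightarrow> pos_op a \<Longrightarrow> pos_op (1 - a) \<Longrightarrow> (\<forall>k<n. qf a (v k) \<le> (1/2)^n) \<Longrightarrow> Re (\<tau> a) < e\<^sup>2 / K'\<^sup>2"
    by blast
  have "\<forall>k<n. \<forall>\<^sub>F m in sequentially. (norm (a m \<rhd> v k))\<^sup>2 / K'\<^sup>2 \<le> (1/2)^n"
  proof (intro allI impI)
    fix k
    have "(\<lambda>m. (norm (a m \<rhd> v k))\<^sup>2 / K'\<^sup>2) \<longlonglongrightarrow> 0\<^sup>2 / K'\<^sup>2"
      using tendsto_norm_zero[OF assms(3)[of "v k"]] by (intro tendsto_divide tendsto_power tendsto_const) (use K' in auto)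
    then have "\<forall>\<^sub>F m in sequentially. (norm (a m \<rhd> v k))\<^sup>2 / K'\<^sup>2 < (1/2)^n"
      by (rule order_tendstoD) simp
    then show "\<forall>\<^sub>F m in sequentially. (norm (a m \<rhd> v k))\<^sup>2 / K'\<^sup>2 \<le> (1/2)^n"
      by (rule eventually_mono) simp
  qed
  then have "\<forall>\<^sub>F m in sequentially. \<forall>k<n. (norm (a m \<rhd> v k))\<^sup>2 / K'\<^sup>2 \<le> (1/2)^n"
    using eventually_ball_finite[of "{..<n}"
        "\<lambda>m k. (norm (a m \<rhd> v k))\<^sup>2 / K'\<^sup>2 \<le> (1/2)^n" sequentially] by (simp add: Ball_def)
  then obtain N where N: "\<And>m k. m \<ge> N \<Longrightarrow> k < n \<Longrightarrow> (norm (a m \<rhd> v k))\<^sup>2 / K'\<^sup>2 \<le> (1/2)^n"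
    unfolding eventually_sequentially by blast
  have "n2 (a m) < e" if "m \<ge> N" for m
  proof -
    have "Re (\<tau> (complex_of_real (1 / K'\<^sup>2) *\<^sub>C (adj (a m) * a m))) < e\<^sup>2 / K'\<^sup>2"
      by (rule n[OF d(1-3)]) (simp only: d(5), use N that in blast)
    then have "(n2 (a m))\<^sup>2 < e\<^sup>2" using K' unfolding d(4) by (simp add: divide_less_cancel)
    then show ?thesis using e by (simp add: power_less_imp_less_base)
  qed
  then show "\<exists>no. \<forall>n\<ge>no. norm (n2 (a n) - 0) < e" using assms(1) by auto
qed

text \<open>Norm balls are complete for the trace norm. A sequence that is Cauchy in trace norm must
  be strongly Cauchy: otherwise differences with geometrically small trace norm would stay away from
  zero at one vector.\<close>

lemma n2_complete:
  assumes aM: "\<And>n::nat. a n \<in> M" and bd: "\<And>n. nrm (a n) \<le> K"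
    and C: "\<And>e. e > 0 \<Longrightarrow> \<exists>N. \<forall>m\<ge>N. \<forall>n\<ge>N. n2 (a m - a n) < e"
  shows "\<exists>A\<in>M. nrm A \<le> K \<and> (\<lambda>n. n2 (a n - A)) \<longlonglongrightarrow> 0"
proof -
  define K' where "K' = 2 * \<bar>K\<bar> + 1"
  have K': "K' > 0" "nrm (a m - a n) \<le> K'" for m n
    using nrm_diff[of "a m" "a n"] bd[of m] bd[of n] by (auto simp: K'_def)
  have cauchy: "Cauchy (\<lambda>n. a n \<rhd> v)" for v
  proof (rule ccontr)
    assume "\<not> Cauchy (\<lambda>n. a n \<rhd> v)"
    then obtain e where e: "e > 0" "\<And>N. \<exists>m\<ge>N. \<exists>n\<ge>N. \<not> dist (a m \<rhd> v) (a n \<rhd> v) < e"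
      unfolding Cauchy_def by blast
    \<comment> \<open>The rate \<open>(1/2)^k\<close> survives squaring and normalization as the
      rate required by \<open>trace_small_imp_weak\<close>.\<close>
    have "\<exists>m n. n2 (a m - a n) < K' * (1/2)^k \<and> e \<le> norm ((a m - a n) \<rhd> v)" for k
    proof -
      have "K' * (1/2)^k > 0" using K'(1) by simp
      from C[OF this] obtain N where
        N: "\<And>m n. m \<ge> N \<Longrightarrow> n \<ge> N \<Longrightarrow> n2 (a m - a n) < K' * (1/2)^k" by blast
      obtain m n where "m \<ge> N" "n \<ge> N" "\<not> dist (a m \<rhd> v) (a n \<rhd> v) < e" using e(2) by blast
      then show ?thesis using N by (intro exI[of _ m] exI[of _ n]) (simp add: dist_norm)
    qed
    then obtain f g where fg: "\<And>k. n2 (a (f k) - a (g k)) < K' * (1/2)^k"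
      "\<And>k. e \<le> norm ((a (f k) - a (g k)) \<rhd> v)" by metis
    have bM: "a (f k) - a (g k) \<in> M" for k using aM by simp
    define d where "d k = complex_of_real (1 / K'\<^sup>2) *\<^sub>C (adj (a (f k) - a (g k)) * (a (f k) - a (g k)))" for k
    note d = normalized_square[OF bM K'(2,1), folded d_def]
    have "(\<lambda>k. qf (d k) v) \<longlonglongrightarrow> 0"
    proof (rule trace_small_imp_weak[OF d(1-3)])
      fix k
      have "(n2 (a (f k) - a (g k)))\<^sup>2 \<le> (K' * (1/2)^k)\<^sup>2"
        using fg(1)[of k] bM by (intro power_mono) auto
      then have "(n2 (a (f k) - a (g k)))\<^sup>2 / K'\<^sup>2 \<le> ((1/2)^k)\<^sup>2"
        using K' by (simp add: power_mult_distrib pos_divide_le_eq mult.commute)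
      also have "((1/2::real)^k)\<^sup>2 \<le> (1/2)^k"
        by (simp add: power2_eq_square mult_left_le power_le_one)
      finally show "Re (\<tau> (d k)) \<le> (1/2)^k" by (simp only: d(4))
    qed
    moreover have "e\<^sup>2 / K'\<^sup>2 \<le> qf (d k) v" for k
      unfolding d(5) using fg(2)[of k] e(1) by (intro divide_right_mono power_mono) auto
    ultimately have "e\<^sup>2 / K'\<^sup>2 \<le> 0" by (intro LIMSEQ_le_const[where X = "\<lambda>k. qf (d k) v"]) auto
    then show False using e(1) K' by (simp add: divide_le_0_iff)
  qed
  obtain A where A: "\<And>v. (\<lambda>n. a n \<rhd> v) \<longlonglongrightarrow> A \<rhd> v" "nrm A \<le> K" using Bop_lim[OF cauchy bd] by blast
  have AM: "A \<in> M" by (rule lim_in[OF aM A(1)])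
  have "(\<lambda>n. n2 (a n - A)) \<longlonglongrightarrow> 0"
  proof (rule strong_imp_n2)
    show "nrm (a n - A) \<le> K + K" for n using nrm_diff[of "a n" A] bd[of n] A(2) by linarith
    show "(\<lambda>n. (a n - A) \<rhd> v) \<longlonglongrightarrow> 0" for v using A(1)[of v] by (simp add: LIM_zero)
  qed (use aM AM in auto)
  then show ?thesis using AM A(2) by blast
qed

end

section \<open>Density of generating subalgebras\<close>

lemma linear_coefficient_zero:
  assumes "\<And>t::real. 2 * t * b \<le> t\<^sup>2 * a" shows "b = (0::real)"
proof (rule ccontr)
  assume b: "b \<noteq> 0"
  have a: "0 \<le> a" using assms[of 1] assms[of "-1"] by simp
  define t where "t = b / (a + 1)"
  have "2 * t * b = 2 * b\<^sup>2 / (a + 1)" by (simp add: t_def power2_eq_square)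
  moreover have "t\<^sup>2 * a = (b\<^sup>2 / (a + 1)) * (a / (a + 1))" by (simp add: t_def power2_eq_square)
  moreover have "(b\<^sup>2 / (a + 1)) * (a / (a + 1)) \<le> b\<^sup>2 / (a + 1)"
    using a by (intro mult_right_le_one_le) (auto simp: divide_le_eq)
  ultimately have "2 * b\<^sup>2 / (a + 1) \<le> b\<^sup>2 / (a + 1)" using assms[of t] by linarith
  then have "2 * b\<^sup>2 \<le> b\<^sup>2" using a by (simp add: divide_le_cancel)
  then show False using b by simp
qed

lemma norm_diff_sq:
  "(norm (u - v))\<^sup>2 = (norm u)\<^sup>2 - 2 * Re (cinner v u) + (norm (v::'h::complex_hilbert_space))\<^sup>2"
  unfolding power2_norm_eq_inner inner_eq_Re_cinner[of v u, symmetric]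
  by (simp add: inner_diff_left inner_diff_right inner_commute[of u v])

text \<open>Projection of a tuple \<open>t\<close> onto the closure of \<open>{(c u\<^sub>k)\<^sub>k | c \<in> S}\<close> in the \<open>n\<close>-fold direct sum
  of the Hilbert space, which is not available as a type because \<open>n\<close> varies.\<close>

lemma tuple_projection:
  fixes S :: "'h::complex_hilbert_space bop set" and u t :: "nat \<Rightarrow> 'h"
  assumes S0: "0 \<in> S" and Sadd: "\<And>a b. a \<in> S \<Longrightarrow> b \<in> S \<Longrightarrow> a + b \<in> S"
    and Ssc: "\<And>r a. a \<in> S \<Longrightarrow> complex_of_real r *\<^sub>C a \<in> S"
  shows "\<exists>p s. (\<forall>m::nat. s m \<in> S) \<and> (\<forall>k<n. (\<lambda>m. s m \<rhd> u k) \<longlonglongrightarrow> p k) \<and>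
    (\<forall>c\<in>S. (\<Sum>k<n. Re (cinner (c \<rhd> u k) (t k - p k))) = 0)"
proof -
  define q where "q c = (\<Sum>k<n. (norm (t k - c \<rhd> u k))\<^sup>2)" for c :: "'h bop"
  define d where "d a b = (\<Sum>k<n. (norm (a \<rhd> u k - b \<rhd> u k))\<^sup>2)" for a b :: "'h bop"
  have mid: "\<exists>m\<in>S. d a b \<le> 2 * q a + 2 * q b - 4 * q m" if ab: "a \<in> S" "b \<in> S" for a b
  proof
    define m where "m = complex_of_real (1/2) *\<^sub>C (a + b)"
    show "m \<in> S" unfolding m_def using ab by (intro Ssc Sadd)
    have par: "(norm (x - y))\<^sup>2 = 2 * (norm (w - x))\<^sup>2 + 2 * (norm (w - y))\<^sup>2
        - 4 * (norm (w - (1/2) *\<^sub>R (x + y)))\<^sup>2" for x y w :: 'h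
      unfolding power2_norm_eq_inner
      by (simp add: inner_diff_left inner_diff_right inner_add_left inner_add_right
          inner_commute[of y x] inner_commute[of x w] inner_commute[of y w] algebra_simps)
    have "m \<rhd> v = (1/2) *\<^sub>R (a \<rhd> v + b \<rhd> v)" for v
      unfolding m_def ap_simps by (simp only: scaleC_complex_of_real)
    then have "d a b = 2 * q a + 2 * q b - 4 * q m"
      unfolding d_def q_def sum_distrib_left sum.distrib[symmetric] sum_subtractf[symmetric]
      by (intro sum.cong refl) (simp only: par)
    then show "d a b \<le> 2 * q a + 2 * q b - 4 * q m" by simp
  qed
  have ne: "S \<noteq> {}" using S0 by blast
  have q0: "0 \<le> q c" for c unfolding q_def by (intro sum_nonneg) simp
  obtain \<mu> s where s: "\<And>m::nat. s m \<in> S" "(\<lambda>m. q (s m)) \<longlonglongrightarrow> \<mu>" "\<And>a. a \<in> S \<Longrightarrow> \<mu> \<le> q a"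
    "\<And>m. q (s m) - \<mu> < 1 / real (Suc m)"
    "\<And>a b. a \<in> S \<Longrightarrow> b \<in> S \<Longrightarrow> d a b \<le> 2 * (q a - \<mu>) + 2 * (q b - \<mu>)"
    using minimizing_sequence[of S 0 q d, OF ne q0 mid] by blast
  have "Cauchy (\<lambda>m. s m \<rhd> u k)" if k: "k < n" for k
  proof (rule metric_CauchyI)
    fix e :: real assume e: "e > 0"
    obtain N where N: "\<And>m m'. m \<ge> N \<Longrightarrow> m' \<ge> N \<Longrightarrow>
      2 * (1 / real (Suc m)) + 2 * (1 / real (Suc m')) < e\<^sup>2"
      using inv_Suc_pair_less[of "e\<^sup>2"] e by (metis zero_less_power)
    have "dist (s m \<rhd> u k) (s m' \<rhd> u k) < e" if "m \<ge> N" "m' \<ge> N" for m m'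
    proof -
      have "(norm (s m \<rhd> u k - s m' \<rhd> u k))\<^sup>2 \<le> d (s m) (s m')"
        unfolding d_def by (rule member_le_sum[of k "{..<n}" "\<lambda>k. (norm (s m \<rhd> u k - s m' \<rhd> u k))\<^sup>2"])
          (use k in auto)
      also have "\<dots> < e\<^sup>2"
        by (rule pair_less[OF s(5)[OF s(1)[of m] s(1)[of m']] s(4)[of m] s(4)[of m'] N[OF that]])
      finally show ?thesis using e by (simp add: dist_norm power_less_imp_less_base)
    qed
    then show "\<exists>M. \<forall>m\<ge>M. \<forall>n\<ge>M. dist (s m \<rhd> u k) (s n \<rhd> u k) < e" by blast
  qed
  then have "\<forall>k. \<exists>w. k < n \<longrightarrow> (\<lambda>m. s m \<rhd> u k) \<longlonglongrightarrow> w"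
    using Cauchy_convergent convergent_def by blast
  from choice[OF this] obtain p where p: "\<And>k. k < n \<Longrightarrow> (\<lambda>m. s m \<rhd> u k) \<longlonglongrightarrow> p k" by blast
  have "(\<Sum>k<n. Re (cinner (c \<rhd> u k) (t k - p k))) = 0" if c: "c \<in> S" for c
  proof (rule linear_coefficient_zero)
    fix y :: real
    let ?l = "\<lambda>m. q (s m + complex_of_real y *\<^sub>C c)"
    have lim1: "(\<lambda>m. q (s m)) \<longlonglongrightarrow> (\<Sum>k<n. (norm (t k - p k))\<^sup>2)"
      unfolding q_def by (intro tendsto_sum tendsto_power tendsto_norm tendsto_diff tendsto_const p) simp
    have lim2: "?l \<longlonglongrightarrow> (\<Sum>k<n. (norm (t k - (p k + y *\<^sub>R (c \<rhd> u k))))\<^sup>2)"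
      unfolding q_def ap_simps scaleC_complex_of_real
      by (intro tendsto_sum tendsto_power tendsto_norm tendsto_diff tendsto_add tendsto_const p) simp
    have "\<mu> \<le> (\<Sum>k<n. (norm (t k - (p k + y *\<^sub>R (c \<rhd> u k))))\<^sup>2)"
      by (rule LIMSEQ_le_const[OF lim2]) (use s(1,3) Sadd Ssc c in blast)
    moreover have "\<mu> = (\<Sum>k<n. (norm (t k - p k))\<^sup>2)" using LIMSEQ_unique[OF s(2) lim1] .
    moreover have "(\<Sum>k<n. (norm (t k - (p k + y *\<^sub>R (c \<rhd> u k))))\<^sup>2) =
      (\<Sum>k<n. (norm (t k - p k))\<^sup>2) - 2 * y * (\<Sum>k<n. Re (cinner (c \<rhd> u k) (t k - p k)))
      + y\<^sup>2 * (\<Sum>k<n. (norm (c \<rhd> u k))\<^sup>2)"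
      unfolding sum_distrib_left sum.distrib[symmetric] sum_subtractf[symmetric]
    proof (intro sum.cong refl)
      fix k
      show "(norm (t k - (p k + y *\<^sub>R (c \<rhd> u k))))\<^sup>2 = (norm (t k - p k))\<^sup>2
        - 2 * y * Re (cinner (c \<rhd> u k) (t k - p k)) + y\<^sup>2 * (norm (c \<rhd> u k))\<^sup>2"
        using norm_diff_sq[of "t k - p k" "y *\<^sub>R (c \<rhd> u k)"]
        by (simp add: diff_diff_eq cinner_scaleR_left power_mult_distrib)
    qed
    ultimately show "2 * y * (\<Sum>k<n. Re (cinner (c \<rhd> u k) (t k - p k))) \<le> y\<^sup>2 * (\<Sum>k<n. (norm (c \<rhd> u k))\<^sup>2)"
      by linarith
  qed
  then show ?thesis using s(1) p by blast
qed

locale tuple_density =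
  fixes A :: "'h::complex_hilbert_space bop set" and u :: "nat \<Rightarrow> 'h" and n :: nat
  assumes star: "star_subalgebra A" and one: "1 \<in> A"
begin

lemma A_closed: "0 \<in> A" "a \<in> A \<Longrightarrow> b \<in> A \<Longrightarrow> a + b \<in> A" "a \<in> A \<Longrightarrow> b \<in> A \<Longrightarrow> a * b \<in> A"
  "a \<in> A \<Longrightarrow> c *\<^sub>C a \<in> A" "a \<in> A \<Longrightarrow> adj a \<in> A"
  using star by (auto simp: star_subalgebra_def)

text \<open>\<open>p\<close> is the orthogonal projection of the tuple \<open>t\<close> onto the
  closure of the tuples \<open>(a u_k)\<close> with \<open>a \<in> A\<close>. Entries from index
  \<open>n\<close> on are unconstrained, so uniqueness is only claimed below
  \<open>n\<close>.\<close>

definition PR :: "(nat \<Rightarrow> 'h) \<Rightarrow> (nat \<Rightarrow> 'h) \<Rightarrow> bool" where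
  "PR t p \<longleftrightarrow> (\<exists>s. (\<forall>m::nat. s m \<in> A) \<and> (\<forall>k<n. (\<lambda>m. s m \<rhd> u k) \<longlonglongrightarrow> p k)) \<and>
    (\<forall>c\<in>A. (\<Sum>k<n. cinner (c \<rhd> u k) (t k - p k)) = 0)"

lemma PR_ex: "\<exists>p. PR t p"
proof -
  obtain p s where ps: "\<forall>m::nat. s m \<in> A" "\<forall>k<n. (\<lambda>m. s m \<rhd> u k) \<longlonglongrightarrow> p k"
    and o: "\<And>c. c \<in> A \<Longrightarrow> (\<Sum>k<n. Re (cinner (c \<rhd> u k) (t k - p k))) = 0"
    using tuple_projection[of A n u t, OF A_closed(1,2,4)] by blast
  have "(\<Sum>k<n. cinner (c \<rhd> u k) (t k - p k)) = 0" if "c \<in> A" for c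
  proof (rule complex_eqI)
    show "Re (\<Sum>k<n. cinner (c \<rhd> u k) (t k - p k)) = Re 0" using o[OF that] by simp
    have "Im (cinner w r) = Re (cinner (\<i> *\<^sub>C w) r)" for w r :: 'h by (simp add: cinner_scaleC_left)
    then show "Im (\<Sum>k<n. cinner (c \<rhd> u k) (t k - p k)) = Im 0"
      using o[OF A_closed(4)[OF that, of \<i>]] by simp
  qed
  then show ?thesis using ps unfolding PR_def by blast
qed

lemma PR_lin: assumes "PR t p" "PR t' p'" shows "PR (\<lambda>k. a *\<^sub>C t k + t' k) (\<lambda>k. a *\<^sub>C p k + p' k)"
proof -
  obtain s s' where s: "\<And>m::nat. s m \<in> A" "\<And>k. k < n \<Longrightarrow> (\<lambda>m. s m \<rhd> u k) \<longlonglongrightarrow> p k"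
    "\<And>m::nat. s' m \<in> A" "\<And>k. k < n \<Longrightarrow> (\<lambda>m. s' m \<rhd> u k) \<longlonglongrightarrow> p' k"
    using assms unfolding PR_def by blast
  have o: "(\<Sum>k<n. cinner (c \<rhd> u k) (t k - p k)) = 0" "(\<Sum>k<n. cinner (c \<rhd> u k) (t' k - p' k)) = 0" if "c \<in> A" for c
    using assms that unfolding PR_def by blast+
  show ?thesis unfolding PR_def
  proof (intro conjI exI ballI allI impI)
    show "a *\<^sub>C s m + s' m \<in> A" for m by (intro A_closed s)
    show "(\<lambda>m. (a *\<^sub>C s m + s' m) \<rhd> u k) \<longlonglongrightarrow> a *\<^sub>C p k + p' k" if "k < n" for k
      unfolding ap_simps by (intro tendsto_add tendsto_scaleC s that)
    fix c assume c: "c \<in> A"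
    have "(\<Sum>k<n. cinner (c \<rhd> u k) (a *\<^sub>C t k + t' k - (a *\<^sub>C p k + p' k))) =
      a * (\<Sum>k<n. cinner (c \<rhd> u k) (t k - p k)) + (\<Sum>k<n. cinner (c \<rhd> u k) (t' k - p' k))"
      unfolding sum_distrib_left sum.distrib[symmetric]
      by (intro sum.cong refl) (simp add: cinner_diff_right cinner_add_right cinner_scaleC_right algebra_simps)
    then show "(\<Sum>k<n. cinner (c \<rhd> u k) (a *\<^sub>C t k + t' k - (a *\<^sub>C p k + p' k))) = 0"
      by (simp add: o[OF c])
  qed
qed

lemma PR_zero: "PR (\<lambda>_. 0) (\<lambda>_. 0)"
  unfolding PR_def using A_closed(1) by (auto intro!: exI[of _ "\<lambda>_. 0"])

lemma PR_sum: "finite F \<Longrightarrow> (\<And>i. i \<in> F \<Longrightarrow> PR (t i) (p i)) \<Longrightarrow> PR (\<lambda>k. \<Sum>i\<in>F. t i k) (\<lambda>k. \<Sum>i\<in>F. p i k)"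
proof (induction F rule: finite_induct)
  case (insert i F)
  then show ?case using PR_lin[of "t i" "p i" "\<lambda>k. \<Sum>i\<in>F. t i k" "\<lambda>k. \<Sum>i\<in>F. p i k" 1] by simp
qed (simp add: PR_zero)

lemma PR_ap: assumes "PR t p" "a \<in> A" shows "PR (\<lambda>k. a \<rhd> t k) (\<lambda>k. a \<rhd> p k)"
proof -
  obtain s where s: "\<And>m::nat. s m \<in> A" "\<And>k. k < n \<Longrightarrow> (\<lambda>m. s m \<rhd> u k) \<longlonglongrightarrow> p k"
    using assms unfolding PR_def by blast
  show ?thesis unfolding PR_def
  proof (intro conjI exI ballI allI impI)
    show "a * s m \<in> A" for m by (intro A_closed assms(2) s(1))
    show "(\<lambda>m. (a * s m) \<rhd> u k) \<longlonglongrightarrow> a \<rhd> p k" if "k < n" for k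
      unfolding ap_simps by (intro tendsto_ap s that)
    fix c assume c: "c \<in> A"
    have e: "cinner (c \<rhd> u k) (a \<rhd> t k - a \<rhd> p k) = cinner ((adj a * c) \<rhd> u k) (t k - p k)" for k
      by (simp add: cinner_adj_left ap_diff)
    have "adj a * c \<in> A" by (intro A_closed assms(2) c)
    then show "(\<Sum>k<n. cinner (c \<rhd> u k) (a \<rhd> t k - a \<rhd> p k)) = 0"
      using assms(1) unfolding PR_def e by blast
  qed
qed

lemma PR_orth: assumes "PR t p" "PR t' p'" shows "(\<Sum>k<n. cinner (p' k) (t k - p k)) = 0"
proof -
  obtain s where s: "\<And>m::nat. s m \<in> A" "\<And>k. k < n \<Longrightarrow> (\<lambda>m. s m \<rhd> u k) \<longlonglongrightarrow> p' k"
    using assms unfolding PR_def by blast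
  have "(\<lambda>m. \<Sum>k<n. cinner (s m \<rhd> u k) (t k - p k)) \<longlonglongrightarrow> (\<Sum>k<n. cinner (p' k) (t k - p k))"
    by (intro tendsto_sum tendsto_cinner tendsto_const s) simp
  moreover have "(\<Sum>k<n. cinner (s m \<rhd> u k) (t k - p k)) = 0" for m
    using assms(1) s(1) unfolding PR_def by blast
  ultimately show ?thesis using LIMSEQ_unique[OF _ tendsto_const] by simp
qed

lemma PR_uniq: assumes "PR t p" "PR t p'" "k < n" shows "p k = p' k"
proof -
  have "PR (\<lambda>k. (-1) *\<^sub>C t k + t k) (\<lambda>k. (-1) *\<^sub>C p k + p' k)" by (rule PR_lin[OF assms(1,2)])
  note o = PR_orth[OF assms(1) this] PR_orth[OF assms(2) this]
  have m: "(-1) *\<^sub>C w = - w" for w :: 'h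
    using scaleC_complex_of_real[of "-1" w] by simp
  have "(\<Sum>k<n. (norm (p' k - p k))\<^sup>2) = Re (\<Sum>k<n. cinner (p' k - p k) (p' k - p k))"
    by (simp add: cinner_self del: of_real_power)
  also have "(\<Sum>k<n. cinner (p' k - p k) (p' k - p k)) =
     (\<Sum>k<n. cinner ((-1) *\<^sub>C p k + p' k) (t k - p k)) - (\<Sum>k<n. cinner ((-1) *\<^sub>C p k + p' k) (t k - p' k))"
    unfolding sum_subtractf[symmetric] m
    by (intro sum.cong refl) (simp add: cinner_diff_right)
  also have "\<dots> = 0" by (simp only: o) simp
  finally have "(\<Sum>k<n. (norm (p' k - p k))\<^sup>2) = 0" by simp
  then have "(norm (p' k - p k))\<^sup>2 = 0" using assms(3) by (subst (asm) sum_nonneg_eq_0_iff) auto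
  then show ?thesis by simp
qed

lemma PR_bound: assumes "PR t p" "k < n" shows "(norm (p k))\<^sup>2 \<le> (\<Sum>k<n. (norm (t k))\<^sup>2)"
proof -
  have "(norm (t k))\<^sup>2 = (norm (p k))\<^sup>2 + 2 * Re (cinner (p k) (t k - p k)) + (norm (t k - p k))\<^sup>2" for k
    using norm_diff_sq[of "t k" "p k"] by (simp add: cinner_diff_right cinner_self del: of_real_power)
  then have "(\<Sum>k<n. (norm (t k))\<^sup>2) = (\<Sum>k<n. (norm (p k))\<^sup>2) + 2 * Re (\<Sum>k<n. cinner (p k) (t k - p k))
     + (\<Sum>k<n. (norm (t k - p k))\<^sup>2)"
    by (simp add: sum.distrib sum_distrib_left)
  also have "(\<Sum>k<n. cinner (p k) (t k - p k)) = 0" by (rule PR_orth[OF assms(1) assms(1)])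
  finally have "(\<Sum>k<n. (norm (p k))\<^sup>2) \<le> (\<Sum>k<n. (norm (t k))\<^sup>2)"
    using sum_nonneg[of "{..<n}" "\<lambda>k. (norm (t k - p k))\<^sup>2"] by simp
  moreover have "(norm (p k))\<^sup>2 \<le> (\<Sum>k<n. (norm (p k))\<^sup>2)"
    by (rule member_le_sum[of k "{..<n}" "\<lambda>k. (norm (p k))\<^sup>2"]) (use assms(2) in auto)
  ultimately show ?thesis by linarith
qed

text \<open>The amplification step of the double commutant theorem: the matrix entries
  \<open>P k l\<close> of the projection commute with \<open>A\<close>, hence with \<open>z\<close>.
  So the closure of the tuples \<open>(a u_k)\<close> is invariant under \<open>z\<close>, and it
  contains \<open>u\<close> because \<open>1 \<in> A\<close>.\<close>

lemma density_sequence: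
  assumes z: "z \<in> commutant (commutant A)"
  shows "\<exists>s. (\<forall>m::nat. s m \<in> A) \<and> (\<forall>k<n. (\<lambda>m. s m \<rhd> u k) \<longlonglongrightarrow> z \<rhd> u k)"
proof -
  obtain pr where pr: "\<And>t. PR t (pr t)" using PR_ex by metis
  define e where "e l v k = (if k = l then v else (0::'h))" for l k :: nat and v
  have "\<exists>P. \<forall>v. P \<rhd> v = pr (e l v) k" if k: "k < n" for k l
  proof (rule Bop_ex[where K = 1])
    fix v w c
    have "PR (e l (v + w)) (\<lambda>k. 1 *\<^sub>C pr (e l v) k + pr (e l w) k)"
      using PR_lin[OF pr[of "e l v"] pr[of "e l w"], of 1] by (rule back_subst[of "\<lambda>t. PR t _"]) (auto simp: e_def)
    from PR_uniq[OF pr this k] show "pr (e l (v + w)) k = pr (e l v) k + pr (e l w) k" by simp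
    have "PR (e l (c *\<^sub>C v)) (\<lambda>k. c *\<^sub>C pr (e l v) k + 0)"
      using PR_lin[OF pr[of "e l v"] PR_zero, of c] by (rule back_subst[of "\<lambda>t. PR t _"]) (auto simp: e_def)
    from PR_uniq[OF pr this k] show "pr (e l (c *\<^sub>C v)) k = c *\<^sub>C pr (e l v) k" by simp
    have "(norm (pr (e l v) k))\<^sup>2 \<le> (\<Sum>k<n. (norm (e l v k))\<^sup>2)" by (rule PR_bound[OF pr k])
    also have "\<dots> = (\<Sum>k<n. if k = l then (norm v)\<^sup>2 else 0)" by (intro sum.cong) (auto simp: e_def)
    also have "\<dots> \<le> (norm v)\<^sup>2" by simp
    finally show "norm (pr (e l v) k) \<le> 1 * norm v" by (simp add: power2_le_iff_abs_le)
  qed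
  then have "\<forall>k l. \<exists>P. k < n \<longrightarrow> (\<forall>v. P \<rhd> v = pr (e l v) k)" by blast
  then obtain P where P: "\<And>k l v. k < n \<Longrightarrow> P k l \<rhd> v = pr (e l v) k" by metis
  have comm: "P k l \<in> commutant A" if k: "k < n" for k l
    unfolding commutant_def
  proof safe
    fix a assume a: "a \<in> A"
    show "P k l * a = a * P k l"
    proof (rule bop_eqI)
      fix v
      have "PR (e l (a \<rhd> v)) (\<lambda>k. a \<rhd> pr (e l v) k)"
        using PR_ap[OF pr[of "e l v"] a] by (rule back_subst[of "\<lambda>t. PR t _"]) (auto simp: e_def)
      from PR_uniq[OF pr this k] show "(P k l * a) \<rhd> v = (a * P k l) \<rhd> v" by (simp add: P k)
    qed
  qed
  have sumP: "(\<Sum>l<n. P k l \<rhd> t l) = pr t k" if k: "k < n" for t k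
  proof -
    define t' where "t' = (\<lambda>k. \<Sum>l<n. e l (t l) k)"
    have "t' k = t k" if "k < n" for k
      using that by (simp add: t'_def e_def)
    then have "PR t p \<longleftrightarrow> PR t' p" for p unfolding PR_def by simp
    moreover have "PR t' (\<lambda>k. \<Sum>l<n. pr (e l (t l)) k)"
      unfolding t'_def by (rule PR_sum) (auto intro: pr)
    ultimately show ?thesis using PR_uniq[OF pr _ k, of t] by (simp add: P k)
  qed
  have PRu: "PR u u" unfolding PR_def using one by (auto intro!: exI[of _ "\<lambda>_. 1"])
  have "pr (\<lambda>l. z \<rhd> u l) k = z \<rhd> u k" if k: "k < n" for k
  proof -
    have "pr (\<lambda>l. z \<rhd> u l) k = (\<Sum>l<n. (P k l * z) \<rhd> u l)" using sumP[OF k, of "\<lambda>l. z \<rhd> u l"] by simp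
    also have "\<dots> = (\<Sum>l<n. (z * P k l) \<rhd> u l)"
    proof (intro sum.cong refl)
      fix l
      have "P k l * z = z * P k l" using z comm[OF k, of l] unfolding commutant_def by auto
      then show "(P k l * z) \<rhd> u l = (z * P k l) \<rhd> u l" by simp
    qed
    also have "\<dots> = z \<rhd> (\<Sum>l<n. P k l \<rhd> u l)" by (simp add: ap_sum)
    also have "(\<Sum>l<n. P k l \<rhd> u l) = u k" using sumP[OF k, of u] PR_uniq[OF pr PRu k] by simp
    finally show ?thesis .
  qed
  then show ?thesis using pr[of "\<lambda>l. z \<rhd> u l"] unfolding PR_def by auto
qed

end

text \<open>Taking adjoints is not strongly continuous, so real parts of approximants need not
  converge. Instead \<open>z u\<close> is projected onto the real space of the tuples given by
  self-adjoint elements, and the residual \<open>r\<close> is shown to vanish by testing it against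
  \<open>c m + adj (c m)\<close>.\<close>

lemma selfadj_density_sequence:
  fixes A :: "'h::complex_hilbert_space bop set" and u :: "nat \<Rightarrow> 'h"
  assumes star: "star_subalgebra A" and one: "1 \<in> A"
    and z: "z \<in> commutant (commutant A)" "adj z = z"
  shows "\<exists>s. (\<forall>m::nat. s m \<in> A \<and> adj (s m) = s m) \<and> (\<forall>k<n. (\<lambda>m. s m \<rhd> u k) \<longlonglongrightarrow> z \<rhd> u k)"
proof -
  define S where "S = {c \<in> A. adj c = c}"
  interpret T0: tuple_density A u n by unfold_locales (rule star, rule one)
  note cl = T0.A_closed
  obtain p s where ps: "\<And>m::nat. s m \<in> S" "\<And>k. k < n \<Longrightarrow> (\<lambda>m. s m \<rhd> u k) \<longlonglongrightarrow> p k"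
    and o: "\<And>c. c \<in> S \<Longrightarrow> (\<Sum>k<n. Re (cinner (c \<rhd> u k) (z \<rhd> u k - p k))) = 0"
    using tuple_projection[of S n u "\<lambda>k. z \<rhd> u k"] cl by (auto simp: S_def)
  define r where "r k = z \<rhd> u k - p k" for k
  \<comment> \<open>The tuple is doubled because \<open>adj (c m)\<close> is moved over to the
    residual, so \<open>c m\<close> has to approximate \<open>z\<close> on \<open>r\<close> as well
    as on \<open>u\<close>.\<close>
  define w where "w k = (if k < n then u k else r (k - n))" for k
  interpret T: tuple_density A w "n + n" by unfold_locales (rule star, rule one)
  obtain c where c: "\<And>m::nat. c m \<in> A" "\<And>k. k < n + n \<Longrightarrow> (\<lambda>m. c m \<rhd> w k) \<longlonglongrightarrow> z \<rhd> w k"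
    using T.density_sequence[OF z(1)] by blast
  have cu: "(\<lambda>m. c m \<rhd> u k) \<longlonglongrightarrow> z \<rhd> u k" if "k < n" for k
    using c(2)[of k] that by (simp add: w_def)
  have cr: "(\<lambda>m. c m \<rhd> r k) \<longlonglongrightarrow> z \<rhd> r k" if "k < n" for k
    using c(2)[of "k + n"] that by (simp add: w_def)
  have zero: "(\<Sum>k<n. Re (cinner (c m \<rhd> u k) (r k) + cinner (u k) (c m \<rhd> r k))) = 0" for m
  proof -
    have "c m + adj (c m) \<in> S" using cl c(1) by (simp add: S_def add.commute)
    from o[OF this] show ?thesis
      by (simp add: r_def[symmetric] cinner_add_left cinner_adj_left)
  qed
  have "(\<lambda>m. \<Sum>k<n. Re (cinner (c m \<rhd> u k) (r k) + cinner (u k) (c m \<rhd> r k))) \<longlonglongrightarrow>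
    (\<Sum>k<n. Re (cinner (z \<rhd> u k) (r k) + cinner (u k) (z \<rhd> r k)))"
    by (intro tendsto_sum tendsto_Re tendsto_add tendsto_cinner tendsto_const cu cr) simp_all
  from LIMSEQ_unique[OF this[unfolded zero] tendsto_const]
  have "(\<Sum>k<n. Re (cinner (z \<rhd> u k) (r k) + cinner (u k) (z \<rhd> r k))) = 0" .
  moreover have "cinner (u k) (z \<rhd> r k) = cinner (z \<rhd> u k) (r k)" for k
    using cinner_adj_left[of z] z(2) by metis
  ultimately have zr: "(\<Sum>k<n. Re (cinner (z \<rhd> u k) (r k))) = 0"
    by (simp add: sum_distrib_left[symmetric])
  have "(\<lambda>m. \<Sum>k<n. Re (cinner (s m \<rhd> u k) (r k))) \<longlonglongrightarrow> (\<Sum>k<n. Re (cinner (p k) (r k)))"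
    by (intro tendsto_sum tendsto_Re tendsto_cinner tendsto_const ps) simp
  moreover have "(\<Sum>k<n. Re (cinner (s m \<rhd> u k) (r k))) = 0" for m
    using o[OF ps(1)] by (simp add: r_def)
  ultimately have pr: "(\<Sum>k<n. Re (cinner (p k) (r k))) = 0"
    using LIMSEQ_unique[OF _ tendsto_const] by simp
  have "(norm (r k))\<^sup>2 = Re (cinner (z \<rhd> u k) (r k)) - Re (cinner (p k) (r k))" for k
  proof -
    have "cinner (z \<rhd> u k - p k) (r k) = of_real ((norm (r k))\<^sup>2)"
      using cinner_self[of "r k"] by (simp add: r_def)
    then show ?thesis by (simp add: cinner_diff_left complex_eq_iff del: of_real_power)
  qed
  then have "(\<Sum>k<n. (norm (r k))\<^sup>2) = 0" by (simp add: sum_subtractf zr pr)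
  then have "r k = 0" if "k < n" for k
    using that by (subst (asm) sum_nonneg_eq_0_iff) auto
  then have "p k = z \<rhd> u k" if "k < n" for k using that by (simp add: r_def)
  then show ?thesis using ps by (intro exI[of _ s]) (auto simp: S_def)
qed

subsection \<open>Cayley resolvents\<close>

text \<open>The resolvent \<open>(1 + \<i> c)^{-1}\<close> has norm at most 1 whatever the norm of
  \<open>c\<close>. Density provides approximants of \<open>z\<close> without any norm bound, and
  passing to resolvents does the work of Kaplansky's density theorem.\<close>

definition res_i :: "'h::complex_hilbert_space bop \<Rightarrow> 'h bop" where
  "res_i c = (SOME g. g * (1 + \<i> *\<^sub>C c) = 1 \<and> (1 + \<i> *\<^sub>C c) * g = 1 \<and> nrm g \<le> 1)"

lemma res_i:
  assumes "adj c = (c::'h::complex_hilbert_space bop)"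
  shows "res_i c * (1 + \<i> *\<^sub>C c) = 1" "(1 + \<i> *\<^sub>C c) * res_i c = 1" "nrm (res_i c) \<le> 1"
proof -
  have "(norm v)\<^sup>2 \<le> qf (1 + \<i> *\<^sub>C c) v" for v
  proof -
    have "cnj (cinner v (c \<rhd> v)) = cinner v (c \<rhd> v)"
      by (metis assms cinner_adj_left cinner_commute)
    then have "Im (cinner v (c \<rhd> v)) = 0" by (simp add: complex_eq_iff)
    then show ?thesis by (simp add: cinner_add_right cinner_scaleC_right cinner_self del: of_real_power)
  qed
  from lax_milgram_inverse[OF this]
  have "\<exists>g. g * (1 + \<i> *\<^sub>C c) = 1 \<and> (1 + \<i> *\<^sub>C c) * g = 1 \<and> nrm g \<le> 1" by blast
  from someI_ex[OF this] show "res_i c * (1 + \<i> *\<^sub>C c) = 1" "(1 + \<i> *\<^sub>C c) * res_i c = 1" "nrm (res_i c) \<le> 1"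
    unfolding res_i_def by blast+
qed

lemma inverse_unique_bop:
  fixes g h s :: "'h::complex_hilbert_space bop"
  assumes "g * s = 1" "s * h = 1" shows "g = h"
  by (metis assms mult.assoc mult_1_left mult_1_right)

lemma geometric_sum_bop:
  fixes t :: "'h::complex_hilbert_space bop"
  shows "(1 - t) * (\<Sum>k<n. t ^ k) = 1 - t ^ n"
proof (induction n)
  case (Suc n)
  have "(1 - t) * (\<Sum>k<Suc n. t ^ k) = (1 - t) * (\<Sum>k<n. t ^ k) + (1 - t) * t ^ n"
    by (simp only: sum.lessThan_Suc distrib_left)
  then show ?case unfolding Suc.IH by (simp add: left_diff_distrib)
qed simp

section \<open>Trace-norm density of a star-subalgebra with bicommutant \<open>M\<close>\<close>

locale dense_subalgebra = tracial_vna M \<tau> for M :: "'h::complex_hilbert_space bop set" and \<tau> +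
  fixes A
  assumes star: "star_subalgebra A" and one: "1 \<in> A" and AM: "A \<subseteq> M"
    and gen: "commutant (commutant A) = M"
begin

definition L where "L = {z \<in> M. \<forall>e>0. \<exists>c\<in>A. n2 (z - c) < e}"

lemma A_closed: "0 \<in> A" "a \<in> A \<Longrightarrow> b \<in> A \<Longrightarrow> a + b \<in> A" "a \<in> A \<Longrightarrow> b \<in> A \<Longrightarrow> a * b \<in> A"
  "a \<in> A \<Longrightarrow> c *\<^sub>C a \<in> A" "a \<in> A \<Longrightarrow> adj a \<in> A"
  using star by (auto simp: star_subalgebra_def)

lemma A_power: "a \<in> A \<Longrightarrow> a ^ n \<in> A"
  by (induction n) (auto intro: A_closed one)

lemma A_sum: "(\<And>i. i \<in> F \<Longrightarrow> g i \<in> A) \<Longrightarrow> (\<Sum>i\<in>F. g i) \<in> A"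
  by (induction F rule: infinite_finite_induct) (auto intro: A_closed)

lemma AL: "a \<in> A \<Longrightarrow> a \<in> L"
  using AM by (auto simp: L_def intro!: bexI[of _ a])

lemma L_D: "z \<in> L \<Longrightarrow> e > 0 \<Longrightarrow> \<exists>c\<in>A. n2 (z - c) < e"
  by (simp add: L_def)

lemma L_M: "z \<in> L \<Longrightarrow> z \<in> M" by (simp add: L_def)

lemma L_closed: assumes "z \<in> M" "\<And>e. e > 0 \<Longrightarrow> \<exists>c\<in>L. n2 (z - c) < e" shows "z \<in> L"
  unfolding L_def
proof safe
  fix e :: real assume "0 < e"
  then have e2: "e / 2 > 0" by simp
  obtain c where c: "c \<in> L" "n2 (z - c) < e / 2" using assms(2)[OF e2] by blast
  obtain c' where c': "c' \<in> A" "n2 (c - c') < e / 2" using L_D[OF c(1) e2] by blast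
  have "n2 (z - c') \<le> n2 (z - c) + n2 (c - c')"
    by (intro n2_triangle3 assms(1) L_M[OF c(1)] subsetD[OF AM c'(1)])
  then show "\<exists>c\<in>A. n2 (z - c) < e" using c c' by (intro bexI[of _ c']) auto
qed (rule assms(1))

lemma L_lim:
  assumes "z \<in> M" "\<And>n::nat. c n \<in> L" "\<And>n. n2 (z - c n) \<le> f n" "f \<longlonglongrightarrow> 0" shows "z \<in> L"
proof (rule L_closed[OF assms(1)])
  fix e :: real assume "e > 0"
  then obtain n where "f n < e" using order_tendstoD(2)[OF assms(4), of e] eventually_happens by fastforce
  then show "\<exists>c\<in>L. n2 (z - c) < e" using assms(2,3) by (intro bexI[of _ "c n"]) (auto intro: le_less_trans)
qed

lemma L_add: assumes "z \<in> L" "w \<in> L" shows "z + w \<in> L"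
  unfolding L_def
proof safe
  fix e :: real assume "0 < e"
  then have e2: "e / 2 > 0" by simp
  obtain c where c: "c \<in> A" "n2 (z - c) < e / 2" using L_D[OF assms(1) e2] by blast
  obtain d where d: "d \<in> A" "n2 (w - d) < e / 2" using L_D[OF assms(2) e2] by blast
  have "n2 ((z - c) + (w - d)) \<le> n2 (z - c) + n2 (w - d)"
    by (intro n2_triangle diff_in L_M assms subsetD[OF AM] c d)
  moreover have "(z - c) + (w - d) = z + w - (c + d)" by simp
  ultimately show "\<exists>c\<in>A. n2 (z + w - c) < e" using c d by (intro bexI[of _ "c + d"] A_closed) auto
qed (intro add_in L_M assms)

lemma L_mult_A: assumes "z \<in> L" "a \<in> A" shows "z * a \<in> L"
proof (rule L_closed)
  show "z * a \<in> M" by (intro mult_in L_M assms subsetD[OF AM])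
  fix e :: real assume "e > 0"
  then have "e / (nrm a + 1) > 0" by (simp add: add_nonneg_pos)
  then obtain c where c: "c \<in> A" "n2 (z - c) < e / (nrm a + 1)" using L_D[OF assms(1)] by blast
  have M: "z \<in> M" "c \<in> M" "a \<in> M" using assms c AM L_M by auto
  have "n2 (z * a - c * a) \<le> n2 (z - c) * nrm a"
    using n2_mult_right[of "z - c" a] M by (simp add: left_diff_distrib)
  also have "\<dots> \<le> n2 (z - c) * (nrm a + 1)" using M by (intro mult_left_mono) auto
  also have "\<dots> < e" using c(2) by (simp add: pos_less_divide_eq add_nonneg_pos)
  finally show "\<exists>c\<in>L. n2 (z * a - c) < e" using AL[OF A_closed(3)[OF c(1) assms(2)]] by blast
qed

text \<open>Only \<open>w\<close> is replaced by an element of \<open>A\<close>, with the fixed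
  operator \<open>z\<close> as bounded factor; \<open>L_mult_A\<close> does the rest. Approximating
  both factors at once would call for norm bounds on the approximants.\<close>

lemma L_mult: assumes "z \<in> L" "w \<in> L" shows "z * w \<in> L"
proof (rule L_closed)
  show "z * w \<in> M" by (intro mult_in L_M assms)
  fix e :: real assume "e > 0"
  then have "e / (nrm z + 1) > 0" by (simp add: add_nonneg_pos)
  then obtain c where c: "c \<in> A" "n2 (w - c) < e / (nrm z + 1)" using L_D[OF assms(2)] by blast
  have M: "z \<in> M" "c \<in> M" "w \<in> M" using assms c AM L_M by auto
  have "n2 (z * w - z * c) \<le> nrm z * n2 (w - c)"
    using n2_mult_left[of z "w - c"] M by (simp add: right_diff_distrib)
  also have "\<dots> \<le> (nrm z + 1) * n2 (w - c)" using M by (intro mult_right_mono) auto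
  also have "\<dots> < e" using c(2) by (simp add: pos_less_divide_eq add_nonneg_pos mult.commute)
  finally show "\<exists>c\<in>L. n2 (z * w - c) < e" using L_mult_A[OF assms(1) c(1)] by blast
qed

lemma L_scaleC: "z \<in> L \<Longrightarrow> c *\<^sub>C z \<in> L"
  using L_mult_A[of z "c *\<^sub>C 1"] A_closed(4)[OF one, of c] by simp

lemma L_diff: "z \<in> L \<Longrightarrow> w \<in> L \<Longrightarrow> z - w \<in> L"
  using L_add[of z "(-1) *\<^sub>C w"] L_scaleC[of w "-1"] by (simp add: scaleC_bop_distrib)

lemma L_power: "z \<in> L \<Longrightarrow> z ^ n \<in> L"
  by (induction n) (auto intro: L_mult AL one)

lemma L_sum: "(\<And>i. i \<in> F \<Longrightarrow> g i \<in> L) \<Longrightarrow> (\<Sum>i\<in>F. g i) \<in> L"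
  by (induction F rule: infinite_finite_induct) (auto intro: L_add AL A_closed)

text \<open>The resolvent equals \<open>(1 - \<i> c) (1 + c\<^sup>2)^{-1}\<close>, and the second
  factor is a Neumann series whose partial sums are polynomials in \<open>c\<close>.\<close>

lemma res_i_A_in_L:
  assumes c: "c \<in> A" "adj c = c" shows "res_i c \<in> L"
proof -
  have cM: "c \<in> M" using c AM by blast
  have p: "pos_op (c * c)" using pos_op_adj_mult[of c] c by simp
  define w where "w = res1 (c * c)"
  have w: "w * (1 + c * c) = 1" "(1 + c * c) * w = 1" unfolding w_def using res1[OF p] by auto
  have wM: "w \<in> M" by (rule inverse_in[OF _ w]) (use cM in auto)
  have "(1 + \<i> *\<^sub>C c) * ((1 - \<i> *\<^sub>C c) * w) = (1 + c * c) * w"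
    by (simp add: mult.assoc[symmetric]) (simp add: algebra_simps scaleC_bop_distrib)
  then have rw: "res_i c = (1 - \<i> *\<^sub>C c) * w"
    using inverse_unique_bop[OF res_i(1)[OF c(2)]] w by simp
  \<comment> \<open>\<open>1 + c\<^sup>2\<close> lies between 1 and \<open>R\<close>, hence
    \<open>t\<close> lies between 0 and \<open>1 - 1 / R\<close>.\<close>
  define R where "R = (nrm c)\<^sup>2 + 1"
  have R: "R \<ge> 1" by (simp add: R_def)
  define t where "t = 1 - complex_of_real (1 / R) *\<^sub>C (1 + c * c)"
  have sc: "(1 - t) = complex_of_real (1 / R) *\<^sub>C (1 + c * c)" by (simp add: t_def)
  have qt: "qf t v = (norm v)\<^sup>2 - (1 / R) * ((norm v)\<^sup>2 + (norm (c \<rhd> v))\<^sup>2)" for v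
    unfolding t_def qf_simps using qf_adj_mult[of v c] c(2) by simp
  have nc: "(norm (c \<rhd> v))\<^sup>2 \<le> (nrm c)\<^sup>2 * (norm v)\<^sup>2" for v
    using power_mono[OF norm_ap_le[of c v], of 2] by (simp add: power_mult_distrib)
  have tpos: "pos_op t"
  proof (rule pos_opI)
    show "adj t = t" using c by (simp add: t_def)
    fix v
    have "(norm v)\<^sup>2 + (norm (c \<rhd> v))\<^sup>2 \<le> R * (norm v)\<^sup>2" using nc[of v] by (simp add: R_def algebra_simps)
    then have "(1 / R) * ((norm v)\<^sup>2 + (norm (c \<rhd> v))\<^sup>2) \<le> (norm v)\<^sup>2"
      using R by (simp add: pos_divide_le_eq mult.commute)
    then show "0 \<le> qf t v" by (simp add: qt)
  qed
  define \<theta> where "\<theta> = 1 - 1 / R"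
  have th: "0 \<le> \<theta>" "\<theta> < 1" using R by (auto simp: \<theta>_def)
  have nt: "nrm t \<le> \<theta>"
  proof (rule pos_op_nrm_le[OF tpos _ th(1)])
    fix v
    have "(1 / R) * (norm v)\<^sup>2 \<le> (1 / R) * ((norm v)\<^sup>2 + (norm (c \<rhd> v))\<^sup>2)"
      using R by (intro mult_left_mono) auto
    then show "qf t v \<le> \<theta> * (norm v)\<^sup>2" by (simp add: qt \<theta>_def left_diff_distrib)
  qed
  define S where "S n = complex_of_real (1 / R) *\<^sub>C (\<Sum>k<n. t ^ k)" for n :: nat
  have tA: "t \<in> A"
  proof -
    have "t = 1 + complex_of_real (- 1 / R) *\<^sub>C (1 + c * c)" by (simp add: t_def scaleC_bop_distrib)
    then show ?thesis using c one by (auto intro!: A_closed)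
  qed
  have SA: "(1 - \<i> *\<^sub>C c) * S n \<in> A" for n
  proof -
    have "1 + (- \<i>) *\<^sub>C c \<in> A" by (intro A_closed one c)
    then have "1 - \<i> *\<^sub>C c \<in> A" by (simp add: scaleC_bop_distrib)
    then show ?thesis unfolding S_def by (intro A_closed A_sum A_power tA)
  qed
  have S1: "(1 + c * c) * S n = 1 - t ^ n" for n
    using geometric_sum_bop[of t n] by (simp add: S_def sc)
  have wS: "w - S n = w * t ^ n" for n
  proof -
    have "S n = w * ((1 + c * c) * S n)" by (simp add: mult.assoc[symmetric] w)
    then show ?thesis by (simp add: S1 right_diff_distrib)
  qed
  show ?thesis
  proof (rule L_lim)
    show "(1 - \<i> *\<^sub>C c) * S n \<in> L" for n using SA AL by blast
    show "res_i c \<in> M" using rw wM cM by auto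
    define C where "C = nrm ((1 - \<i> *\<^sub>C c) * w)"
    show "n2 (res_i c - (1 - \<i> *\<^sub>C c) * S n) \<le> C * \<theta> ^ n" for n
    proof -
      have e: "res_i c - (1 - \<i> *\<^sub>C c) * S n = ((1 - \<i> *\<^sub>C c) * w) * t ^ n"
        unfolding rw right_diff_distrib[symmetric] wS by (simp add: mult.assoc)
      have "n2 (res_i c - (1 - \<i> *\<^sub>C c) * S n) \<le> nrm (((1 - \<i> *\<^sub>C c) * w) * t ^ n)"
        unfolding e using cM wM tA AM by (intro n2_le_nrm) auto
      also have "\<dots> \<le> C * nrm (t ^ n)" unfolding C_def by (rule nrm_mult)
      also have "\<dots> \<le> C * \<theta> ^ n"
        using nrm_power[of t n] power_mono[OF nt, of n] by (intro mult_left_mono) (auto simp: C_def)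
      finally show ?thesis .
    qed
    show "(\<lambda>n. C * \<theta> ^ n) \<longlonglongrightarrow> 0" using th by (intro tendsto_mult_right_zero LIMSEQ_realpow_zero)
  qed
qed

lemma res_i_in_M: assumes "z \<in> M" "adj z = z" shows "res_i z \<in> M"
  by (rule inverse_in[of "1 + \<i> *\<^sub>C z"]) (use assms res_i[OF assms(2)] in auto)

text \<open>Two resolvents differ by \<open>res_i c (\<i> (c - z)) res_i z\<close>. So
  \<open>c\<close> has to be close to \<open>z\<close> only at the finitely many vectors
  \<open>res_i z (v k)\<close>, and \<open>weak_imp_trace_small\<close> converts smallness at the
  \<open>v k\<close> into smallness in trace norm.\<close>

lemma res_i_in_L:
  assumes z: "z \<in> M" "adj z = z" shows "res_i z \<in> L"
proof (rule L_closed[OF res_i_in_M[OF z]])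
  fix e :: real assume e: "e > 0"
  obtain v :: "nat \<Rightarrow> 'h" where v: "\<And>a. a \<in> M \<Longrightarrow> adj a = a \<Longrightarrow> (\<And>k. a \<rhd> v k = 0) \<Longrightarrow> a = 0"
    using separating_sequence by blast
  have "e\<^sup>2 / 4 > 0" using e by simp
  from weak_imp_trace_small[where v = v, OF v this] obtain n where
    n: "\<And>a. a \<in> M \<Longrightarrow> pos_op a \<Longrightarrow> pos_op (1 - a) \<Longrightarrow> (\<forall>k<n. qf a (v k) \<le> (1/2)^n) \<Longrightarrow> Re (\<tau> a) < e\<^sup>2 / 4"
    by blast
  define u where "u k = res_i z \<rhd> v k" for k
  obtain s where s: "\<And>m::nat. s m \<in> A" "\<And>m. adj (s m) = s m" "\<And>k. k < n \<Longrightarrow> (\<lambda>m. s m \<rhd> u k) \<longlonglongrightarrow> z \<rhd> u k"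
    using selfadj_density_sequence[OF star one, of z n u] z gen by auto
  have "\<forall>\<^sub>F m in sequentially. \<forall>k\<in>{..<n}. (norm (s m \<rhd> u k - z \<rhd> u k))\<^sup>2 / 4 < (1/2)^n"
  proof (rule eventually_ball_finite, simp, intro ballI)
    fix k assume "k \<in> {..<n}"
    then have "(\<lambda>m. (norm (s m \<rhd> u k - z \<rhd> u k))\<^sup>2 / 4) \<longlonglongrightarrow> 0\<^sup>2 / 4"
      using s(3)[of k] by (intro tendsto_divide tendsto_power tendsto_const tendsto_norm_zero LIM_zero) auto
    then show "\<forall>\<^sub>F m in sequentially. (norm (s m \<rhd> u k - z \<rhd> u k))\<^sup>2 / 4 < (1/2)^n"
      by (rule order_tendstoD) simp
  qed
  then obtain m where m: "\<And>k. k < n \<Longrightarrow> (norm (s m \<rhd> u k - z \<rhd> u k))\<^sup>2 / 4 < (1/2)^n"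
    using eventually_happens by fastforce
  define c where "c = s m"
  have c: "c \<in> A" "adj c = c" "c \<in> M" using s(1,2) AM by (auto simp: c_def)
  define d where "d = res_i z - res_i c"
  have dM: "d \<in> M" using res_i_in_M z c by (auto simp: d_def)
  have dn: "nrm d \<le> 2" using nrm_diff[of "res_i z" "res_i c"] res_i(3)[OF z(2)] res_i(3)[OF c(2)]
    unfolding d_def by linarith
  have de: "d = res_i c * (\<i> *\<^sub>C (c - z)) * res_i z"
  proof -
    have "res_i c * (\<i> *\<^sub>C (c - z)) * res_i z = (res_i c * (1 + \<i> *\<^sub>C c)) * res_i z - res_i c * ((1 + \<i> *\<^sub>C z) * res_i z)"
      by (simp add: algebra_simps scaleC_bop_distrib)
    then show ?thesis using res_i[OF z(2)] res_i[OF c(2)] by (simp add: d_def)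
  qed
  have dv: "(norm (d \<rhd> v k))\<^sup>2 \<le> (norm (c \<rhd> u k - z \<rhd> u k))\<^sup>2" for k
  proof (rule power_mono)
    have "norm (d \<rhd> v k) \<le> nrm (res_i c) * norm ((\<i> *\<^sub>C (c - z)) \<rhd> u k)"
      unfolding de u_def ap_simps(2) by (rule norm_ap_le)
    also have "\<dots> \<le> 1 * norm ((\<i> *\<^sub>C (c - z)) \<rhd> u k)" by (intro mult_right_mono res_i(3) c) auto
    finally show "norm (d \<rhd> v k) \<le> norm (c \<rhd> u k - z \<rhd> u k)" by (simp add: norm_scaleC)
  qed simp
  note ns = normalized_square[OF dM dn zero_less_numeral]
  have "Re (\<tau> (complex_of_real (1 / 2\<^sup>2) *\<^sub>C (adj d * d))) < e\<^sup>2 / 4"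
  proof (rule n)
    show "\<forall>k<n. qf (complex_of_real (1 / 2\<^sup>2) *\<^sub>C (adj d * d)) (v k) \<le> (1/2)^n"
    proof (intro allI impI)
      fix k assume "k < n"
      have "(norm (d \<rhd> v k))\<^sup>2 / 2\<^sup>2 \<le> (norm (c \<rhd> u k - z \<rhd> u k))\<^sup>2 / 2\<^sup>2"
        by (intro divide_right_mono dv) simp
      also have "\<dots> \<le> (1/2)^n" using m[OF \<open>k < n\<close>] by (simp add: c_def)
      finally show "qf (complex_of_real (1 / 2\<^sup>2) *\<^sub>C (adj d * d)) (v k) \<le> (1/2)^n"
        unfolding ns(5) .
    qed
  qed (rule ns)+
  then have "(n2 d)\<^sup>2 / 2\<^sup>2 < e\<^sup>2 / 4" unfolding ns(4) .
  then have "n2 d < e" using e by (simp add: power_less_imp_less_base)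
  then show "\<exists>c\<in>L. n2 (res_i z - c) < e" using res_i_A_in_L[OF c(1,2)] unfolding d_def by blast
qed

text \<open>Recovers \<open>z\<close> from its resolvent \<open>v\<close>: as
  \<open>1 - v = \<i> z v\<close> has norm at most 1/3, the inverse \<open>1 + \<i> z\<close> of
  \<open>v\<close> is a Neumann series in \<open>1 - v\<close>.\<close>

lemma small_selfadj_in_L:
  assumes z: "z \<in> M" "adj z = z" "nrm z \<le> 1/3" shows "z \<in> L"
proof -
  define v where "v = res_i z"
  have vL: "v \<in> L" unfolding v_def by (rule res_i_in_L[OF z(1,2)])
  note r = res_i[OF z(2), folded v_def]
  define e where "e = 1 - v"
  have eL: "e \<in> L" unfolding e_def by (intro L_diff vL AL one)
  have "v + (\<i> *\<^sub>C z) * v = 1" using r(2) by (simp add: distrib_right)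
  then have ez: "e = (\<i> *\<^sub>C z) * v" by (simp add: e_def algebra_simps)
  have "nrm e \<le> nrm (\<i> *\<^sub>C z) * nrm v" unfolding ez by (rule nrm_mult)
  also have "\<dots> \<le> (1/3) * 1"
    using nrm_scaleC[of \<i> z] z(3) r(3) by (intro mult_mono) auto
  finally have en: "nrm e \<le> 1/3" by simp
  define S where "S n = (\<Sum>k<n. e ^ k)" for n :: nat
  have S: "S n = (1 + \<i> *\<^sub>C z) * (1 - e ^ n)" for n
  proof -
    have "v * S n = 1 - e ^ n" using geometric_sum_bop[of e n] by (simp add: S_def e_def)
    then have "(1 + \<i> *\<^sub>C z) * (1 - e ^ n) = ((1 + \<i> *\<^sub>C z) * v) * S n" by (simp add: mult.assoc)
    then show ?thesis by (simp only: r) simp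
  qed
  have "1 + \<i> *\<^sub>C z \<in> L"
  proof (rule L_lim)
    show "S n \<in> L" for n unfolding S_def by (intro L_sum L_power eL)
    show zM: "1 + \<i> *\<^sub>C z \<in> M" using z by blast
    show "n2 (1 + \<i> *\<^sub>C z - S n) \<le> nrm (1 + \<i> *\<^sub>C z) * (1/3) ^ n" for n
    proof -
      have "n2 (1 + \<i> *\<^sub>C z - S n) = n2 ((1 + \<i> *\<^sub>C z) * e ^ n)"
        unfolding S by (simp add: right_diff_distrib)
      also have "\<dots> \<le> nrm ((1 + \<i> *\<^sub>C z) * e ^ n)" using zM L_M[OF eL] by (intro n2_le_nrm) auto
      also have "\<dots> \<le> nrm (1 + \<i> *\<^sub>C z) * nrm (e ^ n)" by (rule nrm_mult)
      also have "\<dots> \<le> nrm (1 + \<i> *\<^sub>C z) * (1/3) ^ n"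
        using nrm_power[of e n] power_mono[OF en, of n] by (intro mult_left_mono) auto
      finally show ?thesis .
    qed
    show "(\<lambda>n. nrm (1 + \<i> *\<^sub>C z) * (1/3) ^ n) \<longlonglongrightarrow> 0"
      by (intro tendsto_mult_right_zero LIMSEQ_realpow_zero) auto
  qed
  from L_scaleC[OF L_diff[OF this AL[OF one]], of "- \<i>"] show ?thesis by simp
qed

lemma selfadj_in_L:
  assumes z: "z \<in> M" "adj z = z" shows "z \<in> L"
proof -
  define K where "K = 3 * (nrm z + 1)"
  have K: "K > 0" by (simp add: K_def add_nonneg_pos)
  define w where "w = complex_of_real (1 / K) *\<^sub>C z"
  have "nrm w \<le> cmod (complex_of_real (1 / K)) * nrm z" unfolding w_def by (rule nrm_scaleC)
  also have "\<dots> = nrm z / K" using K by (simp add: norm_divide)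
  also have "\<dots> \<le> 1/3" using K by (simp add: pos_divide_le_eq) (simp add: K_def)
  finally have "w \<in> L" using z by (intro small_selfadj_in_L) (auto simp: w_def)
  from L_scaleC[OF this, of "complex_of_real K"] show ?thesis using K by (simp add: w_def)
qed

theorem n2_dense: assumes "z \<in> M" "e > 0" shows "\<exists>c\<in>A. n2 (z - c) < e"
proof -
  define h where "h = complex_of_real (1/2) *\<^sub>C (z + adj z)"
  define k where "k = (- \<i> / 2) *\<^sub>C (z - adj z)"
  have "h \<in> L" by (rule selfadj_in_L) (use assms in \<open>auto simp: h_def add.commute\<close>)
  moreover have "k \<in> L" by (rule selfadj_in_L) (use assms in \<open>auto simp: k_def scaleC_bop_distrib\<close>)
  moreover have "z = h + \<i> *\<^sub>C k"
  proof -
    have "h + \<i> *\<^sub>C k = complex_of_real (1/2) *\<^sub>C z + complex_of_real (1/2) *\<^sub>C z"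
      unfolding h_def k_def by (simp add: scaleC_bop_distrib)
    then show ?thesis by (simp only: scaleC_bop_distrib(2)[symmetric]) simp
  qed
  ultimately have "z \<in> L" by (simp add: L_add L_scaleC)
  then show ?thesis using assms(2) by (simp add: L_def)
qed

end

section \<open>Conditional expectations\<close>

locale cond_exp = tracial_vna M \<tau> for M :: "'h::complex_hilbert_space bop set" and \<tau> +
  fixes B :: "'h bop set" and E :: "'h bop \<Rightarrow> 'h bop"
  assumes subalg: "vn_subalgebra B M" and ce: "trace_cond_exp M \<tau> B E"

sublocale cond_exp \<subseteq> B: vna B
  using subalg by unfold_locales (simp add: vn_subalgebra_def)

context cond_exp
begin

lemma BM [simp, intro]: "b \<in> B \<Longrightarrow> b \<in> M"
  using subalg by (auto simp: vn_subalgebra_def)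

lemma E_in [simp, intro]: "a \<in> M \<Longrightarrow> E a \<in> B"
  and E_add: "a \<in> M \<Longrightarrow> b \<in> M \<Longrightarrow> E (a + b) = E a + E b"
  and E_scaleC: "a \<in> M \<Longrightarrow> E (z *\<^sub>C a) = z *\<^sub>C E a"
  and E_pos: "a \<in> M \<Longrightarrow> pos_op a \<Longrightarrow> pos_op (E a)"
  and E_id: "b \<in> B \<Longrightarrow> E b = b"
  and E_bimod: "a \<in> M \<Longrightarrow> b \<in> B \<Longrightarrow> c \<in> B \<Longrightarrow> E (b * a * c) = b * E a * c"
  and tr_E: "a \<in> M \<Longrightarrow> \<tau> (E a) = \<tau> a"
  using ce unfolding trace_cond_exp_def clinear_on_def by auto

lemma E_left: "a \<in> M \<Longrightarrow> b \<in> B \<Longrightarrow> E (b * a) = b * E a"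
  using E_bimod[of a b 1] by simp

lemma E_right: "a \<in> M \<Longrightarrow> b \<in> B \<Longrightarrow> E (a * b) = E a * b"
  using E_bimod[of a 1 b] by simp

lemma E_zero [simp]: "E 0 = 0" by (rule E_id) simp

lemma E_one [simp]: "E 1 = 1" by (rule E_id) simp

lemma E_minus: "a \<in> M \<Longrightarrow> E (- a) = - E a"
  using E_scaleC[of a "-1"] by (simp add: scaleC_bop_distrib)

lemma E_diff: "a \<in> M \<Longrightarrow> b \<in> M \<Longrightarrow> E (a - b) = E a - E b"
  using E_add[of a "- b"] by (simp add: E_minus)

lemma E_sum: "(\<And>i. i \<in> F \<Longrightarrow> g i \<in> M) \<Longrightarrow> E (\<Sum>i\<in>F. g i) = (\<Sum>i\<in>F. E (g i))"
proof (induction F rule: infinite_finite_induct)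
  case (insert x F)
  then show ?case using E_add[of "g x" "sum g F"] sum_in[of F g] by auto
qed auto

lemma E_selfadj: assumes "a \<in> M" "adj a = a" shows "adj (E a) = E a"
proof -
  define K where "K = complex_of_real (nrm a) *\<^sub>C (1::'h bop)"
  have "pos_op (E (K - a))" unfolding K_def
    by (intro E_pos pos_op_nrm_minus) (use assms in auto)
  then have "adj (E (K - a)) = E (K - a)" by (rule pos_op_adj)
  moreover have "E (K - a) = K - E a" using assms by (simp add: E_diff K_def E_scaleC)
  ultimately show ?thesis by (simp add: K_def)
qed

lemma E_adj: assumes "a \<in> M" shows "E (adj a) = adj (E a)"
proof -
  have 1: "adj (E (a + adj a)) = E (a + adj a)" by (rule E_selfadj) (use assms in \<open>auto simp: add.commute\<close>)
  have 2: "adj (E (\<i> *\<^sub>C (a - adj a))) = E (\<i> *\<^sub>C (a - adj a))"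
    by (rule E_selfadj) (use assms in \<open>auto simp: scaleC_bop_distrib\<close>)
  have "adj (E a) + adj (E (adj a)) = E a + E (adj a)" using 1 assms by (simp add: E_add)
  moreover have "adj (E a) - adj (E (adj a)) = E (adj a) - E a"
  proof -
    have "(-\<i>) *\<^sub>C (adj (E a) - adj (E (adj a))) = \<i> *\<^sub>C (E a - E (adj a))"
      using 2 assms by (simp add: E_scaleC E_diff)
    then have "\<i> *\<^sub>C ((-\<i>) *\<^sub>C (adj (E a) - adj (E (adj a)))) = \<i> *\<^sub>C (\<i> *\<^sub>C (E a - E (adj a)))" by simp
    then show ?thesis by (simp add: scaleC_bop_distrib)
  qed
  ultimately have "(adj (E a) + adj (E (adj a))) + (adj (E a) - adj (E (adj a))) =
    (E a + E (adj a)) + (E (adj a) - E a)" by simp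
  then have "adj (E a) + adj (E a) = E (adj a) + E (adj a)" by simp
  then have "complex_of_real (1/2) *\<^sub>C (adj (E a) + adj (E a)) = complex_of_real (1/2) *\<^sub>C (E (adj a) + E (adj a))"
    by simp
  then show ?thesis by (simp only: scaleC_bop_distrib(1) scaleC_bop_distrib(2)[symmetric]) simp
qed

lemma tr_E_left: "a \<in> M \<Longrightarrow> c \<in> M \<Longrightarrow> \<tau> (E a * E c) = \<tau> (E a * c)"
  using tr_E[of "E a * c"] by (simp add: E_left)

lemma tr_E_right: "a \<in> M \<Longrightarrow> c \<in> M \<Longrightarrow> \<tau> (E a * E c) = \<tau> (a * E c)"
  using tr_E[of "a * E c"] by (simp add: E_right)

definition Q where "Q = commutant B \<inter> M"

lemma Q_M [simp, intro]: "q \<in> Q \<Longrightarrow> q \<in> M" by (simp add: Q_def)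

lemma Q_comm: "q \<in> Q \<Longrightarrow> b \<in> B \<Longrightarrow> q * b = b * q"
  by (auto simp: Q_def commutant_def)

lemma Q_closed: "1 \<in> Q" "p \<in> Q \<Longrightarrow> q \<in> Q \<Longrightarrow> p * q \<in> Q" "p \<in> Q \<Longrightarrow> q \<in> Q \<Longrightarrow> p + q \<in> Q"
  "q \<in> Q \<Longrightarrow> adj q \<in> Q" "q \<in> Q \<Longrightarrow> c *\<^sub>C q \<in> Q" "q \<in> Q \<Longrightarrow> q ^ n \<in> Q"
proof -
  show m: "1 \<in> Q" "p \<in> Q \<Longrightarrow> q \<in> Q \<Longrightarrow> p * q \<in> Q" for p q
    by (auto simp: Q_def intro: commutant_closed)
  show "p \<in> Q \<Longrightarrow> q \<in> Q \<Longrightarrow> p + q \<in> Q" "q \<in> Q \<Longrightarrow> c *\<^sub>C q \<in> Q"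
    by (auto simp: Q_def intro: commutant_closed)
  show "q \<in> Q \<Longrightarrow> adj q \<in> Q" using commutant_adj[of B q] by (auto simp: Q_def)
  show "q \<in> Q \<Longrightarrow> q ^ n \<in> Q" by (induction n) (auto intro: m)
qed

text \<open>For \<open>b \<in> B\<close> one has
  \<open>\<tau> (b q c) = \<tau> (q b c) = \<tau> (b c q)\<close>; with \<open>b\<close> the adjoint
  of the difference \<open>d\<close>, faithfulness gives \<open>d = 0\<close>. Thus \<open>E\<close>
  is cyclic for elements that commute with \<open>B\<close>.\<close>

lemma E_comm_Q: assumes "q \<in> Q" "c \<in> M" shows "E (q * c) = E (c * q)"
proof -
  define d where "d = E (q * c) - E (c * q)"
  have dB: "d \<in> B" unfolding d_def using assms by auto
  have "adj d * d = adj d * E (q * c) - adj d * E (c * q)" by (simp add: d_def right_diff_distrib)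
  also have "\<dots> = E (adj d * (q * c)) - E (adj d * (c * q))" using dB assms by (simp add: E_left)
  finally have "\<tau> (adj d * d) = \<tau> (adj d * (q * c)) - \<tau> (adj d * (c * q))"
    using dB assms by (simp add: tr_diff tr_E)
  also have "adj d * (q * c) = q * (adj d * c)"
    using Q_comm[OF assms(1), of "adj d"] dB by (simp add: mult.assoc[symmetric])
  also have "\<tau> (q * (adj d * c)) = \<tau> ((adj d * c) * q)" using assms dB by (intro tr_comm) auto
  finally have "\<tau> (adj d * d) = 0" by (simp add: mult.assoc)
  then have "d = 0" using tr_faithful dB by blast
  then show ?thesis by (simp add: d_def)
qed

lemma E_Q_comm: assumes "q \<in> Q" "b \<in> B" shows "b * E q = E q * b"
proof -
  have "b * E q = E (b * q)" "E q * b = E (q * b)" using assms by (simp_all add: E_left E_right)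
  then show ?thesis using Q_comm[OF assms] by simp
qed

end

subsection \<open>Complete positivity\<close>

lemma sum_Suc_square:
  fixes f :: "nat \<Rightarrow> nat \<Rightarrow> 'a::comm_monoid_add"
  shows "(\<Sum>k<Suc n. \<Sum>l<Suc n. f k l) =
    (\<Sum>k<n. \<Sum>l<n. f k l) + (\<Sum>k<n. f k n) + (\<Sum>l<n. f n l) + f n n"
  by (simp add: sum.distrib ac_simps)

text \<open>The induction passes from a matrix to the Schur complement of its last diagonal entry.\<close>

lemma (in vna) schur_positive:
  fixes t :: "nat \<Rightarrow> nat \<Rightarrow> 'h bop" and b :: "nat \<Rightarrow> 'h bop"
  assumes "\<And>k l. k < n \<Longrightarrow> l < n \<Longrightarrow> t k l \<in> M" "\<And>k l. k < n \<Longrightarrow> l < n \<Longrightarrow> adj (t k l) = t l k"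
    and "\<And>\<beta>. (\<And>k. k < n \<Longrightarrow> \<beta> k \<in> M) \<Longrightarrow> pos_op (\<Sum>k<n. \<Sum>l<n. adj (\<beta> k) * t k l * \<beta> l)"
  shows "pos_op (\<Sum>k<n. \<Sum>l<n. adj (b k) * t k l * b l)"
  using assms
proof (induction n arbitrary: t b)
  case (Suc n)
  note tM = Suc.prems(1) and tadj = Suc.prems(2) and tpos = Suc.prems(3)
  have tnn: "pos_op (t n n)"
  proof -
    have "pos_op (\<Sum>k<Suc n. \<Sum>l<Suc n. adj (if k = n then 1 else 0) * t k l * (if l = n then 1 else 0))"
      by (rule tpos) auto
    then show ?thesis unfolding sum_Suc_square by simp
  qed
  define X where "X = (\<Sum>k<Suc n. \<Sum>l<Suc n. adj (b k) * t k l * b l)"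
  have main: "pos_op (X + complex_of_real \<epsilon> *\<^sub>C (adj (b n) * b n))" if eps: "\<epsilon> > 0" for \<epsilon> :: real
  proof -
    \<comment> \<open>The diagonal entry may fail to be invertible. The perturbation is removed at
      the end by letting \<open>\<epsilon>\<close> tend to zero.\<close>
    define a where "a = t n n + complex_of_real \<epsilon> *\<^sub>C 1"
    have aM: "a \<in> M" using tM[of n n] by (simp add: a_def)
    have apos: "pos_op a" unfolding a_def using eps by (intro pos_op_add tnn pos_op_scale) auto
    have "(norm v)\<^sup>2 \<le> qf (complex_of_real (1 / \<epsilon>) *\<^sub>C a) v" for v
      using pos_op_qf[OF tnn, of v] eps unfolding a_def qf_simps by (simp add: distrib_left)
    from lax_milgram_inverse[OF this] obtain h' where
      h': "h' * (complex_of_real (1 / \<epsilon>) *\<^sub>C a) = 1" "(complex_of_real (1 / \<epsilon>) *\<^sub>C a) * h' = 1" by blast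
    define h where "h = complex_of_real (1 / \<epsilon>) *\<^sub>C h'"
    have h: "h * a = 1" "a * h = 1" using h' by (simp_all add: h_def)
    have hM: "h \<in> M" by (rule inverse_in[OF aM h])
    have hadj: "adj h = h"
    proof (rule inverse_unique_bop)
      show "a * h = 1" by (rule h)
      show "adj h * a = 1" using arg_cong[OF h(2), of adj] pos_op_adj[OF apos] by simp
    qed
    have hpos: "pos_op h"
    proof -
      have "pos_op (adj h * a * h)" by (rule pos_op_conj[OF apos])
      then show ?thesis by (simp add: hadj h)
    qed
    have hl: "h * (a * w) = w" "a * (h * w) = w" for w using h by (simp_all add: mult.assoc[symmetric])
    define s where "s k l = t k l - t k n * h * t n l" for k l
    \<comment> \<open>Completion of the square in the last coefficient; \<open>h\<close> is the
      inverse of the perturbed diagonal entry \<open>a\<close>.\<close>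
    have complete: "(\<Sum>k<n. \<Sum>l<n. adj (\<beta> k) * s k l * \<beta> l) + adj (y + a * \<beta> n) * h * (y + a * \<beta> n)
       = (\<Sum>k<Suc n. \<Sum>l<Suc n. adj (\<beta> k) * t k l * \<beta> l) + complex_of_real \<epsilon> *\<^sub>C (adj (\<beta> n) * \<beta> n)"
      if y: "y = (\<Sum>l<n. t n l * \<beta> l)" for \<beta> y
    proof -
      have ya: "adj y = (\<Sum>k<n. adj (\<beta> k) * t k n)"
        unfolding y adj_sum by (intro sum.cong refl) (simp add: tadj)
      have "(\<Sum>k<n. \<Sum>l<n. adj (\<beta> k) * (t k n * h * t n l) * \<beta> l) = adj y * h * y"
      proof -
        have "adj y * h * y = (\<Sum>k<n. adj (\<beta> k) * t k n) * (h * (\<Sum>l<n. t n l * \<beta> l))"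
          unfolding ya[symmetric] y[symmetric] by (simp add: mult.assoc)
        also have "h * (\<Sum>l<n. t n l * \<beta> l) = (\<Sum>l<n. h * (t n l * \<beta> l))" by (rule sum_distrib_left)
        finally show ?thesis unfolding sum_product by (simp add: mult.assoc)
      qed
      then have "(\<Sum>k<n. \<Sum>l<n. adj (\<beta> k) * s k l * \<beta> l) =
          (\<Sum>k<n. \<Sum>l<n. adj (\<beta> k) * t k l * \<beta> l) - adj y * h * y"
        by (simp add: s_def right_diff_distrib left_diff_distrib sum_subtractf)
      moreover have "adj (y + a * \<beta> n) * h * (y + a * \<beta> n) =
          adj y * h * y + adj y * \<beta> n + adj (\<beta> n) * y + adj (\<beta> n) * (a * \<beta> n)"
        using pos_op_adj[OF apos] by (simp add: distrib_left distrib_right mult.assoc hl)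
      moreover have "adj y * \<beta> n = (\<Sum>k<n. adj (\<beta> k) * t k n * \<beta> n)"
        by (simp add: ya sum_distrib_right)
      moreover have "adj (\<beta> n) * y = (\<Sum>l<n. adj (\<beta> n) * t n l * \<beta> l)"
        by (simp add: y sum_distrib_left mult.assoc)
      moreover have "adj (\<beta> n) * (a * \<beta> n) = adj (\<beta> n) * t n n * \<beta> n + complex_of_real \<epsilon> *\<^sub>C (adj (\<beta> n) * \<beta> n)"
        by (simp add: a_def distrib_left distrib_right mult.assoc)
      ultimately show ?thesis unfolding sum_Suc_square by (simp add: algebra_simps)
    qed
    have "pos_op (\<Sum>k<n. \<Sum>l<n. adj (b k) * s k l * b l)"
    proof (rule Suc.IH)
      fix k l assume kl: "k < n" "l < n"
      show "s k l \<in> M" unfolding s_def using kl tM hM by auto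
      show "adj (s k l) = s l k" unfolding s_def using kl by (simp add: tadj hadj mult.assoc)
    next
      fix \<beta> assume \<beta>: "\<And>k. k < n \<Longrightarrow> \<beta> k \<in> M"
      define y where "y = (\<Sum>l<n. t n l * \<beta> l)"
      have yM: "y \<in> M" unfolding y_def by (intro sum_in mult_in tM \<beta>) auto
      \<comment> \<open>The last coefficient solves \<open>y + a * \<beta>' n = 0\<close>, so the
        completed square vanishes and only the Schur complement remains.\<close>
      define \<beta>' where "\<beta>' k = (if k < n then \<beta> k else - (h * y))" for k
      have y': "y = (\<Sum>l<n. t n l * \<beta>' l)" unfolding y_def by (intro sum.cong) (auto simp: \<beta>'_def)
      have z: "y + a * \<beta>' n = 0" by (simp add: \<beta>'_def hl)
      have e: "(\<Sum>k<n. \<Sum>l<n. adj (\<beta>' k) * s k l * \<beta>' l) = (\<Sum>k<n. \<Sum>l<n. adj (\<beta> k) * s k l * \<beta> l)"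
        by (intro sum.cong refl) (simp add: \<beta>'_def)
      have "pos_op ((\<Sum>k<Suc n. \<Sum>l<Suc n. adj (\<beta>' k) * t k l * \<beta>' l) + complex_of_real \<epsilon> *\<^sub>C (adj (\<beta>' n) * \<beta>' n))"
      proof (intro pos_op_add pos_op_scale pos_op_adj_mult tpos)
        show "\<beta>' k \<in> M" if "k < Suc n" for k using \<beta> hM yM by (auto simp: \<beta>'_def)
      qed (use eps in simp)
      then show "pos_op (\<Sum>k<n. \<Sum>l<n. adj (\<beta> k) * s k l * \<beta> l)"
        unfolding complete[OF y', symmetric] z e by simp
    qed
    from pos_op_add[OF this pos_op_conj[OF hpos]]
    show ?thesis unfolding X_def complete[OF refl, symmetric] .
  qed
  have "adj X = X"
  proof -
    have "adj (X + complex_of_real 1 *\<^sub>C (adj (b n) * b n)) = X + complex_of_real 1 *\<^sub>C (adj (b n) * b n)"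
      by (rule pos_op_adj[OF main]) simp
    then show ?thesis by simp
  qed
  moreover have "0 \<le> qf X v" for v
  proof (rule field_le_epsilon)
    fix e :: real assume e: "0 < e"
    define \<epsilon> where "\<epsilon> = e / ((norm (b n \<rhd> v))\<^sup>2 + 1)"
    have "\<epsilon> > 0" using e by (simp add: \<epsilon>_def add_nonneg_pos)
    from pos_op_qf[OF main[OF this], of v]
    have "0 \<le> qf X v + \<epsilon> * (norm (b n \<rhd> v))\<^sup>2" unfolding qf_simps qf_adj_mult .
    also have "\<epsilon> * (norm (b n \<rhd> v))\<^sup>2 \<le> e"
    proof -
      have "e * (norm (b n \<rhd> v))\<^sup>2 \<le> e * ((norm (b n \<rhd> v))\<^sup>2 + 1)" using e by (intro mult_left_mono) auto
      then show ?thesis by (simp add: \<epsilon>_def pos_divide_le_eq add_nonneg_pos)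
    qed
    finally show "0 \<le> qf X v + e" by simp
  qed
  ultimately show ?case unfolding X_def by (rule pos_opI)
qed simp

context cond_exp
begin

text \<open>For coefficients from \<open>B\<close> the sum is \<open>E (adj w * w)\<close> with
  \<open>w\<close> the sum of the \<open>a k * \<beta> k\<close>; \<open>schur_positive\<close>
  extends this to coefficients that are arbitrary operators.\<close>

lemma E_completely_positive:
  fixes a b :: "nat \<Rightarrow> 'h bop"
  assumes "\<And>k. k < n \<Longrightarrow> a k \<in> M"
  shows "pos_op (\<Sum>k<n. \<Sum>l<n. adj (b k) * E (adj (a k) * a l) * b l)"
proof (rule B.schur_positive[where t = "\<lambda>k l. E (adj (a k) * a l)" and b = b])
  fix k l assume "k < n" "l < n"
  then show "E (adj (a k) * a l) \<in> B" "adj (E (adj (a k) * a l)) = E (adj (a l) * a k)"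
    using assms by (auto simp: E_adj[symmetric])
next
  fix \<beta> assume \<beta>: "\<And>k. k < n \<Longrightarrow> \<beta> k \<in> B"
  define w where "w = (\<Sum>k<n. a k * \<beta> k)"
  have wM: "w \<in> M" unfolding w_def using assms \<beta> by (intro sum_in) auto
  have "adj w * w = (\<Sum>k<n. \<Sum>l<n. adj (\<beta> k) * (adj (a k) * a l) * \<beta> l)"
    unfolding w_def adj_sum by (simp add: sum_product mult.assoc)
  also have "E \<dots> = (\<Sum>k<n. \<Sum>l<n. adj (\<beta> k) * E (adj (a k) * a l) * \<beta> l)"
  proof -
    have m: "adj (\<beta> k) * (adj (a k) * a l) * \<beta> l \<in> M" if "k < n" "l < n" for k l
      using assms \<beta> that by auto
    have "E (\<Sum>k<n. \<Sum>l<n. adj (\<beta> k) * (adj (a k) * a l) * \<beta> l) =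
      (\<Sum>k<n. E (\<Sum>l<n. adj (\<beta> k) * (adj (a k) * a l) * \<beta> l))"
      by (rule E_sum) (auto intro!: sum_in m)
    also have "\<dots> = (\<Sum>k<n. \<Sum>l<n. E (adj (\<beta> k) * (adj (a k) * a l) * \<beta> l))"
      by (intro sum.cong refl E_sum) (auto intro!: m)
    also have "\<dots> = (\<Sum>k<n. \<Sum>l<n. adj (\<beta> k) * E (adj (a k) * a l) * \<beta> l)"
      using assms \<beta> by (intro sum.cong refl E_bimod) auto
    finally show ?thesis .
  qed
  finally show "pos_op (\<Sum>k<n. \<Sum>l<n. adj (\<beta> k) * E (adj (a k) * a l) * \<beta> l)"
    using E_pos[of "adj w * w"] pos_op_adj_mult[of w] wM by simp
qed

end

subsection \<open>Averaging over the unitary group\<close>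

text \<open>Midpoints in place of all convex combinations: this is what the parallelogram argument
  uses, and it keeps inductions down to two cases.\<close>

inductive_set avg :: "'h::complex_hilbert_space bop set \<Rightarrow> 'h bop \<Rightarrow> 'h bop set" for B a where
  base: "u \<in> B \<Longrightarrow> adj u * u = 1 \<Longrightarrow> u * adj u = 1 \<Longrightarrow> u * a * adj u \<in> avg B a"
| mid: "c \<in> avg B a \<Longrightarrow> d \<in> avg B a \<Longrightarrow> complex_of_real (1/2) *\<^sub>C (c + d) \<in> avg B a"

context cond_exp
begin

lemma nrm_unitary: "adj u * u = 1 \<Longrightarrow> nrm u \<le> 1"
proof (rule nrm_le, simp)
  fix v assume "adj u * u = 1"
  then have "(norm (u \<rhd> v))\<^sup>2 = (norm v)\<^sup>2" using qf_adj_mult[of v u] by (simp add: cinner_self)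
  then show "norm (u \<rhd> v) \<le> 1 * norm v" by simp
qed

lemma avg_M: "c \<in> avg B a \<Longrightarrow> a \<in> M \<Longrightarrow> c \<in> M"
  by (induction rule: avg.induct) auto

lemma half_half: "complex_of_real (1/2) *\<^sub>C (c + c) = (c::'h bop)"
  by (simp only: scaleC_bop_distrib(1) scaleC_bop_distrib(2)[symmetric]) simp

lemma nrm_conj_unitary:
  assumes "adj u * u = 1" "u * adj u = 1" shows "nrm (u * c * adj u) \<le> nrm c"
proof -
  have "nrm (u * c * adj u) \<le> nrm (u * c) * nrm (adj u)" by (rule nrm_mult)
  also have "\<dots> \<le> nrm (u * c) * 1" using nrm_unitary[OF assms(1)] by (intro mult_left_mono) auto
  also have "nrm (u * c) \<le> nrm u * nrm c" by (rule nrm_mult)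
  also have "\<dots> \<le> 1 * nrm c" using nrm_unitary[OF assms(1)] by (intro mult_right_mono) auto
  finally show ?thesis by simp
qed

lemma avg_nrm: "c \<in> avg B a \<Longrightarrow> nrm c \<le> nrm a"
proof (induction rule: avg.induct)
  case (base u)
  then show ?case by (intro nrm_conj_unitary) auto
next
  case (mid c d)
  have "nrm (complex_of_real (1/2) *\<^sub>C (c + d)) \<le> cmod (complex_of_real (1/2)) * nrm (c + d)" by (rule nrm_scaleC)
  also have "\<dots> = nrm (c + d) / 2" by (simp add: norm_divide)
  finally show ?case using nrm_add[of c d] mid by linarith
qed

lemma avg_selfadj: "c \<in> avg B a \<Longrightarrow> adj a = a \<Longrightarrow> adj c = c"
  by (induction rule: avg.induct) (auto simp: mult.assoc)

lemma avg_conj: "c \<in> avg B a \<Longrightarrow> u \<in> B \<Longrightarrow> adj u * u = 1 \<Longrightarrow> u * adj u = 1 \<Longrightarrow> u * c * adj u \<in> avg B a"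
proof (induction rule: avg.induct)
  case (base v)
  have "adj (u * v) * (u * v) = adj v * (adj u * u) * v" by (simp add: mult.assoc)
  then have 1: "adj (u * v) * (u * v) = 1" using base by simp
  have "(u * v) * adj (u * v) = u * (v * adj v) * adj u" by (simp add: mult.assoc)
  then have 2: "(u * v) * adj (u * v) = 1" using base by simp
  from avg.base[OF _ 1 2, of B a] base show ?case by (simp add: mult.assoc)
next
  case (mid c d)
  from avg.mid[OF mid.IH(1) mid.IH(2)] mid.prems show ?case by (simp add: distrib_left distrib_right)
qed

text \<open>For self-adjoint \<open>b\<close> the Cayley transform \<open>u = 2 g - 1\<close>, where
  \<open>g\<close> is the resolvent of \<open>b\<close>, is unitary and determines
  \<open>b\<close>.\<close>

lemma commutes_unitaries:
  assumes comm: "\<And>u. u \<in> B \<Longrightarrow> adj u * u = 1 \<Longrightarrow> u * adj u = 1 \<Longrightarrow> y * u = u * y"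
  shows "y \<in> commutant B"
proof -
  have sa: "y * b = b * y" if b: "b \<in> B" "adj b = b" for b
  proof -
    define g where "g = res_i b"
    have g: "g * (1 + \<i> *\<^sub>C b) = 1" "(1 + \<i> *\<^sub>C b) * g = 1" unfolding g_def using res_i[OF b(2)] by auto
    have gB: "g \<in> B" by (rule B.inverse_in[OF _ g]) (use b in auto)
    have ga: "(1 - \<i> *\<^sub>C b) * adj g = 1" "adj g * (1 - \<i> *\<^sub>C b) = 1"
      using arg_cong[OF g(1), of adj] arg_cong[OF g(2), of adj] b by (simp_all add: scaleC_bop_distrib)
    \<comment> \<open>Since the two factors add up to 2, \<open>g\<close> and its adjoint satisfy
      \<open>2 g (adj g) = g + adj g\<close>, which is the unitarity of
      \<open>2 g - 1\<close>.\<close>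
    have two: "(1 + \<i> *\<^sub>C b) + (1 - \<i> *\<^sub>C b) = (1::'h bop) + 1" by simp
    have "g * ((1 + \<i> *\<^sub>C b) + (1 - \<i> *\<^sub>C b)) * adj g = (g * (1 + \<i> *\<^sub>C b)) * adj g + g * ((1 - \<i> *\<^sub>C b) * adj g)"
      by (simp only: distrib_left distrib_right mult.assoc)
    then have gg: "g * adj g + g * adj g = adj g + g" unfolding two g ga by (simp add: distrib_left distrib_right)
    have "adj g * ((1 + \<i> *\<^sub>C b) + (1 - \<i> *\<^sub>C b)) * g = adj g * ((1 + \<i> *\<^sub>C b) * g) + (adj g * (1 - \<i> *\<^sub>C b)) * g"
      by (simp only: distrib_left distrib_right mult.assoc)
    then have gg': "adj g * g + adj g * g = adj g + g" unfolding two g ga by (simp add: distrib_left distrib_right)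
    define u where "u = g + g - 1"
    have "u * adj u = (g * adj g + g * adj g) + (g * adj g + g * adj g) - (g + g) - (adj g + adj g) + 1"
      by (simp add: u_def algebra_simps)
    then have u1: "u * adj u = 1" unfolding gg by (simp add: algebra_simps)
    have "adj u * u = (adj g * g + adj g * g) + (adj g * g + adj g * g) - (g + g) - (adj g + adj g) + 1"
      by (simp add: u_def algebra_simps)
    then have u2: "adj u * u = 1" unfolding gg' by (simp add: algebra_simps)
    have "u \<in> B" using gB by (simp add: u_def)
    from comm[OF this u2 u1] have "y * (g + g) = (g + g) * y" by (simp add: u_def algebra_simps)
    then have "complex_of_real (1/2) *\<^sub>C (y * g + y * g) = complex_of_real (1/2) *\<^sub>C (g * y + g * y)"
      by (simp add: distrib_left distrib_right)
    then have yg: "y * g = g * y" unfolding half_half .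
    have "(1 + \<i> *\<^sub>C b) * (y * g) * (1 + \<i> *\<^sub>C b) = (1 + \<i> *\<^sub>C b) * (g * y) * (1 + \<i> *\<^sub>C b)" unfolding yg ..
    then have "(1 + \<i> *\<^sub>C b) * y * (g * (1 + \<i> *\<^sub>C b)) = ((1 + \<i> *\<^sub>C b) * g) * y * (1 + \<i> *\<^sub>C b)"
      by (simp only: mult.assoc)
    then have "(1 + \<i> *\<^sub>C b) * y = y * (1 + \<i> *\<^sub>C b)" unfolding g by simp
    then have "\<i> *\<^sub>C (b * y) = \<i> *\<^sub>C (y * b)" by (simp add: distrib_left distrib_right)
    then have "(-\<i>) *\<^sub>C (\<i> *\<^sub>C (b * y)) = (-\<i>) *\<^sub>C (\<i> *\<^sub>C (y * b))" by simp
    then show ?thesis by simp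
  qed
  show ?thesis unfolding commutant_def
  proof safe
    fix b assume b: "b \<in> B"
    define h where "h = b + adj b"
    define k where "k = \<i> *\<^sub>C (b - adj b)"
    have "y * h = h * y" by (rule sa) (use b in \<open>auto simp: h_def add.commute\<close>)
    moreover have "y * k = k * y" by (rule sa) (use b in \<open>auto simp: k_def scaleC_bop_distrib\<close>)
    moreover have "b = complex_of_real (1/2) *\<^sub>C (h + (-\<i>) *\<^sub>C k)"
      using half_half[of b] by (simp add: h_def k_def)
    moreover have "y * (complex_of_real (1/2) *\<^sub>C (h + (-\<i>) *\<^sub>C k)) = complex_of_real (1/2) *\<^sub>C (y * h + (-\<i>) *\<^sub>C (y * k))"
      by (simp add: distrib_left)
    moreover have "(complex_of_real (1/2) *\<^sub>C (h + (-\<i>) *\<^sub>C k)) * y = complex_of_real (1/2) *\<^sub>C (h * y + (-\<i>) *\<^sub>C (k * y))"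
      by (simp add: distrib_right)
    ultimately show "y * b = b * y" by metis
  qed
qed

lemma quad_le: "d \<le> 2 * x + 2 * x \<Longrightarrow> x < y \<Longrightarrow> d \<le> 4 * (y::real)"
  by linarith

text \<open>\<open>y\<close> is the element of least trace norm in the closure of
  \<open>avg B a\<close>. Conjugation by a unitary of \<open>B\<close> preserves this set and the
  trace norm, so it fixes the minimizer. The limit lies in \<open>M\<close> because the averages are
  bounded in norm and \<open>n2_complete\<close> applies.\<close>

theorem averaging:
  assumes a: "a \<in> M"
  shows "\<exists>y\<in>Q. (\<exists>s. (\<forall>n::nat. s n \<in> avg B a) \<and> (\<lambda>n. n2 (s n - y)) \<longlonglongrightarrow> 0) \<and> (adj a = a \<longrightarrow> adj y = y)"
proof -
  define q where "q c = (n2 c)\<^sup>2" for c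
  define d where "d c c' = (n2 (c - c'))\<^sup>2" for c c'
  have avM: "c \<in> M" if "c \<in> avg B a" for c using avg_M that a by blast
  have mid: "\<exists>m\<in>avg B a. d c c' \<le> 2 * q c + 2 * q c' - 4 * q m" if "c \<in> avg B a" "c' \<in> avg B a" for c c'
    by (rule bexI[OF _ avg.mid[OF that]]) (simp only: d_def q_def n2_parallelogram avM that order_refl)
  have "1 * a * adj 1 \<in> avg B a" by (rule avg.base) auto
  then have ne: "avg B a \<noteq> {}" by blast
  have q0: "0 \<le> q c" for c by (simp add: q_def)
  obtain \<mu> s where s: "\<And>n::nat. s n \<in> avg B a" "\<And>n. q (s n) - \<mu> < 1 / real (Suc n)"
    "\<And>c c'. c \<in> avg B a \<Longrightarrow> c' \<in> avg B a \<Longrightarrow> d c c' \<le> 2 * (q c - \<mu>) + 2 * (q c' - \<mu>)"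
    using minimizing_sequence[of "avg B a" 0 q d, OF ne q0 mid] by blast
  have sM: "s n \<in> M" for n using s(1) avM by blast
  have C: "\<exists>N. \<forall>m\<ge>N. \<forall>n\<ge>N. n2 (s m - s n) < e" if e: "e > 0" for e
  proof -
    obtain N where N: "\<And>m n. m \<ge> N \<Longrightarrow> n \<ge> N \<Longrightarrow>
      2 * (1 / real (Suc m)) + 2 * (1 / real (Suc n)) < e\<^sup>2"
      using inv_Suc_pair_less[of "e\<^sup>2"] e by (metis zero_less_power)
    have "n2 (s m - s n) < e" if "m \<ge> N" "n \<ge> N" for m n
    proof -
      have "(n2 (s m - s n))\<^sup>2 < e\<^sup>2"
        by (rule pair_less[OF s(3)[OF s(1)[of m] s(1)[of n], unfolded d_def] s(2)[of m] s(2)[of n] N[OF that]])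
      then show ?thesis using e by (simp add: power_less_imp_less_base)
    qed
    then show ?thesis by blast
  qed
  obtain y where y: "y \<in> M" "(\<lambda>n. n2 (s n - y)) \<longlonglongrightarrow> 0"
    using n2_complete[of s "nrm a", OF sM avg_nrm[OF s(1)] C] by blast
  have uy: "y * u = u * y" if u: "u \<in> B" "adj u * u = 1" "u * adj u = 1" for u
  proof -
    have uM: "u \<in> M" "adj u \<in> M" using u by auto
    have "n2 (u * y * adj u - y) \<le> 0 + (0 + 0)"
    proof (rule LIMSEQ_le_const)
      have "(\<lambda>n. sqrt (4 * (1 / real (Suc n)))) \<longlonglongrightarrow> sqrt (4 * 0)"
        using LIMSEQ_Suc[OF lim_inverse_n[where 'a = real]]
        by (intro tendsto_real_sqrt tendsto_mult tendsto_const) (simp add: inverse_eq_divide)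
      then show "(\<lambda>n. n2 (s n - y) + (sqrt (4 * (1 / real (Suc n))) + n2 (s n - y))) \<longlonglongrightarrow> 0 + (0 + 0)"
        by (intro tendsto_add y(2)) simp
      show "\<exists>N. \<forall>n\<ge>N. n2 (u * y * adj u - y) \<le> n2 (s n - y) + (sqrt (4 * (1 / real (Suc n))) + n2 (s n - y))"
      proof (intro exI allI impI)
        fix n
        have us: "u * s n * adj u \<in> avg B a" by (rule avg_conj[OF s(1) u])
        have "q (u * s n * adj u) = q (s n)"
        proof -
          have "adj (u * s n * adj u) * (u * s n * adj u) = u * (adj (s n) * (adj u * u) * s n) * adj u"
            by (simp add: mult.assoc)
          also have "\<dots> = u * ((adj (s n) * s n) * adj u)" using u by (simp add: mult.assoc)
          also have "\<tau> \<dots> = \<tau> (((adj (s n) * s n) * adj u) * u)" using uM sM by (intro tr_comm) auto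
          also have "((adj (s n) * s n) * adj u) * u = adj (s n) * s n" using u by (simp add: mult.assoc)
          finally show ?thesis using avM[OF us] sM by (simp add: q_def n2_sq del: adj_simps)
        qed
        then have "d (u * s n * adj u) (s n) \<le> 4 * (1 / real (Suc n))"
          using s(3)[OF us s(1)[of n]] quad_le[OF _ s(2)[of n]] by simp
        then have 1: "n2 (u * s n * adj u - s n) \<le> sqrt (4 * (1 / real (Suc n)))"
          unfolding d_def by (rule real_le_rsqrt)
        have "u * y * adj u - u * s n * adj u = u * (y - s n) * adj u" by (simp add: algebra_simps)
        then have "n2 (u * y * adj u - u * s n * adj u) \<le> nrm u * n2 (y - s n) * nrm (adj u)"
          using n2_mult3[of u "y - s n" "adj u"] uM y(1) sM by simp
        also have "\<dots> \<le> 1 * n2 (y - s n) * 1"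
          using nrm_unitary[OF u(2)] y(1) sM by (intro mult_mono mult_nonneg_nonneg) auto
        also have "n2 (y - s n) = n2 (s n - y)" using y(1) sM by (rule n2_diff_commute)
        finally have 2: "n2 (u * y * adj u - u * s n * adj u) \<le> n2 (s n - y)" by simp
        have "n2 (u * y * adj u - y) \<le> n2 (u * y * adj u - u * s n * adj u) + n2 (u * s n * adj u - y)"
          using uM y(1) sM by (intro n2_triangle3) auto
        moreover have "n2 (u * s n * adj u - y) \<le> n2 (u * s n * adj u - s n) + n2 (s n - y)"
          using uM y(1) sM by (intro n2_triangle3) auto
        ultimately show "n2 (u * y * adj u - y) \<le> n2 (s n - y) + (sqrt (4 * (1 / real (Suc n))) + n2 (s n - y))"
          using 1 2 by linarith
      qed
    qed
    then have "u * y * adj u - y = 0" using uM y(1) by (intro n2_eq_zero) auto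
    then have "u * y * adj u * u = y * u" by simp
    then show ?thesis using u by (simp add: mult.assoc)
  qed
  have "y \<in> Q" unfolding Q_def using commutes_unitaries[OF uy] y(1) by blast
  moreover have "adj y = y" if sa: "adj a = a"
  proof -
    have "n2 (adj y - y) \<le> 0 + 0"
    proof (rule LIMSEQ_le_const[OF tendsto_add[OF y(2) y(2)]], intro exI allI impI)
      fix n
      have "adj y - s n = - adj (s n - y)" using avg_selfadj[OF s(1) sa] by simp
      then have "n2 (adj y - s n) = n2 (s n - y)"
        using y(1) sM n2_minus n2_adj by (metis adj_in diff_in)
      then show "n2 (adj y - y) \<le> n2 (s n - y) + n2 (s n - y)"
        using n2_triangle3[of "adj y" "s n" y] y(1) sM by simp
    qed
    then show ?thesis using n2_eq_zero[of "adj y - y"] y(1) by simp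
  qed
  ultimately show ?thesis using s(1) y(2) by blast
qed

end

section \<open>Vectors of the GNS space as functionals\<close>

context tracial_vna
begin

text \<open>Independence of the representing Cauchy sequences, which makes the description in
  \<open>L2_inner\<close> determine a number.\<close>

lemma tendsto_tr_inner:
  assumes sM: "\<And>n::nat. s n \<in> M" "\<And>n. s' n \<in> M" "\<And>n. t n \<in> M" "a \<in> M"
    and bs: "\<And>n. n2 (s n) \<le> K" and ss': "(\<lambda>n. n2 (s n - s' n)) \<longlonglongrightarrow> 0"
    and ta: "(\<lambda>n. n2 (t n - a)) \<longlonglongrightarrow> 0" and c: "(\<lambda>n. \<tau> (adj (s n) * a)) \<longlonglongrightarrow> c"
  shows "(\<lambda>n. \<tau> (adj (s' n) * t n)) \<longlonglongrightarrow> c"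
proof -
  have "(\<lambda>n. \<tau> (adj (s' n) * t n) - \<tau> (adj (s n) * a)) \<longlonglongrightarrow> 0"
  proof (rule Lim_null_comparison)
    show "(\<lambda>n. n2 (s n - s' n) * (n2 (t n - a) + n2 a) + K * n2 (t n - a)) \<longlonglongrightarrow> 0"
      using tendsto_add[OF tendsto_mult[OF ss' tendsto_add[OF ta tendsto_const]] tendsto_mult[OF tendsto_const ta]]
      by simp
    show "\<forall>\<^sub>F n in sequentially. norm (\<tau> (adj (s' n) * t n) - \<tau> (adj (s n) * a)) \<le>
       n2 (s n - s' n) * (n2 (t n - a) + n2 a) + K * n2 (t n - a)"
    proof (intro always_eventually allI)
      fix n
      have "adj (s' n) * t n - adj (s n) * a = adj (s n) * (t n - a) - adj (s n - s' n) * t n"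
        by (simp add: algebra_simps)
      then have "\<tau> (adj (s' n) * t n) - \<tau> (adj (s n) * a) = \<tau> (adj (s n) * (t n - a)) - \<tau> (adj (s n - s' n) * t n)"
        using sM by (simp add: tr_diff[symmetric] del: adj_simps)
      then have "norm (\<tau> (adj (s' n) * t n) - \<tau> (adj (s n) * a)) \<le>
         cmod (\<tau> (adj (s n) * (t n - a))) + cmod (\<tau> (adj (s n - s' n) * t n))"
        by (metis norm_triangle_ineq4)
      also have "cmod (\<tau> (adj (s n) * (t n - a))) \<le> n2 (s n) * n2 (t n - a)" using sM by (intro tr_CS) auto
      also have "\<dots> \<le> K * n2 (t n - a)" using sM by (intro mult_right_mono bs) auto
      also have "cmod (\<tau> (adj (s n - s' n) * t n)) \<le> n2 (s n - s' n) * n2 (t n)" using sM by (intro tr_CS) auto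
      also have "\<dots> \<le> n2 (s n - s' n) * (n2 (t n - a) + n2 a)"
        using sM n2_triangle[of "t n - a" a] by (intro mult_left_mono) auto
      finally show "norm (\<tau> (adj (s' n) * t n) - \<tau> (adj (s n) * a)) \<le>
         n2 (s n - s' n) * (n2 (t n - a) + n2 a) + K * n2 (t n - a)" by simp
    qed
  qed
  from tendsto_add[OF this c] show ?thesis by simp
qed

text \<open>Extracts from a GNS vector the functional by which it pairs with \<open>M\<close>;
  conjugate variables are used below only in this form.\<close>

lemma L2_functional:
  assumes "\<xi> \<in> L2 M \<tau>"
  shows "\<exists>f K. (\<forall>a\<in>M. \<forall>b\<in>M. f (a + b) = f a + f b) \<and> (\<forall>c. \<forall>a\<in>M. f (c *\<^sub>C a) = c * f a) \<and>
    (\<forall>a\<in>M. cmod (f a) \<le> K * n2 a) \<and> (\<forall>a\<in>M. L2_inner \<tau> \<xi> (L2_vec M \<tau> a) = f a)"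
proof -
  obtain s where s: "s \<in> L2_Cauchy M \<tau>" and xi: "\<xi> = L2_rel M \<tau> `` {s}"
    using assms unfolding L2_def by (rule quotientE)
  have sM: "s n \<in> M" for n using s unfolding L2_Cauchy_def by blast
  have sC: "\<exists>N. \<forall>m\<ge>N. \<forall>n\<ge>N. n2 (s m - s n) < e" if "e > 0" for e
    using s that unfolding L2_Cauchy_def by blast
  have lim: "\<exists>c. (\<lambda>n. \<tau> (adj (s n) * a)) \<longlonglongrightarrow> c" if a: "a \<in> M" for a
  proof -
    have "Cauchy (\<lambda>n. \<tau> (adj (s n) * a))"
    proof (rule metric_CauchyI)
      fix e :: real assume e: "e > 0"
      have na: "n2 a + 1 > 0" using a by (simp add: add_nonneg_pos)
      then obtain N where N: "\<forall>m\<ge>N. \<forall>n\<ge>N. n2 (s m - s n) < e / (n2 a + 1)" using sC[of "e / (n2 a + 1)"] e by auto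
      have "dist (\<tau> (adj (s m) * a)) (\<tau> (adj (s n) * a)) < e" if "m \<ge> N" "n \<ge> N" for m n
      proof -
        have "dist (\<tau> (adj (s m) * a)) (\<tau> (adj (s n) * a)) = cmod (\<tau> (adj (s m - s n) * a))"
          using sM a by (simp add: dist_norm left_diff_distrib tr_diff)
        also have "\<dots> \<le> n2 (s m - s n) * n2 a" using sM a by (intro tr_CS) auto
        also have "\<dots> \<le> n2 (s m - s n) * (n2 a + 1)" using sM by (intro mult_left_mono) auto
        also have "\<dots> < e" using N that na by (simp add: pos_less_divide_eq)
        finally show ?thesis .
      qed
      then show "\<exists>M. \<forall>m\<ge>M. \<forall>n\<ge>M. dist (\<tau> (adj (s m) * a)) (\<tau> (adj (s n) * a)) < e" by blast
    qed
    then show ?thesis using Cauchy_convergent convergent_def by blast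
  qed
  define f where "f a = lim (\<lambda>n. \<tau> (adj (s n) * a))" for a
  have f: "(\<lambda>n. \<tau> (adj (s n) * a)) \<longlonglongrightarrow> f a" if "a \<in> M" for a
    unfolding f_def using lim[OF that] by (simp add: convergent_def convergent_LIMSEQ_iff[symmetric])
  obtain N where N: "\<And>n. n \<ge> N \<Longrightarrow> n2 (s N - s n) < 1" using sC[of 1] by fastforce
  define K where "K = Max ((\<lambda>n. n2 (s n)) ` {..N}) + 1"
  have bs: "n2 (s n) \<le> K" for n
  proof -
    have m: "n2 (s k) \<le> Max ((\<lambda>n. n2 (s n)) ` {..N})" if "k \<le> N" for k using that by (intro Max_ge) auto
    show ?thesis
    proof (cases "n \<le> N")
      case False
      have "n2 (s n) \<le> n2 (s n - s N) + n2 (s N)" using n2_triangle[of "s n - s N" "s N"] sM by simp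
      moreover have "n2 (s N - s n) < 1" using N[of n] False by simp
      ultimately show ?thesis using m[OF order_refl] n2_diff_commute[OF sM sM, of n N]
        unfolding K_def by linarith
    next
      case True
      from m[OF this] show ?thesis unfolding K_def by linarith
    qed
  qed
  have "f (a + b) = f a + f b" if "a \<in> M" "b \<in> M" for a b
  proof -
    have "(\<lambda>n. \<tau> (adj (s n) * (a + b))) \<longlonglongrightarrow> f a + f b"
      using tendsto_add[OF f[OF that(1)] f[OF that(2)]] that sM by (simp add: distrib_left tr_add)
    then show ?thesis using f[of "a + b"] that LIMSEQ_unique by blast
  qed
  moreover have "f (c *\<^sub>C a) = c * f a" if "a \<in> M" for a c
  proof -
    have "(\<lambda>n. \<tau> (adj (s n) * (c *\<^sub>C a))) \<longlonglongrightarrow> c * f a"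
      using tendsto_mult[OF tendsto_const f[OF that], of c] that sM by (simp add: tr_scaleC)
    then show ?thesis using f[of "c *\<^sub>C a"] that LIMSEQ_unique by blast
  qed
  moreover have "cmod (f a) \<le> K * n2 a" if a: "a \<in> M" for a
  proof (rule LIMSEQ_le_const2[OF tendsto_norm[OF f[OF a]]], intro exI allI impI)
    fix n
    have "cmod (\<tau> (adj (s n) * a)) \<le> n2 (s n) * n2 a" using sM a by (intro tr_CS) auto
    also have "\<dots> \<le> K * n2 a" using a by (intro mult_right_mono bs) auto
    finally show "norm (\<tau> (adj (s n) * a)) \<le> K * n2 a" .
  qed
  moreover have "L2_inner \<tau> \<xi> (L2_vec M \<tau> a) = f a" if a: "a \<in> M" for a
    unfolding L2_inner_def
  proof (rule the_equality)
    show all: "\<forall>s'\<in>\<xi>. \<forall>t\<in>L2_vec M \<tau> a. (\<lambda>n. \<tau> (adj (s' n) * t n)) \<longlonglongrightarrow> f a"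
    proof safe
      fix s' t assume s': "s' \<in> \<xi>" and t: "t \<in> L2_vec M \<tau> a"
      have s'M: "s' n \<in> M" for n using s' unfolding xi L2_rel_def L2_Cauchy_def by blast
      have tM: "t n \<in> M" for n using t unfolding L2_vec_def L2_rel_def L2_Cauchy_def by blast
      have d1: "(\<lambda>n. n2 (s n - s' n)) \<longlonglongrightarrow> 0" using s' unfolding xi L2_rel_def by simp
      have "(\<lambda>n. n2 (a - t n)) \<longlonglongrightarrow> 0" using t unfolding L2_vec_def L2_rel_def by simp
      then have d2: "(\<lambda>n. n2 (t n - a)) \<longlonglongrightarrow> 0" using n2_diff_commute[OF a tM] by simp
      show "(\<lambda>n. \<tau> (adj (s' n) * t n)) \<longlonglongrightarrow> f a"
        by (rule tendsto_tr_inner[OF sM s'M tM a bs d1 d2 f[OF a]])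
    qed
    have sxi: "s \<in> \<xi>" unfolding xi L2_rel_def using s by simp
    have ca: "(\<lambda>_. a) \<in> L2_Cauchy M \<tau>" unfolding L2_Cauchy_def using a by auto
    then have av: "(\<lambda>_. a) \<in> L2_vec M \<tau> a" unfolding L2_vec_def L2_rel_def by simp
    fix c assume "\<forall>s\<in>\<xi>. \<forall>t\<in>L2_vec M \<tau> a. (\<lambda>n. \<tau> (adj (s n) * t n)) \<longlonglongrightarrow> c"
    from bspec[OF bspec[OF this sxi] av] have "(\<lambda>n. \<tau> (adj (s n) * a)) \<longlonglongrightarrow> c" .
    then show "c = f a" using f[OF a] LIMSEQ_unique by blast
  qed
  ultimately show ?thesis
    by (intro exI[of _ f] exI[of _ K] conjI ballI allI)
qed

end

section \<open>Polynomials in three commuting variables\<close>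

text \<open>The key \<open>(k, l, m)\<close> stands for the monomial \<open>s\<^sup>k t\<^sup>l r\<^sup>m\<close>.\<close>

type_synonym pol = "(nat \<times> nat \<times> nat) \<Rightarrow>\<^sub>0 real"

abbreviation mnm :: "nat \<times> nat \<times> nat \<Rightarrow> real \<Rightarrow> pol" where "mnm \<equiv> Poly_Mapping.single"

lemma pol_induct [case_names zero add]:
  assumes "P (0::pol)" "\<And>p \<kappa> c. P p \<Longrightarrow> P (p + mnm \<kappa> c)" shows "P p"
proof (induction p rule: update_induct)
  case (update p \<kappa> c)
  have "Poly_Mapping.update \<kappa> c p = p + mnm \<kappa> c"
    using update(1) by (intro poly_mapping_eqI) (auto simp: lookup_update lookup_add lookup_single in_keys_iff when_def)
  then show ?case using assms(2)[OF update(3)] by simp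
qed (rule assms(1))

text \<open>The linear extension of a map on monomials. The scalar action is a parameter because the
  values are reals, complex numbers, polynomials or operators.\<close>

definition lins :: "(real \<Rightarrow> 'b \<Rightarrow> 'b) \<Rightarrow> (nat \<times> nat \<times> nat \<Rightarrow> 'b::comm_monoid_add) \<Rightarrow> pol \<Rightarrow> 'b" where
  "lins sc g p = (\<Sum>\<kappa>\<in>Poly_Mapping.keys p. sc (Poly_Mapping.lookup p \<kappa>) (g \<kappa>))"

locale scaling =
  fixes sc :: "real \<Rightarrow> 'b::comm_monoid_add \<Rightarrow> 'b"
  assumes sc_add: "sc (a + b) x = sc a x + sc b x" and sc_zero: "sc 0 x = 0"
begin

lemma lins_superset:
  assumes "finite F" "Poly_Mapping.keys p \<subseteq> F"
  shows "lins sc g p = (\<Sum>\<kappa>\<in>F. sc (Poly_Mapping.lookup p \<kappa>) (g \<kappa>))"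
  unfolding lins_def
  by (rule sum.mono_neutral_left) (use assms in \<open>auto simp: in_keys_iff sc_zero\<close>)

lemma lins_zero [simp]: "lins sc g 0 = 0"
  by (simp add: lins_def)

lemma lins_mono [simp]: "lins sc g (mnm \<kappa> c) = sc c (g \<kappa>)"
  using lins_superset[of "{\<kappa>}" "mnm \<kappa> c" g] by simp

lemma lins_add [simp]: "lins sc g (p + q) = lins sc g p + lins sc g q"
proof -
  let ?F = "Poly_Mapping.keys p \<union> Poly_Mapping.keys q"
  have "Poly_Mapping.keys (p + q) \<subseteq> ?F" by (rule Poly_Mapping.keys_add)
  then show ?thesis
    by (simp add: lins_superset[of ?F] lookup_add sc_add sum.distrib)
qed

end

interpretation real_sc: scaling "(*) :: real \<Rightarrow> real \<Rightarrow> real"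
  by unfold_locales (auto simp: distrib_right)

interpretation op_sc: scaling "\<lambda>c (a::'h::complex_hilbert_space bop). complex_of_real c *\<^sub>C a"
  by unfold_locales (auto simp: scaleC_bop_distrib)

definition cst :: "real \<Rightarrow> pol" where "cst c = mnm 0 c"

lemma cst_simps: "cst (a + b) = cst a + cst b" "cst (a * b) = cst a * cst b" "cst 0 = 0" "cst 1 = 1"
  "cst (- a) = - cst a"
  by (simp_all add: cst_def single_add mult_single single_uminus)

lemma cst_numeral: "cst (numeral n) = numeral n"
  by (simp add: cst_def)

lemma cst_mult_mono: "cst a * mnm \<kappa> b = mnm \<kappa> (a * b)"
  by (simp add: cst_def mult_single)

interpretation pol_sc: scaling "\<lambda>c (a::pol). cst c * a"
  by unfold_locales (auto simp: cst_simps distrib_right)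

abbreviation lin :: "(nat \<times> nat \<times> nat \<Rightarrow> pol) \<Rightarrow> pol \<Rightarrow> pol" where
  "lin \<equiv> lins (\<lambda>c a. cst c * a)"

abbreviation Lw :: "(nat \<times> nat \<times> nat \<Rightarrow> real) \<Rightarrow> pol \<Rightarrow> real" where
  "Lw \<equiv> lins (*)"

lemma Lw_minus: "Lw w (- p) = - Lw w p"
  using real_sc.lins_add[of w p "- p"] by simp

lemma Lw_diff: "Lw w (p - q) = Lw w p - Lw w q"
  using real_sc.lins_add[of w p "- q"] by (simp add: Lw_minus)

lemma Lw_cst: "Lw w (cst c * p) = c * Lw w p"
  by (induction p rule: pol_induct) (simp_all add: distrib_left cst_mult_mono)

lemma lin_cst: "lin g (cst c * p) = cst c * lin g p"
  by (induction p rule: pol_induct) (simp_all add: distrib_left cst_mult_mono cst_simps mult.assoc)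

lemma lin_minus: "lin g (- p) = - lin g p"
  using pol_sc.lins_add[of g p "- p"] by (simp add: add_eq_0_iff2)

lemma lin_diff: "lin g (p - q) = lin g p - lin g q"
  using pol_sc.lins_add[of g p "- q"] by (simp add: lin_minus)

definition subst :: "(nat \<times> nat \<times> nat \<Rightarrow> nat \<times> nat \<times> nat) \<Rightarrow> pol \<Rightarrow> pol" where
  "subst h = lin (\<lambda>\<kappa>. mnm (h \<kappa>) 1)"

lemma subst_mono: "subst h (mnm \<kappa> c) = mnm (h \<kappa>) c"
  by (simp add: subst_def cst_mult_mono)

lemma subst_add: "subst h (p + q) = subst h p + subst h q"
  and subst_zero: "subst h 0 = 0"
  and subst_diff: "subst h (p - q) = subst h p - subst h q"
  and subst_cst_mult: "subst h (cst c * p) = cst c * subst h p"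
  by (simp_all add: subst_def lin_diff lin_cst)

lemma subst_mult:
  assumes "\<And>a b. h (a + b) = h a + h b" shows "subst h (p * q) = subst h p * subst h q"
proof (induction p rule: pol_induct)
  case (add p \<kappa> c)
  have "subst h (mnm \<kappa> c * q) = subst h (mnm \<kappa> c) * subst h q"
    by (induction q rule: pol_induct) (simp_all add: distrib_left subst_add subst_zero mult_single subst_mono assms)
  then show ?case using add by (simp add: distrib_right subst_add)
qed (simp add: subst_zero)

lemma subst_cst: "h 0 = 0 \<Longrightarrow> subst h (cst c) = cst c"
  by (simp add: cst_def subst_mono)

section \<open>Variables, substitutions and divided differences\<close>

definition vs :: pol where "vs = mnm (1, 0, 0) 1"
definition vt :: pol where "vt = mnm (0, 1, 0) 1"
definition vr :: pol where "vr = mnm (0, 0, 1) 1"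

definition to_t :: "nat \<times> nat \<times> nat \<Rightarrow> nat \<times> nat \<times> nat" where
  "to_t = (\<lambda>(k, l, m). (0, k + l, m))"

definition r_to_t :: "nat \<times> nat \<times> nat \<Rightarrow> nat \<times> nat \<times> nat" where
  "r_to_t = (\<lambda>(k, l, m). (k, l + m, 0))"

lemma to_t_add: "to_t (a + b) = to_t a + to_t b" "to_t 0 = 0"
  and r_to_t_add: "r_to_t (a + b) = r_to_t a + r_to_t b" "r_to_t 0 = 0"
  by (simp_all add: to_t_def r_to_t_def zero_prod_def split: prod.splits)

text \<open>The divided difference \<open>(p(s, r) - p(t, r)) / (s - t)\<close>.\<close>

definition dd :: "pol \<Rightarrow> pol" where
  "dd = lin (\<lambda>(k, l, m). \<Sum>i<k. mnm (i, k - 1 - i + l, m) 1)"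

lemma dd_mono: "dd (mnm (k, l, m) c) = (\<Sum>i<k. mnm (i, k - 1 - i + l, m) c)"
  by (simp add: dd_def sum_distrib_left cst_mult_mono)

lemma dd_add: "dd (p + q) = dd p + dd q" and dd_zero: "dd 0 = 0"
  and dd_diff: "dd (p - q) = dd p - dd q" and dd_cst_mult: "dd (cst c * p) = cst c * dd p"
  by (simp_all add: dd_def lin_diff lin_cst)

lemma dd_leibniz_mono:
  "dd (mnm \<kappa> c * mnm \<kappa>' c') = dd (mnm \<kappa> c) * subst to_t (mnm \<kappa>' c') + mnm \<kappa> c * dd (mnm \<kappa>' c')"
proof -
  obtain k l m where \<kappa>: "\<kappa> = (k, l, m)" by (cases \<kappa>)
  obtain k' l' m' where \<kappa>': "\<kappa>' = (k', l', m')" by (cases \<kappa>')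
  define g where "g i = mnm (i, k + k' - 1 - i + (l + l'), m + m') (c * c')" for i
  have "dd (mnm \<kappa> c * mnm \<kappa>' c') = (\<Sum>i<k + k'. g i)"
    by (simp add: \<kappa> \<kappa>' mult_single dd_mono g_def)
  also have "\<dots> = (\<Sum>i<k. g i) + (\<Sum>i=k..<k + k'. g i)"
    by (simp add: lessThan_atLeast0 sum.atLeastLessThan_concat)
  also have "(\<Sum>i=k..<k + k'. g i) = (\<Sum>i<k'. g (k + i))"
    using sum.shift_bounds_nat_ivl[of g 0 k k'] by (simp add: lessThan_atLeast0 add.commute)
  also have "(\<Sum>i<k. g i) = dd (mnm \<kappa> c) * subst to_t (mnm \<kappa>' c')"
    unfolding \<kappa> \<kappa>' dd_mono subst_mono sum_distrib_right
    by (intro sum.cong refl) (auto simp: g_def mult_single to_t_def intro!: arg_cong2[where f = Poly_Mapping.single])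
  also have "(\<Sum>i<k'. g (k + i)) = mnm \<kappa> c * dd (mnm \<kappa>' c')"
    unfolding \<kappa> \<kappa>' dd_mono sum_distrib_left
    by (intro sum.cong refl) (auto simp: g_def mult_single intro!: arg_cong2[where f = Poly_Mapping.single])
  finally show ?thesis .
qed

text \<open>\<open>p(s) q(s) - p(t) q(t) = (p(s) - p(t)) q(t) + p(s) (q(s) - q(t))\<close>, divided
  by \<open>s - t\<close>. As \<open>dd\<close> is defined without division, the rule is checked on
  monomials.\<close>

lemma dd_leibniz: "dd (p * q) = dd p * subst to_t q + p * dd q"
proof (induction p rule: pol_induct)
  case (add p \<kappa> c)
  have "dd (mnm \<kappa> c * q) = dd (mnm \<kappa> c) * subst to_t q + mnm \<kappa> c * dd q"
    by (induction q rule: pol_induct)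
      (simp_all add: distrib_left dd_add dd_zero subst_add subst_zero dd_leibniz_mono)
  then show ?case using add by (simp add: distrib_right dd_add)
qed (simp add: dd_zero)

definition tfree :: "pol \<Rightarrow> bool" where
  "tfree p \<longleftrightarrow> (\<forall>\<kappa>\<in>Poly_Mapping.keys p. fst (snd \<kappa>) = 0)"

lemma tfree_mult: "tfree p \<Longrightarrow> tfree q \<Longrightarrow> tfree (p * q)"
  unfolding tfree_def using keys_mult[of p q] by fastforce

lemma tfree_diff: "tfree p \<Longrightarrow> tfree q \<Longrightarrow> tfree (p - q)"
  unfolding tfree_def using keys_diff[of p q] by blast

lemma tfree_mono: "tfree (mnm (k, 0, m) c)"
  by (simp add: tfree_def)

lemma tfree_cst: "tfree (cst c)" "tfree 1" "tfree (numeral n)"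
proof -
  show c: "tfree (cst c)" for c by (simp add: cst_def tfree_def zero_prod_def)
  show "tfree 1" using c[of 1] by (simp add: cst_simps)
  show "tfree (numeral n)" using c[of "numeral n"] by (simp add: cst_numeral)
qed

subsection \<open>A cone of positive polynomials on a cube\<close>

definition gen :: "real \<Rightarrow> pol \<Rightarrow> pol" where "gen K v = cst (K * K) - v * v"

text \<open>Certificates of nonnegativity on the cube where \<open>s\<close>, \<open>t\<close>,
  \<open>r\<close> are at most \<open>K\<close> in absolute value. The set is closed under sums and
  products, so a polynomial inequality is proved by placing the difference in \<open>cone K\<close>,
  and then holds under every weight satisfying \<open>posw\<close>.\<close>

inductive_set cone :: "real \<Rightarrow> pol set" for K where
  zero: "0 \<in> cone K"
| add: "p \<in> cone K \<Longrightarrow> p + q * q * (gen K vs ^ a * gen K vt ^ b * gen K vr ^ c) \<in> cone K"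

lemma cone_plus: "p \<in> cone K \<Longrightarrow> q \<in> cone K \<Longrightarrow> q + p \<in> cone K"
  by (induction rule: cone.induct) (auto simp: add.assoc[symmetric] intro: cone.intros)

lemma cone_elem: "q * q * (gen K vs ^ a * gen K vt ^ b * gen K vr ^ c) \<in> cone K"
  using cone.add[OF cone.zero] by simp

lemma cone_mult_elem: "p \<in> cone K \<Longrightarrow> p * (q * q * (gen K vs ^ a * gen K vt ^ b * gen K vr ^ c)) \<in> cone K"
proof (induction rule: cone.induct)
  case (add p q' a' b' c')
  have "(p + q' * q' * (gen K vs ^ a' * gen K vt ^ b' * gen K vr ^ c')) * (q * q * (gen K vs ^ a * gen K vt ^ b * gen K vr ^ c))
    = p * (q * q * (gen K vs ^ a * gen K vt ^ b * gen K vr ^ c)) +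
      (q' * q) * (q' * q) * (gen K vs ^ (a' + a) * gen K vt ^ (b' + b) * gen K vr ^ (c' + c))"
    by (simp add: power_add algebra_simps)
  then show ?case using cone.add[OF add.IH] by metis
qed (simp add: cone.zero)

lemma cone_mult: "q \<in> cone K \<Longrightarrow> p \<in> cone K \<Longrightarrow> p * q \<in> cone K"
proof (induction rule: cone.induct)
  case (add q q' a b c)
  from cone_plus[OF cone_mult_elem[OF add.prems] add.IH[OF add.prems]]
  show ?case by (simp add: distrib_left)
qed (simp add: cone.zero)

lemma cone_square: "q * q \<in> cone K"
  using cone_elem[of q K 0 0 0] by simp

lemma cone_gen: "gen K vs \<in> cone K" "gen K vt \<in> cone K" "gen K vr \<in> cone K"
  using cone_elem[of 1 K 1 0 0] cone_elem[of 1 K 0 1 0] cone_elem[of 1 K 0 0 1] by simp_all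

lemma cone_cst: "0 \<le> c \<Longrightarrow> cst c \<in> cone K"
  using cone_square[of "cst (sqrt c)" K] by (simp add: cst_simps(2)[symmetric])

lemma cone_one: "1 \<in> cone K"
  using cone_square[of 1 K] by simp

text \<open>Positivity of a moment functional on the cube, tested on the generating elements of
  \<open>cone K\<close>.\<close>

definition posw :: "real \<Rightarrow> (nat \<times> nat \<times> nat \<Rightarrow> real) \<Rightarrow> bool" where
  "posw K w \<longleftrightarrow> (\<forall>q a b c. 0 \<le> Lw w (q * q * (gen K vs ^ a * gen K vt ^ b * gen K vr ^ c)))"

lemma cone_nonneg: "p \<in> cone K \<Longrightarrow> posw K w \<Longrightarrow> 0 \<le> Lw w p"
  by (induction rule: cone.induct) (auto simp: posw_def)

subsection \<open>Iterating a cubic with slope \<open>3/2\<close> at the origin\<close>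

text \<open>\<open>\<phi> x = (3 x - x\<^sup>3) / 2\<close> maps \<open>[-1, 1]\<close> monotonically onto itself and has slope \<open>3/2\<close> at \<open>0\<close>;
  the identity \<open>1 - \<phi>\<^sup>2 = (1 - x\<^sup>2)\<^sup>2 (4 - x\<^sup>2) / 4\<close> keeps the iterates inside the cone.\<close>

definition cub :: "pol \<Rightarrow> pol" where "cub x = cst (1/2) * (3 * x - x * x * x)"

definition hh :: "pol \<Rightarrow> pol" where "hh x = 1 - x * x"

text \<open>The divided difference \<open>(cub x - cub y) / (x - y)\<close>, which is
  \<open>(3 - x\<^sup>2 - x y - y\<^sup>2) / 2\<close>, written so that membership in the cone is
  visible.\<close>

definition dcub :: "pol \<Rightarrow> pol \<Rightarrow> pol" where
  "dcub x y = cst (3/4) * (hh x + hh y) + cst (1/4) * ((x - y) * (x - y))"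

lemma cst_half: "2 * cst (1/2) = 1" "cst (1/4) = cst (1/2) * cst (1/2)"
  "cst (3/4) = 3 * (cst (1/2) * cst (1/2))" "cst (3/2) = 3 * cst (1/2)"
proof -
  have "cst (2 * (1/2)) = cst 2 * cst (1/2)" by (rule cst_simps)
  then show "2 * cst (1/2) = 1" by (simp add: cst_numeral cst_simps)
  have "cst (1/2 * (1/2)) = cst (1/2) * cst (1/2)" by (rule cst_simps)
  then show q: "cst (1/4) = cst (1/2) * cst (1/2)" by simp
  have "cst (3 * (1/4)) = cst 3 * cst (1/4)" by (rule cst_simps)
  then show "cst (3/4) = 3 * (cst (1/2) * cst (1/2))" by (simp add: cst_numeral q)
  have "cst (3 * (1/2)) = cst 3 * cst (1/2)" by (rule cst_simps)
  then show "cst (3/2) = 3 * cst (1/2)" by (simp add: cst_numeral)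
qed

lemma hh_cub: "hh (cub x) = hh x * hh x * (cst (1/4) * (3 + hh x))"
proof -
  define H where "H = cst (1/2)"
  have four: "4 * (H * H) = 1"
  proof -
    have "4 * (H * H) = (2 * H) * (2 * H)" by simp
    then show ?thesis by (simp add: H_def cst_half)
  qed
  have "hh x * hh x * (H * H * (3 + hh x)) =
     4 * (H * H) - (H * (3 * x - x * x * x)) * (H * (3 * x - x * x * x))"
    by (simp add: hh_def algebra_simps)
  then show ?thesis unfolding four by (simp add: hh_def cub_def H_def cst_half)
qed

lemma dcub_eq: "dcub x y = cst (1/2) * (3 - (x * x + x * y + y * y))"
proof -
  define H where "H = cst (1/2)"
  have two: "2 * H = 1" by (simp add: H_def cst_half)
  have "dcub x y = (2 * H) * (H * (3 - (x * x + x * y + y * y)))"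
    by (simp add: dcub_def hh_def cst_half H_def[symmetric] algebra_simps)
  then show ?thesis unfolding two unfolding H_def by simp
qed

lemma dd_cub: "dd (cub p) = dd p * dcub p (subst to_t p)"
proof -
  have "dd (p * p * p) = dd p * (p * p + p * subst to_t p + subst to_t p * subst to_t p)"
    unfolding dd_leibniz by (simp add: algebra_simps)
  moreover have "dd (3 * p) = 3 * dd p"
    using dd_cst_mult[of 3 p] by (simp add: cst_numeral)
  ultimately have "dd (cub p) = cst (1/2) * (3 * dd p - dd p * (p * p + p * subst to_t p + subst to_t p * subst to_t p))"
    by (simp add: cub_def dd_cst_mult dd_diff)
  then show ?thesis by (simp add: dcub_eq algebra_simps)
qed

lemma subst_cub:
  assumes "\<And>a b. h (a + b) = h a + h b" shows "subst h (cub p) = cub (subst h p)"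
proof -
  have "subst h (3 * p) = 3 * subst h p"
    using subst_cst_mult[of h 3 p] by (simp add: cst_numeral)
  then show ?thesis by (simp add: cub_def subst_cst_mult subst_diff subst_mult[OF assms])
qed

lemma hh_subst: "(\<And>a b. h (a + b) = h a + h b) \<Longrightarrow> h 0 = 0 \<Longrightarrow> subst h (hh p) = hh (subst h p)"
  using subst_cst[of h 1] by (simp add: hh_def subst_diff subst_mult cst_simps)

fun iter :: "pol \<Rightarrow> nat \<Rightarrow> pol" where
  "iter u 0 = u" | "iter u (Suc n) = cub (iter u n)"

fun bump :: "pol \<Rightarrow> nat \<Rightarrow> pol" where
  "bump u 0 = 1" | "bump u (Suc n) = bump u n * hh (iter u n)"

definition dif :: "real \<Rightarrow> pol \<Rightarrow> pol \<Rightarrow> pol" where "dif K v w = cst (1 / (2 * K)) * (v - w)"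

text \<open>\<open>4 K\<^sup>2 - (v - w)\<^sup>2 = 2 (K\<^sup>2 - v\<^sup>2) + 2 (K\<^sup>2 -
  w\<^sup>2) + (v + w)\<^sup>2\<close>. This dictates the factor \<open>1 / (2 * K)\<close> in
  \<open>dif\<close>.\<close>

lemma hh_dif:
  assumes "K > 0" "gen K v \<in> cone K" "gen K w \<in> cone K" shows "hh (dif K v w) \<in> cone K"
proof -
  define c where "c = cst (1 / (2 * K))"
  have "(1 / (2 * K)) * (1 / (2 * K)) * (4 * (K * K)) = 1" using assms(1) by simp
  then have "cst (1 / (2 * K)) * cst (1 / (2 * K)) * (cst 4 * cst (K * K)) = 1"
    by (simp only: cst_simps(2)[symmetric] cst_simps(4))
  then have one: "c * c * (4 * cst (K * K)) = 1" by (simp only: c_def cst_numeral)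
  have "hh (dif K v w) = c * c * (4 * cst (K * K)) - (c * (v - w)) * (c * (v - w))"
    unfolding one by (simp add: hh_def dif_def c_def)
  also have "\<dots> = (c * c) * (gen K v + gen K v + (gen K w + gen K w) + (v + w) * (v + w))"
    by (simp add: gen_def algebra_simps)
  also have "\<dots> \<in> cone K" by (intro cone_mult cone_plus cone_square assms)
  finally show ?thesis .
qed

lemma hh_iter: assumes "hh u \<in> cone K" shows "hh (iter u n) \<in> cone K"
proof (induction n)
  case (Suc n)
  have "3 \<in> cone K" using cone_cst[of 3 K] by (simp add: cst_numeral)
  then show ?case unfolding iter.simps hh_cub
    using Suc by (intro cone_mult cone_plus cone_cst) auto
qed (simp add: assms)

lemma bump_cone: assumes "hh u \<in> cone K" shows "bump u n \<in> cone K"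
  by (induction n) (auto intro: cone_one cone_mult hh_iter assms)

lemma bump_le_one: assumes "hh u \<in> cone K" shows "1 - bump u n \<in> cone K"
proof (induction n)
  case (Suc n)
  have "1 - bump u (Suc n) = (1 - bump u n) + bump u n * (iter u n * iter u n)"
    by (simp add: hh_def algebra_simps)
  then show ?case using Suc by (simp only:) (intro cone_plus cone_mult cone_square bump_cone assms)
qed (simp add: cone.zero)

text \<open>Needed for the trace norm of the smeared iterate, whose square is the weight of such a
  product.\<close>

lemma iter_product_le_one:
  assumes "hh u \<in> cone K" "hh v \<in> cone K" shows "1 - iter u n * iter v n \<in> cone K"
proof -
  have "1 - iter u n * iter v n = cst (1/2) * (hh (iter u n) + hh (iter v n) + (iter u n - iter v n) * (iter u n - iter v n))"
  proof -
    define H where "H = cst (1/2)"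
    have two: "2 * H = 1" by (simp add: H_def cst_half)
    have "H * (hh x + hh y + (x - y) * (x - y)) = (2 * H) * (1 - x * y)" for x y
      by (simp add: hh_def algebra_simps)
    then show ?thesis unfolding two unfolding H_def by simp
  qed
  also have "\<dots> \<in> cone K" by (intro cone_mult cone_plus cone_square cone_cst hh_iter assms) simp
  finally show ?thesis .
qed

lemma hh_le_one: "1 - hh x \<in> cone K"
  using cone_square[of x K] by (simp add: hh_def)

text \<open>With \<open>p = hh x\<close> and \<open>q = hh y\<close> the bound rests on
  \<open>p + q - 2 p q = p (1 - q) + q (1 - p)\<close>. The factor 3/2 is the slope of the cubic at
  the origin; \<open>p\<close> and \<open>q\<close> become the next factors of the two
  bumps.\<close>

lemma dcub_lower:
  assumes "hh x \<in> cone K" "hh y \<in> cone K"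
  shows "dcub x y \<in> cone K" "dcub x y - cst (3/2) * (hh x * hh y) \<in> cone K"
proof -
  show "dcub x y \<in> cone K" unfolding dcub_def
    by (intro cone_plus cone_mult cone_cst cone_square assms) auto
  define H where "H = cst (1/2)"
  have two: "2 * H = 1" by (simp add: H_def cst_half)
  have "dcub x y - cst (3/2) * (hh x * hh y) = dcub x y - (2 * H) * (3 * H * (hh x * hh y))"
    unfolding two by (simp add: cst_half H_def)
  also have "\<dots> = cst (3/4) * (hh x * (1 - hh y) + hh y * (1 - hh x)) + cst (1/4) * ((x - y) * (x - y))"
    by (simp add: dcub_def cst_half H_def[symmetric] algebra_simps)
  also have "\<dots> \<in> cone K"
    by (intro cone_plus cone_mult cone_cst cone_square assms hh_le_one) auto
  finally show "dcub x y - cst (3/2) * (hh x * hh y) \<in> cone K" .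
qed

lemma subst_iter:
  assumes "\<And>a b. h (a + b) = h a + h b" shows "subst h (iter u n) = iter (subst h u) n"
  by (induction n) (simp_all add: subst_cub assms)

lemma subst_bump:
  assumes "\<And>a b. h (a + b) = h a + h b" "h 0 = 0" shows "subst h (bump u n) = bump (subst h u) n"
proof (induction n)
  case 0
  then show ?case using subst_cst[where h = h and c = 1] assms(2) by (simp add: cst_simps)
next
  case (Suc n)
  then show ?case by (simp add: subst_mult hh_subst subst_iter assms)
qed

lemma subst_dif: "subst to_t (dif K vs vr) = dif K vt vr" "subst r_to_t (dif K vs vr) = dif K vs vt"
  by (simp_all add: dif_def subst_cst_mult subst_diff vs_def vr_def vt_def subst_mono to_t_def r_to_t_def)

lemma tfree_iter: "tfree u \<Longrightarrow> tfree (iter u n)"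
  by (induction n) (auto simp: cub_def intro!: tfree_mult tfree_diff tfree_cst)

lemma tfree_bump: "tfree u \<Longrightarrow> tfree (bump u n)"
  by (induction n) (auto simp: hh_def intro!: tfree_mult tfree_diff tfree_cst tfree_iter)

lemma tfree_dif: "tfree (dif K vs vr)"
  unfolding dif_def vs_def vr_def by (intro tfree_mult tfree_diff tfree_cst tfree_mono)

text \<open>By the chain rule each iteration multiplies the divided difference by a
  \<open>dcub\<close>, which is at least 3/2 times one more factor of either bump. The initial slope
  is the \<open>1 / (2 * K)\<close> of \<open>dif\<close>.\<close>

lemma dd_iter_lower:
  assumes "K > 0"
  defines "u \<equiv> dif K vs vr" and "v \<equiv> dif K vt vr"
  shows "dd (iter u n) - cst ((3/2)^n / (2 * K)) * (bump u n * bump v n) \<in> cone K"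
proof (induction n)
  case 0
  have "dd (dif K vs vr) = cst (1 / (2 * K)) * (dd vs - dd vr)"
    by (simp add: dif_def dd_cst_mult dd_diff)
  moreover have "dd vs = 1" "dd vr = 0"
    unfolding vs_def vr_def dd_mono by (simp_all add: zero_prod_def[symmetric])
  ultimately show ?case by (simp add: u_def cone.zero)
next
  case (Suc n)
  have u: "hh u \<in> cone K" unfolding u_def by (rule hh_dif[OF assms(1) cone_gen(1,3)])
  have v: "hh v \<in> cone K" unfolding v_def by (rule hh_dif[OF assms(1) cone_gen(2,3)])
  have st: "subst to_t (iter u n) = iter v n"
    by (simp add: subst_iter to_t_add u_def v_def subst_dif)
  define x y P R e where "x = iter u n" and "y = iter v n" and "P = bump u n" and "R = bump v n" and "e = dcub x y"
  define c where "c = cst ((3/2)^n / (2 * K))"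
  have c': "cst ((3/2)^Suc n / (2 * K)) = c * cst (3/2)"
    by (simp add: c_def cst_simps(2)[symmetric] mult.commute)
  have "dd (iter u (Suc n)) - cst ((3/2)^Suc n / (2 * K)) * (bump u (Suc n) * bump v (Suc n))
    = (dd x - c * (P * R)) * e + c * (P * R) * (e - cst (3/2) * (hh x * hh y))"
    unfolding c' by (simp add: dd_cub st x_def y_def P_def R_def e_def algebra_simps)
  also have "\<dots> \<in> cone K"
  proof (intro cone_plus cone_mult)
    show "dd x - c * (P * R) \<in> cone K" using Suc by (simp add: x_def P_def R_def c_def)
    show "c \<in> cone K" unfolding c_def using assms(1) by (intro cone_cst) simp
    show "P \<in> cone K" "R \<in> cone K" unfolding P_def R_def by (intro bump_cone u v)+
    show "e \<in> cone K" "e - cst (3/2) * (hh x * hh y) \<in> cone K"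
      unfolding e_def x_def y_def by (intro dcub_lower hh_iter u v)+
  qed
  finally show ?case .
qed

lemma posw_bounds:
  assumes K: "K > 0" and w: "posw K w"
  defines "u \<equiv> dif K vs vr" and "v \<equiv> dif K vt vr"
  shows "Lw w (bump u n * bump u n) \<le> Lw w (bump u n)" "Lw w (bump u n) \<le> Lw w 1"
    "Lw w (iter u n * iter (dif K vs vt) n) \<le> Lw w 1"
    "(3/2)^n / (2 * K) * Lw w (bump u n * bump v n) \<le> Lw w (dd (iter u n))"
proof -
  have u: "hh u \<in> cone K" unfolding u_def by (rule hh_dif[OF K cone_gen(1,3)])
  have v: "hh (dif K vs vt) \<in> cone K" by (rule hh_dif[OF K cone_gen(1,2)])
  have "bump u n * (1 - bump u n) \<in> cone K" by (intro cone_mult bump_cone bump_le_one u)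
  from cone_nonneg[OF this w] show "Lw w (bump u n * bump u n) \<le> Lw w (bump u n)"
    by (simp add: right_diff_distrib Lw_diff)
  from cone_nonneg[OF bump_le_one[OF u] w] show "Lw w (bump u n) \<le> Lw w 1" by (simp add: Lw_diff)
  from cone_nonneg[OF iter_product_le_one[OF u v] w]
  show "Lw w (iter u n * iter (dif K vs vt) n) \<le> Lw w 1" by (simp add: Lw_diff)
  from cone_nonneg[OF dd_iter_lower[OF K] w]
  show "(3/2)^n / (2 * K) * Lw w (bump u n * bump v n) \<le> Lw w (dd (iter u n))"
    by (simp add: Lw_diff Lw_cst u_def v_def)
qed

section \<open>Bounded functionals for the trace norm\<close>

context tracial_vna
begin

text \<open>Such a functional stands for pairing with a GNS vector.\<close>

definition lf :: "('h bop \<Rightarrow> complex) \<Rightarrow> bool" where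
  "lf g \<longleftrightarrow> (\<forall>a\<in>M. \<forall>b\<in>M. g (a + b) = g a + g b) \<and> (\<forall>c. \<forall>a\<in>M. g (c *\<^sub>C a) = c * g a) \<and>
    (\<exists>K\<ge>0. \<forall>a\<in>M. cmod (g a) \<le> K * n2 a)"

lemma lfD: "lf g \<Longrightarrow> a \<in> M \<Longrightarrow> b \<in> M \<Longrightarrow> g (a + b) = g a + g b"
  "lf g \<Longrightarrow> a \<in> M \<Longrightarrow> g (c *\<^sub>C a) = c * g a"
  "lf g \<Longrightarrow> \<exists>K\<ge>0. \<forall>a\<in>M. cmod (g a) \<le> K * n2 a"
  by (auto simp: lf_def)

lemma lf_zero_at: "lf g \<Longrightarrow> g 0 = 0"
  using lfD(2)[of g 0 0] by simp

lemma lf_diff_at: "lf g \<Longrightarrow> a \<in> M \<Longrightarrow> b \<in> M \<Longrightarrow> g (a - b) = g a - g b"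
  using lfD(1)[of g a "(-1) *\<^sub>C b"] lfD(2)[of g b "-1"] by (simp add: scaleC_bop_distrib)

lemma lf_cong: assumes "lf g" "\<And>a. a \<in> M \<Longrightarrow> g a = g' a" shows "lf g'"
  using assms(1) unfolding lf_def by (auto simp: assms(2)[symmetric])

lemma lf_zero: "lf (\<lambda>_. 0)"
  by (auto simp: lf_def intro!: exI[of _ 0])

lemma lf_add: assumes "lf g" "lf h" shows "lf (\<lambda>a. g a + h a)"
proof -
  obtain K K' where K: "K \<ge> 0" "\<And>a. a \<in> M \<Longrightarrow> cmod (g a) \<le> K * n2 a"
    "K' \<ge> 0" "\<And>a. a \<in> M \<Longrightarrow> cmod (h a) \<le> K' * n2 a" using lfD(3)[OF assms(1)] lfD(3)[OF assms(2)] by blast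
  have "cmod (g a + h a) \<le> (K + K') * n2 a" if "a \<in> M" for a
    using norm_triangle_ineq[of "g a" "h a"] K(2)[OF that] K(4)[OF that] by (simp add: distrib_right)
  then show ?thesis unfolding lf_def
    using assms K by (auto simp: lfD distrib_left intro!: exI[of _ "K + K'"])
qed

lemma lf_minus: assumes "lf g" shows "lf (\<lambda>a. - g a)"
  using assms unfolding lf_def by auto

lemma lf_diff: "lf g \<Longrightarrow> lf h \<Longrightarrow> lf (\<lambda>a. g a - h a)"
  using lf_add[of g "\<lambda>a. - h a"] lf_minus[of h] by simp

lemma lf_conj: assumes "lf g" "p \<in> M" "q \<in> M" shows "lf (\<lambda>a. g (p * (a * q)))"
proof -
  obtain K where K: "K \<ge> 0" "\<And>a. a \<in> M \<Longrightarrow> cmod (g a) \<le> K * n2 a" using lfD(3)[OF assms(1)] by blast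
  have "cmod (g (p * (a * q))) \<le> (K * (nrm p * nrm q)) * n2 a" if a: "a \<in> M" for a
  proof -
    have "cmod (g (p * (a * q))) \<le> K * n2 (p * a * q)" using K(2)[of "p * a * q"] a assms by (simp add: mult.assoc)
    also have "\<dots> \<le> K * (nrm p * n2 a * nrm q)" using a assms K(1) by (intro mult_left_mono n2_mult3) auto
    finally show ?thesis by (simp add: mult_ac)
  qed
  then show ?thesis unfolding lf_def
    using assms K by (auto simp: lfD distrib_left distrib_right intro!: exI[of _ "K * (nrm p * nrm q)"])
qed

lemma lf_tr: "lf \<tau>"
  unfolding lf_def by (auto simp: tr_add tr_scaleC tr_le_n2 intro!: exI[of _ 1])

lemma lf_tr_mult: assumes "p \<in> M" shows "lf (\<lambda>a. \<tau> (p * a))"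
  using lf_conj[OF lf_tr assms one_in] by simp

lemma lf_lim:
  assumes g: "lf g" and s: "\<And>n::nat. s n \<in> M" "y \<in> M" "(\<lambda>n. n2 (s n - y)) \<longlonglongrightarrow> 0"
  shows "(\<lambda>n. g (s n)) \<longlonglongrightarrow> g y"
proof -
  obtain K where K: "K \<ge> 0" "\<And>a. a \<in> M \<Longrightarrow> cmod (g a) \<le> K * n2 a" using lfD(3)[OF g] by blast
  have "\<forall>\<^sub>F n in sequentially. norm (g (s n) - g y) \<le> K * n2 (s n - y)"
    using K(2)[OF diff_in[OF s(1) s(2)]] s(1,2) by (simp add: lf_diff_at[OF g])
  from Lim_null_comparison[OF this tendsto_mult_right_zero[OF s(3)]]
  show ?thesis by (rule LIM_zero_cancel)
qed

end

context cond_exp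
begin

text \<open>A functional with one common value on all unitary conjugates keeps that value at
  midpoints.\<close>

lemma lf_avg:
  assumes "lf g" "a \<in> M" "\<And>u. u \<in> B \<Longrightarrow> adj u * u = 1 \<Longrightarrow> u * adj u = 1 \<Longrightarrow> g (u * a * adj u) = k" "c \<in> avg B a"
  shows "g c = k"
  using assms(4)
proof (induction rule: avg.induct)
  case (mid c d)
  then show ?case using assms(1) avg_M[OF _ assms(2)] by (simp add: lfD)
qed (use assms in blast)

end

section \<open>Words and their divided differences\<close>

text \<open>A list of pairs stands for a sum of simple tensors, and \<open>lsum g\<close> evaluates
  the bilinear form \<open>g\<close> on it.\<close>

definition lsum :: "('a \<Rightarrow> 'b \<Rightarrow> 'c::comm_monoid_add) \<Rightarrow> ('a \<times> 'b) list \<Rightarrow> 'c" where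
  "lsum g L = sum_list (map (case_prod g) L)"

lemma lsum_simps [simp]: "lsum g [] = 0" "lsum g ((l, r) # L) = g l r + lsum g L"
  "lsum g (L @ L') = lsum g L + lsum g L'"
  by (auto simp: lsum_def)

lemma lsum_map [simp]: "lsum g (map (map_prod h k) L) = lsum (\<lambda>l r. g (h l) (k r)) L"
  by (induction L) (auto simp: lsum_def)

lemma lsum_map_comp [simp]:
  "lsum g (map (map_prod h k \<circ> F) L) = lsum (\<lambda>l r. g (h l) (k r)) (map F L)"
  by (simp del: map_map add: list.map_comp[symmetric])

lemma lsum_cong: "(\<And>l r. (l, r) \<in> set L \<Longrightarrow> g l r = g' l r) \<Longrightarrow> lsum g L = lsum g' L"
  by (induction L) auto

lemma lsum_mult: "lsum (\<lambda>l r. c * g l r) L = c * (lsum g L :: 'a::comm_ring_1)"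
  by (induction L) (auto simp: distrib_left)

lemma lsum_add: "lsum (\<lambda>l r. g l r + g' l r) L = lsum g L + (lsum g' L :: 'a::comm_ring_1)"
  by (induction L) (auto simp: algebra_simps)

fun val :: "('h::complex_hilbert_space bop \<times> 'i option) list \<Rightarrow> 'h bop" where
  "val [] = 1"
| "val ((g, o') # w) = g * val w"

text \<open>The letters tagged \<open>Some i\<close> are the variables with derivative \<open>1 \<otimes> 1\<close> under \<open>\<partial>\<^sub>i\<close>;
  \<open>spl i w\<close> lists the simple tensors in \<open>\<partial>\<^sub>i w\<close>.\<close>

fun spl :: "'i \<Rightarrow> ('h::complex_hilbert_space bop \<times> 'i option) list \<Rightarrow> ('h bop \<times> 'h bop) list" where
  "spl i [] = []"
| "spl i ((g, o') # w) = (if o' = Some i then [(1, val w)] else []) @ map (map_prod ((*) g) id) (spl i w)"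

lemma val_append [simp]: "val (v @ w) = val v * val w"
  by (induction v rule: val.induct) (auto simp: mult.assoc)

text \<open>The Leibniz rule \<open>\<partial> (v w) = \<partial> v \<cdot> w + v \<cdot> \<partial>
  w\<close>, read under an arbitrary \<open>g\<close>.\<close>

lemma lsum_spl_append:
  "lsum g (spl i (v @ w)) = lsum (\<lambda>l r. g l (r * val w)) (spl i v) + lsum (\<lambda>l r. g (val v * l) r) (spl i w)"
proof (induction v arbitrary: g)
  case (Cons a v)
  obtain h o' where a: "a = (h, o')" by (cases a)
  show ?case by (simp add: a Cons mult.assoc add.assoc)
qed simp

definition valp :: "('h::complex_hilbert_space bop \<times> 'i option) list list \<Rightarrow> 'h bop" where
  "valp \<gamma> = sum_list (map val \<gamma>)"

lemma valp_simps [simp]: "valp [] = 0" "valp (w # \<gamma>) = val w + valp \<gamma>" "valp (\<gamma> @ \<gamma>') = valp \<gamma> + valp \<gamma>'"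
  by (auto simp: valp_def)

lemma valp_map: "(\<And>w. val (h w) = a * val w * b) \<Longrightarrow> valp (map h \<gamma>) = a * valp \<gamma> * b"
  by (induction \<gamma> rule: list.induct) (auto simp: distrib_left distrib_right)

text \<open>\<open>f i\<close> is the pairing with the \<open>i\<close>-th conjugate variable, and
  \<open>f_word\<close> is the conjugate relation for the diagonal covariance.\<close>

locale conj_vars = cond_exp M \<tau> B E for M :: "'h::complex_hilbert_space bop set" and \<tau> B E +
  fixes I :: "'i set" and x :: "'i \<Rightarrow> 'h bop" and f :: "'i \<Rightarrow> 'h bop \<Rightarrow> complex"
  assumes xM: "j \<in> I \<Longrightarrow> x j \<in> M" and xsa: "j \<in> I \<Longrightarrow> adj (x j) = x j"
    and gen: "M = commutant (commutant (star_generated (B \<union> x ` I)))"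
    and lf_f: "i \<in> I \<Longrightarrow> lf (f i)"
    and f_word: "\<And>i d j b. i \<in> I \<Longrightarrow> (\<forall>k\<in>{1..d}. j k \<in> I) \<Longrightarrow> (\<forall>k\<le>d. b k \<in> B) \<Longrightarrow>
      f i (word x j b 0 d) =
        (\<Sum>k=1..d. if i = j k then \<tau> (E (word x j b 0 (k - 1)) * E (word x j b k d)) else 0)"
begin

definition lets0 where "lets0 = (\<lambda>b. (b, None)) ` B \<union> (\<lambda>j. (x j, Some j)) ` I"

definition inM :: "('h bop \<times> 'i option) list \<Rightarrow> bool" where "inM w \<longleftrightarrow> (\<forall>a\<in>set w. fst a \<in> M)"

lemma inM_simps [simp]: "inM []" "inM (a # w) \<longleftrightarrow> fst a \<in> M \<and> inM w" "inM (v @ w) \<longleftrightarrow> inM v \<and> inM w"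
  by (auto simp: inM_def)

lemma val_M [simp]: "inM w \<Longrightarrow> val w \<in> M"
  by (induction w rule: val.induct) auto

lemma spl_M: "inM w \<Longrightarrow> (l, r) \<in> set (spl i w) \<Longrightarrow> l \<in> M \<and> r \<in> M"
  by (induction w arbitrary: l r rule: val.induct) (auto split: if_splits)

lemma lf_lsum: "(\<And>l r. (l, r) \<in> set L \<Longrightarrow> lf (g l r)) \<Longrightarrow> lf (\<lambda>a. lsum (\<lambda>l r. g l r a) L)"
proof (induction L)
  case (Cons p L)
  obtain l r where "p = (l, r)" by (cases p)
  with Cons show ?case by (auto intro!: lf_add)
qed (simp add: lf_zero)

definition tr2 where "tr2 i w = lsum (\<lambda>l r. \<tau> (E l * E r)) (spl i w)"

lemma word_zero: "word x j b n n = b n"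
  by (simp add: word_def)

lemma word_mult: "word x j (b(0 := c * b 0)) 0 d = c * word x j b 0 d"
proof -
  have "map (\<lambda>k. x (j k) * (b(0 := c * b 0)) k) [Suc 0..<Suc d] = map (\<lambda>k. x (j k) * b k) [Suc 0..<Suc d]"
    by (rule map_cong) auto
  then show ?thesis by (simp only: word_def) (simp add: mult.assoc)
qed

lemma word_upd: "0 < m \<Longrightarrow> word x j (b(0 := c)) m d = word x j b m d"
proof -
  assume "0 < m"
  then have "map (\<lambda>k. x (j k) * (b(0 := c)) k) [Suc m..<Suc d] = map (\<lambda>k. x (j k) * b k) [Suc m..<Suc d]"
    by (intro map_cong) auto
  then show ?thesis using \<open>0 < m\<close> by (simp only: word_def) simp
qed

lemma word_shift:
  "word x (\<lambda>k. if k = 1 then i else j (k - 1)) (\<lambda>k. if k = 0 then 1 else b (k - 1)) (Suc m) (Suc d) = word x j b m d"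
proof -
  have "[Suc (Suc m)..<Suc (Suc d)] = map Suc [Suc m..<Suc d]" by (rule map_Suc_upt[symmetric])
  then have "map (\<lambda>k. x (if k = 1 then i else j (k - 1)) * (if k = 0 then 1 else b (k - 1))) [Suc (Suc m)..<Suc (Suc d)]
    = map (\<lambda>k. x (j k) * b k) [Suc m..<Suc d]"
    by (simp only: map_map) (rule map_cong, auto)
  then show ?thesis by (simp only: word_def) simp
qed

lemma word_shift0:
  "word x (\<lambda>k. if k = 1 then i else j (k - 1)) (\<lambda>k. if k = 0 then 1 else b (k - 1)) 0 (Suc d) = x i * word x j b 0 d"
proof -
  let ?j = "\<lambda>k. if k = 1 then i else j (k - 1)" and ?b = "\<lambda>k. if k = 0 then 1 else b (k - 1)"
  have "[Suc 0..<Suc (Suc d)] = Suc 0 # [Suc (Suc 0)..<Suc (Suc d)]" by (rule upt_conv_Cons) simp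
  then have "word x ?j ?b 0 (Suc d) = x i * (b 0 * (\<Prod>k\<leftarrow>[Suc (Suc 0)..<Suc (Suc d)]. x (?j k) * ?b k))"
    by (simp only: word_def) (simp add: mult.assoc)
  also have "b 0 * (\<Prod>k\<leftarrow>[Suc (Suc 0)..<Suc (Suc d)]. x (?j k) * ?b k) = word x ?j ?b (Suc 0) (Suc d)"
    by (simp only: word_def) simp
  finally show ?thesis by (simp only: word_shift)
qed

text \<open>Letter lists may contain several elements of \<open>B\<close> in a row, or none between
  two variables; they are brought into the alternating form of the conjugate relation. The extra
  left factor \<open>g\<close> absorbs the first letter in the induction.\<close>

lemma base_word:
  assumes "w \<in> lists lets0"
  shows "\<exists>d j b. (\<forall>k\<in>{1..d}. j k \<in> I) \<and> (\<forall>k\<le>d. b k \<in> B) \<and> val w = word x j b 0 d \<and>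
    (\<forall>i g. lsum (\<lambda>l r. \<tau> (E (g * l) * E r)) (spl i w) =
      (\<Sum>k=1..d. if i = j k then \<tau> (E (g * word x j b 0 (k - 1)) * E (word x j b k d)) else 0))"
  using assms
proof (induction w rule: list.induct)
  case Nil
  then show ?case by (intro exI[of _ 0] exI[of _ "\<lambda>_. 1"]) (auto simp: word_zero)
next
  case (Cons a w)
  obtain d j b where IH: "\<forall>k\<in>{1..d}. j k \<in> I" "\<forall>k\<le>d. b k \<in> B" "val w = word x j b 0 d"
    "\<And>i g. lsum (\<lambda>l r. \<tau> (E (g * l) * E r)) (spl i w) =
      (\<Sum>k=1..d. if i = j k then \<tau> (E (g * word x j b 0 (k - 1)) * E (word x j b k d)) else 0)"
    using Cons by auto
  from Cons.prems have "a \<in> lets0" by simp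
  then consider c where "c \<in> B" "a = (c, None)" | i0 where "i0 \<in> I" "a = (x i0, Some i0)"
    unfolding lets0_def by blast
  then show ?case
  proof cases
    case 1
    define b' where "b' = b(0 := c * b 0)"
    have w0: "word x j b' 0 k = c * word x j b 0 k" for k unfolding b'_def by (rule word_mult)
    have wk: "word x j b' k d = word x j b k d" if "0 < k" for k unfolding b'_def using that by (rule word_upd)
    have "lsum (\<lambda>l r. \<tau> (E (g * l) * E r)) (spl i (a # w)) =
      (\<Sum>k=1..d. if i = j k then \<tau> (E (g * word x j b' 0 (k - 1)) * E (word x j b' k d)) else 0)" for i g
    proof -
      have "lsum (\<lambda>l r. \<tau> (E (g * l) * E r)) (spl i (a # w)) = lsum (\<lambda>l r. \<tau> (E ((g * c) * l) * E r)) (spl i w)"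
        by (simp add: 1 mult.assoc)
      also have "\<dots> = (\<Sum>k=1..d. if i = j k then \<tau> (E (g * word x j b' 0 (k - 1)) * E (word x j b' k d)) else 0)"
        unfolding IH(4) by (intro sum.cong refl) (auto simp: w0 wk mult.assoc)
      finally show ?thesis .
    qed
    moreover have "\<forall>k\<le>d. b' k \<in> B" using IH(2) 1 by (auto simp: b'_def)
    moreover have "val (a # w) = word x j b' 0 d" by (simp add: 1 IH(3) w0)
    ultimately show ?thesis using IH(1) by blast
  next
    case 2
    \<comment> \<open>Prepending a variable shifts all positions by one and inserts the coefficient
      1 in front of it.\<close>
    define j' where "j' k = (if k = 1 then i0 else j (k - 1))" for k :: nat
    define b' where "b' k = (if k = 0 then 1 else b (k - 1))" for k :: nat
    have sh: "word x j' b' (Suc m) (Suc n) = word x j b m n" for m n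
      unfolding j'_def b'_def by (rule word_shift)
    have sh0: "word x j' b' 0 (Suc n) = x i0 * word x j b 0 n" for n
      unfolding j'_def b'_def by (rule word_shift0)
    have s0: "word x j' b' 0 0 = 1" by (simp add: word_zero b'_def)
    have "lsum (\<lambda>l r. \<tau> (E (g * l) * E r)) (spl i (a # w)) =
      (\<Sum>k=1..Suc d. if i = j' k then \<tau> (E (g * word x j' b' 0 (k - 1)) * E (word x j' b' k (Suc d))) else 0)" for i g
    proof -
      have "(\<Sum>k=1..Suc d. if i = j' k then \<tau> (E (g * word x j' b' 0 (k - 1)) * E (word x j' b' k (Suc d))) else 0)
        = (if i = j' 1 then \<tau> (E (g * word x j' b' 0 0) * E (word x j' b' 1 (Suc d))) else 0) +
          (\<Sum>k=Suc 1..Suc d. if i = j' k then \<tau> (E (g * word x j' b' 0 (k - 1)) * E (word x j' b' k (Suc d))) else 0)"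
        by (subst sum.atLeast_Suc_atMost) auto
      also have "(\<Sum>k=Suc 1..Suc d. if i = j' k then \<tau> (E (g * word x j' b' 0 (k - 1)) * E (word x j' b' k (Suc d))) else 0)
         = (\<Sum>k=1..d. if i = j' (Suc k) then \<tau> (E (g * word x j' b' 0 k) * E (word x j' b' (Suc k) (Suc d))) else 0)"
        by (subst sum.atLeast_Suc_atMost_Suc_shift) (simp only: comp_def diff_Suc_1)
      also have "\<dots> = (\<Sum>k=1..d. if i = j k then \<tau> (E (g * x i0 * word x j b 0 (k - 1)) * E (word x j b k d)) else 0)"
      proof (intro sum.cong refl)
        fix k assume "k \<in> {1..d}"
        then obtain k' where k: "k = Suc k'" by (cases k) auto
        show "(if i = j' (Suc k) then \<tau> (E (g * word x j' b' 0 k) * E (word x j' b' (Suc k) (Suc d))) else 0) =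
          (if i = j k then \<tau> (E (g * x i0 * word x j b 0 (k - 1)) * E (word x j b k d)) else 0)"
          unfolding sh by (simp add: k sh0 j'_def mult.assoc)
      qed
      also have "\<dots> = lsum (\<lambda>l r. \<tau> (E (g * x i0 * l) * E r)) (spl i w)" by (rule IH(4)[symmetric])
      also have "(if i = j' 1 then \<tau> (E (g * word x j' b' 0 0) * E (word x j' b' 1 (Suc d))) else 0) =
         (if i = i0 then \<tau> (E g * E (val w)) else 0)"
        using sh[of 0 d] by (simp add: j'_def s0 IH(3))
      finally show ?thesis by (auto simp: 2 mult.assoc)
    qed
    moreover have "\<forall>k\<in>{1..Suc d}. j' k \<in> I"
    proof
      fix k assume k: "k \<in> {1..Suc d}"
      then have "k - 1 \<in> {1..d}" if "k \<noteq> 1" using that by auto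
      then show "j' k \<in> I" using IH(1) 2 by (auto simp: j'_def)
    qed
    moreover have "\<forall>k\<le>Suc d. b' k \<in> B" using IH(2) by (auto simp: b'_def)
    moreover have "val (a # w) = word x j' b' 0 (Suc d)" by (simp add: 2 IH(3) sh0)
    ultimately show ?thesis by blast
  qed
qed

lemma base_formula: assumes "i \<in> I" "w \<in> lists lets0" shows "f i (val w) = tr2 i w"
proof -
  obtain d j b where w: "\<forall>k\<in>{1..d}. j k \<in> I" "\<forall>k\<le>d. b k \<in> B" "val w = word x j b 0 d"
    "\<And>i g. lsum (\<lambda>l r. \<tau> (E (g * l) * E r)) (spl i w) =
      (\<Sum>k=1..d. if i = j k then \<tau> (E (g * word x j b 0 (k - 1)) * E (word x j b k d)) else 0)"
    using base_word[OF assms(2)] by blast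
  show ?thesis unfolding w(3) f_word[OF assms(1) w(1,2)] tr2_def
    using w(4)[of 1 i] unfolding mult_1_left by (rule sym)
qed

subsection \<open>Replacing the variables by their averages\<close>

definition Y :: "'i \<Rightarrow> 'h bop" where
  "Y j = (SOME y. y \<in> Q \<and> adj y = y \<and> (\<exists>s. (\<forall>n::nat. s n \<in> avg B (x j)) \<and> (\<lambda>n. n2 (s n - y)) \<longlonglongrightarrow> 0))"

lemma Y: assumes "j \<in> I"
  shows "Y j \<in> Q" "adj (Y j) = Y j" "\<exists>s. (\<forall>n::nat. s n \<in> avg B (x j)) \<and> (\<lambda>n. n2 (s n - Y j)) \<longlonglongrightarrow> 0"
proof -
  have "\<exists>y. y \<in> Q \<and> adj y = y \<and> (\<exists>s. (\<forall>n::nat. s n \<in> avg B (x j)) \<and> (\<lambda>n. n2 (s n - y)) \<longlonglongrightarrow> 0)"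
    using averaging[OF xM[OF assms]] xsa[OF assms] by blast
  from someI_ex[OF this] show "Y j \<in> Q" "adj (Y j) = Y j"
    "\<exists>s. (\<forall>n::nat. s n \<in> avg B (x j)) \<and> (\<lambda>n. n2 (s n - Y j)) \<longlonglongrightarrow> 0"
    unfolding Y_def by blast+
qed

lemma YM [simp]: "j \<in> I \<Longrightarrow> Y j \<in> M" using Y(1) by auto

definition lets1 where "lets1 = lets0 \<union> (\<lambda>j. (Y j, Some j)) ` I"

lemma lets1_M: "a \<in> lets1 \<Longrightarrow> fst a \<in> M"
  by (auto simp: lets1_def lets0_def xM)

lemma lists1_M: "w \<in> lists lets1 \<Longrightarrow> inM w"
  by (auto simp: inM_def intro: lets1_M)

lemma lets0_lets1: "w \<in> lists lets0 \<Longrightarrow> w \<in> lists lets1"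
  by (auto simp: lets1_def)

lemma B_lets0: "b \<in> B \<Longrightarrow> (b, None) \<in> lets0" by (auto simp: lets0_def)

text \<open>If \<open>p\<close> is unitary, the term in which the derivation hits \<open>x j\<close>
  does not depend on \<open>p\<close>, because
  \<open>E (val u * p) * E (adj p * val v) = E (val u) * E (val v)\<close>. All other terms are
  bounded functionals of \<open>p * x j * adj p\<close>. Hence the relation passes to averages and
  to their limit \<open>Y j\<close>.\<close>

lemma formula_limit:
  assumes j: "j \<in> I" and i: "i \<in> I" and u: "inM u" and v: "inM v"
    and H: "\<And>p. p \<in> B \<Longrightarrow> f i (val (u @ [(p, None), (x j, Some j), (adj p, None)] @ v)) =
      tr2 i (u @ [(p, None), (x j, Some j), (adj p, None)] @ v)"
  shows "f i (val (u @ (Y j, Some j) # v)) = tr2 i (u @ (Y j, Some j) # v)"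
proof -
  define T1 where "T1 c = lsum (\<lambda>l r. \<tau> (E l * r * (c * val v))) (spl i u)" for c
  define T3 where "T3 c = lsum (\<lambda>l r. \<tau> (val u * (c * (l * E r)))) (spl i v)" for c
  define k where "k = (if j = i then \<tau> (E (val u) * E (val v)) else 0)"
  \<comment> \<open>Collects everything that is linear in the letter put in place of
    \<open>x j\<close>; the relation for that letter then reads \<open>g c = k\<close>.\<close>
  define g where "g c = f i (val u * (c * val v)) - T1 c - T3 c" for c
  have uM: "val u \<in> M" and vM: "val v \<in> M" using u v by auto
  have lfg: "lf g" unfolding g_def T1_def T3_def
  proof (intro lf_diff lf_lsum)
    show "lf (\<lambda>c. f i (val u * (c * val v)))" by (rule lf_conj[OF lf_f[OF i] uM vM])
    fix l r assume "(l, r) \<in> set (spl i u)"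
    then have "l \<in> M" "r \<in> M" using spl_M[OF u] by auto
    then show "lf (\<lambda>a. \<tau> (E l * r * (a * val v)))" by (intro lf_conj[OF lf_tr] vM) auto
  next
    fix l r assume "(l, r) \<in> set (spl i v)"
    then have "l \<in> M" "r \<in> M" using spl_M[OF v] by auto
    then show "lf (\<lambda>a. \<tau> (val u * (a * (l * E r))))" by (intro lf_conj[OF lf_tr] uM) auto
  qed
  have split: "tr2 i (u @ (c, Some j) # v) = T1 c + k + T3 c" if c: "c \<in> M" for c
  proof -
    have "lsum (\<lambda>l r. \<tau> (E l * E (r * (c * val v)))) (spl i u) = T1 c"
      unfolding T1_def
    proof (rule lsum_cong)
      fix l r assume "(l, r) \<in> set (spl i u)"
      then have "l \<in> M" "r \<in> M" using spl_M[OF u] by auto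
      then show "\<tau> (E l * E (r * (c * val v))) = \<tau> (E l * r * (c * val v))"
        using c vM by (simp add: tr_E_left mult.assoc)
    qed
    moreover have "lsum (\<lambda>l r. \<tau> (E (val u * (c * l)) * E r)) (spl i v) = T3 c"
      unfolding T3_def
    proof (rule lsum_cong)
      fix l r assume "(l, r) \<in> set (spl i v)"
      then have "l \<in> M" "r \<in> M" using spl_M[OF v] by auto
      then show "\<tau> (E (val u * (c * l)) * E r) = \<tau> (val u * (c * (l * E r)))"
        using c uM by (simp add: tr_E_right mult.assoc)
    qed
    ultimately show ?thesis by (auto simp: tr2_def lsum_spl_append k_def)
  qed
  have base: "g (p * x j * adj p) = k" if p: "p \<in> B" "adj p * p = 1" "p * adj p = 1" for p
  proof -
    define c where "c = p * x j * adj p"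
    have cM: "c \<in> M" unfolding c_def using p xM[OF j] by auto
    have pM: "p \<in> M" "adj p \<in> M" "x j \<in> M" using p xM[OF j] by auto
    have "tr2 i (u @ [(p, None), (x j, Some j), (adj p, None)] @ v) = T1 c + k + T3 c"
    proof -
      have "lsum (\<lambda>l r. \<tau> (E l * E (r * (p * (x j * (adj p * val v)))))) (spl i u) = T1 c"
        unfolding T1_def
      proof (rule lsum_cong)
        fix l r assume "(l, r) \<in> set (spl i u)"
        then have "l \<in> M" "r \<in> M" using spl_M[OF u] by auto
        then show "\<tau> (E l * E (r * (p * (x j * (adj p * val v))))) = \<tau> (E l * r * (c * val v))"
          using pM vM by (simp add: tr_E_left mult.assoc c_def)
      qed
      moreover have "lsum (\<lambda>l r. \<tau> (E (val u * (p * (x j * (adj p * l)))) * E r)) (spl i v) = T3 c"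
        unfolding T3_def
      proof (rule lsum_cong)
        fix l r assume "(l, r) \<in> set (spl i v)"
        then have "l \<in> M" "r \<in> M" using spl_M[OF v] by auto
        then show "\<tau> (E (val u * (p * (x j * (adj p * l)))) * E r) = \<tau> (val u * (c * (l * E r)))"
          using pM uM by (simp add: tr_E_right mult.assoc c_def)
      qed
      moreover have "E (val u * p) * E (adj p * val v) = E (val u) * E (val v)"
      proof -
        have "E (val u * p) * E (adj p * val v) = E (val u) * (p * adj p) * E (val v)"
          using p(1) uM vM by (simp only: E_left E_right mult.assoc B.adj_in)
        then show ?thesis unfolding p(3) by simp
      qed
      ultimately show ?thesis by (auto simp: tr2_def lsum_spl_append k_def)
    qed
    moreover have "f i (val (u @ [(p, None), (x j, Some j), (adj p, None)] @ v)) = f i (val u * (c * val v))"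
      by (simp add: c_def mult.assoc)
    ultimately show ?thesis using H[OF p(1)] by (simp add: g_def c_def[symmetric])
  qed
  obtain s where s: "\<And>n::nat. s n \<in> avg B (x j)" "(\<lambda>n. n2 (s n - Y j)) \<longlonglongrightarrow> 0" using Y(3)[OF j] by blast
  have "(\<lambda>n. g (s n)) \<longlonglongrightarrow> g (Y j)"
    by (rule lf_lim[OF lfg avg_M[OF s(1) xM[OF j]] YM[OF j] s(2)])
  moreover have "g (s n) = k" for n by (rule lf_avg[OF lfg xM[OF j] base s(1)])
  ultimately have "g (Y j) = k" using LIMSEQ_unique[OF _ tendsto_const] by simp
  then show ?thesis using split[OF YM[OF j]] by (simp add: g_def algebra_simps)
qed

text \<open>Induction on the suffix with an arbitrary prefix of original letters. A letter
  \<open>Y j\<close> at the front of the suffix is reached by \<open>formula_limit\<close>, after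
  the prefix has been extended by \<open>p\<close>, \<open>x j\<close> and \<open>adj p\<close>; the
  remaining suffix may already contain averages.\<close>

lemma formula_aux:
  assumes i: "i \<in> I" and "w \<in> lists lets1" "u \<in> lists lets0"
  shows "f i (val (u @ w)) = tr2 i (u @ w)"
  using assms(2,3)
proof (induction w arbitrary: u rule: list.induct)
  case Nil
  then show ?case using base_formula[OF i, of u] by simp
next
  case (Cons a w)
  then have w: "w \<in> lists lets1" and a: "a \<in> lets1" by auto
  show ?case
  proof (cases "a \<in> lets0")
    case True
    then show ?thesis using Cons.IH[OF w, of "u @ [a]"] Cons.prems by simp
  next
    case False
    then obtain j where j: "j \<in> I" "a = (Y j, Some j)" using a by (auto simp: lets1_def)
    show ?thesis unfolding j(2)
    proof (rule formula_limit[OF j(1) i])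
      show "inM u" "inM w" using lists1_M lets0_lets1 Cons.prems w by blast+
      fix p assume "p \<in> B"
      then have "u @ [(p, None), (x j, Some j), (adj p, None)] \<in> lists lets0"
        using Cons.prems j(1) by (auto simp: lets0_def)
      from Cons.IH[OF w this]
      show "f i (val (u @ [(p, None), (x j, Some j), (adj p, None)] @ w)) =
        tr2 i (u @ [(p, None), (x j, Some j), (adj p, None)] @ w)" by simp
    qed
  qed
qed

lemma formula: "i \<in> I \<Longrightarrow> w \<in> lists lets1 \<Longrightarrow> f i (val w) = tr2 i w"
  using formula_aux[of i w "[]"] by simp

subsection \<open>Vectors in the domain of the adjoint derivation\<close>

text \<open>The inner product of \<open>adj a \<otimes> adj b\<close> with
  \<open>\<partial>\<^sub>i w\<close> in the tensor product relative to \<open>B\<close>, where two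
  simple tensors pair as \<open>\<tau> (adj b' * E (adj a' * l) * r)\<close> for
  \<open>a' \<otimes> b'\<close> and \<open>l \<otimes> r\<close>.\<close>

definition W :: "'i \<Rightarrow> 'h bop \<Rightarrow> 'h bop \<Rightarrow> ('h bop \<times> 'i option) list \<Rightarrow> complex" where
  "W i a b w = lsum (\<lambda>l r. \<tau> (b * (E (a * l) * r))) (spl i w)"

definition Wp where "Wp i a b \<gamma> = sum_list (map (W i a b) \<gamma>)"

lemma Wp_simps [simp]: "Wp i a b [] = 0" "Wp i a b (w # \<gamma>) = W i a b w + Wp i a b \<gamma>"
  "Wp i a b (\<gamma> @ \<gamma>') = Wp i a b \<gamma> + Wp i a b \<gamma>'"
  by (auto simp: Wp_def)

abbreviation "polys \<equiv> lists (lists lets1)"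

lemma valp_M: "\<gamma> \<in> polys \<Longrightarrow> valp \<gamma> \<in> M"
  by (induction \<gamma> rule: list.induct) (auto simp: lists1_M)

text \<open>The tensor \<open>adj a \<otimes> adj b\<close> belongs to the domain of the adjoint of
  \<open>\<partial>\<^sub>i\<close>, with \<open>K\<close> bounding the norm of its image.\<close>

definition dom_bound where
  "dom_bound i a b K \<longleftrightarrow> (\<forall>\<gamma>\<in>polys. cmod (Wp i a b \<gamma>) \<le> K * n2 (valp \<gamma>))"

text \<open>The Leibniz rule, solved for one of its terms: \<open>f i (val w0 * val w)\<close> is
  the pairing of \<open>val w0 \<otimes> 1\<close> with \<open>\<partial>\<^sub>i w\<close>, plus
  the term in which \<open>w0\<close> is differentiated, which is a bounded functional of
  \<open>val w\<close>.\<close>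

lemma dom_bound_poly:
  assumes i: "i \<in> I" and \<alpha>: "\<alpha> \<in> lists (lists lets0)"
  shows "\<exists>K\<ge>0. dom_bound i (valp \<alpha>) 1 K"
proof -
  have "\<exists>g. lf g \<and> (\<forall>w\<in>lists lets1. W i (valp \<alpha>) 1 w = g (val w))"
    using \<alpha>
  proof (induction \<alpha> rule: list.induct)
    case Nil
    have "lsum (\<lambda>l r. 0) L = (0::complex)" for L :: "('h bop \<times> 'h bop) list" by (induction L) auto
    then have "W i (valp []) 1 w = 0" for w by (simp add: W_def)
    then show ?case using lf_zero by blast
  next
    case (Cons w0 \<alpha>)
    then obtain g where g: "lf g" "\<And>w. w \<in> lists lets1 \<Longrightarrow> W i (valp \<alpha>) 1 w = g (val w)" by auto
    have w0: "w0 \<in> lists lets0" and \<alpha>: "\<alpha> \<in> lists (lists lets0)" using Cons.prems by auto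
    have w0M: "inM w0" using lists1_M[OF lets0_lets1[OF w0]] .
    have valM: "valp \<alpha> \<in> M" using \<alpha> lets0_lets1 by (intro valp_M) auto
    define h where "h c = f i (val w0 * c) - lsum (\<lambda>l r. \<tau> (E l * r * c)) (spl i w0)" for c
    have "lf h" unfolding h_def
    proof (intro lf_diff lf_lsum)
      show "lf (\<lambda>c. f i (val w0 * c))" using lf_conj[OF lf_f[OF i] val_M[OF w0M] one_in] by simp
      fix l r assume "(l, r) \<in> set (spl i w0)"
      then have "l \<in> M" "r \<in> M" using spl_M[OF w0M] by auto
      then show "lf (\<lambda>a. \<tau> (E l * r * a))" by (intro lf_tr_mult) auto
    qed
    moreover have "W i (valp (w0 # \<alpha>)) 1 w = h (val w) + g (val w)" if w: "w \<in> lists lets1" for w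
    proof -
      have wM: "inM w" using lists1_M[OF w] .
      have "w0 @ w \<in> lists lets1" using w lets0_lets1[OF w0] by auto
      from formula[OF i this]
      have "f i (val w0 * val w) = lsum (\<lambda>l r. \<tau> (E l * E (r * val w))) (spl i w0)
          + lsum (\<lambda>l r. \<tau> (E (val w0 * l) * E r)) (spl i w)"
        by (simp add: tr2_def lsum_spl_append)
      also have "lsum (\<lambda>l r. \<tau> (E l * E (r * val w))) (spl i w0) = lsum (\<lambda>l r. \<tau> (E l * r * val w)) (spl i w0)"
      proof (rule lsum_cong)
        fix l r assume "(l, r) \<in> set (spl i w0)"
        then have "l \<in> M" "r \<in> M" using spl_M[OF w0M] by auto
        then show "\<tau> (E l * E (r * val w)) = \<tau> (E l * r * val w)"
          using wM by (simp add: tr_E_left mult.assoc)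
      qed
      also have "lsum (\<lambda>l r. \<tau> (E (val w0 * l) * E r)) (spl i w) = W i (val w0) 1 w"
        unfolding W_def
      proof (rule lsum_cong)
        fix l r assume "(l, r) \<in> set (spl i w)"
        then have "l \<in> M" "r \<in> M" using spl_M[OF wM] by auto
        then show "\<tau> (E (val w0 * l) * E r) = \<tau> (1 * (E (val w0 * l) * r))"
          using w0M by (simp add: tr_E_left)
      qed
      finally have "W i (val w0) 1 w = h (val w)" by (simp add: h_def)
      moreover have "W i (valp (w0 # \<alpha>)) 1 w = W i (val w0) 1 w + W i (valp \<alpha>) 1 w"
        unfolding W_def lsum_add[symmetric]
      proof (rule lsum_cong)
        fix l r assume "(l, r) \<in> set (spl i w)"
        then have "l \<in> M" "r \<in> M" using spl_M[OF wM] by auto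
        then show "\<tau> (1 * (E (valp (w0 # \<alpha>) * l) * r)) = \<tau> (1 * (E (val w0 * l) * r)) + \<tau> (1 * (E (valp \<alpha> * l) * r))"
          using w0M valM by (simp add: distrib_right E_add tr_add)
      qed
      ultimately show ?thesis using g(2)[OF w] by simp
    qed
    ultimately show ?case using lf_add[OF _ g(1), of h] by blast
  qed
  then obtain g where g: "lf g" "\<And>w. w \<in> lists lets1 \<Longrightarrow> W i (valp \<alpha>) 1 w = g (val w)" by blast
  have "Wp i (valp \<alpha>) 1 \<gamma> = g (valp \<gamma>)" if "\<gamma> \<in> polys" for \<gamma>
    using that
  proof (induction \<gamma> rule: list.induct)
    case (Cons w \<gamma>)
    then show ?case using g by (simp add: lfD(1)[OF g(1)] lists1_M valp_M)
  qed (simp add: lf_zero_at g)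
  then show ?thesis using lfD(3)[OF g(1)] valp_M unfolding dom_bound_def by metis
qed

lemma W_linear_left:
  assumes "a \<in> M" "a' \<in> M" "w \<in> lists lets1"
  shows "W i (a + a') 1 w = W i a 1 w + W i a' 1 w" "W i (c *\<^sub>C a) 1 w = c * W i a 1 w"
proof -
  have m: "l \<in> M" "r \<in> M" if "(l, r) \<in> set (spl i w)" for l r
    using spl_M[OF lists1_M[OF assms(3)] that] by auto
  show "W i (a + a') 1 w = W i a 1 w + W i a' 1 w"
    unfolding W_def lsum_add[symmetric]
    by (rule lsum_cong) (use assms m in \<open>simp add: distrib_right E_add tr_add\<close>)
  show "W i (c *\<^sub>C a) 1 w = c * W i a 1 w"
    unfolding W_def lsum_mult[symmetric]
    by (rule lsum_cong) (use assms m in \<open>simp add: E_scaleC tr_scaleC\<close>)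
qed

lemma Wp_linear_left:
  assumes "a \<in> M" "a' \<in> M" "\<gamma> \<in> polys"
  shows "Wp i (a + a') 1 \<gamma> = Wp i a 1 \<gamma> + Wp i a' 1 \<gamma>" "Wp i (c *\<^sub>C a) 1 \<gamma> = c * Wp i a 1 \<gamma>"
  using assms(3) by (induction \<gamma> rule: list.induct) (auto simp: W_linear_left[OF assms(1,2)] distrib_left)

lemma lf_Wp_left: assumes "\<gamma> \<in> polys" shows "lf (\<lambda>a. Wp i a 1 \<gamma>)"
  using assms
proof (induction \<gamma> rule: list.induct)
  case (Cons w \<gamma>)
  have wM: "inM w" using Cons.prems lists1_M by auto
  have "lf (\<lambda>a. W i a 1 w)"
  proof -
    have "lf (\<lambda>a. lsum (\<lambda>l r. \<tau> (1 * (a * (l * E r)))) (spl i w))"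
    proof (rule lf_lsum)
      fix l r assume "(l, r) \<in> set (spl i w)"
      then have "l \<in> M" "r \<in> M" using spl_M[OF wM] by auto
      then show "lf (\<lambda>a. \<tau> (1 * (a * (l * E r))))" by (intro lf_conj[OF lf_tr]) auto
    qed
    moreover have "lsum (\<lambda>l r. \<tau> (1 * (a * (l * E r)))) (spl i w) = W i a 1 w" if "a \<in> M" for a
      unfolding W_def
    proof (rule lsum_cong)
      fix l r assume "(l, r) \<in> set (spl i w)"
      then have "l \<in> M" "r \<in> M" using spl_M[OF wM] by auto
      then show "\<tau> (1 * (a * (l * E r))) = \<tau> (1 * (E (a * l) * r))"
        using that tr_E_left[of "a * l" r] tr_E_right[of "a * l" r] by (simp add: mult.assoc)
    qed
    ultimately show ?thesis by (rule lf_cong)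
  qed
  then show ?case using Cons by (auto intro!: lf_add)
qed (simp add: lf_zero)

lemma half_le: assumes "w \<le> (1/2) * (a + b)" "a \<le> k" "b \<le> k" shows "w \<le> (k::real)"
proof -
  have "(1/2) * (a + b) \<le> (1/2) * (k + k)" using assms by (intro mult_left_mono add_mono) auto
  then show ?thesis using assms(1) by simp
qed

text \<open>As \<open>\<partial>\<^sub>i\<close> vanishes on \<open>B\<close>, conjugating
  \<open>a\<close> by a unitary amounts to conjugating the polynomial by the adjoint unitary, which
  preserves its trace norm. So the same \<open>K\<close> serves all averages and their
  limit.\<close>

lemma dom_bound_average:
  assumes K: "dom_bound i a 1 K" and a: "a \<in> M" and s: "\<And>n::nat. s n \<in> avg B a" and y: "y \<in> M"
    and lim: "(\<lambda>n. n2 (s n - y)) \<longlonglongrightarrow> 0"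
  shows "dom_bound i y 1 K"
proof -
  have av: "cmod (Wp i c 1 \<gamma>) \<le> K * n2 (valp \<gamma>)" if "c \<in> avg B a" "\<gamma> \<in> polys" for c \<gamma>
    using that
  proof (induction arbitrary: \<gamma> rule: avg.induct)
    case (base u)
    have uM: "u \<in> M" "adj u \<in> M" using base by auto
    define h where "h w = [(adj u, None)] @ w @ [(u, None)]" for w :: "('h bop \<times> 'i option) list"
    have "(u, None) \<in> lets1" "(adj u, None) \<in> lets1"
      using B_lets0 base(1) B.adj_in[OF base(1)] by (simp_all add: lets1_def)
    then have hw: "h w \<in> lists lets1" if "w \<in> lists lets1" for w using that by (simp add: h_def)
    have hp: "map h \<gamma> \<in> polys"
      using base(4) by (induction \<gamma> rule: list.induct) (simp_all only: list.map lists.Nil Cons_in_lists_iff hw)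
    have hW: "W i (u * a * adj u) 1 w = W i a 1 (h w)" if w: "w \<in> lists lets1" for w
    proof -
      have "W i a 1 (h w) = lsum (\<lambda>l r. \<tau> (1 * (E (a * (adj u * l)) * (r * u)))) (spl i w)"
        unfolding h_def W_def by (simp only: lsum_spl_append) simp
      also have "\<dots> = W i (u * a * adj u) 1 w"
        unfolding W_def
      proof (rule lsum_cong)
        fix l r assume "(l, r) \<in> set (spl i w)"
        then have lr: "l \<in> M" "r \<in> M" using spl_M[OF lists1_M[OF w]] by auto
        have "\<tau> ((E (a * (adj u * l)) * r) * u) = \<tau> (u * (E (a * (adj u * l)) * r))"
          using lr uM a by (intro tr_comm) auto
        also have "u * (E (a * (adj u * l)) * r) = E (u * (a * (adj u * l))) * r"
          using lr uM a base by (simp add: E_left mult.assoc)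
        finally show "\<tau> (1 * (E (a * (adj u * l)) * (r * u))) = \<tau> (1 * (E (u * a * adj u * l) * r))"
          by (simp add: mult.assoc)
      qed
      finally show ?thesis by simp
    qed
    have "Wp i (u * a * adj u) 1 \<gamma> = Wp i a 1 (map h \<gamma>)"
      using base(4) by (induction \<gamma> rule: list.induct) (auto simp: hW)
    also have "cmod \<dots> \<le> K * n2 (valp (map h \<gamma>))" using K hp unfolding dom_bound_def by blast
    also have "valp (map h \<gamma>) = adj u * valp \<gamma> * u"
      by (rule valp_map) (simp add: h_def mult.assoc)
    also have "n2 (adj u * valp \<gamma> * u) = n2 (valp \<gamma>)"
    proof -
      have vM: "valp \<gamma> \<in> M" using valp_M base by blast
      have "adj (adj u * valp \<gamma> * u) * (adj u * valp \<gamma> * u) = adj u * (adj (valp \<gamma>) * (u * adj u) * valp \<gamma>) * u"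
        by (simp add: mult.assoc)
      also have "\<dots> = adj u * ((adj (valp \<gamma>) * valp \<gamma>) * u)" using base by (simp add: mult.assoc)
      also have "\<tau> \<dots> = \<tau> (((adj (valp \<gamma>) * valp \<gamma>) * u) * adj u)" using uM vM by (intro tr_comm) auto
      also have "((adj (valp \<gamma>) * valp \<gamma>) * u) * adj u = adj (valp \<gamma>) * valp \<gamma>" using base by (simp add: mult.assoc)
      finally show ?thesis by (simp add: trace_norm2_def del: adj_simps)
    qed
    finally show ?case .
  next
    case (mid c d)
    have M: "c \<in> M" "d \<in> M" using mid.hyps avg_M a by blast+
    have "Wp i (complex_of_real (1/2) *\<^sub>C (c + d)) 1 \<gamma> = complex_of_real (1/2) * (Wp i c 1 \<gamma> + Wp i d 1 \<gamma>)"
      using M mid.prems by (simp add: Wp_linear_left del: of_real_divide)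
    then have "cmod (Wp i (complex_of_real (1/2) *\<^sub>C (c + d)) 1 \<gamma>) = (1/2) * cmod (Wp i c 1 \<gamma> + Wp i d 1 \<gamma>)"
      by (simp add: norm_mult del: of_real_divide)
    also have "\<dots> \<le> (1/2) * (cmod (Wp i c 1 \<gamma>) + cmod (Wp i d 1 \<gamma>))"
      by (intro mult_left_mono norm_triangle_ineq) simp
    finally show ?case by (rule half_le[OF _ mid.IH(1)[OF mid.prems] mid.IH(2)[OF mid.prems]])
  qed
  show ?thesis unfolding dom_bound_def
  proof
    fix \<gamma> assume g: "\<gamma> \<in> polys"
    have "(\<lambda>n. Wp i (s n) 1 \<gamma>) \<longlonglongrightarrow> Wp i y 1 \<gamma>"
      by (rule lf_lim[OF lf_Wp_left[OF g] avg_M[OF s a] y lim])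
    from LIMSEQ_le_const2[OF tendsto_norm[OF this]] av[OF s g]
    show "cmod (Wp i y 1 \<gamma>) \<le> K * n2 (valp \<gamma>)" by blast
  qed
qed

end

section \<open>Weights coming from operators\<close>

lemma lins_cong: "(\<And>\<kappa>. \<kappa> \<in> Poly_Mapping.keys p \<Longrightarrow> g \<kappa> = g' \<kappa>) \<Longrightarrow> lins sc g p = lins sc g' p"
  unfolding lins_def by (intro sum.cong refl) simp

lemma tfree_cong: "tfree p \<Longrightarrow> (\<And>k m. g (k, 0, m) = g' (k, 0, m)) \<Longrightarrow> lins sc g p = lins sc g' p"
  by (rule lins_cong) (auto simp: tfree_def)

lemma Lw_subst: "Lw w (subst h p) = Lw (\<lambda>\<kappa>. w (h \<kappa>)) p"
  by (induction p rule: pol_induct) (simp_all add: subst_zero subst_add subst_mono)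

lemma Lw_mult: "Lw w (p * q) = Lw (\<lambda>\<kappa>. Lw (\<lambda>\<kappa>'. w (\<kappa> + \<kappa>')) q) p"
proof (induction p rule: pol_induct)
  case (add p \<kappa> c)
  have "Lw w (mnm \<kappa> c * q) = c * Lw (\<lambda>\<kappa>'. w (\<kappa> + \<kappa>')) q"
    by (induction q rule: pol_induct) (simp_all add: distrib_left mult_single mult.assoc)
  then show ?case using add by (simp add: distrib_right)
qed simp

lemma Lw_mult_sum: "Lw w (p * q) = (\<Sum>\<kappa>\<in>Poly_Mapping.keys p. \<Sum>\<kappa>'\<in>Poly_Mapping.keys q.
    Poly_Mapping.lookup p \<kappa> * (Poly_Mapping.lookup q \<kappa>' * w (\<kappa> + \<kappa>')))"
  unfolding Lw_mult by (simp add: lins_def sum_distrib_left)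

abbreviation Lop :: "(nat \<times> nat \<times> nat \<Rightarrow> 'h::complex_hilbert_space bop) \<Rightarrow> pol \<Rightarrow> 'h bop" where
  "Lop \<equiv> lins (\<lambda>c a. complex_of_real c *\<^sub>C a)"

interpretation cplx_sc: scaling "\<lambda>c (z::complex). complex_of_real c * z"
  by unfold_locales (auto simp: distrib_right)

abbreviation Lc :: "(nat \<times> nat \<times> nat \<Rightarrow> complex) \<Rightarrow> pol \<Rightarrow> complex" where
  "Lc \<equiv> lins (\<lambda>c z. complex_of_real c * z)"

lemma Lop_diff: "Lop w (p - q) = Lop w p - Lop w q"
proof -
  have "Lop w (p - q) + Lop w q = Lop w p" using op_sc.lins_add[of w "p - q" q] by simp
  then show ?thesis by (simp add: algebra_simps)
qed

lemma (in vna) Lop_in: "(\<And>\<kappa>. w \<kappa> \<in> M) \<Longrightarrow> Lop w p \<in> M"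
  unfolding lins_def by (intro sum_in) auto

lemma (in tracial_vna) lf_Lop:
  assumes "lf g" "\<And>\<kappa>. w \<kappa> \<in> M" shows "g (Lop w p) = Lc (\<lambda>\<kappa>. g (w \<kappa>)) p"
  by (induction p rule: pol_induct)
    (simp_all add: lf_zero_at[OF assms(1)] lfD(1,2)[OF assms(1)] assms(2) Lop_in)

lemma Re_Lc: "Re (Lc w p) = Lw (\<lambda>\<kappa>. Re (w \<kappa>)) p"
  by (induction p rule: pol_induct) simp_all

text \<open>Products of the generators \<open>K\<^sup>2 - v\<^sup>2\<close> are absorbed into the weight.\<close>

definition triadd :: "'h::complex_hilbert_space bop set \<Rightarrow> ('h bop \<Rightarrow> 'h bop \<Rightarrow> 'h bop \<Rightarrow> real) \<Rightarrow> bool" where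
  "triadd M g \<longleftrightarrow> (\<forall>a\<in>M. \<forall>b\<in>M. \<forall>c\<in>M. \<forall>d\<in>M. \<forall>r.
     g (complex_of_real r *\<^sub>C a - b) c d = r * g a c d - g b c d \<and>
     g c (complex_of_real r *\<^sub>C a - b) d = r * g c a d - g c b d \<and>
     g c d (complex_of_real r *\<^sub>C a - b) = r * g c d a - g c d b)"

context vna
begin

definition wt :: "('h bop \<Rightarrow> 'h bop \<Rightarrow> 'h bop \<Rightarrow> real) \<Rightarrow> 'h bop \<Rightarrow> 'h bop \<Rightarrow> nat \<Rightarrow> nat \<Rightarrow> nat \<Rightarrow>
    nat \<times> nat \<times> nat \<Rightarrow> real" where
  "wt g y A a b c = (\<lambda>(k, l, m). g (y ^ k * A ^ a) (y ^ l * A ^ b) (y ^ m * A ^ c))"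

lemma wt_gen:
  assumes g: "triadd M g" and y: "y \<in> M" and A: "A = complex_of_real (K * K) *\<^sub>C 1 - y * y"
  shows "Lw (wt g y A a b c) (gen K vs * p) = Lw (wt g y A (Suc a) b c) p"
    "Lw (wt g y A a b c) (gen K vt * p) = Lw (wt g y A a (Suc b) c) p"
    "Lw (wt g y A a b c) (gen K vr * p) = Lw (wt g y A a b (Suc c)) p"
proof -
  have AM: "A \<in> M" using y by (simp add: A)
  have pw: "y ^ k * A ^ Suc a = complex_of_real (K * K) *\<^sub>C (y ^ k * A ^ a) - y ^ (2 + k) * A ^ a" for k a
  proof -
    have "y ^ k * A ^ Suc a = y ^ k * (complex_of_real (K * K) *\<^sub>C 1 - y * y) * A ^ a"
      unfolding A power_Suc by (simp only: mult.assoc)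
    also have "\<dots> = complex_of_real (K * K) *\<^sub>C (y ^ k * A ^ a) - y ^ k * (y * y) * A ^ a"
      by (simp only: right_diff_distrib left_diff_distrib scaleC_bop_simps mult_1_right)
    also have "y ^ k * (y * y) = y ^ (2 + k)"
      by (metis add.commute power2_eq_square power_add)
    finally show ?thesis .
  qed
  have M: "y ^ k * A ^ a \<in> M" for k a using y AM by auto
  note t = g[unfolded triadd_def, rule_format]
  have sq: "vs * vs = mnm (2, 0, 0) 1" "vt * vt = mnm (0, 2, 0) 1" "vr * vr = mnm (0, 0, 2) 1"
    by (simp_all add: vs_def vt_def vr_def mult_single numeral_2_eq_2)
  show "Lw (wt g y A a b c) (gen K vs * p) = Lw (wt g y A (Suc a) b c) p"
  proof (induction p rule: pol_induct)
    case (add p \<kappa> e)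
    obtain k l m where \<kappa>: "\<kappa> = (k, l, m)" by (cases \<kappa>)
    have "Lw (wt g y A a b c) (gen K vs * mnm \<kappa> e) = e * wt g y A (Suc a) b c \<kappa>"
      unfolding gen_def left_diff_distrib Lw_diff Lw_cst sq \<kappa> mult_single real_sc.lins_mono
      unfolding wt_def by (simp only: case_prod_conv pw add_Pair t(1)[OF M M M M] add_0_left mult_1_left) (simp add: algebra_simps)
    then show ?case using add by (simp add: distrib_left)
  qed simp
  show "Lw (wt g y A a b c) (gen K vt * p) = Lw (wt g y A a (Suc b) c) p"
  proof (induction p rule: pol_induct)
    case (add p \<kappa> e)
    obtain k l m where \<kappa>: "\<kappa> = (k, l, m)" by (cases \<kappa>)
    have "Lw (wt g y A a b c) (gen K vt * mnm \<kappa> e) = e * wt g y A a (Suc b) c \<kappa>"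
      unfolding gen_def left_diff_distrib Lw_diff Lw_cst sq \<kappa> mult_single real_sc.lins_mono
      unfolding wt_def by (simp only: case_prod_conv pw add_Pair t[OF M M M M] add_0_left mult_1_left) (simp add: algebra_simps)
    then show ?case using add by (simp add: distrib_left)
  qed simp
  show "Lw (wt g y A a b c) (gen K vr * p) = Lw (wt g y A a b (Suc c)) p"
  proof (induction p rule: pol_induct)
    case (add p \<kappa> e)
    obtain k l m where \<kappa>: "\<kappa> = (k, l, m)" by (cases \<kappa>)
    have "Lw (wt g y A a b c) (gen K vr * mnm \<kappa> e) = e * wt g y A a b (Suc c) \<kappa>"
      unfolding gen_def left_diff_distrib Lw_diff Lw_cst sq \<kappa> mult_single real_sc.lins_mono
      unfolding wt_def by (simp only: case_prod_conv pw add_Pair t[OF M M M M] add_0_left mult_1_left) (simp add: algebra_simps)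
    then show ?case using add by (simp add: distrib_left)
  qed simp
qed

lemma wt_gens:
  assumes "triadd M g" "y \<in> M" "A = complex_of_real (K * K) *\<^sub>C 1 - y * y"
  shows "Lw (wt g y A 0 0 0) (p * (gen K vs ^ a * gen K vt ^ b * gen K vr ^ c)) = Lw (wt g y A a b c) p"
proof -
  note w = wt_gen[OF assms]
  have 1: "Lw (wt g y A a0 b0 c0) (gen K vs ^ a * p) = Lw (wt g y A (a0 + a) b0 c0) p" for a0 b0 c0 p
    by (induction a arbitrary: a0) (simp_all add: mult.assoc w)
  have 2: "Lw (wt g y A a0 b0 c0) (gen K vt ^ b * p) = Lw (wt g y A a0 (b0 + b) c0) p" for a0 b0 c0 p
    by (induction b arbitrary: b0) (simp_all add: mult.assoc w)
  have 3: "Lw (wt g y A a0 b0 c0) (gen K vr ^ c * p) = Lw (wt g y A a0 b0 (c0 + c)) p" for a0 b0 c0 p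
    by (induction c arbitrary: c0) (simp_all add: mult.assoc w)
  have "p * (gen K vs ^ a * gen K vt ^ b * gen K vr ^ c) = gen K vs ^ a * (gen K vt ^ b * (gen K vr ^ c * p))"
    by (simp add: mult_ac)
  then show ?thesis by (simp only: 1 2 3) simp
qed

lemma posw_wt:
  assumes "triadd M g" "y \<in> M" "A = complex_of_real (K * K) *\<^sub>C 1 - y * y"
    and "\<And>q a b c. 0 \<le> Lw (wt g y A a b c) (q * q)"
  shows "posw K (wt g y A 0 0 0)"
  unfolding posw_def wt_gens[OF assms(1-3)] using assms(4) by blast

lemma cosquare_root:
  assumes y: "y \<in> M" "adj y = y" and K: "nrm y \<le> K"
  obtains D where "D \<in> M" "adj D = D" "D * D = complex_of_real (K * K) *\<^sub>C 1 - y * y"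
    "\<And>z. z * y = y * z \<Longrightarrow> z * D = D * z"
proof -
  define A where "A = complex_of_real (K * K) *\<^sub>C 1 - y * y"
  have AM: "A \<in> M" using y by (simp add: A_def)
  have pos: "pos_op A"
  proof (rule pos_opI)
    show "adj A = A" by (simp add: A_def y)
    fix v
    have "norm (y \<rhd> v) \<le> K * norm v"
      using norm_ap_le[of y v] mult_right_mono[OF K, of "norm v"] by simp
    then have "(norm (y \<rhd> v))\<^sup>2 \<le> (K * norm v)\<^sup>2" by (rule power_mono) simp
    then show "0 \<le> qf A v" unfolding A_def qf_simps using qf_adj_mult[of v y] y(2)
      by (simp add: power_mult_distrib power2_eq_square[of K])
  qed
  obtain D where D: "D \<in> M" "pos_op D" "D * D = A" "\<And>z. z * A = A * z \<Longrightarrow> z * D = D * z"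
    using sqrt_in[OF AM pos] by blast
  show ?thesis
  proof (rule that)
    show "z * D = D * z" if "z * y = y * z" for z
    proof (rule D(4))
      have "z * (y * y) = (y * y) * z" using that by (metis mult.assoc)
      then show "z * A = A * z" by (simp add: A_def right_diff_distrib left_diff_distrib)
    qed
  qed (rule D(1) pos_op_adj[OF D(2)] D(3)[unfolded A_def])+
qed

end

lemma power_commute_bop:
  fixes y :: "'h::complex_hilbert_space bop"
  shows "z * y = y * z \<Longrightarrow> z * y ^ n = y ^ n * z"
  by (rule power_commuting_commutes[symmetric]) simp

subsection \<open>Complete positivity over finite index sets\<close>

lemma (in vna) schur_positive_set:
  fixes t :: "'k \<Rightarrow> 'k \<Rightarrow> 'h bop" and b :: "'k \<Rightarrow> 'h bop"
  assumes F: "finite F" and tM: "\<And>k l. k \<in> F \<Longrightarrow> l \<in> F \<Longrightarrow> t k l \<in> M"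
    and tadj: "\<And>k l. k \<in> F \<Longrightarrow> l \<in> F \<Longrightarrow> adj (t k l) = t l k"
    and pos: "\<And>\<beta>. (\<And>k. k \<in> F \<Longrightarrow> \<beta> k \<in> M) \<Longrightarrow> pos_op (\<Sum>k\<in>F. \<Sum>l\<in>F. adj (\<beta> k) * t k l * \<beta> l)"
  shows "pos_op (\<Sum>k\<in>F. \<Sum>l\<in>F. adj (b k) * t k l * b l)"
proof -
  obtain e where e: "bij_betw e {0..<card F} F" using ex_bij_betw_nat_finite[OF F] by blast
  then have e: "bij_betw e {..<card F} F" by (simp add: lessThan_atLeast0)
  have eF: "e k \<in> F" if "k < card F" for k using bij_betwE[OF e] that by auto
  have sums: "(\<Sum>k\<in>F. \<Sum>l\<in>F. g k l) = (\<Sum>k<card F. \<Sum>l<card F. g (e k) (e l))" for g :: "'k \<Rightarrow> 'k \<Rightarrow> 'h bop"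
    by (simp add: sum.reindex_bij_betw[OF e, symmetric])
  have "pos_op (\<Sum>k<card F. \<Sum>l<card F. adj (b (e k)) * t (e k) (e l) * b (e l))"
  proof (rule schur_positive[where t = "\<lambda>k l. t (e k) (e l)" and b = "\<lambda>k. b (e k)"])
    fix \<beta> :: "nat \<Rightarrow> 'h bop" assume \<beta>: "\<And>k. k < card F \<Longrightarrow> \<beta> k \<in> M"
    define \<beta>' where "\<beta>' k = \<beta> (the_inv_into {..<card F} e k)" for k
    have \<beta>e: "\<beta>' (e k) = \<beta> k" if "k < card F" for k
      unfolding \<beta>'_def using the_inv_into_f_f[of e "{..<card F}" k] e that by (simp add: bij_betw_def)
    have "\<beta>' k \<in> M" if "k \<in> F" for k
    proof -
      have "k \<in> e ` {..<card F}" using bij_betw_imp_surj_on[OF e] that by simp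
      then obtain k' where "k' < card F" "k = e k'" by blast
      then show ?thesis using \<beta> \<beta>e by simp
    qed
    from pos[of \<beta>', OF this] show "pos_op (\<Sum>k<card F. \<Sum>l<card F. adj (\<beta> k) * t (e k) (e l) * \<beta> l)"
      unfolding sums by (simp add: \<beta>e)
  qed (auto intro: tM tadj eF)
  then show ?thesis unfolding sums .
qed

context cond_exp
begin

lemma E_cp_set:
  fixes a b :: "'k \<Rightarrow> 'h bop"
  assumes F: "finite F" and aM: "\<And>k. k \<in> F \<Longrightarrow> a k \<in> M"
  shows "pos_op (\<Sum>k\<in>F. \<Sum>l\<in>F. adj (b k) * E (adj (a k) * a l) * b l)"
proof -
  obtain e where e: "bij_betw e {0..<card F} F" using ex_bij_betw_nat_finite[OF F] by blast
  then have e: "bij_betw e {..<card F} F" by (simp add: lessThan_atLeast0)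
  have "pos_op (\<Sum>k<card F. \<Sum>l<card F. adj (b (e k)) * E (adj (a (e k)) * a (e l)) * b (e l))"
    by (rule E_completely_positive[where a = "\<lambda>k. a (e k)" and b = "\<lambda>k. b (e k)"])
      (use bij_betwE[OF e] aM in auto)
  moreover have "(\<Sum>k\<in>F. \<Sum>l\<in>F. g k l) = (\<Sum>k<card F. \<Sum>l<card F. g (e k) (e l))" for g :: "'k \<Rightarrow> 'k \<Rightarrow> 'h bop"
    by (simp add: sum.reindex_bij_betw[OF e, symmetric])
  ultimately show ?thesis by simp
qed

text \<open>A Schur product of two positive kernels. Because the \<open>b k\<close> commute with
  \<open>B\<close>, the product with coefficients from \<open>B\<close> is \<open>E\<close> applied
  to the first kernel with coefficients \<open>b k * \<beta> k\<close>.\<close>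

lemma E_cp_hadamard:
  fixes a b c :: "'k \<Rightarrow> 'h bop"
  assumes F: "finite F" and aM: "\<And>k. k \<in> F \<Longrightarrow> a k \<in> M" and bQ: "\<And>k. k \<in> F \<Longrightarrow> b k \<in> Q"
  shows "pos_op (\<Sum>k\<in>F. \<Sum>l\<in>F. adj (c k) * (E (adj (a k) * a l) * E (adj (b k) * b l)) * c l)"
proof (rule B.schur_positive_set[OF F, where t = "\<lambda>k l. E (adj (a k) * a l) * E (adj (b k) * b l)" and b = c])
  fix k l assume kl: "k \<in> F" "l \<in> F"
  have q: "adj (b k) * b l \<in> Q" using kl bQ by (intro Q_closed) auto
  have q': "adj (b l) * b k \<in> Q" using kl bQ by (intro Q_closed) auto
  have aM': "adj (a k) * a l \<in> M" "adj (a l) * a k \<in> M" using kl aM by auto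
  show "E (adj (a k) * a l) * E (adj (b k) * b l) \<in> B" using aM' q by auto
  have "adj (E (adj (a k) * a l) * E (adj (b k) * b l)) = E (adj (b l) * b k) * E (adj (a l) * a k)"
    using aM' q by (simp add: E_adj[symmetric] Q_M)
  then show "adj (E (adj (a k) * a l) * E (adj (b k) * b l)) = E (adj (a l) * a k) * E (adj (b l) * b k)"
    using E_Q_comm[OF q', of "E (adj (a l) * a k)"] aM' by simp
next
  fix \<beta> assume \<beta>: "\<And>k. k \<in> F \<Longrightarrow> \<beta> k \<in> B"
  define T where "T = (\<Sum>k\<in>F. \<Sum>l\<in>F. adj (b k * \<beta> k) * E (adj (a k) * a l) * (b l * \<beta> l))"
  have "pos_op T" unfolding T_def by (rule E_cp_set[OF F aM])
  have tM: "adj (b k * \<beta> k) * E (adj (a k) * a l) * (b l * \<beta> l) \<in> M" if "k \<in> F" "l \<in> F" for k l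
    using that aM bQ[THEN Q_M] \<beta> by auto
  have TM: "T \<in> M" unfolding T_def by (intro sum_in tM)
  have "E T = (\<Sum>k\<in>F. \<Sum>l\<in>F. E (adj (b k * \<beta> k) * E (adj (a k) * a l) * (b l * \<beta> l)))"
  proof -
    have "E T = (\<Sum>k\<in>F. E (\<Sum>l\<in>F. adj (b k * \<beta> k) * E (adj (a k) * a l) * (b l * \<beta> l)))"
      unfolding T_def by (rule E_sum, intro sum_in tM)
    also have "\<dots> = (\<Sum>k\<in>F. \<Sum>l\<in>F. E (adj (b k * \<beta> k) * E (adj (a k) * a l) * (b l * \<beta> l)))"
      by (intro sum.cong refl E_sum tM)
    finally show ?thesis .
  qed
  also have "\<dots> = (\<Sum>k\<in>F. \<Sum>l\<in>F. adj (\<beta> k) * (E (adj (a k) * a l) * E (adj (b k) * b l)) * \<beta> l)"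
  proof (intro sum.cong refl)
    fix k l assume kl: "k \<in> F" "l \<in> F"
    have e: "E (adj (a k) * a l) \<in> B" using aM kl by auto
    have bb: "adj (b k) * E (adj (a k) * a l) = E (adj (a k) * a l) * adj (b k)"
      using Q_comm[OF Q_closed(4)[OF bQ[OF kl(1)]] e] .
    have "adj (b k * \<beta> k) * E (adj (a k) * a l) * (b l * \<beta> l) =
      adj (\<beta> k) * (adj (b k) * E (adj (a k) * a l)) * b l * \<beta> l" by (simp add: mult.assoc)
    also have "\<dots> = (adj (\<beta> k) * E (adj (a k) * a l)) * (adj (b k) * b l) * \<beta> l"
      unfolding bb by (simp add: mult.assoc)
    also have "E \<dots> = (adj (\<beta> k) * E (adj (a k) * a l)) * E (adj (b k) * b l) * \<beta> l"
      by (rule E_bimod) (use kl \<beta> e bQ[THEN Q_M] in auto)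
    finally show "E (adj (b k * \<beta> k) * E (adj (a k) * a l) * (b l * \<beta> l)) =
      adj (\<beta> k) * (E (adj (a k) * a l) * E (adj (b k) * b l)) * \<beta> l" by (simp add: mult.assoc)
  qed
  finally show "pos_op (\<Sum>k\<in>F. \<Sum>l\<in>F. adj (\<beta> k) * (E (adj (a k) * a l) * E (adj (b k) * b l)) * \<beta> l)"
    using E_pos[OF TM \<open>pos_op T\<close>] by simp
qed

end

section \<open>A variable with a conjugate is relatively diffuse\<close>

locale rel_var = cond_exp M \<tau> B E for M :: "'h::complex_hilbert_space bop set" and \<tau> B E +
  fixes y :: "'h bop" and K :: real
  assumes yQ: "y \<in> Q" and ysa: "adj y = y" and yK: "nrm y \<le> K" and K0: "K > 0"
begin

lemma yM [simp]: "y \<in> M" using yQ by blast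

lemma yp [simp]: "y ^ k \<in> M" "y ^ k \<in> Q" "adj (y ^ k) = y ^ k"
  by (intro power_in yM) (intro Q_closed(6) yQ, simp only: adj_power ysa)

lemma Ey_comm: "b \<in> B \<Longrightarrow> b * E (y ^ k) = E (y ^ k) * b"
  by (rule E_Q_comm) simp

lemma y_B_comm: "b \<in> B \<Longrightarrow> y ^ k * b = b * y ^ k"
  by (rule Q_comm) simp

lemma Ey_adj: "adj (E (y ^ k)) = E (y ^ k)"
  by (rule E_selfadj) (simp_all add: ysa)

section \<open>Moments of the variable relative to \<open>B\<close> and their positivity\<close>

definition g3 :: "'h bop \<Rightarrow> 'h bop \<Rightarrow> 'h bop \<Rightarrow> real" where
  "g3 a b c = Re (\<tau> (E a * E b * E c))"

text \<open>In the commutative picture, the joint moments of three copies of \<open>y\<close> that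
  are conditionally independent over \<open>B\<close>.\<close>

definition w3 :: "nat \<times> nat \<times> nat \<Rightarrow> real" where
  "w3 = (\<lambda>(k, l, m). Re (\<tau> (E (y ^ k) * E (y ^ l) * E (y ^ m))))"

lemma triadd_g3: "triadd M g3"
  unfolding triadd_def g3_def
  by (intro ballI allI conjI)
    (simp_all add: E_diff E_scaleC right_diff_distrib left_diff_distrib tr_diff tr_scaleC)

text \<open>Two of the copies are covered by \<open>E_cp_hadamard\<close>, the third by its outer
  coefficients. The root \<open>D\<close> distributes the powers of
  \<open>K\<^sup>2 - y\<^sup>2\<close> evenly over both sides of each kernel.\<close>

lemma posw_w3: "posw K w3"
proof -
  obtain D where D: "D \<in> M" "adj D = D" "D * D = complex_of_real (K * K) *\<^sub>C 1 - y * y"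
    "\<And>z. z * y = y * z \<Longrightarrow> z * D = D * z" using cosquare_root[OF yM ysa yK] by blast
  have DQ: "D \<in> Q"
  proof -
    have "b * y = y * b" if "b \<in> B" for b using Q_comm[OF yQ that] by simp
    then have "b * D = D * b" if "b \<in> B" for b using D(4) that by blast
    then show ?thesis using D(1) by (auto simp: Q_def commutant_def)
  qed
  have yD: "y * D = D * y" by (rule D(4)) simp
  have cc: "D ^ m * y ^ k = y ^ k * D ^ m" for k m
    by (metis yD power_commute_bop)
  have pw: "(D * D) ^ a = D ^ a * D ^ a" for a
    by (simp add: power_mult_distrib[symmetric] power_commuting_commutes power_add[symmetric] mult_2[symmetric] power_mult power2_eq_square)
  define v where "v k a = y ^ k * D ^ a" for k a
  have vQ: "v k a \<in> Q" for k a unfolding v_def using yQ DQ by (intro Q_closed) auto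
  have vM: "v k a \<in> M" for k a using vQ by blast
  have vv: "adj (v k a) * v k' a = y ^ (k + k') * (D * D) ^ a" for k k' a
  proof -
    have "adj (v k a) * v k' a = D ^ a * (y ^ k * y ^ k') * D ^ a"
      by (simp add: v_def D(2) ysa mult.assoc)
    also have "\<dots> = y ^ (k + k') * (D ^ a * D ^ a)"
      by (simp add: power_add[symmetric] cc mult.assoc)
    finally show ?thesis by (simp add: pw)
  qed
  have "posw K (wt g3 y (D * D) 0 0 0)"
  proof (rule posw_wt[OF triadd_g3 yM D(3)])
    fix q :: pol and a b c :: nat
    define F where "F = Poly_Mapping.keys q"
    define qq where "qq \<kappa> = Poly_Mapping.lookup q \<kappa>" for \<kappa>
    define T where "T \<kappa> \<kappa>' = adj (complex_of_real (qq \<kappa>) *\<^sub>C v (snd (snd \<kappa>)) c) *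
      (E (adj (v (fst \<kappa>) a) * v (fst \<kappa>') a) * E (adj (v (fst (snd \<kappa>)) b) * v (fst (snd \<kappa>')) b)) *
      (complex_of_real (qq \<kappa>') *\<^sub>C v (snd (snd \<kappa>')) c)" for \<kappa> \<kappa>'
    have "pos_op (\<Sum>\<kappa>\<in>F. \<Sum>\<kappa>'\<in>F. T \<kappa> \<kappa>')"
      unfolding T_def by (rule E_cp_hadamard[where a = "\<lambda>\<kappa>. v (fst \<kappa>) a" and b = "\<lambda>\<kappa>. v (fst (snd \<kappa>)) b"
          and c = "\<lambda>\<kappa>. complex_of_real (qq \<kappa>) *\<^sub>C v (snd (snd \<kappa>)) c"]) (auto simp: F_def vM vQ)
    moreover have TM: "T \<kappa> \<kappa>' \<in> M" for \<kappa> \<kappa>' unfolding T_def using vM by auto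
    ultimately have "0 \<le> Re (\<tau> (\<Sum>\<kappa>\<in>F. \<Sum>\<kappa>'\<in>F. T \<kappa> \<kappa>'))"
      by (intro tr_pos_Re sum_in)
    also have "\<tau> (\<Sum>\<kappa>\<in>F. \<Sum>\<kappa>'\<in>F. T \<kappa> \<kappa>') = (\<Sum>\<kappa>\<in>F. \<Sum>\<kappa>'\<in>F. \<tau> (T \<kappa> \<kappa>'))"
      by (simp add: tr_sum sum_in TM)
    also have "Re \<dots> = (\<Sum>\<kappa>\<in>F. \<Sum>\<kappa>'\<in>F. Re (\<tau> (T \<kappa> \<kappa>')))" by simp
    also have "\<dots> = Lw (wt g3 y (D * D) a b c) (q * q)"
      unfolding Lw_mult_sum F_def[symmetric] qq_def[symmetric]
    proof (intro sum.cong refl)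
      fix \<kappa> \<kappa>' :: "nat \<times> nat \<times> nat"
      obtain k l m where \<kappa>: "\<kappa> = (k, l, m)" by (cases \<kappa>)
      obtain k' l' m' where \<kappa>': "\<kappa>' = (k', l', m')" by (cases \<kappa>')
      define e where "e = E (adj (v k a) * v k' a) * E (adj (v l b) * v l' b)"
      have eB: "e \<in> B" unfolding e_def using vM by auto
      have "T \<kappa> \<kappa>' = complex_of_real (qq \<kappa> * qq \<kappa>') *\<^sub>C (adj (v m c) * (e * v m' c))"
        by (simp add: T_def \<kappa> \<kappa>' e_def mult.assoc mult.commute)
      moreover have "adj (v m c) * (e * v m' c) = e * (adj (v m c) * v m' c)"
        using Q_comm[OF Q_closed(4)[OF vQ] eB, of m c] by (simp add: mult.assoc[symmetric])
      ultimately have "\<tau> (T \<kappa> \<kappa>') = complex_of_real (qq \<kappa> * qq \<kappa>') * \<tau> (e * (adj (v m c) * v m' c))"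
        using eB vM by (simp add: tr_scaleC)
      also have "\<tau> (e * (adj (v m c) * v m' c)) = \<tau> (e * E (adj (v m c) * v m' c))"
        using tr_E[of "e * (adj (v m c) * v m' c)"] eB vM by (simp add: E_left)
      finally have "Re (\<tau> (T \<kappa> \<kappa>')) = qq \<kappa> * qq \<kappa>' * Re (\<tau> (e * E (adj (v m c) * v m' c)))" by simp
      also have "Re (\<tau> (e * E (adj (v m c) * v m' c))) = wt g3 y (D * D) a b c (\<kappa> + \<kappa>')"
        by (simp add: e_def wt_def g3_def \<kappa> \<kappa>' vv)
      finally show "Re (\<tau> (T \<kappa> \<kappa>')) = qq \<kappa> * (qq \<kappa>' * wt g3 y (D * D) a b c (\<kappa> + \<kappa>'))" by simp
    qed
    finally show "0 \<le> Lw (wt g3 y (D * D) a b c) (q * q)" .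
  qed
  moreover have "wt g3 y (D * D) 0 0 0 = w3" by (simp add: wt_def w3_def g3_def fun_eq_iff)
  ultimately show ?thesis by simp
qed

text \<open>\<open>s\<close> multiplies by \<open>y\<close> from the left and \<open>r\<close> from
  the right; \<open>t\<close> is treated like \<open>r\<close>, which gives an action of the whole
  polynomial ring.\<close>

definition act :: "pol \<Rightarrow> 'h bop \<Rightarrow> 'h bop" where
  "act p c = Lop (\<lambda>(k, l, m). y ^ k * c * y ^ (l + m)) p"

definition gc :: "'h bop \<Rightarrow> 'h bop \<Rightarrow> 'h bop \<Rightarrow> 'h bop \<Rightarrow> real" where
  "gc c a b d = Re (\<tau> (adj c * a * c * b * d))"

lemma act_M: "c \<in> M \<Longrightarrow> act p c \<in> M"
  unfolding act_def by (rule Lop_in) auto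

lemma act_add: "act (p + q) c = act p c + act q c" and act_zero [simp]: "act 0 c = 0"
  and act_mnm: "act (mnm (k, l, m) e) c = complex_of_real e *\<^sub>C (y ^ k * c * y ^ (l + m))"
  and act_diff: "act (p - q) c = act p c - act q c"
  by (simp_all add: act_def Lop_diff)

lemma act_one: "act 1 c = c"
  using act_mnm[of 0 0 0 1 c] by (simp add: zero_prod_def[symmetric])

lemma act_lin: "act p (a + complex_of_real e *\<^sub>C c) = act p a + complex_of_real e *\<^sub>C act p c"
proof (induction p rule: pol_induct)
  case (add p \<kappa> d)
  obtain k l m where \<kappa>: "\<kappa> = (k, l, m)" by (cases \<kappa>)
  show ?case by (simp add: act_add add \<kappa> act_mnm distrib_left distrib_right scaleC_bop_distrib mult.commute)
qed simp

lemma act_diff_right: "act p (a - c) = act p a - act p c"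
  using act_lin[of p a "-1" c] by (simp add: scaleC_bop_distrib)

lemma act_zero_right [simp]: "act p 0 = 0"
  using act_diff_right[of p 0 0] by simp

lemma act_mult: "act (p * q) c = act p (act q c)"
proof (induction p rule: pol_induct)
  case (add p \<kappa> e)
  obtain k l m where \<kappa>: "\<kappa> = (k, l, m)" by (cases \<kappa>)
  have "act (mnm \<kappa> e * q) c = act (mnm \<kappa> e) (act q c)"
  proof (induction q rule: pol_induct)
    case (add q \<kappa>' e')
    obtain k' l' m' where \<kappa>': "\<kappa>' = (k', l', m')" by (cases \<kappa>')
    have "act (mnm \<kappa> e * mnm \<kappa>' e') c = act (mnm \<kappa> e) (act (mnm \<kappa>' e') c)"
    proof -
      have "y ^ (l + l' + (m + m')) = y ^ (l' + m') * y ^ (l + m)" by (simp add: power_add[symmetric] ac_simps)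
      then show ?thesis by (simp add: \<kappa> \<kappa>' mult_single act_mnm power_add mult.assoc)
    qed
    then show ?case using add act_lin[of "mnm \<kappa> e" "act q c" 1 "act (mnm \<kappa>' e') c"]
      by (simp add: distrib_left act_add)
  qed simp
  then show ?case using add by (simp add: distrib_right act_add)
qed simp

text \<open>Left and right multiplication by the self-adjoint \<open>y\<close> are symmetric for the
  trace inner product, so the squared norm is the weight of \<open>p * p\<close>.\<close>

lemma n2_act: assumes c: "c \<in> M" shows "(n2 (act p c))\<^sup>2 = Lw (wt (gc c) y 1 0 0 0) (p * p)"
proof -
  define F where "F = Poly_Mapping.keys p"
  define pp where "pp \<kappa> = Poly_Mapping.lookup p \<kappa>" for \<kappa>
  define X where "X = (\<lambda>(k, l, m). y ^ k * c * y ^ (l + m))"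
  have XM: "X \<kappa> \<in> M" for \<kappa> using c by (auto simp: X_def split: prod.splits)
  have a: "act p c = (\<Sum>\<kappa>\<in>F. complex_of_real (pp \<kappa>) *\<^sub>C X \<kappa>)"
    by (simp add: act_def lins_def F_def pp_def X_def)
  have "adj (act p c) * act p c = (\<Sum>\<kappa>\<in>F. \<Sum>\<kappa>'\<in>F. complex_of_real (pp \<kappa> * pp \<kappa>') *\<^sub>C (adj (X \<kappa>) * X \<kappa>'))"
    unfolding a adj_sum sum_product by (intro sum.cong refl) (simp add: mult.commute)
  then have "(n2 (act p c))\<^sup>2 = (\<Sum>\<kappa>\<in>F. \<Sum>\<kappa>'\<in>F. pp \<kappa> * pp \<kappa>' * Re (\<tau> (adj (X \<kappa>) * X \<kappa>')))"
    using act_M[OF c] XM by (simp add: n2_sq tr_sum sum_in tr_scaleC)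
  also have "\<dots> = Lw (wt (gc c) y 1 0 0 0) (p * p)"
    unfolding Lw_mult_sum F_def[symmetric] pp_def[symmetric]
  proof (intro sum.cong refl)
    fix \<kappa> \<kappa>' :: "nat \<times> nat \<times> nat"
    obtain k l m where \<kappa>: "\<kappa> = (k, l, m)" by (cases \<kappa>)
    obtain k' l' m' where \<kappa>': "\<kappa>' = (k', l', m')" by (cases \<kappa>')
    have "\<tau> (adj (X \<kappa>) * X \<kappa>') = \<tau> (y ^ (l + m) * (adj c * y ^ k * y ^ k' * c * y ^ (l' + m')))"
      by (simp add: X_def \<kappa> \<kappa>' ysa mult.assoc)
    also have "\<dots> = \<tau> ((adj c * y ^ k * y ^ k' * c * y ^ (l' + m')) * y ^ (l + m))"
      using c by (intro tr_comm) auto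
    also have "(adj c * y ^ k * y ^ k' * c * y ^ (l' + m')) * y ^ (l + m) =
      adj c * y ^ (k + k') * c * y ^ (l + l') * y ^ (m + m')"
    proof -
      have "y ^ (l' + m') * y ^ (l + m) = y ^ (l + l') * y ^ (m + m')" by (simp add: power_add[symmetric] ac_simps)
      then show ?thesis by (simp add: power_add[of y k k'] mult.assoc)
    qed
    finally show "pp \<kappa> * pp \<kappa>' * Re (\<tau> (adj (X \<kappa>) * X \<kappa>')) = pp \<kappa> * (pp \<kappa>' * wt (gc c) y 1 0 0 0 (\<kappa> + \<kappa>'))"
      by (simp add: wt_def gc_def \<kappa> \<kappa>')
  qed
  finally show ?thesis .
qed

text \<open>After the roots \<open>D\<close> of \<open>K\<^sup>2 - y\<^sup>2\<close> have been split
  off, each value to be tested is the squared trace norm of a single element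
  \<open>V\<close>.\<close>

lemma posw_gc: assumes c: "c \<in> M" shows "posw K (wt (gc c) y 1 0 0 0)"
proof -
  obtain D where D: "D \<in> M" "adj D = D" "D * D = complex_of_real (K * K) *\<^sub>C 1 - y * y"
    "\<And>z. z * y = y * z \<Longrightarrow> z * D = D * z" using cosquare_root[OF yM ysa yK] by blast
  have yD: "y * D = D * y" by (rule D(4)) simp
  have cc: "D ^ m * y ^ k = y ^ k * D ^ m" for k m
    by (metis yD power_commute_bop)
  have pw: "(D * D) ^ a = D ^ a * D ^ a" for a
    by (simp add: power_add[symmetric] mult_2[symmetric] power_mult power2_eq_square)
  have tri: "triadd M (gc c)"
    unfolding triadd_def gc_def using c
    by (intro ballI allI conjI)
      (simp_all add: right_diff_distrib left_diff_distrib tr_diff tr_scaleC)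
  have "posw K (wt (gc c) y (D * D) 0 0 0)"
  proof (rule posw_wt[OF tri yM D(3)])
    fix q :: pol and a b d :: nat
    define F where "F = Poly_Mapping.keys q"
    define qq where "qq \<kappa> = Poly_Mapping.lookup q \<kappa>" for \<kappa>
    define X where "X = (\<lambda>(k, l, m). (y ^ k * D ^ a) * c * (y ^ (l + m) * D ^ (b + d)))"
    have XM: "X \<kappa> \<in> M" for \<kappa> using c D(1) by (auto simp: X_def split: prod.splits)
    define V where "V = (\<Sum>\<kappa>\<in>F. complex_of_real (qq \<kappa>) *\<^sub>C X \<kappa>)"
    have VM: "V \<in> M" unfolding V_def using XM by (intro sum_in) auto
    have "adj V * V = (\<Sum>\<kappa>\<in>F. \<Sum>\<kappa>'\<in>F. complex_of_real (qq \<kappa> * qq \<kappa>') *\<^sub>C (adj (X \<kappa>) * X \<kappa>'))"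
      unfolding V_def adj_sum sum_product by (intro sum.cong refl) (simp add: mult.commute)
    then have "(n2 V)\<^sup>2 = (\<Sum>\<kappa>\<in>F. \<Sum>\<kappa>'\<in>F. qq \<kappa> * qq \<kappa>' * Re (\<tau> (adj (X \<kappa>) * X \<kappa>')))"
      using VM XM by (simp add: n2_sq tr_sum sum_in tr_scaleC)
    also have "\<dots> = Lw (wt (gc c) y (D * D) a b d) (q * q)"
      unfolding Lw_mult_sum F_def[symmetric] qq_def[symmetric]
    proof (intro sum.cong refl)
      fix \<kappa> \<kappa>' :: "nat \<times> nat \<times> nat"
      obtain k l m where \<kappa>: "\<kappa> = (k, l, m)" by (cases \<kappa>)
      obtain k' l' m' where \<kappa>': "\<kappa>' = (k', l', m')" by (cases \<kappa>')
      have "adj (X \<kappa>) * X \<kappa>' = (D ^ (b + d) * y ^ (l + m)) * (adj c * (D ^ a * y ^ k * y ^ k' * D ^ a) * c * (y ^ (l' + m') * D ^ (b + d)))"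
        by (simp add: X_def \<kappa> \<kappa>' ysa D(2) mult.assoc)
      also have "\<tau> \<dots> = \<tau> ((adj c * (D ^ a * y ^ k * y ^ k' * D ^ a) * c * (y ^ (l' + m') * D ^ (b + d))) * (D ^ (b + d) * y ^ (l + m)))"
        using c D(1) by (intro tr_comm) auto
      also have "(D ^ a * y ^ k * y ^ k' * D ^ a) = y ^ (k + k') * (D * D) ^ a"
        by (simp add: pw power_add cc mult.assoc)
      also have "(adj c * (y ^ (k + k') * (D * D) ^ a) * c * (y ^ (l' + m') * D ^ (b + d))) * (D ^ (b + d) * y ^ (l + m)) =
        adj c * (y ^ (k + k') * (D * D) ^ a) * c * (y ^ (l + l') * (D * D) ^ b) * (y ^ (m + m') * (D * D) ^ d)"
      proof -
        have "(y ^ (l' + m') * D ^ (b + d)) * (D ^ (b + d) * y ^ (l + m)) = y ^ (l' + m') * ((D * D) ^ (b + d) * y ^ (l + m))"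
          by (simp add: pw mult.assoc)
        also have "(D * D) ^ (b + d) * y ^ (l + m) = y ^ (l + m) * (D * D) ^ (b + d)"
          unfolding pw by (metis cc mult.assoc)
        also have "y ^ (l' + m') * (y ^ (l + m) * (D * D) ^ (b + d)) = y ^ (l + l') * (y ^ (m + m') * (D * D) ^ b) * (D * D) ^ d"
        proof -
          have "y ^ (l' + m') * y ^ (l + m) = y ^ (l + l') * y ^ (m + m')" by (simp add: power_add[symmetric] ac_simps)
          then show ?thesis by (simp add: power_add[of "D * D"] mult.assoc[symmetric])
        qed
        also have "y ^ (m + m') * (D * D) ^ b = (D * D) ^ b * y ^ (m + m')"
          unfolding pw by (metis cc mult.assoc)
        finally show ?thesis by (simp add: mult.assoc)
      qed
      finally show "qq \<kappa> * qq \<kappa>' * Re (\<tau> (adj (X \<kappa>) * X \<kappa>')) = qq \<kappa> * (qq \<kappa>' * wt (gc c) y (D * D) a b d (\<kappa> + \<kappa>'))"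
        by (simp add: wt_def gc_def \<kappa> \<kappa>')
    qed
    finally show "0 \<le> Lw (wt (gc c) y (D * D) a b d) (q * q)" by (metis zero_le_power2)
  qed
  moreover have "wt (gc c) y (D * D) 0 0 0 = wt (gc c) y 1 0 0 0" by (simp add: wt_def)
  ultimately show ?thesis by simp
qed

definition P :: "nat \<Rightarrow> pol" where "P n = bump (dif K vs vr) n"

definition X :: "nat \<Rightarrow> pol" where "X n = iter (dif K vs vr) n"

lemma tfree_P: "tfree (P n)" and tfree_X: "tfree (X n)"
  unfolding P_def X_def by (intro tfree_bump tfree_iter tfree_dif)+

text \<open>The polynomial inequalities \<open>P\<^sup>2 \<le> P \<le> 1\<close>, evaluated under
  the weight of \<open>c\<close>.\<close>

lemma act_P_contraction: assumes c: "c \<in> M" shows "n2 (act (P n) c) \<le> n2 c"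
proof (rule power2_le_imp_le)
  note b = posw_bounds[OF K0 posw_gc[OF c]]
  have "(n2 (act (P n) c))\<^sup>2 \<le> Lw (wt (gc c) y 1 0 0 0) 1"
    unfolding n2_act[OF c] P_def using b(1,2)[of n] by linarith
  also have "\<dots> = (n2 (act 1 c))\<^sup>2" by (simp add: n2_act[OF c])
  finally show "(n2 (act (P n) c))\<^sup>2 \<le> (n2 c)\<^sup>2" by (simp add: act_one)
qed (simp add: c)

text \<open>Every iterate is a multiple of \<open>s - r\<close>, which annihilates whatever commutes
  with \<open>y\<close>; all factors of the bump therefore act as 1.\<close>

lemma act_P_fixes: assumes z: "z * y = y * z" shows "act (P n) z = z"
proof -
  have "act (dif K vs vr) z = 0"
  proof -
    have "dif K vs vr = mnm (1, 0, 0) (1 / (2 * K)) - mnm (0, 0, 1) (1 / (2 * K))"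
      by (simp add: dif_def vs_def vr_def right_diff_distrib cst_mult_mono)
    then show ?thesis by (simp add: act_diff act_mnm z)
  qed
  then have x0: "act (X n) z = 0" for n
  proof (induction n)
    case (Suc n)
    have "X (Suc n) = (cst (1/2) * (3 - X n * X n)) * X n"
      by (simp add: X_def cub_def algebra_simps)
    then show ?case using Suc by (simp only: act_mult) simp
  qed (simp add: X_def)
  show ?thesis
  proof (induction n)
    case (Suc n)
    have "P (Suc n) = P n - (P n * X n) * X n" by (simp add: P_def X_def hh_def algebra_simps)
    then show ?case using Suc x0 by (simp add: act_diff act_mult)
  qed (simp add: P_def act_one)
qed

text \<open>The value of the pairing with \<open>a\<close> and \<open>b\<close> on a tensor
  \<open>l \<otimes> r\<close> acted upon by \<open>p\<close>, after cyclicity has turned it into an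
  expression in \<open>c = l a\<close> and \<open>d = b r\<close>.\<close>

definition \<Phi> :: "'h bop \<Rightarrow> 'h bop \<Rightarrow> pol \<Rightarrow> complex" where
  "\<Phi> c d p = Lc (\<lambda>(k, l, m). \<tau> (E (y ^ k * c) * E (y ^ (l + m) * d))) p"

text \<open>Cauchy-Schwarz for the positive kernel \<open>E (adj a1 * a2)\<close>. The index
  \<open>None\<close> carries \<open>c\<close> and \<open>d\<close>, the indices
  \<open>Some \<kappa>\<close> the monomials of \<open>p\<close>, and a free scalar \<open>z\<close>
  in front of \<open>d\<close> yields the quadratic inequality.\<close>

lemma Phi_CS:
  assumes c: "c \<in> M" and d: "d \<in> M" and p: "tfree p"
  shows "(cmod (\<Phi> c d p))\<^sup>2 \<le> Lw w3 (p * p) * Re (\<tau> (adj d * E (adj c * c) * d))"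
proof -
  define F where "F = Poly_Mapping.keys p"
  define pp where "pp \<kappa> = Poly_Mapping.lookup p \<kappa>" for \<kappa>
  define N where "N = Re (\<tau> (adj d * E (adj c * c) * d))"
  have F: "finite F" by (simp add: F_def)
  have cpM: "adj d * E (adj c * c) * d \<in> M" using c d by auto
  have main: "0 \<le> Lw w3 (p * p) + 2 * Re (z * \<Phi> c d p) + (cmod z)\<^sup>2 * N" for z
  proof -
    define G where "G = insert None (Some ` F)"
    define a where "a o' = (case o' of None \<Rightarrow> c | Some \<kappa> \<Rightarrow> y ^ fst \<kappa>)" for o' :: "(nat \<times> nat \<times> nat) option"
    define b where "b o' = (case o' of None \<Rightarrow> z *\<^sub>C d | Some \<kappa> \<Rightarrow> complex_of_real (pp \<kappa>) *\<^sub>C y ^ (snd (snd \<kappa>)))" for o' :: "(nat \<times> nat \<times> nat) option"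
    define t where "t o1 o2 = adj (b o1) * E (adj (a o1) * a o2) * b o2" for o1 o2
    have abM: "a o' \<in> M" "b o' \<in> M" for o' using c d by (auto simp: a_def b_def split: option.splits)
    have tM: "t o1 o2 \<in> M" for o1 o2 unfolding t_def using abM by auto
    have "pos_op (\<Sum>o1\<in>G. \<Sum>o2\<in>G. t o1 o2)"
      unfolding t_def by (rule E_cp_set) (auto simp: G_def F abM)
    then have "0 \<le> Re (\<tau> (\<Sum>o1\<in>G. \<Sum>o2\<in>G. t o1 o2))" by (intro tr_pos_Re sum_in tM)
    also have "\<tau> (\<Sum>o1\<in>G. \<Sum>o2\<in>G. t o1 o2) = (\<Sum>o1\<in>G. \<Sum>o2\<in>G. \<tau> (t o1 o2))"
      by (simp add: tr_sum sum_in tM)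
    also have "\<dots> = \<tau> (t None None) + (\<Sum>\<kappa>\<in>F. \<tau> (t None (Some \<kappa>))) + (\<Sum>\<kappa>\<in>F. \<tau> (t (Some \<kappa>) None))
        + (\<Sum>\<kappa>\<in>F. \<Sum>\<kappa>'\<in>F. \<tau> (t (Some \<kappa>) (Some \<kappa>')))"
      unfolding G_def by (simp add: F sum.reindex sum.distrib add.assoc image_iff)
    also have "(\<Sum>\<kappa>\<in>F. \<tau> (t (Some \<kappa>) None)) = z * \<Phi> c d p"
    proof -
      have "\<tau> (t (Some \<kappa>) None) = z * (complex_of_real (pp \<kappa>) * (case \<kappa> of (k, l, m) \<Rightarrow> \<tau> (E (y ^ k * c) * E (y ^ (l + m) * d))))"
        if "\<kappa> \<in> F" for \<kappa>
      proof -
        obtain k l m where \<kappa>: "\<kappa> = (k, l, m)" by (cases \<kappa>)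
        have l: "l = 0" using p that by (auto simp: tfree_def F_def \<kappa>)
        have "\<tau> (y ^ m * (E (y ^ k * c) * d)) = \<tau> ((E (y ^ k * c) * d) * y ^ m)"
          using c d by (intro tr_comm) auto
        also have "\<dots> = \<tau> (E (y ^ k * c) * E (d * y ^ m))"
          using c d by (simp add: tr_E_left mult.assoc)
        also have "E (d * y ^ m) = E (y ^ m * d)" using E_comm_Q[of "y ^ m" d] d by simp
        finally show ?thesis using c d
          by (simp add: t_def a_def b_def \<kappa> l ysa tr_scaleC mult.assoc mult.left_commute)
      qed
      then show ?thesis by (simp add: \<Phi>_def lins_def F_def pp_def sum_distrib_left)
    qed
    also have "(\<Sum>\<kappa>\<in>F. \<tau> (t None (Some \<kappa>))) = cnj (z * \<Phi> c d p)"
    proof -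
      have "\<tau> (t None (Some \<kappa>)) = cnj (\<tau> (t (Some \<kappa>) None))" for \<kappa>
      proof -
        have "t None (Some \<kappa>) = adj (t (Some \<kappa>) None)"
          using abM by (simp add: t_def E_adj[symmetric] mult.assoc)
        then show ?thesis using tr_adj[OF tM] by simp
      qed
      then have "(\<Sum>\<kappa>\<in>F. \<tau> (t None (Some \<kappa>))) = cnj (\<Sum>\<kappa>\<in>F. \<tau> (t (Some \<kappa>) None))" by simp
      then show ?thesis using \<open>(\<Sum>\<kappa>\<in>F. \<tau> (t (Some \<kappa>) None)) = z * \<Phi> c d p\<close> by simp
    qed
    also have "\<tau> (t None None) = complex_of_real ((cmod z)\<^sup>2) * \<tau> (adj d * E (adj c * c) * d)"
      using cpM by (simp add: t_def a_def b_def tr_scaleC complex_norm_square mult.assoc del: of_real_power)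
    also have "Re (complex_of_real ((cmod z)\<^sup>2) * \<tau> (adj d * E (adj c * c) * d) + cnj (z * \<Phi> c d p) + z * \<Phi> c d p
       + (\<Sum>\<kappa>\<in>F. \<Sum>\<kappa>'\<in>F. \<tau> (t (Some \<kappa>) (Some \<kappa>')))) =
       (cmod z)\<^sup>2 * N + 2 * Re (z * \<Phi> c d p) + (\<Sum>\<kappa>\<in>F. \<Sum>\<kappa>'\<in>F. Re (\<tau> (t (Some \<kappa>) (Some \<kappa>'))))"
      by (simp add: N_def del: of_real_power)
    also have "(\<Sum>\<kappa>\<in>F. \<Sum>\<kappa>'\<in>F. Re (\<tau> (t (Some \<kappa>) (Some \<kappa>')))) = Lw w3 (p * p)"
      unfolding Lw_mult_sum F_def[symmetric] pp_def[symmetric]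
    proof (intro sum.cong refl)
      fix \<kappa> \<kappa>' assume mem: "\<kappa> \<in> F" "\<kappa>' \<in> F"
      obtain k l m where \<kappa>: "\<kappa> = (k, l, m)" by (cases \<kappa>)
      obtain k' l' m' where \<kappa>': "\<kappa>' = (k', l', m')" by (cases \<kappa>')
      have l: "l = 0" "l' = 0" using p mem by (auto simp: tfree_def F_def \<kappa> \<kappa>')
      have "\<tau> (y ^ m * (E (y ^ (k + k')) * y ^ m')) = \<tau> ((E (y ^ (k + k')) * y ^ m') * y ^ m)"
        by (intro tr_comm) auto
      also have "(E (y ^ (k + k')) * y ^ m') * y ^ m = E (y ^ (k + k')) * y ^ (m + m')"
        by (simp add: mult.assoc power_add[symmetric] add.commute)
      also have "\<tau> (E (y ^ (k + k')) * y ^ (m + m')) = \<tau> (E (y ^ (k + k')) * E (y ^ (m + m')))"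
        by (simp add: tr_E_left)
      finally show "Re (\<tau> (t (Some \<kappa>) (Some \<kappa>'))) = pp \<kappa> * (pp \<kappa>' * w3 (\<kappa> + \<kappa>'))"
        by (simp add: t_def a_def b_def \<kappa> \<kappa>' l ysa tr_scaleC w3_def mult.assoc power_add[symmetric])
    qed
    finally show ?thesis by simp
  qed
  have N0: "0 \<le> N" unfolding N_def using c d
    by (intro tr_pos_Re pos_op_conj E_pos pos_op_adj_mult) auto
  define w where "w = cmod (\<Phi> c d p)"
  \<comment> \<open>The scalar \<open>z\<close> is chosen as \<open>- s\<close> times the conjugate
    of \<open>\<Phi> c d p\<close>, which makes the cross term real.\<close>
  have q: "0 \<le> Lw w3 (p * p) - 2 * s * w\<^sup>2 + s\<^sup>2 * w\<^sup>2 * N" for s :: real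
  proof -
    have "Re ((- complex_of_real s * cnj (\<Phi> c d p)) * \<Phi> c d p) = - s * w\<^sup>2"
    proof -
      have "(- complex_of_real s * cnj (\<Phi> c d p)) * \<Phi> c d p = - complex_of_real s * (\<Phi> c d p * cnj (\<Phi> c d p))" by simp
      also have "\<Phi> c d p * cnj (\<Phi> c d p) = of_real (w\<^sup>2)" unfolding w_def by (rule complex_norm_square[symmetric])
      finally have "(- complex_of_real s * cnj (\<Phi> c d p)) * \<Phi> c d p = complex_of_real (- s * w\<^sup>2)" by simp
      then show ?thesis by (simp only: Re_complex_of_real)
    qed
    moreover have "(cmod (- complex_of_real s * cnj (\<Phi> c d p)))\<^sup>2 = s\<^sup>2 * w\<^sup>2"
      by (simp add: norm_mult power_mult_distrib w_def)
    ultimately show ?thesis using main[of "- complex_of_real s * cnj (\<Phi> c d p)"] by simp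
  qed
  have "w\<^sup>2 \<le> Lw w3 (p * p) * N"
  proof (cases "N = 0")
    case True
    have "w\<^sup>2 \<le> 0"
    proof (rule ccontr)
      assume "\<not> w\<^sup>2 \<le> 0"
      then have p: "w\<^sup>2 > 0" by simp
      have "2 * ((Lw w3 (p * p) + 1) / (2 * w\<^sup>2)) * w\<^sup>2 = Lw w3 (p * p) + 1" using p by simp
      then show False using q[of "(Lw w3 (p * p) + 1) / (2 * w\<^sup>2)"] True by simp
    qed
    then show ?thesis using True by simp
  next
    case False
    then have p': "N > 0" using N0 by simp
    have "Lw w3 (p * p) - 2 * (1 / N) * w\<^sup>2 + (1 / N)\<^sup>2 * w\<^sup>2 * N = Lw w3 (p * p) - w\<^sup>2 / N"
      using p' by (simp add: power2_eq_square field_simps)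
    then have "w\<^sup>2 / N \<le> Lw w3 (p * p)" using q[of "1 / N"] by linarith
    then show ?thesis using p' by (simp add: pos_divide_le_eq)
  qed
  then show ?thesis by (simp add: w_def N_def)
qed

text \<open>\<open>smear n\<close> is \<open>x\<^sub>n (s - r)\<close> with \<open>s = y\<close> and \<open>r\<close> integrated out: it stays bounded, while its
  divided difference dominates the growing multiple \<open>(3/2)\<^sup>n\<close> of a bump at the diagonal.\<close>

definition smear :: "nat \<Rightarrow> 'h bop" where
  "smear n = Lop (\<lambda>(k, l, m). y ^ k * E (y ^ (l + m))) (X n)"

lemma sum_tr_square:
  assumes gM: "\<And>\<kappa>. g \<kappa> \<in> M"
  shows "(n2 (Lop g p))\<^sup>2 = (\<Sum>\<kappa>\<in>Poly_Mapping.keys p. \<Sum>\<kappa>'\<in>Poly_Mapping.keys p.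
    Poly_Mapping.lookup p \<kappa> * (Poly_Mapping.lookup p \<kappa>' * Re (\<tau> (adj (g \<kappa>) * g \<kappa>'))))"
proof -
  have "adj (Lop g p) * Lop g p = (\<Sum>\<kappa>\<in>Poly_Mapping.keys p. \<Sum>\<kappa>'\<in>Poly_Mapping.keys p.
     complex_of_real (Poly_Mapping.lookup p \<kappa> * Poly_Mapping.lookup p \<kappa>') *\<^sub>C (adj (g \<kappa>) * g \<kappa>'))"
    unfolding lins_def adj_sum sum_product by (intro sum.cong refl) (simp add: mult.commute)
  then show ?thesis using Lop_in[of g p, OF gM] gM
    by (simp add: n2_sq tr_sum sum_in tr_scaleC mult.assoc)
qed

lemma smear_M: "smear n \<in> M"
  unfolding smear_def by (rule Lop_in) auto

text \<open>Squaring integrates out \<open>r\<close> twice, which calls for a second copy named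
  \<open>t\<close>: the squared norm is the weight of \<open>X(s, r) X(s, t)\<close>, at most the
  weight of 1.\<close>

lemma n2_smear: "n2 (smear n) \<le> 1"
proof -
  let ?X = "X n"
  have "(n2 (smear n))\<^sup>2 = Lw w3 (?X * subst r_to_t ?X)"
  proof -
    have "(n2 (smear n))\<^sup>2 = (\<Sum>\<kappa>\<in>Poly_Mapping.keys ?X. \<Sum>\<kappa>'\<in>Poly_Mapping.keys ?X.
        Poly_Mapping.lookup ?X \<kappa> * (Poly_Mapping.lookup ?X \<kappa>' * w3 (\<kappa> + r_to_t \<kappa>')))"
    proof -
      define g where "g = (\<lambda>(k, l, m). y ^ k * E (y ^ (l + m)))"
      have gM: "g \<kappa> \<in> M" for \<kappa> by (auto simp: g_def split: prod.splits)
      have sm: "smear n = Lop g ?X" by (simp only: smear_def g_def)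
      show ?thesis unfolding sm sum_tr_square[of g, OF gM]
      proof (intro sum.cong refl)
        fix \<kappa> \<kappa>' assume mem: "\<kappa> \<in> Poly_Mapping.keys ?X" "\<kappa>' \<in> Poly_Mapping.keys ?X"
        obtain k l m where \<kappa>: "\<kappa> = (k, l, m)" by (cases \<kappa>)
        obtain k' l' m' where \<kappa>': "\<kappa>' = (k', l', m')" by (cases \<kappa>')
        have l: "l = 0" "l' = 0" using tfree_X[of n] mem by (auto simp: tfree_def \<kappa> \<kappa>')
        have "adj (y ^ k * E (y ^ m)) * (y ^ k' * E (y ^ m')) = E (y ^ m) * (y ^ (k + k') * E (y ^ m'))"
          by (simp add: Ey_adj ysa power_add mult.assoc)
        also have "y ^ (k + k') * E (y ^ m') = E (y ^ m') * y ^ (k + k')" by (rule y_B_comm) simp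
        also have "E (y ^ m) * (E (y ^ m') * y ^ (k + k')) = (E (y ^ m) * E (y ^ m')) * y ^ (k + k')"
          by (simp add: mult.assoc)
        also have "\<tau> \<dots> = \<tau> (E (y ^ (k + k')) * E (y ^ m') * E (y ^ m))"
        proof -
          have "\<tau> ((E (y ^ m) * E (y ^ m')) * y ^ (k + k')) = \<tau> (E (y ^ m) * E (y ^ m') * E (y ^ (k + k')))"
            using tr_E[of "(E (y ^ m) * E (y ^ m')) * y ^ (k + k')"] by (simp add: E_left)
          also have "E (y ^ m) * E (y ^ m') * E (y ^ (k + k')) = E (y ^ (k + k')) * E (y ^ m') * E (y ^ m)"
            using Ey_comm[of "E (y ^ m) * E (y ^ m')" "k + k'"] Ey_comm[of "E (y ^ m)" m'] by (simp add: mult.assoc)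
          finally show ?thesis .
        qed
        finally show "Poly_Mapping.lookup ?X \<kappa> * (Poly_Mapping.lookup ?X \<kappa>' *
            Re (\<tau> (adj (g \<kappa>) * g \<kappa>'))) =
          Poly_Mapping.lookup ?X \<kappa> * (Poly_Mapping.lookup ?X \<kappa>' * w3 (\<kappa> + r_to_t \<kappa>'))"
          by (simp add: \<kappa> \<kappa>' l g_def w3_def r_to_t_def)
      qed
    qed
    also have "\<dots> = Lw w3 (?X * subst r_to_t ?X)"
      unfolding Lw_mult Lw_subst by (simp add: lins_def sum_distrib_left)
    finally show ?thesis .
  qed
  also have "subst r_to_t ?X = iter (dif K vs vt) n"
    by (simp add: X_def subst_iter r_to_t_add subst_dif)
  also have "Lw w3 (?X * iter (dif K vs vt) n) \<le> Lw w3 1"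
    unfolding X_def by (rule posw_bounds(3)[OF K0 posw_w3])
  also have "Lw w3 1 = 1"
    using real_sc.lins_mono[of w3 0 1] by (simp add: w3_def zero_prod_def[symmetric]) (simp add: zero_prod_def)
  finally have "(n2 (smear n))\<^sup>2 \<le> 1\<^sup>2" by simp
  then show ?thesis by (rule power2_le_imp_le) simp
qed

text \<open>Cauchy-Schwarz in the variable \<open>r\<close>: integrating \<open>s\<close> out of the
  bump leaves an operator whose trace is the weight of \<open>P n\<close> and whose squared trace
  norm is the weight of \<open>P(s, r) P(t, r)\<close>.\<close>

lemma bump_square_lower: "(Lw w3 (P n))\<^sup>2 \<le> Lw w3 (P n * bump (dif K vt vr) n)"
proof -
  let ?P = "P n"
  define g where "g = (\<lambda>(k, l, m). E (y ^ k) * y ^ (l + m))"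
  have gM: "g \<kappa> \<in> M" for \<kappa> by (auto simp: g_def split: prod.splits)
  have tr: "Re (\<tau> (Lop g ?P)) = Lw w3 ?P"
  proof -
    have "\<tau> (Lop g ?P) = Lc (\<lambda>\<kappa>. \<tau> (g \<kappa>)) ?P" by (rule lf_Lop[OF lf_tr gM])
    then have "Re (\<tau> (Lop g ?P)) = Lw (\<lambda>\<kappa>. Re (\<tau> (g \<kappa>))) ?P" by (simp add: Re_Lc)
    also have "\<dots> = Lw w3 ?P"
      by (rule tfree_cong[OF tfree_P]) (simp add: g_def w3_def tr_E_left)
    finally show ?thesis .
  qed
  have "(n2 (Lop g ?P))\<^sup>2 = (\<Sum>\<kappa>\<in>Poly_Mapping.keys ?P. \<Sum>\<kappa>'\<in>Poly_Mapping.keys ?P.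
        Poly_Mapping.lookup ?P \<kappa> * (Poly_Mapping.lookup ?P \<kappa>' * w3 (\<kappa> + to_t \<kappa>')))"
    unfolding sum_tr_square[of g, OF gM]
  proof (intro sum.cong refl)
    fix \<kappa> \<kappa>' assume mem: "\<kappa> \<in> Poly_Mapping.keys ?P" "\<kappa>' \<in> Poly_Mapping.keys ?P"
    obtain k l m where \<kappa>: "\<kappa> = (k, l, m)" by (cases \<kappa>)
    obtain k' l' m' where \<kappa>': "\<kappa>' = (k', l', m')" by (cases \<kappa>')
    have l: "l = 0" "l' = 0" using tfree_P[of n] mem by (auto simp: tfree_def \<kappa> \<kappa>')
    have "adj (g \<kappa>) * g \<kappa>' = y ^ m * (E (y ^ k) * E (y ^ k')) * y ^ m'"
      by (simp add: g_def \<kappa> \<kappa>' l Ey_adj ysa mult.assoc)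
    also have "y ^ m * (E (y ^ k) * E (y ^ k')) = (E (y ^ k) * E (y ^ k')) * y ^ m" by (rule y_B_comm) simp
    also have "(E (y ^ k) * E (y ^ k')) * y ^ m * y ^ m' = (E (y ^ k) * E (y ^ k')) * y ^ (m + m')"
      by (simp add: power_add mult.assoc)
    also have "\<tau> \<dots> = \<tau> (E (y ^ k) * E (y ^ k') * E (y ^ (m + m')))"
      using tr_E[of "(E (y ^ k) * E (y ^ k')) * y ^ (m + m')"] by (simp add: E_left)
    finally show "Poly_Mapping.lookup ?P \<kappa> * (Poly_Mapping.lookup ?P \<kappa>' * Re (\<tau> (adj (g \<kappa>) * g \<kappa>'))) =
      Poly_Mapping.lookup ?P \<kappa> * (Poly_Mapping.lookup ?P \<kappa>' * w3 (\<kappa> + to_t \<kappa>'))"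
      by (simp add: \<kappa> \<kappa>' l w3_def to_t_def)
  qed
  also have "\<dots> = Lw w3 (?P * subst to_t ?P)"
    unfolding Lw_mult Lw_subst by (simp add: lins_def sum_distrib_left)
  also have "subst to_t ?P = bump (dif K vt vr) n"
    by (simp add: P_def subst_bump to_t_add subst_dif)
  finally have n: "(n2 (Lop g ?P))\<^sup>2 = Lw w3 (?P * bump (dif K vt vr) n)" .
  have "\<bar>Re (\<tau> (Lop g ?P))\<bar> \<le> n2 (Lop g ?P)"
    using tr_le_n2[OF Lop_in[of g, OF gM]] abs_Re_le_cmod order_trans by blast
  then have "(Re (\<tau> (Lop g ?P)))\<^sup>2 \<le> (n2 (Lop g ?P))\<^sup>2" by (metis abs_le_square_iff abs_of_nonneg Lop_in[of g, OF gM] n2_nonneg)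
  then show ?thesis by (simp add: tr n)
qed

text \<open>The relation \<open>fy\<close> turns \<open>f (smear n)\<close> into the weight of the
  divided difference of \<open>X n\<close>. It stays below \<open>C\<close>, but by
  \<open>dd_iter_lower\<close> exceeds \<open>(3/2)^n / (2 * K)\<close> times the weight of
  \<open>P(s, r) P(t, r)\<close>. Hence the weight of \<open>P n\<close> tends to zero, that of
  \<open>P n * P n\<close> is at most as large, and \<open>Phi_CS\<close> concludes.\<close>

theorem relatively_diffuse:
  assumes f: "lf f" and fy: "\<And>k b. b \<in> B \<Longrightarrow> f (y ^ k * b) = (\<Sum>i<k. \<tau> (E (y ^ i) * E (y ^ (k - 1 - i) * b)))"
    and c: "c \<in> M" and d: "d \<in> M"
  shows "(\<lambda>n. \<Phi> c d (P n)) \<longlonglongrightarrow> 0"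
proof -
  obtain C where C: "C \<ge> 0" "\<And>a. a \<in> M \<Longrightarrow> cmod (f a) \<le> C * n2 a" using lfD(3)[OF f] by blast
  have fs: "Lw w3 (dd (X n)) = Re (f (smear n))" for n
  proof -
    define h where "h = (\<lambda>(k, l, m). y ^ k * E (y ^ (l + m)))"
    have hM: "h \<kappa> \<in> M" for \<kappa> by (auto simp: h_def split: prod.splits)
    have "f (smear n) = Lc (\<lambda>\<kappa>. f (h \<kappa>)) (X n)"
      unfolding smear_def h_def[symmetric] by (rule lf_Lop[OF f hM])
    then have "Re (f (smear n)) = Lw (\<lambda>\<kappa>. Re (f (h \<kappa>))) (X n)" by (simp add: Re_Lc)
    also have "\<dots> = Lw (\<lambda>(k, l, m). \<Sum>i<k. w3 (i, k - 1 - i + l, m)) (X n)"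
    proof (rule tfree_cong[OF tfree_X])
      fix k m
      have "f (h (k, 0, m)) = (\<Sum>i<k. \<tau> (E (y ^ i) * E (y ^ (k - 1 - i)) * E (y ^ m)))"
        by (simp add: h_def fy E_right mult.assoc)
      then show "Re (f (h (k, 0, m))) = (case (k, 0, m) of (k, l, m) \<Rightarrow> \<Sum>i<k. w3 (i, k - 1 - i + l, m))"
        by (simp add: w3_def)
    qed
    also have "\<dots> = Lw w3 (dd (X n))"
    proof -
      have "Lw (\<lambda>(k, l, m). \<Sum>i<k. w3 (i, k - 1 - i + l, m)) p = Lw w3 (dd p)" for p
      proof (induction p rule: pol_induct)
        case (add p \<kappa> e)
        obtain k l m where \<kappa>: "\<kappa> = (k, l, m)" by (cases \<kappa>)
        have "Lw w3 (\<Sum>i\<in>G. mnm (i, k - 1 - i + l, m) e) = (\<Sum>i\<in>G. e * w3 (i, k - 1 - i + l, m))" for G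
          by (induction G rule: infinite_finite_induct) simp_all
        then have "Lw w3 (dd (mnm \<kappa> e)) = e * (\<Sum>i<k. w3 (i, k - 1 - i + l, m))"
          unfolding \<kappa> dd_mono by (simp only: sum_distrib_left)
        then show ?case using add by (simp add: dd_add \<kappa>)
      qed (simp add: dd_zero)
      then show ?thesis .
    qed
    finally show ?thesis by simp
  qed
  have b: "Lw w3 (P n * bump (dif K vt vr) n) \<le> 2 * K * C * (2/3)^n" for n
  proof -
    have "(3/2)^n / (2 * K) * Lw w3 (P n * bump (dif K vt vr) n) \<le> Re (f (smear n))"
      using posw_bounds(4)[OF K0 posw_w3, of n] unfolding P_def[symmetric] X_def[symmetric] fs .
    also have "\<dots> \<le> cmod (f (smear n))" by (rule complex_Re_le_cmod)
    also have "\<dots> \<le> C * n2 (smear n)" by (rule C(2)[OF smear_M])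
    also have "\<dots> \<le> C * 1" by (intro mult_left_mono n2_smear C(1))
    finally have le: "(3/2)^n / (2 * K) * Lw w3 (P n * bump (dif K vt vr) n) \<le> C" by simp
    have "Lw w3 (P n * bump (dif K vt vr) n) =
      (2 * K * (2/3)^n) * ((3/2)^n / (2 * K) * Lw w3 (P n * bump (dif K vt vr) n))"
    proof -
      have "(2/3)^n * (3/2)^n = (1::real)" by (simp add: power_mult_distrib[symmetric])
      then have "(2 * K * (2/3)^n) * ((3/2)^n / (2 * K)) = 1" using K0 by simp
      then show ?thesis by (simp only: mult.assoc[symmetric] mult_1_left)
    qed
    also have "\<dots> \<le> (2 * K * (2/3)^n) * C" using K0 by (intro mult_left_mono le) simp
    finally show ?thesis by (simp add: mult_ac)
  qed
  have lim0: "(\<lambda>n. 2 * K * C * (2/3)^n) \<longlonglongrightarrow> 0"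
    by (intro tendsto_mult_right_zero LIMSEQ_realpow_zero) auto
  have Pn0: "(\<lambda>n. (Lw w3 (P n))\<^sup>2) \<longlonglongrightarrow> 0"
    by (rule real_tendsto_sandwich[OF _ _ tendsto_const lim0])
      (use order_trans[OF bump_square_lower b] in auto)
  then have "(\<lambda>n. sqrt ((Lw w3 (P n))\<^sup>2)) \<longlonglongrightarrow> sqrt 0" by (rule tendsto_real_sqrt)
  then have Pn: "(\<lambda>n. \<bar>Lw w3 (P n)\<bar>) \<longlonglongrightarrow> 0" by simp
  define N where "N = \<bar>Re (\<tau> (adj d * E (adj c * c) * d))\<bar>"
  have "(\<lambda>n. (cmod (\<Phi> c d (P n)))\<^sup>2) \<longlonglongrightarrow> 0"
  proof (rule real_tendsto_sandwich[OF _ _ tendsto_const])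
    show "\<forall>\<^sub>F n in sequentially. (cmod (\<Phi> c d (P n)))\<^sup>2 \<le> \<bar>Lw w3 (P n)\<bar> * N"
    proof (intro always_eventually allI)
      fix n
      have "(cmod (\<Phi> c d (P n)))\<^sup>2 \<le> Lw w3 (P n * P n) * Re (\<tau> (adj d * E (adj c * c) * d))"
        by (rule Phi_CS[OF c d tfree_P])
      also have "\<dots> \<le> Lw w3 (P n * P n) * N"
      proof (rule mult_left_mono)
        show "0 \<le> Lw w3 (P n * P n)" using cone_nonneg[OF cone_square posw_w3] .
      qed (simp add: N_def)
      also have "\<dots> \<le> \<bar>Lw w3 (P n)\<bar> * N"
        using posw_bounds(1)[OF K0 posw_w3, of n] by (intro mult_right_mono) (auto simp: P_def N_def)
      finally show "(cmod (\<Phi> c d (P n)))\<^sup>2 \<le> \<bar>Lw w3 (P n)\<bar> * N" .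
    qed
    show "(\<lambda>n. \<bar>Lw w3 (P n)\<bar> * N) \<longlonglongrightarrow> 0" by (rule tendsto_mult_left_zero[OF Pn])
  qed simp
  then have "(\<lambda>n. sqrt ((cmod (\<Phi> c d (P n)))\<^sup>2)) \<longlonglongrightarrow> sqrt 0" by (rule tendsto_real_sqrt)
  then show ?thesis by (simp add: tendsto_norm_zero_iff)
qed

end

section \<open>Two variables\<close>

lemma val_replicate [simp]: "val (replicate k (g, o')) = g ^ k"
  by (induction k) simp_all

lemma spl_replicate: "o' \<noteq> Some i \<Longrightarrow> spl i (replicate k (g, o')) = []"
  by (induction k) simp_all

lemma tendsto_lsum_zero:
  fixes g :: "'a \<Rightarrow> 'b \<Rightarrow> nat \<Rightarrow> complex"
  shows "(\<And>l r. (l, r) \<in> set L \<Longrightarrow> (\<lambda>n. g l r n) \<longlonglongrightarrow> 0) \<Longrightarrow> (\<lambda>n. lsum (\<lambda>l r. g l r n) L) \<longlonglongrightarrow> 0"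
proof (induction L)
  case (Cons p L)
  obtain l r where p: "p = (l, r)" by (cases p)
  have "(\<lambda>n. g l r n + lsum (\<lambda>l r. g l r n) L) \<longlonglongrightarrow> 0 + 0"
    by (intro tendsto_add Cons.IH Cons.prems) (auto simp: p)
  then show ?case by (simp add: p)
qed simp

context conj_vars
begin

lemma lsum_spl_power:
  "lsum (\<lambda>l r. \<tau> (E (g * l) * E r)) (spl j (replicate k (y, Some j) @ [(b, None)])) =
    (\<Sum>i<k. \<tau> (E (g * y ^ i) * E (y ^ (k - Suc i) * b)))"
proof (induction k arbitrary: g)
  case (Suc k)
  have "lsum (\<lambda>l r. \<tau> (E (g * l) * E r)) (spl j (replicate (Suc k) (y, Some j) @ [(b, None)])) =
    \<tau> (E g * E (y ^ k * b)) + (\<Sum>i<k. \<tau> (E ((g * y) * y ^ i) * E (y ^ (k - Suc i) * b)))"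
    unfolding Suc[symmetric] by (simp add: mult.assoc)
  then show ?case unfolding sum.lessThan_Suc_shift by (simp add: mult.assoc)
qed simp

lemma formula_power:
  assumes "j \<in> I" "b \<in> B"
  shows "f j (Y j ^ k * b) = (\<Sum>i<k. \<tau> (E (Y j ^ i) * E (Y j ^ (k - 1 - i) * b)))"
proof -
  have "replicate k (Y j, Some j) @ [(b, None)] \<in> lists lets1"
    using assms by (auto simp: lets1_def lets0_def)
  from formula[OF assms(1) this] show ?thesis
    using lsum_spl_power[of 1 j k "Y j" b] by (simp add: tr2_def)
qed

lemma W_scale:
  assumes w: "w \<in> lists lets1" and a: "a \<in> M" "b \<in> M"
  shows "W i a b ((c *\<^sub>C 1, None) # w) = c * W i a b w"
proof -
  have "lsum (\<lambda>l r. \<tau> (b * (E (a * (c *\<^sub>C 1 * l)) * r))) (spl i w) = lsum (\<lambda>l r. c * \<tau> (b * (E (a * l) * r))) (spl i w)"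
  proof (rule lsum_cong)
    fix l r assume "(l, r) \<in> set (spl i w)"
    then have "l \<in> M" "r \<in> M" using spl_M[OF lists1_M[OF w]] by auto
    then show "\<tau> (b * (E (a * (c *\<^sub>C 1 * l)) * r)) = c * \<tau> (b * (E (a * l) * r))"
      using a by (simp add: E_scaleC tr_scaleC)
  qed
  then show ?thesis by (simp add: W_def lsum_mult)
qed

lemma scalar_letter: "(c *\<^sub>C 1, None) \<in> lets1"
  using B_lets0[of "c *\<^sub>C 1"] by (auto simp: lets1_def)

lemma Y_letter: "j \<in> I \<Longrightarrow> (Y j, Some j) \<in> lets1"
  by (auto simp: lets1_def)

lemma Wp_scale:
  assumes "\<gamma> \<in> polys" and a: "a \<in> M" "b \<in> M"
  shows "Wp i a b (map ((#) (c *\<^sub>C 1, None)) \<gamma>) = c * Wp i a b \<gamma>"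
    "map ((#) (c *\<^sub>C 1, None)) \<gamma> \<in> polys" "valp (map ((#) (c *\<^sub>C 1, None)) \<gamma>) = c *\<^sub>C valp \<gamma>"
proof -
  show "valp (map ((#) (c *\<^sub>C 1, None)) \<gamma>) = c *\<^sub>C valp \<gamma>"
    using valp_map[of "(#) (c *\<^sub>C 1, None)" "c *\<^sub>C 1" 1 \<gamma>] by simp
  show "map ((#) (c *\<^sub>C 1, None)) \<gamma> \<in> polys" "Wp i a b (map ((#) (c *\<^sub>C 1, None)) \<gamma>) = c * Wp i a b \<gamma>"
    using assms(1) by (induction \<gamma> rule: list.induct) (simp_all add: W_scale[OF _ a] scalar_letter distrib_left)
qed

end

section \<open>Action of one variable on derivatives with respect to another\<close>

locale conj_pair = conj_vars M \<tau> B E I x f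
  for M :: "'h::complex_hilbert_space bop set" and \<tau> B E and I :: "'i set" and x f +
  fixes i j assumes i: "i \<in> I" and j: "j \<in> I" and ij: "i \<noteq> j"

text \<open>The summand 1 keeps the norm bound positive even if \<open>Y j\<close> is zero.\<close>

sublocale conj_pair \<subseteq> rv: rel_var M \<tau> B E "Y j" "nrm (Y j) + 1"
  by unfold_locales (use Y[OF j] in \<open>auto intro: add_nonneg_pos\<close>)

context conj_pair
begin

text \<open>A word realizing a monomial of the action. As \<open>i \<noteq> j\<close>, the added
  letters contribute nothing to the derivative, so \<open>\<partial>\<^sub>i\<close> of the sandwich
  is the monomial acting on \<open>\<partial>\<^sub>i w\<close>. The scalar is a letter because it
  lies in \<open>B\<close>.\<close>

definition sandwich :: "real \<Rightarrow> nat \<Rightarrow> nat \<Rightarrow> ('h bop \<times> 'i option) list \<Rightarrow> ('h bop \<times> 'i option) list" where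
  "sandwich e k n w = (complex_of_real e *\<^sub>C 1, None) # replicate k (Y j, Some j) @ w @ replicate n (Y j, Some j)"

lemma sandwich_lists: "w \<in> lists lets1 \<Longrightarrow> sandwich e k n w \<in> lists lets1"
  using scalar_letter[of "complex_of_real e"] Y_letter[OF j] by (auto simp: sandwich_def split: if_splits)

lemma val_sandwich: "val (sandwich e k n w) = (complex_of_real e *\<^sub>C (Y j ^ k)) * val w * Y j ^ n"
  by (simp add: sandwich_def mult.assoc)

text \<open>The pairing with \<open>a\<close> and \<open>b\<close> after \<open>p\<close> has acted
  on \<open>\<partial>\<^sub>i w\<close>; for \<open>p = 1\<close> it is
  \<open>W i a b w\<close>.\<close>

definition \<Psi> :: "'h bop \<Rightarrow> 'h bop \<Rightarrow> ('h bop \<times> 'i option) list \<Rightarrow> pol \<Rightarrow> complex" where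
  "\<Psi> a b w p = lsum (\<lambda>l r. rv.\<Phi> (l * a) (b * r) p) (spl i w)"

definition \<Psi>p :: "'h bop \<Rightarrow> 'h bop \<Rightarrow> ('h bop \<times> 'i option) list list \<Rightarrow> pol \<Rightarrow> complex" where
  "\<Psi>p a b \<gamma> p = sum_list (map (\<lambda>w. \<Psi> a b w p) \<gamma>)"

lemma Phi_add: "rv.\<Phi> c d (p + q) = rv.\<Phi> c d p + rv.\<Phi> c d q"
  and Phi_zero: "rv.\<Phi> c d 0 = 0"
  and Phi_mono: "rv.\<Phi> c d (mnm (k, l, m) e) = complex_of_real e * \<tau> (E (Y j ^ k * c) * E (Y j ^ (l + m) * d))"
  by (simp_all add: rv.\<Phi>_def)

lemma Psi_add: "\<Psi> a b w (p + q) = \<Psi> a b w p + \<Psi> a b w q"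
  by (simp add: \<Psi>_def Phi_add lsum_add)

lemma Psip_add: "\<Psi>p a b \<gamma> (p + q) = \<Psi>p a b \<gamma> p + \<Psi>p a b \<gamma> q"
  by (simp add: \<Psi>p_def Psi_add sum_list_addf)

lemma Psip_zero: "\<Psi>p a b \<gamma> 0 = 0"
proof -
  have "lsum (\<lambda>l r. 0) L = (0::complex)" for L :: "('h bop \<times> 'h bop) list" by (induction L) auto
  then have "\<Psi> a b w 0 = 0" for w by (simp add: \<Psi>_def Phi_zero)
  then show ?thesis by (simp add: \<Psi>p_def)
qed

text \<open>Cyclicity of the trace and of \<open>E\<close> on the commutant of \<open>B\<close> brings the powers of \<open>Y j\<close>
  together.\<close>

lemma sandwich_term:
  assumes ab: "a \<in> Q" "b \<in> Q" and lr: "l \<in> M" "r \<in> M"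
  shows "\<tau> (b * (E (a * (Y j ^ k * l)) * (r * Y j ^ n))) = \<tau> (E (Y j ^ k * (l * a)) * E (Y j ^ n * (b * r)))"
proof -
  define e where "e = E (a * (Y j ^ k * l))"
  have M: "a \<in> M" "b \<in> M" using ab by auto
  have eB: "e \<in> B" unfolding e_def using M lr by auto
  have "b * (e * (r * Y j ^ n)) = (b * e) * (r * Y j ^ n)" by (simp add: mult.assoc)
  also have "b * e = e * b" by (rule Q_comm[OF ab(2) eB])
  also have "(e * b) * (r * Y j ^ n) = e * ((b * r) * Y j ^ n)" by (simp add: mult.assoc)
  also have "\<tau> \<dots> = \<tau> (e * E ((b * r) * Y j ^ n))"
    unfolding e_def using M lr by (intro tr_E_left[symmetric]) auto
  also have "E ((b * r) * Y j ^ n) = E (Y j ^ n * (b * r))"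
    using M lr by (intro E_comm_Q[symmetric]) auto
  finally have "\<tau> (b * (e * (r * Y j ^ n))) = \<tau> (e * E (Y j ^ n * (b * r)))" .
  moreover have "E (Y j ^ k * (l * a)) = e"
    unfolding e_def using E_comm_Q[OF ab(1), of "Y j ^ k * l"] lr by (simp add: mult.assoc)
  ultimately show ?thesis unfolding e_def[symmetric] by simp
qed

lemma W_sandwich:
  assumes ab: "a \<in> Q" "b \<in> Q" and w: "w \<in> lists lets1"
  shows "W i a b (sandwich e k (l + m) w) = \<Psi> a b w (mnm (k, l, m) e)"
proof -
  have M: "a \<in> M" "b \<in> M" using ab by auto
  have m: "l \<in> M" "r \<in> M" if "(l, r) \<in> set (spl i w)" for l r
    using spl_M[OF lists1_M[OF w] that] by auto
  let ?w = "replicate k (Y j, Some j) @ w @ replicate (l + m) (Y j, Some j)"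
  have "?w \<in> lists lets1" using w j by (auto simp: lets1_def)
  then have "W i a b (sandwich e k (l + m) w) = complex_of_real e * W i a b ?w"
    unfolding sandwich_def using M by (rule W_scale)
  also have "W i a b ?w = lsum (\<lambda>l' r. \<tau> (b * (E (a * (Y j ^ k * l')) * (r * Y j ^ (l + m))))) (spl i w)"
    using ij by (simp add: W_def lsum_spl_append spl_replicate)
  also have "\<dots> = lsum (\<lambda>l' r. \<tau> (E (Y j ^ k * (l' * a)) * E (Y j ^ (l + m) * (b * r)))) (spl i w)"
    by (rule lsum_cong) (rule sandwich_term[OF ab m])
  finally show ?thesis by (simp add: \<Psi>_def Phi_mono lsum_mult)
qed

lemma Wp_eq_Psip:
  assumes "a \<in> Q" "b \<in> Q" "\<gamma> \<in> polys"
  shows "Wp i a b \<gamma> = \<Psi>p a b \<gamma> 1"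
proof -
  have "W i a b w = \<Psi> a b w 1" if w: "w \<in> lists lets1" for w
    unfolding W_def \<Psi>_def
  proof (rule lsum_cong)
    fix l r assume "(l, r) \<in> set (spl i w)"
    then have m: "l \<in> M" "r \<in> M" using spl_M[OF lists1_M[OF w]] by auto
    have "rv.\<Phi> (l * a) (b * r) 1 = \<tau> (E (l * a) * E (b * r))"
      using Phi_mono[of "l * a" "b * r" 0 0 0 1] by (simp add: zero_prod_def[symmetric])
    then show "\<tau> (b * (E (a * l) * r)) = rv.\<Phi> (l * a) (b * r) 1"
      using sandwich_term[OF assms(1,2) m, of 0 0] by simp
  qed
  then show ?thesis
    using assms(3) by (induction \<gamma> rule: list.induct) (simp_all add: \<Psi>p_def)
qed

text \<open>Sandwiching all words of \<open>\<gamma>\<close>, once for each monomial of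
  \<open>p\<close>, keeps the result within the word polynomials, so \<open>dom_bound\<close>
  remains applicable after the action.\<close>

lemma act_poly:
  assumes ab: "a \<in> Q" "b \<in> Q" and \<gamma>: "\<gamma> \<in> polys"
  shows "\<exists>\<gamma>'\<in>polys. valp \<gamma>' = rv.act p (valp \<gamma>) \<and> Wp i a b \<gamma>' = \<Psi>p a b \<gamma> p"
proof (induction p rule: pol_induct)
  case zero
  show ?case by (intro bexI[of _ "[]"]) (simp_all add: Psip_zero)
next
  case (add p \<kappa> e)
  obtain k l m where \<kappa>: "\<kappa> = (k, l, m)" by (cases \<kappa>)
  obtain \<gamma>1 where g1: "\<gamma>1 \<in> polys" "valp \<gamma>1 = rv.act p (valp \<gamma>)" "Wp i a b \<gamma>1 = \<Psi>p a b \<gamma> p"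
    using add by blast
  define \<gamma>2 where "\<gamma>2 = map (sandwich e k (l + m)) \<gamma>"
  have "valp \<gamma>2 = rv.act (mnm \<kappa> e) (valp \<gamma>)"
    unfolding \<gamma>2_def valp_map[of "sandwich e k (l + m)", OF val_sandwich] by (simp add: \<kappa> rv.act_mnm)
  moreover have "\<gamma>2 \<in> polys \<and> Wp i a b \<gamma>2 = \<Psi>p a b \<gamma> (mnm \<kappa> e)"
    unfolding \<gamma>2_def \<kappa> using \<gamma>
    by (induction \<gamma> rule: list.induct) (simp_all add: \<Psi>p_def W_sandwich[OF ab] sandwich_lists)
  ultimately show ?case
    using g1 by (intro bexI[of _ "\<gamma>1 @ \<gamma>2"]) (simp_all add: rv.act_add Psip_add)
qed

lemma Psip_tendsto:
  assumes ab: "a \<in> Q" "b \<in> Q" and "\<gamma> \<in> polys"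
  shows "(\<lambda>n. \<Psi>p a b \<gamma> (rv.P n)) \<longlonglongrightarrow> 0"
  using assms(3)
proof (induction \<gamma> rule: list.induct)
  case (Cons w \<gamma>)
  then have w: "w \<in> lists lets1" by simp
  have "(\<lambda>n. \<Psi> a b w (rv.P n)) \<longlonglongrightarrow> 0"
    unfolding \<Psi>_def
  proof (rule tendsto_lsum_zero)
    fix l r assume "(l, r) \<in> set (spl i w)"
    then have m: "l \<in> M" "r \<in> M" using spl_M[OF lists1_M[OF w]] by auto
    show "(\<lambda>n. rv.\<Phi> (l * a) (b * r) (rv.P n)) \<longlonglongrightarrow> 0"
      by (rule rv.relatively_diffuse[OF lf_f[OF j] formula_power[OF j]]) (use m ab in auto)
  qed
  from tendsto_add[OF this Cons.IH] Cons.prems show ?case by (simp add: \<Psi>p_def)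
qed (simp add: \<Psi>p_def)

text \<open>Acting by \<open>1 - P n\<close> annihilates \<open>z\<close>, hence produces from
  \<open>\<gamma>\<close> a polynomial of trace norm at most twice the distance to \<open>z\<close>,
  uniformly in \<open>n\<close>. The complementary pairing with \<open>P n\<close> tends to
  zero.\<close>

lemma Wp_near_commuting:
  assumes ab: "a \<in> Q" "b \<in> Q" and K: "dom_bound i a b K" "0 \<le> K" and \<gamma>: "\<gamma> \<in> polys"
    and z: "z \<in> M" "z * Y j = Y j * z"
  shows "cmod (Wp i a b \<gamma>) \<le> 2 * K * n2 (valp \<gamma> - z)"
proof -
  define v where "v = valp \<gamma> - z"
  have vM: "v \<in> M" "valp \<gamma> \<in> M" unfolding v_def using z valp_M[OF \<gamma>] by auto
  have "cmod (Wp i a b \<gamma>) \<le> 2 * K * n2 v + cmod (\<Psi>p a b \<gamma> (rv.P n))" for n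
  proof -
    obtain \<gamma>' where g: "\<gamma>' \<in> polys" "valp \<gamma>' = rv.act (1 - rv.P n) (valp \<gamma>)"
      "Wp i a b \<gamma>' = \<Psi>p a b \<gamma> (1 - rv.P n)" using act_poly[OF ab \<gamma>] by blast
    have "rv.act (rv.P n) v = rv.act (rv.P n) (valp \<gamma>) - z"
      unfolding v_def by (simp add: rv.act_diff_right rv.act_P_fixes[OF z(2)])
    then have "valp \<gamma>' = v - rv.act (rv.P n) v"
      unfolding g(2) rv.act_diff rv.act_one by (simp add: v_def)
    then have "n2 (valp \<gamma>') \<le> n2 v + n2 (rv.act (rv.P n) v)"
      using n2_triangle_diff[OF vM(1) rv.act_M[OF vM(1)]] by simp
    also have "\<dots> \<le> n2 v + n2 v" using rv.act_P_contraction[OF vM(1)] by (rule add_left_mono)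
    finally have n: "n2 (valp \<gamma>') \<le> 2 * n2 v" by simp
    have "cmod (Wp i a b \<gamma>') \<le> K * n2 (valp \<gamma>')" using K(1) g(1) unfolding dom_bound_def by blast
    also have "\<dots> \<le> K * (2 * n2 v)" by (rule mult_left_mono[OF n K(2)])
    finally have "cmod (\<Psi>p a b \<gamma> (1 - rv.P n)) \<le> 2 * K * n2 v" by (simp add: g(3) mult_ac)
    moreover have "Wp i a b \<gamma> = \<Psi>p a b \<gamma> (1 - rv.P n) + \<Psi>p a b \<gamma> (rv.P n)"
      unfolding Wp_eq_Psip[OF ab \<gamma>] Psip_add[symmetric] by simp
    ultimately show ?thesis using norm_triangle_ineq[of "\<Psi>p a b \<gamma> (1 - rv.P n)" "\<Psi>p a b \<gamma> (rv.P n)"] by simp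
  qed
  moreover have "(\<lambda>n. 2 * K * n2 v + cmod (\<Psi>p a b \<gamma> (rv.P n))) \<longlonglongrightarrow> 2 * K * n2 v + cmod 0"
    by (intro tendsto_add tendsto_const tendsto_norm Psip_tendsto[OF ab \<gamma>])
  ultimately have "cmod (Wp i a b \<gamma>) \<le> 2 * K * n2 v + cmod 0"
    by (intro LIMSEQ_le_const) auto
  then show ?thesis by (simp add: v_def)
qed

end

section \<open>Product rules for multiplication by the averaged variable\<close>

context conj_vars
begin

text \<open>\<open>\<partial>\<^sub>i (\<gamma> y\<^sub>i) = \<partial>\<^sub>i \<gamma> \<cdot>
  y\<^sub>i + \<gamma> \<otimes> 1\<close>. Cyclicity moves the right factor into the second slot of
  the pairing.\<close>

lemma Wp_right_mult:
  assumes i: "i \<in> I" and a: "a \<in> M" and \<gamma>: "\<gamma> \<in> polys"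
  shows "\<exists>\<gamma>'\<in>polys. valp \<gamma>' = valp \<gamma> * Y i \<and> Wp i a 1 \<gamma>' = Wp i a (Y i) \<gamma> + \<tau> (a * valp \<gamma>)"
proof -
  define h where "h w = w @ [(Y i, Some i)]" for w
  have "Wp i a 1 (map h \<gamma>) = Wp i a (Y i) \<gamma> + \<tau> (a * valp \<gamma>) \<and> map h \<gamma> \<in> polys"
    using \<gamma>
  proof (induction \<gamma> rule: list.induct)
    case (Cons w \<gamma>)
    then have w: "w \<in> lists lets1" and \<gamma>: "\<gamma> \<in> polys" by auto
    have wM: "inM w" by (rule lists1_M[OF w])
    have "lsum (\<lambda>l r. \<tau> (1 * (E (a * l) * (r * Y i)))) (spl i w) = W i a (Y i) w"
      unfolding W_def
    proof (rule lsum_cong)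
      fix l r assume "(l, r) \<in> set (spl i w)"
      then have "l \<in> M" "r \<in> M" using spl_M[OF wM] by auto
      then show "\<tau> (1 * (E (a * l) * (r * Y i))) = \<tau> (Y i * (E (a * l) * r))"
        using tr_comm[of "Y i" "E (a * l) * r"] a YM[OF i] by (simp add: mult.assoc)
    qed
    moreover have "W i a 1 (h w) = lsum (\<lambda>l r. \<tau> (1 * (E (a * l) * (r * Y i)))) (spl i w) + \<tau> (E (a * val w))"
      unfolding W_def h_def by (simp only: lsum_spl_append) simp
    moreover have "h w \<in> lists lets1" using w i by (auto simp: h_def lets1_def)
    ultimately show ?case using Cons.IH[OF \<gamma>] a wM valp_M[OF \<gamma>]
      by (simp add: tr_E distrib_left tr_add)
  qed simp
  moreover have "valp (map h \<gamma>) = valp \<gamma> * Y i"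
    using valp_map[of h 1 "Y i" \<gamma>] by (simp add: h_def)
  ultimately show ?thesis by blast
qed

text \<open>\<open>\<partial>\<^sub>i (y\<^sub>i \<gamma>) = 1 \<otimes> \<gamma> + y\<^sub>i
  \<cdot> \<partial>\<^sub>i \<gamma>\<close>. The left factor joins \<open>a\<close>, and the first
  term leaves the conditional expectation of \<open>a\<close>.\<close>

lemma Wp_left_mult:
  assumes i: "i \<in> I" and a: "a \<in> M" and \<gamma>: "\<gamma> \<in> polys"
  shows "\<exists>\<gamma>'\<in>polys. valp \<gamma>' = Y i * valp \<gamma> \<and> Wp i a 1 \<gamma>' = \<tau> (E a * valp \<gamma>) + Wp i (a * Y i) 1 \<gamma>"
proof -
  define h where "h w = (Y i, Some i) # w" for w
  have "Wp i a 1 (map h \<gamma>) = \<tau> (E a * valp \<gamma>) + Wp i (a * Y i) 1 \<gamma> \<and> map h \<gamma> \<in> polys"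
    using \<gamma>
  proof (induction \<gamma> rule: list.induct)
    case (Cons w \<gamma>)
    then have w: "w \<in> lists lets1" and \<gamma>: "\<gamma> \<in> polys" by auto
    have wM: "inM w" by (rule lists1_M[OF w])
    have "W i a 1 (h w) = \<tau> (E a * val w) + W i (a * Y i) 1 w"
      by (simp add: W_def h_def mult.assoc)
    moreover have "h w \<in> lists lets1" using w i by (auto simp: h_def lets1_def)
    ultimately show ?case using Cons.IH[OF \<gamma>] a wM valp_M[OF \<gamma>]
      by (simp add: distrib_left tr_add)
  qed simp
  moreover have "valp (map h \<gamma>) = Y i * valp \<gamma>"
    using valp_map[of h "Y i" 1 \<gamma>] by (simp add: h_def)
  ultimately show ?thesis by blast
qed

text \<open>The product rule expresses the new pairing through one already bounded, at the
  polynomial multiplied by \<open>Y i\<close>, and a bounded functional.\<close>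

lemma dom_bound_right:
  assumes i: "i \<in> I" and a: "a \<in> M" and K: "dom_bound i a 1 K" "0 \<le> K"
  shows "\<exists>K'\<ge>0. dom_bound i a (Y i) K'"
proof -
  obtain C where C: "C \<ge> 0" "\<And>c. c \<in> M \<Longrightarrow> cmod (\<tau> (a * c)) \<le> C * n2 c"
    using lfD(3)[OF lf_tr_mult[OF a]] by blast
  have "dom_bound i a (Y i) (K * nrm (Y i) + C)"
    unfolding dom_bound_def
  proof
    fix \<gamma> assume g: "\<gamma> \<in> polys"
    obtain \<gamma>' where g': "\<gamma>' \<in> polys" "valp \<gamma>' = valp \<gamma> * Y i" "Wp i a 1 \<gamma>' = Wp i a (Y i) \<gamma> + \<tau> (a * valp \<gamma>)"
      using Wp_right_mult[OF i a g] by blast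
    have "cmod (Wp i a 1 \<gamma>') \<le> K * n2 (valp \<gamma> * Y i)" using K(1) g'(1,2) unfolding dom_bound_def by metis
    also have "\<dots> \<le> K * (n2 (valp \<gamma>) * nrm (Y i))"
      using valp_M[OF g] YM[OF i] by (intro mult_left_mono n2_mult_right K(2))
    finally have 1: "cmod (Wp i a 1 \<gamma>') \<le> K * (n2 (valp \<gamma>) * nrm (Y i))" .
    have "Wp i a (Y i) \<gamma> = Wp i a 1 \<gamma>' - \<tau> (a * valp \<gamma>)" by (simp add: g'(3))
    then have "cmod (Wp i a (Y i) \<gamma>) \<le> cmod (Wp i a 1 \<gamma>') + cmod (\<tau> (a * valp \<gamma>))"
      by (simp add: norm_triangle_ineq4)
    also have "\<dots> \<le> K * (n2 (valp \<gamma>) * nrm (Y i)) + C * n2 (valp \<gamma>)"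
      by (intro add_mono 1 C(2) valp_M[OF g])
    finally show "cmod (Wp i a (Y i) \<gamma>) \<le> (K * nrm (Y i) + C) * n2 (valp \<gamma>)"
      by (simp add: algebra_simps)
  qed
  moreover have "0 \<le> K * nrm (Y i) + C" using K(2) C(1) by (simp add: nrm_nonneg)
  ultimately show ?thesis by blast
qed

lemma dom_bound_left:
  assumes i: "i \<in> I" and a: "a \<in> M" and K: "dom_bound i a 1 K" "0 \<le> K"
  shows "\<exists>K'\<ge>0. dom_bound i (a * Y i) 1 K'"
proof -
  have "E a \<in> M" using a by auto
  then obtain C where C: "C \<ge> 0" "\<And>c. c \<in> M \<Longrightarrow> cmod (\<tau> (E a * c)) \<le> C * n2 c"
    using lfD(3)[OF lf_tr_mult] by blast
  have "dom_bound i (a * Y i) 1 (K * nrm (Y i) + C)"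
    unfolding dom_bound_def
  proof
    fix \<gamma> assume g: "\<gamma> \<in> polys"
    obtain \<gamma>' where g': "\<gamma>' \<in> polys" "valp \<gamma>' = Y i * valp \<gamma>" "Wp i a 1 \<gamma>' = \<tau> (E a * valp \<gamma>) + Wp i (a * Y i) 1 \<gamma>"
      using Wp_left_mult[OF i a g] by blast
    have "cmod (Wp i a 1 \<gamma>') \<le> K * n2 (Y i * valp \<gamma>)" using K(1) g'(1,2) unfolding dom_bound_def by metis
    also have "\<dots> \<le> K * (nrm (Y i) * n2 (valp \<gamma>))"
      using valp_M[OF g] YM[OF i] by (intro mult_left_mono n2_mult_left K(2))
    finally have 1: "cmod (Wp i a 1 \<gamma>') \<le> K * (nrm (Y i) * n2 (valp \<gamma>))" .
    have "Wp i (a * Y i) 1 \<gamma> = Wp i a 1 \<gamma>' - \<tau> (E a * valp \<gamma>)" by (simp add: g'(3))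
    then have "cmod (Wp i (a * Y i) 1 \<gamma>) \<le> cmod (Wp i a 1 \<gamma>') + cmod (\<tau> (E a * valp \<gamma>))"
      by (simp add: norm_triangle_ineq4)
    also have "\<dots> \<le> K * (nrm (Y i) * n2 (valp \<gamma>)) + C * n2 (valp \<gamma>)"
      by (intro add_mono 1 C(2) valp_M[OF g])
    finally show "cmod (Wp i (a * Y i) 1 \<gamma>) \<le> (K * nrm (Y i) + C) * n2 (valp \<gamma>)"
      by (simp add: algebra_simps)
  qed
  moreover have "0 \<le> K * nrm (Y i) + C" using K(2) C(1) by (simp add: nrm_nonneg)
  ultimately show ?thesis by blast
qed

subsection \<open>The algebra generated by \<open>B\<close> and the variables\<close>

lemma valp_mult: "\<exists>\<gamma>\<in>lists (lists S). valp \<gamma> = valp \<alpha> * valp \<beta>" if "\<alpha> \<in> lists (lists S)" "\<beta> \<in> lists (lists S)"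
  using that(1)
proof (induction \<alpha> rule: list.induct)
  case Nil
  show ?case by (intro bexI[of _ "[]"]) simp_all
next
  case (Cons w \<alpha>)
  then obtain \<gamma> where g: "\<gamma> \<in> lists (lists S)" "valp \<gamma> = valp \<alpha> * valp \<beta>" by auto
  have "map ((@) w) \<beta> \<in> lists (lists S)" using that(2) Cons.prems by (induction \<beta> rule: list.induct) simp_all
  moreover have "valp (map ((@) w) \<beta>) = val w * valp \<beta>" using valp_map[of "(@) w" "val w" 1 \<beta>] by simp
  ultimately show ?case using g by (intro bexI[of _ "map ((@) w) \<beta> @ \<gamma>"]) (simp_all add: distrib_right)
qed

definition word_star :: "('h bop \<times> 'i option) list \<Rightarrow> ('h bop \<times> 'i option) list" where
  "word_star w = rev (map (map_prod adj id) w)"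

lemma val_word_star: "val (word_star w) = adj (val w)"
  by (induction w rule: val.induct) (simp_all add: word_star_def)

lemma adj_letter: "(g, o') \<in> lets0 \<Longrightarrow> (adj g, o') \<in> lets0"
  unfolding lets0_def using xsa B.adj_in by (auto simp: image_iff)

lemma word_star_lists: "w \<in> lists lets0 \<Longrightarrow> word_star w \<in> lists lets0"
  by (auto simp: word_star_def adj_letter)

lemma generated_words:
  assumes "a \<in> star_generated (B \<union> x ` I)"
  shows "\<exists>\<alpha>\<in>lists (lists lets0). valp \<alpha> = a"
proof -
  define A where "A = valp ` lists (lists lets0)"
  have "star_subalgebra A"
    unfolding star_subalgebra_def
  proof (intro conjI ballI allI)
    show "0 \<in> A" unfolding A_def by (rule image_eqI[of _ _ "[]"]) simp_all
  next
    fix a b assume "a \<in> A" "b \<in> A"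
    then obtain \<alpha> \<beta> where ab: "\<alpha> \<in> lists (lists lets0)" "\<beta> \<in> lists (lists lets0)" "a = valp \<alpha>" "b = valp \<beta>"
      by (auto simp: A_def)
    have "a + b = valp (\<alpha> @ \<beta>)" "\<alpha> @ \<beta> \<in> lists (lists lets0)" using ab by simp_all
    then show "a + b \<in> A" unfolding A_def by (rule image_eqI)
    obtain \<gamma> where "\<gamma> \<in> lists (lists lets0)" "valp \<gamma> = a * b"
      using valp_mult[OF ab(1,2)] ab(3,4) by blast
    then show "a * b \<in> A" unfolding A_def by (metis image_eqI)
  next
    fix c a assume "a \<in> A"
    then obtain \<alpha> where a: "\<alpha> \<in> lists (lists lets0)" "a = valp \<alpha>" by (auto simp: A_def)
    have "(c *\<^sub>C 1, None) \<in> lets0" by (rule B_lets0) simp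
    then have "map ((#) (c *\<^sub>C 1, None)) \<alpha> \<in> lists (lists lets0)"
      using a(1) by (induction \<alpha> rule: list.induct) simp_all
    moreover have "c *\<^sub>C a = valp (map ((#) (c *\<^sub>C 1, None)) \<alpha>)"
      unfolding a(2) using valp_map[of "(#) (c *\<^sub>C 1, None)" "c *\<^sub>C 1" 1 \<alpha>] by simp
    ultimately show "c *\<^sub>C a \<in> A" unfolding A_def by (metis image_eqI)
  next
    show "adj ` A \<subseteq> A"
    proof
      fix b assume "b \<in> adj ` A"
      then obtain \<alpha> where a: "\<alpha> \<in> lists (lists lets0)" "b = adj (valp \<alpha>)" by (auto simp: A_def)
      have "map word_star \<alpha> \<in> lists (lists lets0) \<and> valp (map word_star \<alpha>) = adj (valp \<alpha>)"
        using a(1) by (induction \<alpha> rule: list.induct) (simp_all add: word_star_lists val_word_star)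
      then show "b \<in> A" unfolding A_def a(2) by (metis image_eqI)
    qed
  qed
  moreover have "B \<union> x ` I \<subseteq> A"
  proof
    fix s assume "s \<in> B \<union> x ` I"
    then obtain o' where "(s, o') \<in> lets0" by (auto simp: lets0_def)
    then have "[[(s, o')]] \<in> lists (lists lets0)" "s = valp [[(s, o')]]" by simp_all
    then show "s \<in> A" unfolding A_def by (metis image_eqI)
  qed
  ultimately have "star_generated (B \<union> x ` I) \<subseteq> A" unfolding star_generated_def by blast
  then show ?thesis using assms unfolding A_def by blast
qed

lemma star_subalgebra_generated: "star_subalgebra (star_generated S)"
  unfolding star_generated_def star_subalgebra_def by blast

lemma generated_dense: "dense_subalgebra M \<tau> (star_generated (B \<union> x ` I))"
proof
  show "star_subalgebra (star_generated (B \<union> x ` I))" by (rule star_subalgebra_generated)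
  have "B \<union> x ` I \<subseteq> star_generated (B \<union> x ` I)" unfolding star_generated_def by blast
  then show "1 \<in> star_generated (B \<union> x ` I)" using B.one_in by blast
  show "star_generated (B \<union> x ` I) \<subseteq> M" using subset_bicommutant gen by blast
  show "commutant (commutant (star_generated (B \<union> x ` I))) = M" using gen by simp
qed

subsection \<open>Elements commuting with \<open>B\<close> and its relative commutant\<close>

text \<open>The pairing of \<open>a \<otimes> 1\<close> with \<open>\<partial>\<^sub>i\<close> of
  the commutator of \<open>\<gamma>\<close> and \<open>Y i\<close> is small, as this is also the
  commutator of the error \<open>valp \<gamma> - z\<close> and \<open>Y i\<close>. Its two Leibniz
  terms with \<open>\<partial>\<^sub>i \<gamma>\<close> are small by
  \<open>Wp_near_commuting\<close>. What remains is the functional \<open>T\<close> at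
  \<open>\<gamma>\<close>.\<close>

lemma central_trace:
  assumes i: "i \<in> I" and j: "j \<in> I" and ij: "i \<noteq> j" and z: "z \<in> M" "z * Y i = Y i * z" "z * Y j = Y j * z"
    and a: "a \<in> Q" and K: "dom_bound i a 1 K" "0 \<le> K"
  shows "\<tau> (a * z) = \<tau> (E a * z)"
proof -
  interpret conj_pair M \<tau> B E I x f i j by unfold_locales (rule i j ij)+
  interpret D: dense_subalgebra M \<tau> "star_generated (B \<union> x ` I)" by (rule generated_dense)
  have aM: "a \<in> M" using a by auto
  have q1: "1 \<in> Q" "a * Y i \<in> Q" "Y i \<in> Q" using Q_closed(1,2) a Y(1)[OF i] by blast+
  obtain K1 where K1: "K1 \<ge> 0" "dom_bound i a (Y i) K1" using dom_bound_right[OF i aM K] by blast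
  obtain K2 where K2: "K2 \<ge> 0" "dom_bound i (a * Y i) 1 K2" using dom_bound_left[OF i aM K] by blast
  define T where "T c = \<tau> (a * c) - \<tau> (E a * c)" for c
  have lfT: "lf T" unfolding T_def using aM by (intro lf_diff lf_tr_mult) auto
  obtain C where C: "C \<ge> 0" "\<And>c. c \<in> M \<Longrightarrow> cmod (T c) \<le> C * n2 c" using lfD(3)[OF lfT] by blast
  \<comment> \<open>Sums the constants of the four terms into which \<open>T z\<close> is split: the
    two Leibniz terms, the commutator, and \<open>T\<close> at the error.\<close>
  define D where "D = 2 * K1 + 2 * K2 + 2 * K * nrm (Y i) + C"
  have D0: "D \<ge> 0" unfolding D_def using K1(1) K2(1) K(2) C(1) by (simp add: nrm_nonneg)
  have main: "cmod (T z) \<le> D * n2 (valp \<gamma> - z)" if g: "\<gamma> \<in> polys" for \<gamma>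
  proof -
    define v where "v = valp \<gamma> - z"
    have M: "valp \<gamma> \<in> M" "v \<in> M" "Y i \<in> M" unfolding v_def using valp_M[OF g] z YM[OF i] by auto
    obtain \<gamma>1 where g1: "\<gamma>1 \<in> polys" "valp \<gamma>1 = valp \<gamma> * Y i" "Wp i a 1 \<gamma>1 = Wp i a (Y i) \<gamma> + \<tau> (a * valp \<gamma>)"
      using Wp_right_mult[OF i aM g] by blast
    obtain \<gamma>2 where g2: "\<gamma>2 \<in> polys" "valp \<gamma>2 = Y i * valp \<gamma>" "Wp i a 1 \<gamma>2 = \<tau> (E a * valp \<gamma>) + Wp i (a * Y i) 1 \<gamma>"
      using Wp_left_mult[OF i aM g] by blast
    define \<gamma>3 where "\<gamma>3 = \<gamma>1 @ map ((#) ((-1) *\<^sub>C 1, None)) \<gamma>2"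
    note sc = Wp_scale(1)[OF g2(1) aM one_in, where i = i and c = "-1"]
      Wp_scale(2,3)[OF g2(1) aM one_in, where c = "-1"]
    have "\<gamma>3 \<in> polys" unfolding \<gamma>3_def using g1(1) sc(2) by simp
    then have "cmod (Wp i a 1 \<gamma>3) \<le> K * n2 (valp \<gamma>3)" using K(1) unfolding dom_bound_def by blast
    also have "valp \<gamma>3 = valp \<gamma> * Y i - Y i * valp \<gamma>"
      unfolding \<gamma>3_def valp_simps sc(3) g1(2) g2(2) by (simp add: scaleC_bop_distrib)
    also have "\<dots> = v * Y i - Y i * v" unfolding v_def using z(2) by (simp add: left_diff_distrib right_diff_distrib)
    also have "K * n2 (v * Y i - Y i * v) \<le> K * (2 * (nrm (Y i) * n2 v))"
    proof (rule mult_left_mono[OF _ K(2)])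
      have "n2 (v * Y i - Y i * v) \<le> n2 (v * Y i) + n2 (Y i * v)" using M by (intro n2_triangle_diff) auto
      also have "\<dots> \<le> n2 v * nrm (Y i) + nrm (Y i) * n2 v"
        using M by (intro add_mono n2_mult_left n2_mult_right)
      finally show "n2 (v * Y i - Y i * v) \<le> 2 * (nrm (Y i) * n2 v)" by (simp add: mult.commute)
    qed
    finally have 3: "cmod (Wp i a 1 \<gamma>3) \<le> 2 * K * nrm (Y i) * n2 v" by (simp add: mult_ac)
    have w3: "Wp i a 1 \<gamma>3 = Wp i a (Y i) \<gamma> - Wp i (a * Y i) 1 \<gamma> + T (valp \<gamma>)"
      unfolding \<gamma>3_def Wp_simps sc(1) g1(3) g2(3) T_def by (simp add: algebra_simps)
    have 1: "cmod (Wp i a (Y i) \<gamma>) \<le> 2 * K1 * n2 v"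
      unfolding v_def by (rule Wp_near_commuting[OF a q1(3) K1(2,1) g z(1,3)])
    have 2: "cmod (Wp i (a * Y i) 1 \<gamma>) \<le> 2 * K2 * n2 v"
      unfolding v_def by (rule Wp_near_commuting[OF q1(2,1) K2(2,1) g z(1,3)])
    have "T z = T (valp \<gamma>) - T v"
      using lf_diff_at[OF lfT M(1,2)] by (simp add: v_def)
    also have "\<dots> = (Wp i a 1 \<gamma>3 - Wp i a (Y i) \<gamma>) + (Wp i (a * Y i) 1 \<gamma> - T v)" by (simp add: w3)
    finally have Tz: "T z = (Wp i a 1 \<gamma>3 - Wp i a (Y i) \<gamma>) + (Wp i (a * Y i) 1 \<gamma> - T v)" .
    have "cmod (T z) \<le> (cmod (Wp i a 1 \<gamma>3) + cmod (Wp i a (Y i) \<gamma>)) + (cmod (Wp i (a * Y i) 1 \<gamma>) + cmod (T v))"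
      unfolding Tz
      by (rule order_trans[OF norm_triangle_ineq]) (rule add_mono[OF norm_triangle_ineq4 norm_triangle_ineq4])
    also have "\<dots> \<le> (2 * K * nrm (Y i) * n2 v + 2 * K1 * n2 v) + (2 * K2 * n2 v + C * n2 v)"
      by (rule add_mono[OF add_mono[OF 3 1] add_mono[OF 2 C(2)[OF M(2)]]])
    also have "\<dots> = D * n2 v" by (simp add: D_def algebra_simps)
    finally show ?thesis by (simp add: v_def)
  qed
  have "cmod (T z) \<le> 0"
  proof (rule field_le_epsilon)
    fix e :: real assume e: "e > 0"
    then have "e / (D + 1) > 0" using D0 by simp
    then obtain c where c: "c \<in> star_generated (B \<union> x ` I)" "n2 (z - c) < e / (D + 1)"
      using D.n2_dense[OF z(1)] by blast
    obtain \<gamma> where g: "\<gamma> \<in> lists (lists lets0)" "valp \<gamma> = c" using generated_words[OF c(1)] by blast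
    then have g1: "\<gamma> \<in> polys" by (auto simp: lets1_def)
    have "n2 (valp \<gamma> - z) \<le> e / (D + 1)"
      using c(2) n2_diff_commute[OF valp_M[OF g1] z(1)] by (simp add: g(2))
    then have "D * n2 (valp \<gamma> - z) \<le> D * (e / (D + 1))" by (rule mult_left_mono[OF _ D0])
    also have "\<dots> \<le> e" using D0 e by (simp add: field_simps)
    finally show "cmod (T z) \<le> 0 + e" using main[OF g1] by simp
  qed
  then show ?thesis by (simp add: T_def)
qed

text \<open>\<open>q = z - E z\<close> commutes with \<open>B\<close>, so replacing \<open>a\<close>
  by its average \<open>y\<close> does not change \<open>\<tau> (a q)\<close>; and
  \<open>\<tau> (y q) = 0\<close> by \<open>central_trace\<close>. As polynomials are dense in trace
  norm, \<open>q\<close> is zero.\<close>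

theorem commuting_in_B:
  assumes i: "i \<in> I" and j: "j \<in> I" and ij: "i \<noteq> j"
    and z: "z \<in> M" "\<And>b. b \<in> B \<Longrightarrow> z * b = b * z" "\<And>q. q \<in> Q \<Longrightarrow> z * q = q * z"
  shows "z \<in> B"
proof -
  interpret D: dense_subalgebra M \<tau> "star_generated (B \<union> x ` I)" by (rule generated_dense)
  define q where "q = z - E z"
  have zQ: "z \<in> Q" using z(1,2) by (auto simp: Q_def commutant_def)
  have "E z \<in> Q" using E_Q_comm[OF zQ] z(1) by (auto simp: Q_def commutant_def)
  then have qb: "q * b = b * q" if "b \<in> B" for b
    using Q_comm[OF zQ that] Q_comm[of "E z", OF _ that] by (simp add: q_def left_diff_distrib right_diff_distrib)
  have qM: "q \<in> M" unfolding q_def using z(1) by auto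
  have orth: "\<tau> (a * q) = 0" if "adj a \<in> star_generated (B \<union> x ` I)" for a
  proof -
    have "adj (adj a) \<in> star_generated (B \<union> x ` I)"
      using star_subalgebra_generated that unfolding star_subalgebra_def by blast
    then have aA: "a \<in> star_generated (B \<union> x ` I)" by simp
    then have aM: "a \<in> M" using D.AM by blast
    obtain \<alpha> where \<alpha>: "\<alpha> \<in> lists (lists lets0)" "valp \<alpha> = a" using generated_words[OF aA] by blast
    obtain K where K: "K \<ge> 0" "dom_bound i a 1 K" using dom_bound_poly[OF i \<alpha>(1)] \<alpha>(2) by blast
    obtain y s where y: "y \<in> Q" "\<And>n::nat. s n \<in> avg B a" "(\<lambda>n. n2 (s n - y)) \<longlonglongrightarrow> 0"
      using averaging[OF aM] by blast
    have yM: "y \<in> M" using y(1) by auto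
    have db: "dom_bound i y 1 K" by (rule dom_bound_average[OF K(2) aM y(2) yM y(3)])
    have "\<tau> (y * z) = \<tau> (E y * z)"
      by (rule central_trace[OF i j ij z(1) z(3) z(3) y(1) db K(1)]) (rule Y(1) i j)+
    also have "\<dots> = \<tau> (y * E z)" using yM z(1) tr_E_left tr_E_right by metis
    finally have yq: "\<tau> (y * q) = 0" using yM z(1) by (simp add: q_def right_diff_distrib tr_diff)
    have lfg: "lf (\<lambda>c. \<tau> (1 * (c * q)))" by (rule lf_conj[OF lf_tr one_in qM])
    have base: "\<tau> (1 * (u * a * adj u * q)) = \<tau> (a * q)" if u: "u \<in> B" "adj u * u = 1" "u * adj u = 1" for u
    proof -
      have "\<tau> (u * (a * (adj u * q))) = \<tau> ((a * (adj u * q)) * u)" using u aM qM by (intro tr_comm) auto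
      also have "(a * (adj u * q)) * u = a * (adj u * (q * u))" by (simp add: mult.assoc)
      also have "\<dots> = a * ((adj u * u) * q)" unfolding qb[OF u(1)] by (simp add: mult.assoc)
      finally show ?thesis unfolding u(2) by (simp add: mult.assoc)
    qed
    have "\<tau> (1 * (s n * q)) = \<tau> (a * q)" for n by (rule lf_avg[OF lfg aM base y(2)])
    then have "(\<lambda>n. \<tau> (a * q)) \<longlonglongrightarrow> \<tau> (1 * (y * q))"
      using lf_lim[OF lfg avg_M[OF y(2) aM] yM y(3)] by simp
    then show ?thesis using yq by (simp add: LIMSEQ_const_iff)
  qed
  have "n2 q \<le> 0"
  proof (rule ccontr)
    assume "\<not> n2 q \<le> 0"
    then have pos: "n2 q > 0" by simp
    obtain c where c: "c \<in> star_generated (B \<union> x ` I)" "n2 (q - c) < n2 q" using D.n2_dense[OF qM pos] by blast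
    have cM: "c \<in> M" using c(1) D.AM by blast
    have "\<tau> (adj c * q) = 0" using c(1) by (intro orth) simp
    then have "\<tau> (adj q * q) = \<tau> (adj (q - c) * q)" using qM cM by (simp add: left_diff_distrib tr_diff)
    then have "(n2 q)\<^sup>2 \<le> cmod (\<tau> (adj (q - c) * q))" using n2_sq[OF qM] complex_Re_le_cmod by metis
    also have "\<dots> \<le> n2 (q - c) * n2 q" using qM cM by (intro tr_CS) auto
    also have "\<dots> < n2 q * n2 q" using c(2) pos by (rule mult_strict_right_mono)
    finally show False by (simp add: power2_eq_square)
  qed
  then have "z = E z" using n2_eq_zero[OF qM] by (simp add: q_def)
  then show ?thesis using E_in[OF z(1)] by simp
qed

end

theorem theoremA:
  fixes M B :: "'h::complex_hilbert_space bop set"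
    and \<tau> :: "'h bop \<Rightarrow> complex"
    and E :: "'h bop \<Rightarrow> 'h bop"
    and I :: "'i set"
    and x :: "'i \<Rightarrow> 'h bop"
  assumes "tracial_vn_algebra M \<tau>"
    and "vn_subalgebra B M"
    and "trace_cond_exp M \<tau> B E"
    and "countable I" and "\<exists>i\<in>I. \<exists>j\<in>I. i \<noteq> j"
    and "\<forall>i\<in>I. x i \<in> M \<and> adj (x i) = x i"
    and "M = commutant (commutant (star_generated (B \<union> x ` I)))"
    and "\<exists>\<xi>. conjugate_system M \<tau> B E (diagonal_covariance E) I x \<xi>"
  shows "center (B \<or>\<^sub>v\<^sub>N (commutant B \<inter> M)) = center B \<and> center M \<subseteq> center B"
proof -
  interpret C: cond_exp M \<tau> B E by unfold_locales (rule assms(1-3))+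
  obtain \<xi> where \<xi>: "conjugate_system M \<tau> B E (diagonal_covariance E) I x \<xi>" using assms(8) by blast
  have cv: "conjugate_variable M \<tau> B E (diagonal_covariance E) I x i (\<xi> i)" if "i \<in> I" for i
    using \<xi> that unfolding conjugate_system_def by blast
  have "\<exists>g. C.lf g \<and> (\<forall>a\<in>M. L2_inner \<tau> (\<xi> i) (L2_vec M \<tau> a) = g a)" if i: "i \<in> I" for i
  proof -
    have "\<xi> i \<in> L2 M \<tau>" using cv[OF i] unfolding conjugate_variable_def by blast
    from C.L2_functional[OF this] obtain g K where g: "\<And>a b. a \<in> M \<Longrightarrow> b \<in> M \<Longrightarrow> g (a + b) = g a + g b"
      "\<And>c a. a \<in> M \<Longrightarrow> g (c *\<^sub>C a) = c * g a" "\<And>a. a \<in> M \<Longrightarrow> cmod (g a) \<le> K * C.n2 a"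
      "\<And>a. a \<in> M \<Longrightarrow> L2_inner \<tau> (\<xi> i) (L2_vec M \<tau> a) = g a" by metis
    have "cmod (g a) \<le> \<bar>K\<bar> * C.n2 a" if "a \<in> M" for a
      using g(3)[OF that] mult_right_mono[OF abs_ge_self[of K] C.n2_nonneg[OF that]] by simp
    then have "C.lf g" unfolding C.lf_def using g(1,2) by (intro conjI ballI allI exI[of _ "\<bar>K\<bar>"]) auto
    then show ?thesis using g(4) by blast
  qed
  then obtain f where f: "\<And>i. i \<in> I \<Longrightarrow> C.lf (f i)"
    "\<And>i a. i \<in> I \<Longrightarrow> a \<in> M \<Longrightarrow> L2_inner \<tau> (\<xi> i) (L2_vec M \<tau> a) = f i a" by metis
  have wordM: "word x j b m d \<in> M" if "\<forall>k\<in>{1..d}. j k \<in> I" "\<forall>k\<le>d. b k \<in> B" "m \<le> d"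
    for j :: "nat \<Rightarrow> 'i" and b m d
  proof -
    have "prod_list (map (\<lambda>k. x (j k) * b k) ks) \<in> M" if "set ks \<subseteq> {1..d}" for ks
      using that
    proof (induction ks)
      case (Cons k ks)
      then have "x (j k) \<in> M" "b k \<in> B" using assms(6) \<open>\<forall>k\<in>{1..d}. j k \<in> I\<close> \<open>\<forall>k\<le>d. b k \<in> B\<close> by auto
      then show ?case using Cons by auto
    qed simp
    moreover have "set [Suc m..<Suc d] \<subseteq> {1..d}" by auto
    ultimately have "prod_list (map (\<lambda>k. x (j k) * b k) [Suc m..<Suc d]) \<in> M" by blast
    then show ?thesis unfolding word_def using that(2,3) by (intro C.mult_in) auto
  qed
  interpret conj_vars M \<tau> B E I x f
  proof
    fix i d and j :: "nat \<Rightarrow> 'i" and b :: "nat \<Rightarrow> 'h bop"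
    assume i: "i \<in> I" and jb: "\<forall>k\<in>{1..d}. j k \<in> I" "\<forall>k\<le>d. b k \<in> B"
    have "f i (word x j b 0 d) = L2_inner \<tau> (\<xi> i) (L2_vec M \<tau> (word x j b 0 d))"
      using f(2)[OF i wordM[OF jb]] by simp
    also have "\<dots> = (\<Sum>k=1..d. \<tau> (diagonal_covariance E i (j k) (word x j b 0 (k - 1)) * E (word x j b k d)))"
      using cv[OF i] jb unfolding conjugate_variable_def by blast
    also have "\<dots> = (\<Sum>k=1..d. if i = j k then \<tau> (E (word x j b 0 (k - 1)) * E (word x j b k d)) else 0)"
      by (intro sum.cong refl) (simp add: diagonal_covariance_def C.lf_zero_at[OF C.lf_tr])
    finally show "f i (word x j b 0 d) = \<dots>" .
  qed (use assms(6,7) f(1) in auto)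
  obtain i j where ij: "i \<in> I" "j \<in> I" "i \<noteq> j" using assms(5) by blast
  define N where "N = B \<or>\<^sub>v\<^sub>N (commutant B \<inter> M)"
  have BN: "B \<subseteq> N" "C.Q \<subseteq> N" unfolding N_def C.Q_def vn_join_def vn_generated_def by blast+
  have NM: "N \<subseteq> M" unfolding N_def vn_join_def vn_generated_def using C.vN C.BM by blast
  \<comment> \<open>Serves the centers of both \<open>N\<close> and \<open>M\<close>, as either
    algebra contains \<open>B\<close> and \<open>Q\<close>.\<close>
  have sub: "z \<in> center B" if z: "z \<in> M" "\<And>b. b \<in> B \<union> C.Q \<Longrightarrow> z * b = b * z" for z
  proof -
    have "z \<in> B" by (rule commuting_in_B[OF ij z(1)]) (use z(2) in auto)
    then show ?thesis using z(2) by (auto simp: center_def commutant_def)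
  qed
  have "center N \<subseteq> center B"
  proof
    fix z assume "z \<in> center N"
    then have "z \<in> N" "\<And>b. b \<in> N \<Longrightarrow> z * b = b * z" by (auto simp: center_def commutant_def)
    then show "z \<in> center B" using NM BN by (intro sub) auto
  qed
  moreover have "center B \<subseteq> center N"
  proof
    fix b assume "b \<in> center B"
    then have b: "b \<in> B" "\<And>c. c \<in> B \<Longrightarrow> b * c = c * b" by (auto simp: center_def commutant_def)
    have ab: "adj b * c = c * adj b" if "c \<in> B" for c
      using arg_cong[OF b(2)[OF C.B.adj_in[OF that]], of adj] by simp
    \<comment> \<open>Adding \<open>adj b\<close> makes the set self-adjoint, so its commutant is a
      von Neumann algebra; it contains the generators of \<open>N\<close>, hence
      \<open>N\<close>.\<close>
    have "von_neumann_algebra (commutant {b, adj b})" by (rule commutant_vna) simp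
    moreover have "B \<union> (commutant B \<inter> M) \<subseteq> commutant {b, adj b}"
      using b ab C.B.adj_in[OF b(1)] by (auto simp: commutant_def)
    ultimately have "N \<subseteq> commutant {b, adj b}" unfolding N_def vn_join_def vn_generated_def by blast
    then show "b \<in> center N" using BN(1) b(1) by (auto simp: center_def commutant_def)
  qed
  moreover have "center M \<subseteq> center B"
  proof
    fix z assume "z \<in> center M"
    then have "z \<in> M" "\<And>b. b \<in> M \<Longrightarrow> z * b = b * z" by (auto simp: center_def commutant_def)
    then show "z \<in> center B" using C.Q_M C.BM by (intro sub) auto
  qed
  ultimately show ?thesis unfolding N_def by blast
qed

end
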